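(* Let $\Bbbk$ be a nontrivial commutative ring and $A$ a $\Bbbk$-algebra. Let $\Gamma$ be a stable translation quiver with mesh category $Q$ over $\Bbbk$. If $\Gamma$ is normal (relative to $\Bbbk$), then for every $X\in{}_{Q,A}\mathrm{Mod}$ and every vertex $q\in\Gamma_0$ there is a natural isomorphism $$\mathbb{H}_1^{[q]}(X)\cong\mathscr{H}_q(X).$$
   Context: A stable translation quiver is a triple $(\Gamma,\tau,\sigma)$ where $\Gamma=(\Gamma_0,\Gamma_1)$ is a quiver, possibly infinite, in which every vertex is the target of only finitely many arrows, and $\tau\colon\Gamma_0\to\Gamma_0$, $\sigma\colon\Gamma_1\to\Gamma_1$ are bijections such that for every arrow $a\colon p\to q$ the arrow $\sigma(a)$ goes from $\tau(q)$ to $p$. The path category of $\Gamma$ over $\Bbbk$ has object set $\Gamma_0$, and its hom modules are the free $\Bbbk$-modules on sets of paths (including trivial ones; paths are composed right to left). For $q\in\Gamma_0$ let $a_1\colon p_1\to q,\dots,a_n\colon p_n\to q$ be all the arrows with target $q$ and put $\mu_q=a_1\sigma(a_1)+\cdots+a_n\sigma(a_n)\colon\tau(q)\to q$. The mesh category $Q$ is the quotient of the path category by the two-sided ideal generated by all $\mu_q$, $q\in\Gamma_0$. ${}_{Q,A}\mathrm{Mod}$ is the category of $\Bbbk$-linear functors from $Q$ to left $A$-modules. For $X\in{}_{Q,A}\mathrm{Mod}$ the mesh homology $\mathscr{H}_q(X)$ at $q$ is the homology (at the middle term) of the three term complex of left $A$-modules $$X(\tau(q))\xrightarrow{\ (X(\sigma(a_1)),\dots,X(\sigma(a_n)))^{t}\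 }X(p_1)\oplus\cdots\oplus X(p_n)\xrightarrow{\ (X(a_1)\ \cdots\ X(a_n))\ }X(q).$$ $\Gamma$ is normal (relative to $\Bbbk$) if $\mathscr{H}_q(Q(p,-))=0$ for all $p,q\in\Gamma_0$, where $Q(p,-)$ is viewed as a $\Bbbk$-linear functor $Q\to\Bbbk\text{-Mod}$. Let $\mathfrak{r}$ be the arrow ideal of $Q$, i.e. the ideal generated by all arrows of $\Gamma$. For $q\in\Gamma_0$ let $S\{q\}=Q(-,q)/\mathfrak{r}(-,q)\colon Q^{\mathrm{op}}\to\Bbbk\text{-Mod}$ (so $S\{q\}(q)\cong\Bbbk$ and $S\{q\}(p)=0$ for $p\neq q$). Then $\mathbb{H}_1^{[q]}(X)=\operatorname{Tor}_1^Q(S\{q\},X)$, a left $A$-module, where $W\otimes_Q X=\int^{p\in Q}W(p)\otimes_{\Bbbk}X(p)$ and Tor is computed by projective resolutions of $S\{q\}$ in the category of $\Bbbk$-linear functors $Q^{\mathrm{op}}\to\Bbbk\text{-Mod}$. *)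

theory Defs
  imports
    "HOL-Algebra.Module"
    "HOL-Algebra.RingHom"
    "HOL-Algebra.Generated_Groups"
    "HOL-Algebra.Free_Abelian_Groups"
    "Graph_Theory.Arc_Walk"
begin

section \<open>Modules over a not necessarily commutative ring\<close>

text \<open>
  Modules use the record of HOL-Algebra, whose fields \<open>mult\<close> and \<open>one\<close> are irrelevant for
  modules (and left \<open>undefined\<close> in the constructions below).  The library locale
  \<open>module\<close> requires a commutative ring; \<open>left_module\<close> is the same without commutativity.
  The library locale \<open>submodule\<close> does not need commutativity.
\<close>

locale left_module = R?: ring R + M?: abelian_group M
  for R :: "('a, 'b) ring_scheme" (structure) and M :: "('a, 'm) module" (structure) +
  assumes smult_closed:
      "\<lbrakk>a \<in> carrier R; x \<in> carrier M\<rbrakk> \<Longrightarrow> a \<odot>\<^bsub>M\<^esub> x \<in> carrier M"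
    and smult_l_distr:
      "\<lbrakk>a \<in> carrier R; b \<in> carrier R; x \<in> carrier M\<rbrakk> \<Longrightarrow>
        (a \<oplus>\<^bsub>R\<^esub> b) \<odot>\<^bsub>M\<^esub> x = a \<odot>\<^bsub>M\<^esub> x \<oplus>\<^bsub>M\<^esub> b \<odot>\<^bsub>M\<^esub> x"
    and smult_r_distr:
      "\<lbrakk>a \<in> carrier R; x \<in> carrier M; y \<in> carrier M\<rbrakk> \<Longrightarrow>
        a \<odot>\<^bsub>M\<^esub> (x \<oplus>\<^bsub>M\<^esub> y) = a \<odot>\<^bsub>M\<^esub> x \<oplus>\<^bsub>M\<^esub> a \<odot>\<^bsub>M\<^esub> y"
    and smult_assoc:
      "\<lbrakk>a \<in> carrier R; b \<in> carrier R; x \<in> carrier M\<rbrakk> \<Longrightarrow>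
        (a \<otimes>\<^bsub>R\<^esub> b) \<odot>\<^bsub>M\<^esub> x = a \<odot>\<^bsub>M\<^esub> (b \<odot>\<^bsub>M\<^esub> x)"
    and smult_one: "x \<in> carrier M \<Longrightarrow> \<one>\<^bsub>R\<^esub> \<odot>\<^bsub>M\<^esub> x = x"

definition lmod_hom ::
    "('a, 'b) ring_scheme \<Rightarrow> ('a, 'm) module \<Rightarrow> ('a, 'n) module \<Rightarrow> ('m \<Rightarrow> 'n) set" where
  "lmod_hom R M N = {h \<in> hom (add_monoid M) (add_monoid N).
     \<forall>a\<in>carrier R. \<forall>x\<in>carrier M. h (a \<odot>\<^bsub>M\<^esub> x) = a \<odot>\<^bsub>N\<^esub> h x}"

definition lmod_iso ::
    "('a, 'b) ring_scheme \<Rightarrow> ('a, 'm) module \<Rightarrow> ('a, 'n) module \<Rightarrow> ('m \<Rightarrow> 'n) set" where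
  "lmod_iso R M N = {h \<in> lmod_hom R M N. bij_betw h (carrier M) (carrier N)}"

definition submodule_generated ::
    "('a, 'b) ring_scheme \<Rightarrow> ('a, 'm) module \<Rightarrow> 'm set \<Rightarrow> 'm set" where
  "submodule_generated R M S = \<Inter> {N. submodule N R M \<and> S \<subseteq> N}"

definition quot_module :: "('a, 'm) module \<Rightarrow> 'm set \<Rightarrow> ('a, 'm set) module" where
  "quot_module M N =
    \<lparr>carrier = a_rcosets\<^bsub>M\<^esub> N, monoid.mult = undefined, monoid.one = undefined,
     ring.zero = N, ring.add = set_add M,
     module.smult = (\<lambda>a C. \<Union>x\<in>C. N +>\<^bsub>M\<^esub> (a \<odot>\<^bsub>M\<^esub> x))\<rparr>"

text \<open>The map \<open>M/L \<rightarrow> M'/N'\<close> induced by \<open>h : M \<rightarrow> M'\<close> with \<open>h(L) \<subseteq> N'\<close>.\<close>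

definition quot_map :: "('a, 'n) module \<Rightarrow> 'n set \<Rightarrow> ('m \<Rightarrow> 'n) \<Rightarrow> 'm set \<Rightarrow> 'n set" where
  "quot_map M' N' h C = (\<Union>x\<in>C. N' +>\<^bsub>M'\<^esub> h x)"

definition direct_sum :: "'i set \<Rightarrow> ('i \<Rightarrow> ('a, 'm) module) \<Rightarrow> ('a, 'i \<Rightarrow> 'm) module" where
  "direct_sum I M =
    \<lparr>carrier = {t \<in> (\<Pi>\<^sub>E i\<in>I. carrier (M i)). finite {i \<in> I. t i \<noteq> \<zero>\<^bsub>M i\<^esub>}},
     monoid.mult = undefined, monoid.one = undefined,
     ring.zero = (\<lambda>i\<in>I. \<zero>\<^bsub>M i\<^esub>),
     ring.add = (\<lambda>s t. \<lambda>i\<in>I. s i \<oplus>\<^bsub>M i\<^esub> t i),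
     module.smult = (\<lambda>a t. \<lambda>i\<in>I. a \<odot>\<^bsub>M i\<^esub> t i)\<rparr>"

definition direct_sum_incl :: "'i set \<Rightarrow> ('i \<Rightarrow> ('a, 'm) module) \<Rightarrow> 'i \<Rightarrow> 'm \<Rightarrow> 'i \<Rightarrow> 'm" where
  "direct_sum_incl I M j x = (\<lambda>i\<in>I. if i = j then x else \<zero>\<^bsub>M i\<^esub>)"

text \<open>Homology at the middle term of \<open>L \<rightarrow>\<^sub>f M \<rightarrow>\<^sub>g N\<close>.\<close>

definition homology_at ::
    "('a, 'l) module \<Rightarrow> ('l \<Rightarrow> 'm) \<Rightarrow> ('a, 'm) module \<Rightarrow> ('m \<Rightarrow> 'n) \<Rightarrow> ('a, 'n) module \<Rightarrow>
      ('a, 'm set) module" where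
  "homology_at L f M g N = quot_module (M\<lparr>carrier := a_kernel M N g\<rparr>) (f ` carrier L)"

text \<open>
  A \<open>K\<close>-algebra is a ring \<open>A\<close> (possibly zero, not necessarily commutative) with a structure map
  \<open>\<iota> : K \<rightarrow> A\<close> into the centre; \<open>K\<close> itself is the algebra with structure map the identity.
\<close>

locale ring_algebra = K?: cring K + A?: ring A
  for K :: "('k, 'r) ring_scheme" (structure) and A :: "('a, 's) ring_scheme" (structure) +
  fixes \<iota> :: "'k \<Rightarrow> 'a"
  assumes structure_hom: "\<iota> \<in> ring_hom K A"
    and structure_central:
      "\<lbrakk>c \<in> carrier K; a \<in> carrier A\<rbrakk> \<Longrightarrow> \<iota> c \<otimes>\<^bsub>A\<^esub> a = a \<otimes>\<^bsub>A\<^esub> \<iota> c"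


section \<open>Linear categories and linear functors\<close>

text \<open>\<open>comp_mor C p q r g f\<close> is the composite \<open>g \<circ> f\<close> of \<open>f : p \<rightarrow> q\<close> and \<open>g : q \<rightarrow> r\<close>.\<close>

record ('o, 'k, 'h) lincat =
  obj :: "'o set"
  homs :: "'o \<Rightarrow> 'o \<Rightarrow> ('k, 'h) module"
  comp_mor :: "'o \<Rightarrow> 'o \<Rightarrow> 'o \<Rightarrow> 'h \<Rightarrow> 'h \<Rightarrow> 'h"
  ident :: "'o \<Rightarrow> 'h"

definition opcat :: "('o, 'k, 'h) lincat \<Rightarrow> ('o, 'k, 'h) lincat" where
  "opcat C = \<lparr>obj = obj C, homs = (\<lambda>p q. homs C q p),
     comp_mor = (\<lambda>p q r g f. comp_mor C r q p f g), ident = ident C\<rparr>"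

definition cat_ideal ::
    "('k, 'r) ring_scheme \<Rightarrow> ('o, 'k, 'h) lincat \<Rightarrow> ('o \<Rightarrow> 'o \<Rightarrow> 'h set) \<Rightarrow> bool" where
  "cat_ideal K C I \<longleftrightarrow>
    (\<forall>p\<in>obj C. \<forall>q\<in>obj C. submodule (I p q) K (homs C p q)) \<and>
    (\<forall>p\<in>obj C. \<forall>q\<in>obj C. \<forall>r\<in>obj C. \<forall>f\<in>I p q. \<forall>g\<in>carrier (homs C q r).
       comp_mor C p q r g f \<in> I p r) \<and>
    (\<forall>p\<in>obj C. \<forall>q\<in>obj C. \<forall>r\<in>obj C. \<forall>f\<in>carrier (homs C p q). \<forall>g\<in>I q r.
       comp_mor C p q r g f \<in> I p r)"

definition gen_cat_ideal ::
    "('k, 'r) ring_scheme \<Rightarrow> ('o, 'k, 'h) lincat \<Rightarrow> ('o \<Rightarrow> 'o \<Rightarrow> 'h set) \<Rightarrow> 'o \<Rightarrow> 'o \<Rightarrow> 'h set" where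
  "gen_cat_ideal K C S p q =
    \<Inter> {I p q | I. cat_ideal K C I \<and> (\<forall>u\<in>obj C. \<forall>v\<in>obj C. S u v \<subseteq> I u v)}"

definition quot_cat ::
    "('o, 'k, 'h) lincat \<Rightarrow> ('o \<Rightarrow> 'o \<Rightarrow> 'h set) \<Rightarrow> ('o, 'k, 'h set) lincat" where
  "quot_cat C I = \<lparr>obj = obj C,
     homs = (\<lambda>p q. quot_module (homs C p q) (I p q)),
     comp_mor = (\<lambda>p q r G F. \<Union>g\<in>G. \<Union>f\<in>F. I p r +>\<^bsub>homs C p r\<^esub> comp_mor C p q r g f),
     ident = (\<lambda>p. I p p +>\<^bsub>homs C p p\<^esub> ident C p)\<rparr>"

text \<open>
  In the type \<open>('o, 'h, 'a, 'm) modfun\<close>, \<open>'o\<close> and \<open>'h\<close> are the types of objects and morphisms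
  of the source category and \<open>'m\<close> is the type of elements of the modules \<open>fob F p\<close>
  over a ring with elements of type \<open>'a\<close>.
\<close>

record ('o, 'h, 'a, 'm) modfun =
  fob :: "'o \<Rightarrow> ('a, 'm) module"
  fmor :: "'o \<Rightarrow> 'o \<Rightarrow> 'h \<Rightarrow> 'm \<Rightarrow> 'm"

definition linear_functor ::
    "('k, 'r) ring_scheme \<Rightarrow> ('o, 'k, 'h) lincat \<Rightarrow> ('a, 's) ring_scheme \<Rightarrow> ('k \<Rightarrow> 'a) \<Rightarrow>
      ('o, 'h, 'a, 'm) modfun \<Rightarrow> bool" where
  "linear_functor K C A \<iota> F \<longleftrightarrow>
    (\<forall>p\<in>obj C. left_module A (fob F p)) \<and>
    (\<forall>p\<in>obj C. \<forall>q\<in>obj C. \<forall>f\<in>carrier (homs C p q).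
       fmor F p q f \<in> lmod_hom A (fob F p) (fob F q)) \<and>
    (\<forall>p\<in>obj C. \<forall>q\<in>obj C. \<forall>f\<in>carrier (homs C p q). \<forall>g\<in>carrier (homs C p q).
       \<forall>x\<in>carrier (fob F p).
         fmor F p q (f \<oplus>\<^bsub>homs C p q\<^esub> g) x = fmor F p q f x \<oplus>\<^bsub>fob F q\<^esub> fmor F p q g x) \<and>
    (\<forall>p\<in>obj C. \<forall>q\<in>obj C. \<forall>c\<in>carrier K. \<forall>f\<in>carrier (homs C p q).
       \<forall>x\<in>carrier (fob F p).
         fmor F p q (c \<odot>\<^bsub>homs C p q\<^esub> f) x = \<iota> c \<odot>\<^bsub>fob F q\<^esub> fmor F p q f x) \<and>
    (\<forall>p\<in>obj C. \<forall>x\<in>carrier (fob F p). fmor F p p (ident C p) x = x) \<and>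
    (\<forall>p\<in>obj C. \<forall>q\<in>obj C. \<forall>r\<in>obj C.
       \<forall>f\<in>carrier (homs C p q). \<forall>g\<in>carrier (homs C q r). \<forall>x\<in>carrier (fob F p).
         fmor F p r (comp_mor C p q r g f) x = fmor F q r g (fmor F p q f x))"

abbreviation linear_functor_to_base ::
    "('k, 'r) ring_scheme \<Rightarrow> ('o, 'k, 'h) lincat \<Rightarrow> ('o, 'h, 'k, 'm) modfun \<Rightarrow> bool" where
  "linear_functor_to_base K C F \<equiv> linear_functor K C K (\<lambda>c. c) F"

definition nat_trans ::
    "('o, 'k, 'h) lincat \<Rightarrow> ('a, 's) ring_scheme \<Rightarrow> ('o, 'h, 'a, 'm) modfun \<Rightarrow>
      ('o, 'h, 'a, 'n) modfun \<Rightarrow> ('o \<Rightarrow> 'm \<Rightarrow> 'n) \<Rightarrow> bool" where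
  "nat_trans C A F G \<eta> \<longleftrightarrow>
    (\<forall>p\<in>obj C. \<eta> p \<in> lmod_hom A (fob F p) (fob G p)) \<and>
    (\<forall>p\<in>obj C. \<forall>q\<in>obj C. \<forall>f\<in>carrier (homs C p q). \<forall>x\<in>carrier (fob F p).
       \<eta> q (fmor F p q f x) = fmor G p q f (\<eta> p x))"

definition hom_functor :: "('o, 'k, 'h) lincat \<Rightarrow> 'o \<Rightarrow> ('o, 'h, 'k, 'h) modfun" where
  "hom_functor C p = \<lparr>fob = (\<lambda>q. homs C p q), fmor = (\<lambda>q r g f. comp_mor C p q r g f)\<rparr>"

definition quot_functor ::
    "('o, 'h, 'a, 'm) modfun \<Rightarrow> ('o \<Rightarrow> 'm set) \<Rightarrow> ('o, 'h, 'a, 'm set) modfun" where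
  "quot_functor F N = \<lparr>fob = (\<lambda>p. quot_module (fob F p) (N p)),
     fmor = (\<lambda>p q f. quot_map (fob F q) (N q) (fmor F p q f))\<rparr>"


section \<open>Tensor products\<close>

text \<open>
  The tensor product \<open>W \<otimes>\<^sub>K X\<close> of a \<open>K\<close>-module \<open>W\<close> and a left \<open>A\<close>-module \<open>X\<close> is the free abelian
  group on \<open>W \<times> X\<close> modulo bilinearity and \<open>K\<close>-balancedness.  The operation of \<open>a \<in> A\<close> on the free
  abelian group, \<open>(w, x) \<mapsto> (w, a x)\<close>, gives a module structure only on the quotient.
\<close>

definition free_tensor :: "('k, 'w) module \<Rightarrow> ('a, 'x) module \<Rightarrow> ('a, ('w \<times> 'x) \<Rightarrow>\<^sub>0 int) module" where
  "free_tensor W X =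
    \<lparr>carrier = carrier (free_Abelian_group (carrier W \<times> carrier X)),
     monoid.mult = undefined, monoid.one = undefined, ring.zero = 0, ring.add = (+),
     module.smult = (\<lambda>a. frag_extend (\<lambda>(w, x). frag_of (w, a \<odot>\<^bsub>X\<^esub> x)))\<rparr>"

definition tensor_rels ::
    "('k, 'r) ring_scheme \<Rightarrow> ('k \<Rightarrow> 'a) \<Rightarrow> ('k, 'w) module \<Rightarrow> ('a, 'x) module \<Rightarrow>
      (('w \<times> 'x) \<Rightarrow>\<^sub>0 int) set" where
  "tensor_rels K \<iota> W X = generate (free_Abelian_group (carrier W \<times> carrier X))
    ({frag_of (w \<oplus>\<^bsub>W\<^esub> w', x) - frag_of (w, x) - frag_of (w', x) | w w' x.
        w \<in> carrier W \<and> w' \<in> carrier W \<and> x \<in> carrier X} \<union>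
     {frag_of (w, x \<oplus>\<^bsub>X\<^esub> x') - frag_of (w, x) - frag_of (w, x') | w x x'.
        w \<in> carrier W \<and> x \<in> carrier X \<and> x' \<in> carrier X} \<union>
     {frag_of (c \<odot>\<^bsub>W\<^esub> w, x) - frag_of (w, \<iota> c \<odot>\<^bsub>X\<^esub> x) | c w x.
        c \<in> carrier K \<and> w \<in> carrier W \<and> x \<in> carrier X})"

definition tensor ::
    "('k, 'r) ring_scheme \<Rightarrow> ('k \<Rightarrow> 'a) \<Rightarrow> ('k, 'w) module \<Rightarrow> ('a, 'x) module \<Rightarrow>
      ('a, (('w \<times> 'x) \<Rightarrow>\<^sub>0 int) set) module" where
  "tensor K \<iota> W X = quot_module (free_tensor W X) (tensor_rels K \<iota> W X)"

definition pure_tensor ::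
    "('k, 'r) ring_scheme \<Rightarrow> ('k \<Rightarrow> 'a) \<Rightarrow> ('k, 'w) module \<Rightarrow> ('a, 'x) module \<Rightarrow>
      'w \<Rightarrow> 'x \<Rightarrow> (('w \<times> 'x) \<Rightarrow>\<^sub>0 int) set" where
  "pure_tensor K \<iota> W X w x = tensor_rels K \<iota> W X +>\<^bsub>free_tensor W X\<^esub> frag_of (w, x)"

text \<open>\<open>tensor_map K \<iota> W' X' h k\<close> is \<open>h \<otimes> k : W \<otimes> X \<rightarrow> W' \<otimes> X'\<close>.\<close>

definition tensor_map ::
    "('k, 'r) ring_scheme \<Rightarrow> ('k \<Rightarrow> 'a) \<Rightarrow> ('k, 'w2) module \<Rightarrow> ('a, 'x2) module \<Rightarrow>
      ('w \<Rightarrow> 'w2) \<Rightarrow> ('x \<Rightarrow> 'x2) \<Rightarrow>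
      (('w \<times> 'x) \<Rightarrow>\<^sub>0 int) set \<Rightarrow> (('w2 \<times> 'x2) \<Rightarrow>\<^sub>0 int) set" where
  "tensor_map K \<iota> W' X' h k =
    quot_map (free_tensor W' X') (tensor_rels K \<iota> W' X')
      (frag_extend (\<lambda>(w, x). frag_of (h w, k x)))"

text \<open>
  The tensor product over \<open>C\<close> of \<open>W : C\<^sup>o\<^sup>p \<rightarrow> K-Mod\<close> and \<open>X : C \<rightarrow> A-Mod\<close>, i.e. the coend
  \<open>\<integral>\<^sup>p W(p) \<otimes>\<^sub>K X(p)\<close>: the direct sum of all \<open>W(p) \<otimes>\<^sub>K X(p)\<close> modulo
  \<open>W(f)(w) \<otimes> x - w \<otimes> X(f)(x)\<close> for \<open>f : p \<rightarrow> r\<close> in \<open>C\<close>, \<open>w \<in> W(r)\<close>, \<open>x \<in> X(p)\<close>.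
\<close>

definition coend_sum ::
    "('k, 'r) ring_scheme \<Rightarrow> ('o, 'k, 'h) lincat \<Rightarrow> ('k \<Rightarrow> 'a) \<Rightarrow>
      ('o, 'h, 'k, 'w) modfun \<Rightarrow> ('o, 'h, 'a, 'x) modfun \<Rightarrow>
      ('a, 'o \<Rightarrow> (('w \<times> 'x) \<Rightarrow>\<^sub>0 int) set) module" where
  "coend_sum K C \<iota> W X = direct_sum (obj C) (\<lambda>p. tensor K \<iota> (fob W p) (fob X p))"

definition coend_elt ::
    "('k, 'r) ring_scheme \<Rightarrow> ('o, 'k, 'h) lincat \<Rightarrow> ('k \<Rightarrow> 'a) \<Rightarrow>
      ('o, 'h, 'k, 'w) modfun \<Rightarrow> ('o, 'h, 'a, 'x) modfun \<Rightarrow>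
      'o \<Rightarrow> 'w \<Rightarrow> 'x \<Rightarrow> 'o \<Rightarrow> (('w \<times> 'x) \<Rightarrow>\<^sub>0 int) set" where
  "coend_elt K C \<iota> W X p w x =
    direct_sum_incl (obj C) (\<lambda>p. tensor K \<iota> (fob W p) (fob X p)) p
      (pure_tensor K \<iota> (fob W p) (fob X p) w x)"

definition coend_rels ::
    "('k, 'r) ring_scheme \<Rightarrow> ('o, 'k, 'h) lincat \<Rightarrow> ('a, 's) ring_scheme \<Rightarrow> ('k \<Rightarrow> 'a) \<Rightarrow>
      ('o, 'h, 'k, 'w) modfun \<Rightarrow> ('o, 'h, 'a, 'x) modfun \<Rightarrow>
      ('o \<Rightarrow> (('w \<times> 'x) \<Rightarrow>\<^sub>0 int) set) set" where
  "coend_rels K C A \<iota> W X = submodule_generated A (coend_sum K C \<iota> W X)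
    {coend_elt K C \<iota> W X p (fmor W r p f w) x \<ominus>\<^bsub>coend_sum K C \<iota> W X\<^esub>
       coend_elt K C \<iota> W X r w (fmor X p r f x) | p r f w x.
       p \<in> obj C \<and> r \<in> obj C \<and> f \<in> carrier (homs C p r) \<and>
       w \<in> carrier (fob W r) \<and> x \<in> carrier (fob X p)}"

definition tensor_over ::
    "('k, 'r) ring_scheme \<Rightarrow> ('o, 'k, 'h) lincat \<Rightarrow> ('a, 's) ring_scheme \<Rightarrow> ('k \<Rightarrow> 'a) \<Rightarrow>
      ('o, 'h, 'k, 'w) modfun \<Rightarrow> ('o, 'h, 'a, 'x) modfun \<Rightarrow>
      ('a, ('o \<Rightarrow> (('w \<times> 'x) \<Rightarrow>\<^sub>0 int) set) set) module" where
  "tensor_over K C A \<iota> W X = quot_module (coend_sum K C \<iota> W X) (coend_rels K C A \<iota> W X)"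

text \<open>
  \<open>tensor_over_map K C A \<iota> W' X' \<theta> \<eta>\<close> is the map \<open>\<theta> \<otimes> \<eta> : W \<otimes>\<^sub>C X \<rightarrow> W' \<otimes>\<^sub>C X'\<close>.
\<close>

definition tensor_over_map ::
    "('k, 'r) ring_scheme \<Rightarrow> ('o, 'k, 'h) lincat \<Rightarrow> ('a, 's) ring_scheme \<Rightarrow> ('k \<Rightarrow> 'a) \<Rightarrow>
      ('o, 'h, 'k, 'w2) modfun \<Rightarrow> ('o, 'h, 'a, 'x2) modfun \<Rightarrow>
      ('o \<Rightarrow> 'w \<Rightarrow> 'w2) \<Rightarrow> ('o \<Rightarrow> 'x \<Rightarrow> 'x2) \<Rightarrow>
      ('o \<Rightarrow> (('w \<times> 'x) \<Rightarrow>\<^sub>0 int) set) set \<Rightarrow> ('o \<Rightarrow> (('w2 \<times> 'x2) \<Rightarrow>\<^sub>0 int) set) set" where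
  "tensor_over_map K C A \<iota> W' X' \<theta> \<eta> =
    quot_map (coend_sum K C \<iota> W' X') (coend_rels K C A \<iota> W' X')
      (\<lambda>t. \<lambda>p\<in>obj C. tensor_map K \<iota> (fob W' p) (fob X' p) (\<theta> p) (\<eta> p) (t p))"


section \<open>Projective resolutions and Tor\<close>

text \<open>
  Projectivity in the category of linear functors \<open>C \<rightarrow> K-Mod\<close> is the lifting property against
  epimorphisms \<open>M \<rightarrow> N\<close> (these are the pointwise surjective transformations).
  A definition can quantify only over functors with values in modules on fixed types.
  The types chosen for \<open>M\<close> and \<open>N\<close> lose nothing: the free cover of \<open>P\<close>,
  the sum of the functors \<open>C(p,-)\<close> over all pairs \<open>(p, m)\<close> with \<open>m \<in> P(p)\<close>, consists of functions of
  type \<open>'o \<times> 'm \<Rightarrow> 'h\<close>.  Lifting the identity of \<open>P\<close> (take \<open>N = P\<close>) along this cover exhibits \<open>P\<close>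
  as a retract of a free functor, so that \<open>P\<close> has the lifting property for values in any type.
\<close>

definition projective ::
    "('k, 'r) ring_scheme \<Rightarrow> ('o, 'k, 'h) lincat \<Rightarrow> ('o, 'h, 'k, 'm) modfun \<Rightarrow> bool" where
  "projective K C P \<longleftrightarrow> linear_functor_to_base K C P \<and>
    (\<forall>(M :: ('o, 'h, 'k, 'o \<times> 'm \<Rightarrow> 'h) modfun) (N :: ('o, 'h, 'k, 'm) modfun) \<pi> f.
       linear_functor_to_base K C M \<and> linear_functor_to_base K C N \<and>
       nat_trans C K M N \<pi> \<and> (\<forall>p\<in>obj C. \<pi> p ` carrier (fob M p) = carrier (fob N p)) \<and>
       nat_trans C K P N f \<longrightarrow>
       (\<exists>g. nat_trans C K P M g \<and>
          (\<forall>p\<in>obj C. \<forall>x\<in>carrier (fob P p). \<pi> p (g p x) = f p x)))"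

text \<open>\<open>\<dots> \<rightarrow> P 2 \<rightarrow>\<^bsub>d 1\<^esub> P 1 \<rightarrow>\<^bsub>d 0\<^esub> P 0 \<rightarrow>\<^bsub>\<epsilon>\<^esub> S \<rightarrow> 0\<close>\<close>

definition projective_resolution ::
    "('k, 'r) ring_scheme \<Rightarrow> ('o, 'k, 'h) lincat \<Rightarrow> ('o, 'h, 'k, 's) modfun \<Rightarrow>
      (nat \<Rightarrow> ('o, 'h, 'k, 'm) modfun) \<Rightarrow> (nat \<Rightarrow> 'o \<Rightarrow> 'm \<Rightarrow> 'm) \<Rightarrow> ('o \<Rightarrow> 'm \<Rightarrow> 's) \<Rightarrow> bool" where
  "projective_resolution K C S P d \<epsilon> \<longleftrightarrow>
    (\<forall>n. projective K C (P n)) \<and>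
    (\<forall>n. nat_trans C K (P (Suc n)) (P n) (d n)) \<and>
    nat_trans C K (P 0) S \<epsilon> \<and>
    (\<forall>p\<in>obj C.
       \<epsilon> p ` carrier (fob (P 0) p) = carrier (fob S p) \<and>
       d 0 p ` carrier (fob (P 1) p) = a_kernel (fob (P 0) p) (fob S p) (\<epsilon> p) \<and>
       (\<forall>n. d (Suc n) p ` carrier (fob (P (Suc (Suc n))) p) =
              a_kernel (fob (P (Suc n)) p) (fob (P n) p) (d n p)))"

text \<open>
  \<open>tor1 K C A \<iota> P d X\<close> is the first homology of \<open>P \<otimes>\<^sub>C X\<close>; it is \<open>Tor\<^sub>1(S, X)\<close> when \<open>(P, d, \<epsilon>)\<close> is a
  projective resolution of \<open>S : C\<^sup>o\<^sup>p \<rightarrow> K-Mod\<close>, i.e. of \<open>S\<close> over \<open>opcat C\<close>.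
\<close>

definition tor1 ::
    "('k, 'r) ring_scheme \<Rightarrow> ('o, 'k, 'h) lincat \<Rightarrow> ('a, 's) ring_scheme \<Rightarrow> ('k \<Rightarrow> 'a) \<Rightarrow>
      (nat \<Rightarrow> ('o, 'h, 'k, 'm) modfun) \<Rightarrow> (nat \<Rightarrow> 'o \<Rightarrow> 'm \<Rightarrow> 'm) \<Rightarrow> ('o, 'h, 'a, 'x) modfun \<Rightarrow>
      ('a, ('o \<Rightarrow> (('m \<times> 'x) \<Rightarrow>\<^sub>0 int) set) set set) module" where
  "tor1 K C A \<iota> P d X =
    homology_at
      (tensor_over K C A \<iota> (P 2) X) (tensor_over_map K C A \<iota> (P 1) X (d 1) (\<lambda>p x. x))
      (tensor_over K C A \<iota> (P 1) X) (tensor_over_map K C A \<iota> (P 0) X (d 0) (\<lambda>p x. x))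
      (tensor_over K C A \<iota> (P 0) X)"

text \<open>\<open>tor1_map K C A \<iota> P d Y \<eta>\<close> is the map induced by \<open>\<eta> : X \<rightarrow> Y\<close>.\<close>

definition tor1_map ::
    "('k, 'r) ring_scheme \<Rightarrow> ('o, 'k, 'h) lincat \<Rightarrow> ('a, 's) ring_scheme \<Rightarrow> ('k \<Rightarrow> 'a) \<Rightarrow>
      (nat \<Rightarrow> ('o, 'h, 'k, 'm) modfun) \<Rightarrow> (nat \<Rightarrow> 'o \<Rightarrow> 'm \<Rightarrow> 'm) \<Rightarrow> ('o, 'h, 'a, 'y) modfun \<Rightarrow>
      ('o \<Rightarrow> 'x \<Rightarrow> 'y) \<Rightarrow>
      ('o \<Rightarrow> (('m \<times> 'x) \<Rightarrow>\<^sub>0 int) set) set set \<Rightarrow> ('o \<Rightarrow> (('m \<times> 'y) \<Rightarrow>\<^sub>0 int) set) set set" where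
  "tor1_map K C A \<iota> P d Y \<eta> =
    quot_map (tensor_over K C A \<iota> (P 1) Y)
      (tensor_over_map K C A \<iota> (P 1) Y (d 1) (\<lambda>p x. x) ` carrier (tensor_over K C A \<iota> (P 2) Y))
      (tensor_over_map K C A \<iota> (P 1) Y (\<lambda>p x. x) \<eta>)"


section \<open>Stable translation quivers and mesh categories\<close>

locale stable_translation_quiver = wf_digraph \<Gamma>
  for \<Gamma> :: "('v, 'e) pre_digraph" and \<tau> :: "'v \<Rightarrow> 'v" and \<sigma> :: "'e \<Rightarrow> 'e" +
  assumes finite_in_arcs: "q \<in> verts \<Gamma> \<Longrightarrow> finite (in_arcs \<Gamma> q)"
    and bij_tau: "bij_betw \<tau> (verts \<Gamma>) (verts \<Gamma>)"
    and bij_sigma: "bij_betw \<sigma> (arcs \<Gamma>) (arcs \<Gamma>)"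
    and tail_sigma: "a \<in> arcs \<Gamma> \<Longrightarrow> tail \<Gamma> (\<sigma> a) = \<tau> (head \<Gamma> a)"
    and head_sigma: "a \<in> arcs \<Gamma> \<Longrightarrow> head \<Gamma> (\<sigma> a) = tail \<Gamma> a"

text \<open>
  A path is an arc walk, i.e. the list of its arcs in the order in which they are traversed, so
  the path \<open>b a\<close> (first \<open>a\<close>, then \<open>b\<close>) is the list \<open>[a, b]\<close>.  The free module on the paths from
  \<open>p\<close> to \<open>q\<close> consists of the finitely supported \<open>K\<close>-valued functions on these paths.
\<close>

definition path_module ::
    "('k, 'r) ring_scheme \<Rightarrow> ('v, 'e) pre_digraph \<Rightarrow> 'v \<Rightarrow> 'v \<Rightarrow> ('k, 'e list \<Rightarrow> 'k) module" where
  "path_module K \<Gamma> p q =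
    \<lparr>carrier = {f. (\<forall>w. f w \<in> carrier K) \<and> finite {w. f w \<noteq> \<zero>\<^bsub>K\<^esub>} \<and>
                  (\<forall>w. f w \<noteq> \<zero>\<^bsub>K\<^esub> \<longrightarrow> pre_digraph.awalk \<Gamma> p w q)},
     monoid.mult = undefined, monoid.one = undefined,
     ring.zero = (\<lambda>w. \<zero>\<^bsub>K\<^esub>),
     ring.add = (\<lambda>f g w. f w \<oplus>\<^bsub>K\<^esub> g w),
     module.smult = (\<lambda>c f w. c \<otimes>\<^bsub>K\<^esub> f w)\<rparr>"

definition path_elt :: "('k, 'r) ring_scheme \<Rightarrow> 'e list \<Rightarrow> 'e list \<Rightarrow> 'k" where
  "path_elt K w = (\<lambda>w'. if w' = w then \<one>\<^bsub>K\<^esub> else \<zero>\<^bsub>K\<^esub>)"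

text \<open>
  Composition extends concatenation of paths bilinearly: the coefficient of \<open>g \<circ> f\<close> at \<open>w\<close> is
  the sum of \<open>f u \<cdot> g v\<close> over all decompositions \<open>w = u @ v\<close>.
\<close>

definition path_cat ::
    "('k, 'r) ring_scheme \<Rightarrow> ('v, 'e) pre_digraph \<Rightarrow> ('v, 'k, 'e list \<Rightarrow> 'k) lincat" where
  "path_cat K \<Gamma> = \<lparr>obj = verts \<Gamma>, homs = path_module K \<Gamma>,
     comp_mor = (\<lambda>p q r g f w. \<Oplus>\<^bsub>K\<^esub>i\<in>{..length w}. f (take i w) \<otimes>\<^bsub>K\<^esub> g (drop i w)),
     ident = (\<lambda>p. path_elt K [])\<rparr>"

definition mesh_elt ::
    "('k, 'r) ring_scheme \<Rightarrow> ('v, 'e) pre_digraph \<Rightarrow> ('v \<Rightarrow> 'v) \<Rightarrow> ('e \<Rightarrow> 'e) \<Rightarrow> 'v \<Rightarrow>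
      'e list \<Rightarrow> 'k" where
  "mesh_elt K \<Gamma> \<tau> \<sigma> q =
    (\<Oplus>\<^bsub>path_module K \<Gamma> (\<tau> q) q\<^esub>a\<in>in_arcs \<Gamma> q. path_elt K [\<sigma> a, a])"

definition mesh_ideal ::
    "('k, 'r) ring_scheme \<Rightarrow> ('v, 'e) pre_digraph \<Rightarrow> ('v \<Rightarrow> 'v) \<Rightarrow> ('e \<Rightarrow> 'e) \<Rightarrow> 'v \<Rightarrow> 'v \<Rightarrow>
      ('e list \<Rightarrow> 'k) set" where
  "mesh_ideal K \<Gamma> \<tau> \<sigma> =
    gen_cat_ideal K (path_cat K \<Gamma>) (\<lambda>p q. if p = \<tau> q then {mesh_elt K \<Gamma> \<tau> \<sigma> q} else {})"

definition mesh_cat ::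
    "('k, 'r) ring_scheme \<Rightarrow> ('v, 'e) pre_digraph \<Rightarrow> ('v \<Rightarrow> 'v) \<Rightarrow> ('e \<Rightarrow> 'e) \<Rightarrow>
      ('v, 'k, ('e list \<Rightarrow> 'k) set) lincat" where
  "mesh_cat K \<Gamma> \<tau> \<sigma> = quot_cat (path_cat K \<Gamma>) (mesh_ideal K \<Gamma> \<tau> \<sigma>)"

definition arrow ::
    "('k, 'r) ring_scheme \<Rightarrow> ('v, 'e) pre_digraph \<Rightarrow> ('v \<Rightarrow> 'v) \<Rightarrow> ('e \<Rightarrow> 'e) \<Rightarrow> 'e \<Rightarrow>
      ('e list \<Rightarrow> 'k) set" where
  "arrow K \<Gamma> \<tau> \<sigma> a =
    mesh_ideal K \<Gamma> \<tau> \<sigma> (tail \<Gamma> a) (head \<Gamma> a)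
      +>\<^bsub>path_module K \<Gamma> (tail \<Gamma> a) (head \<Gamma> a)\<^esub> path_elt K [a]"

definition arrow_ideal ::
    "('k, 'r) ring_scheme \<Rightarrow> ('v, 'e) pre_digraph \<Rightarrow> ('v \<Rightarrow> 'v) \<Rightarrow> ('e \<Rightarrow> 'e) \<Rightarrow> 'v \<Rightarrow> 'v \<Rightarrow>
      ('e list \<Rightarrow> 'k) set set" where
  "arrow_ideal K \<Gamma> \<tau> \<sigma> =
    gen_cat_ideal K (mesh_cat K \<Gamma> \<tau> \<sigma>)
      (\<lambda>p q. arrow K \<Gamma> \<tau> \<sigma> ` {a \<in> arcs \<Gamma>. tail \<Gamma> a = p \<and> head \<Gamma> a = q})"

text \<open>
  The stalk functor \<open>S{q} = Q(-,q)/\<rr>(-,q)\<close>; \<open>Q(-,q)\<close> is the hom functor at \<open>q\<close> of \<open>Q\<^sup>o\<^sup>p\<close>.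
\<close>

definition stalk ::
    "('k, 'r) ring_scheme \<Rightarrow> ('v, 'e) pre_digraph \<Rightarrow> ('v \<Rightarrow> 'v) \<Rightarrow> ('e \<Rightarrow> 'e) \<Rightarrow> 'v \<Rightarrow>
      ('v, ('e list \<Rightarrow> 'k) set, 'k, ('e list \<Rightarrow> 'k) set set) modfun" where
  "stalk K \<Gamma> \<tau> \<sigma> q =
    quot_functor (hom_functor (opcat (mesh_cat K \<Gamma> \<tau> \<sigma>)) q) (\<lambda>p. arrow_ideal K \<Gamma> \<tau> \<sigma> p q)"


section \<open>Mesh homology and normality\<close>

text \<open>The value of \<open>X\<close> at an arrow \<open>a\<close>, a map from \<open>X(tail a)\<close> to \<open>X(head a)\<close>.\<close>

definition at_arrow ::
    "('k, 'r) ring_scheme \<Rightarrow> ('v, 'e) pre_digraph \<Rightarrow> ('v \<Rightarrow> 'v) \<Rightarrow> ('e \<Rightarrow> 'e) \<Rightarrow>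
      ('v, ('e list \<Rightarrow> 'k) set, 'a, 'x) modfun \<Rightarrow> 'e \<Rightarrow> 'x \<Rightarrow> 'x" where
  "at_arrow K \<Gamma> \<tau> \<sigma> X a = fmor X (tail \<Gamma> a) (head \<Gamma> a) (arrow K \<Gamma> \<tau> \<sigma> a)"

definition mesh_middle ::
    "('v, 'e) pre_digraph \<Rightarrow> 'v \<Rightarrow> ('v, 'h, 'a, 'x) modfun \<Rightarrow> ('a, 'e \<Rightarrow> 'x) module" where
  "mesh_middle \<Gamma> q X = direct_sum (in_arcs \<Gamma> q) (\<lambda>a. fob X (tail \<Gamma> a))"

definition mesh_in ::
    "('k, 'r) ring_scheme \<Rightarrow> ('v, 'e) pre_digraph \<Rightarrow> ('v \<Rightarrow> 'v) \<Rightarrow> ('e \<Rightarrow> 'e) \<Rightarrow> 'v \<Rightarrow>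
      ('v, ('e list \<Rightarrow> 'k) set, 'a, 'x) modfun \<Rightarrow> 'x \<Rightarrow> 'e \<Rightarrow> 'x" where
  "mesh_in K \<Gamma> \<tau> \<sigma> q X x = (\<lambda>a\<in>in_arcs \<Gamma> q. at_arrow K \<Gamma> \<tau> \<sigma> X (\<sigma> a) x)"

definition mesh_out ::
    "('k, 'r) ring_scheme \<Rightarrow> ('v, 'e) pre_digraph \<Rightarrow> ('v \<Rightarrow> 'v) \<Rightarrow> ('e \<Rightarrow> 'e) \<Rightarrow> 'v \<Rightarrow>
      ('v, ('e list \<Rightarrow> 'k) set, 'a, 'x) modfun \<Rightarrow> ('e \<Rightarrow> 'x) \<Rightarrow> 'x" where
  "mesh_out K \<Gamma> \<tau> \<sigma> q X t = (\<Oplus>\<^bsub>fob X q\<^esub>a\<in>in_arcs \<Gamma> q. at_arrow K \<Gamma> \<tau> \<sigma> X a (t a))"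

definition mesh_homology ::
    "('k, 'r) ring_scheme \<Rightarrow> ('v, 'e) pre_digraph \<Rightarrow> ('v \<Rightarrow> 'v) \<Rightarrow> ('e \<Rightarrow> 'e) \<Rightarrow> 'v \<Rightarrow>
      ('v, ('e list \<Rightarrow> 'k) set, 'a, 'x) modfun \<Rightarrow> ('a, ('e \<Rightarrow> 'x) set) module" where
  "mesh_homology K \<Gamma> \<tau> \<sigma> q X =
    homology_at (fob X (\<tau> q)) (mesh_in K \<Gamma> \<tau> \<sigma> q X)
      (mesh_middle \<Gamma> q X) (mesh_out K \<Gamma> \<tau> \<sigma> q X) (fob X q)"

text \<open>\<open>mesh_homology_map K \<Gamma> \<tau> \<sigma> q Y \<eta>\<close> is the map induced by \<open>\<eta> : X \<rightarrow> Y\<close>.\<close>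

definition mesh_homology_map ::
    "('k, 'r) ring_scheme \<Rightarrow> ('v, 'e) pre_digraph \<Rightarrow> ('v \<Rightarrow> 'v) \<Rightarrow> ('e \<Rightarrow> 'e) \<Rightarrow> 'v \<Rightarrow>
      ('v, ('e list \<Rightarrow> 'k) set, 'a, 'y) modfun \<Rightarrow> ('v \<Rightarrow> 'x \<Rightarrow> 'y) \<Rightarrow>
      ('e \<Rightarrow> 'x) set \<Rightarrow> ('e \<Rightarrow> 'y) set" where
  "mesh_homology_map K \<Gamma> \<tau> \<sigma> q Y \<eta> =
    quot_map (mesh_middle \<Gamma> q Y) (mesh_in K \<Gamma> \<tau> \<sigma> q Y ` carrier (fob Y (\<tau> q)))
      (\<lambda>t. \<lambda>a\<in>in_arcs \<Gamma> q. \<eta> (tail \<Gamma> a) (t a))"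

definition normal_quiver ::
    "('k, 'r) ring_scheme \<Rightarrow> ('v, 'e) pre_digraph \<Rightarrow> ('v \<Rightarrow> 'v) \<Rightarrow> ('e \<Rightarrow> 'e) \<Rightarrow> bool" where
  "normal_quiver K \<Gamma> \<tau> \<sigma> \<longleftrightarrow>
    (\<forall>p\<in>verts \<Gamma>. \<forall>q\<in>verts \<Gamma>.
       let H = mesh_homology K \<Gamma> \<tau> \<sigma> q (hom_functor (mesh_cat K \<Gamma> \<tau> \<sigma>) p)
       in carrier H = {\<zero>\<^bsub>H\<^esub>})"

end

theory Submission
  imports Defs
begin

text \<open>
  Evaluated at \<open>p\<close>, the complex \<open>F : Q(-,\<tau>q) \<rightarrow> \<Oplus>\<^sub>a Q(-,t a) \<rightarrow> Q(-,q)\<close> of representable functors is the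
  mesh complex of \<open>Q(p,-)\<close>.  Normality makes it exact in the middle, and its cokernel is \<open>S{q}\<close> because
  the image of the last map is the arrow ideal.  So \<open>F\<close> is the beginning of a projective resolution of
  \<open>S{q}\<close>, up to the kernel of its first map, which is irrelevant in degree 1; and \<open>F \<otimes>\<^sub>Q X\<close> is the mesh
  complex of \<open>X\<close> by the Yoneda lemma.

  To avoid the modules \<open>F \<otimes>\<^sub>Q X\<close>, the comparison between an arbitrary projective resolution \<open>R\<close> and \<open>F\<close>
  is carried out with elements.  A chain map \<open>f : R \<rightarrow> F\<close> is lifted step by step, a chain map \<open>g : F \<rightarrow> R\<close>
  is given by elements of \<open>R\<close>, and homotopies \<open>g f \<sim> 1\<close> and \<open>f g \<sim> 1\<close> are found in the same way.  The map
  \<open>w \<otimes> x \<mapsto> (X(f w)\<^sub>a x)\<^sub>a\<close> then induces the isomorphism from the homology of \<open>R \<otimes>\<^sub>Q X\<close> to the mesh homology.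
\<close>

section \<open>Modules, quotients and direct sums\<close>

text \<open>The complex F is not itself a \<open>projective_resolution\<close>: its terms have
  elements of different types, and it stops at Q(-,\<tau>q), where its first map is not known to be
  injective. So the comparison with R is made by hand in degrees 0, 1 and 2. Its two directions
  differ in kind. Maps out of R come from the lifting property and are natural transformations
  \<open>f0\<close>, \<open>f1\<close>, \<open>f2\<close>, \<open>h0\<close>, \<open>h1\<close>.
  Maps out of a representable functor are elements, by the Yoneda lemma: \<open>u0\<close>,
  \<open>u\<close> and a lift \<open>v\<close> of the identity of \<tau>q for g, \<open>s0\<close>
  and \<open>s1\<close> for the second homotopy. In degree 1 these satisfy g1 f1 - 1 = d1 h1 + h0 d0
  and f1 g1 - 1 = s0 out + inn s1. After tensoring with X the terms through d0 and out vanish on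
  cycles, and a boundary remains; f0 and f2 ensure that cycles go to cycles and boundaries to
  boundaries. Normality enters through the lifts f2 and s1, the description of the arrow ideal
  through f1 and s0. All data are chosen before X, which gives naturality in X.\<close>

lemma (in abelian_group) uminus_zero: "\<ominus> \<zero> = \<zero>"
  by (simp add: a_inv_def)

lemma (in abelian_group) minus_add_cancel:
  "x \<in> carrier G \<Longrightarrow> y \<in> carrier G \<Longrightarrow> (x \<ominus> y) \<oplus> y = x"
  by (simp add: a_minus_def a_assoc l_neg)

lemma (in abelian_group) minus_eq_zero_iff:
  "x \<in> carrier G \<Longrightarrow> y \<in> carrier G \<Longrightarrow> x \<ominus> y = \<zero> \<longleftrightarrow> x = y"
  using minus_add_cancel[of x y] by (auto simp: a_minus_def r_neg)

lemma (in left_module) smult_l_null [simp]: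
  assumes "x \<in> carrier M"
  shows "\<zero>\<^bsub>R\<^esub> \<odot>\<^bsub>M\<^esub> x = \<zero>\<^bsub>M\<^esub>"
proof -
  have "\<zero>\<^bsub>R\<^esub> \<odot>\<^bsub>M\<^esub> x \<oplus>\<^bsub>M\<^esub> \<zero>\<^bsub>R\<^esub> \<odot>\<^bsub>M\<^esub> x = \<zero>\<^bsub>R\<^esub> \<odot>\<^bsub>M\<^esub> x"
    using smult_l_distr[of "\<zero>\<^bsub>R\<^esub>" "\<zero>\<^bsub>R\<^esub>" x] assms by simp
  then show ?thesis using assms smult_closed[of "\<zero>\<^bsub>R\<^esub>" x] by (simp add: M.add.r_cancel_one)
qed

lemma (in left_module) smult_r_null [simp]:
  assumes "a \<in> carrier R"
  shows "a \<odot>\<^bsub>M\<^esub> \<zero>\<^bsub>M\<^esub> = \<zero>\<^bsub>M\<^esub>"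
proof -
  have "a \<odot>\<^bsub>M\<^esub> \<zero>\<^bsub>M\<^esub> \<oplus>\<^bsub>M\<^esub> a \<odot>\<^bsub>M\<^esub> \<zero>\<^bsub>M\<^esub> = a \<odot>\<^bsub>M\<^esub> \<zero>\<^bsub>M\<^esub>"
    using smult_r_distr[of a "\<zero>\<^bsub>M\<^esub>" "\<zero>\<^bsub>M\<^esub>"] assms by simp
  then show ?thesis using assms smult_closed[of a "\<zero>\<^bsub>M\<^esub>"] by (simp add: M.add.r_cancel_one)
qed

lemma (in left_module) smult_hom:
  "a \<in> carrier R \<Longrightarrow> (\<lambda>x. a \<odot>\<^bsub>M\<^esub> x) \<in> hom (add_monoid M) (add_monoid M)"
  by (auto simp: hom_def smult_closed smult_r_distr)

text \<open>Stated for additive maps because many maps below are linear over no common ring: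
  \<open>w \<mapsto> w \<otimes> x\<close> and \<open>f \<mapsto> X(f) x\<close> lead from K-modules
  to A-modules, and multiplication by an element of the noncommutative ring A is only
  additive.\<close>

lemma additive_hom_simps:
  assumes "abelian_group M" "abelian_group N" "h \<in> hom (add_monoid M) (add_monoid N)"
  shows additive_hom_closed: "x \<in> carrier M \<Longrightarrow> h x \<in> carrier N"
    and additive_hom_add: "x \<in> carrier M \<Longrightarrow> y \<in> carrier M \<Longrightarrow> h (x \<oplus>\<^bsub>M\<^esub> y) = h x \<oplus>\<^bsub>N\<^esub> h y"
    and additive_hom_zero: "h \<zero>\<^bsub>M\<^esub> = \<zero>\<^bsub>N\<^esub>"
    and additive_hom_uminus: "x \<in> carrier M \<Longrightarrow> h (\<ominus>\<^bsub>M\<^esub> x) = \<ominus>\<^bsub>N\<^esub> h x"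
    and additive_hom_minus:
      "x \<in> carrier M \<Longrightarrow> y \<in> carrier M \<Longrightarrow> h (x \<ominus>\<^bsub>M\<^esub> y) = h x \<ominus>\<^bsub>N\<^esub> h y"
    and additive_hom_finsum:
      "f \<in> I \<rightarrow> carrier M \<Longrightarrow> h (finsum M f I) = finsum N (\<lambda>i. h (f i)) I"
proof -
  interpret abelian_group_hom M N h
    by (rule abelian_group_homI)
      (use assms in \<open>auto simp: group_hom_def group_hom_axioms_def abelian_group.a_group\<close>)
  show "x \<in> carrier M \<Longrightarrow> h x \<in> carrier N" by simp
  show "x \<in> carrier M \<Longrightarrow> y \<in> carrier M \<Longrightarrow> h (x \<oplus>\<^bsub>M\<^esub> y) = h x \<oplus>\<^bsub>N\<^esub> h y" by simp
  show "h \<zero>\<^bsub>M\<^esub> = \<zero>\<^bsub>N\<^esub>" by simp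
  show "x \<in> carrier M \<Longrightarrow> h (\<ominus>\<^bsub>M\<^esub> x) = \<ominus>\<^bsub>N\<^esub> h x" by simp
  show "x \<in> carrier M \<Longrightarrow> y \<in> carrier M \<Longrightarrow> h (x \<ominus>\<^bsub>M\<^esub> y) = h x \<ominus>\<^bsub>N\<^esub> h y"
    by (simp add: a_minus_def)
  show "f \<in> I \<rightarrow> carrier M \<Longrightarrow> h (finsum M f I) = finsum N (\<lambda>i. h (f i)) I"
  proof (induction I rule: infinite_finite_induct)
    case (insert i I)
    have "(\<lambda>i. h (f i)) \<in> I \<rightarrow> carrier N" using insert.prems by (auto simp: Pi_iff)
    with insert show ?case by simp
  qed auto
qed

lemma lmod_hom_additive: "h \<in> lmod_hom A M N \<Longrightarrow> h \<in> hom (add_monoid M) (add_monoid N)"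
  by (simp add: lmod_hom_def)

lemma lmod_hom_closed: "h \<in> lmod_hom A M N \<Longrightarrow> x \<in> carrier M \<Longrightarrow> h x \<in> carrier N"
  by (auto simp: lmod_hom_def hom_def)

lemma lmod_hom_add:
  "h \<in> lmod_hom A M N \<Longrightarrow> x \<in> carrier M \<Longrightarrow> y \<in> carrier M \<Longrightarrow> h (x \<oplus>\<^bsub>M\<^esub> y) = h x \<oplus>\<^bsub>N\<^esub> h y"
  by (auto simp: lmod_hom_def hom_def)

lemma lmod_hom_smult:
  "h \<in> lmod_hom A M N \<Longrightarrow> a \<in> carrier A \<Longrightarrow> x \<in> carrier M \<Longrightarrow> h (a \<odot>\<^bsub>M\<^esub> x) = a \<odot>\<^bsub>N\<^esub> h x"
  by (auto simp: lmod_hom_def)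

lemma lmod_homI:
  assumes "\<And>x. x \<in> carrier M \<Longrightarrow> h x \<in> carrier N"
    and "\<And>x y. x \<in> carrier M \<Longrightarrow> y \<in> carrier M \<Longrightarrow> h (x \<oplus>\<^bsub>M\<^esub> y) = h x \<oplus>\<^bsub>N\<^esub> h y"
    and "\<And>a x. a \<in> carrier A \<Longrightarrow> x \<in> carrier M \<Longrightarrow> h (a \<odot>\<^bsub>M\<^esub> x) = a \<odot>\<^bsub>N\<^esub> h x"
  shows "h \<in> lmod_hom A M N"
  using assms by (auto simp: lmod_hom_def hom_def)

lemma lmod_hom_comp:
  "g \<in> lmod_hom A N L \<Longrightarrow> h \<in> lmod_hom A M N \<Longrightarrow> (\<lambda>x. g (h x)) \<in> lmod_hom A M L"
  by (rule lmod_homI) (auto simp: lmod_hom_closed lmod_hom_add lmod_hom_smult)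

lemma left_module_abelian_group: "left_module A M \<Longrightarrow> abelian_group M"
  by (simp add: left_module_def)

lemma lmod_hom_zero:
  "left_module A M \<Longrightarrow> left_module A N \<Longrightarrow> h \<in> lmod_hom A M N \<Longrightarrow> h \<zero>\<^bsub>M\<^esub> = \<zero>\<^bsub>N\<^esub>"
  by (meson additive_hom_zero left_module_abelian_group lmod_hom_additive)

lemma lmod_hom_minus:
  "left_module A M \<Longrightarrow> left_module A N \<Longrightarrow> h \<in> lmod_hom A M N \<Longrightarrow> x \<in> carrier M \<Longrightarrow> y \<in> carrier M
    \<Longrightarrow> h (x \<ominus>\<^bsub>M\<^esub> y) = h x \<ominus>\<^bsub>N\<^esub> h y"
  by (meson additive_hom_minus left_module_abelian_group lmod_hom_additive)

lemma lmod_hom_finsum: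
  "left_module A M \<Longrightarrow> left_module A N \<Longrightarrow> h \<in> lmod_hom A M N \<Longrightarrow> f \<in> I \<rightarrow> carrier M
    \<Longrightarrow> h (finsum M f I) = finsum N (\<lambda>i. h (f i)) I"
  by (rule additive_hom_finsum[OF _ _ lmod_hom_additive]) (auto simp: left_module_abelian_group)

lemma (in left_module) finsum_smult:
  "a \<in> carrier R \<Longrightarrow> f \<in> I \<rightarrow> carrier M
    \<Longrightarrow> a \<odot>\<^bsub>M\<^esub> finsum M f I = finsum M (\<lambda>i. a \<odot>\<^bsub>M\<^esub> f i) I"
  by (rule additive_hom_finsum[OF M.abelian_group_axioms M.abelian_group_axioms smult_hom])

lemma (in left_module) smult_uminus:
  "a \<in> carrier R \<Longrightarrow> x \<in> carrier M \<Longrightarrow> a \<odot>\<^bsub>M\<^esub> (\<ominus>\<^bsub>M\<^esub> x) = \<ominus>\<^bsub>M\<^esub> (a \<odot>\<^bsub>M\<^esub> x)"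
  by (rule additive_hom_uminus[OF M.abelian_group_axioms M.abelian_group_axioms smult_hom])

lemma (in left_module) smult_minus:
  "a \<in> carrier R \<Longrightarrow> x \<in> carrier M \<Longrightarrow> y \<in> carrier M
    \<Longrightarrow> a \<odot>\<^bsub>M\<^esub> (x \<ominus>\<^bsub>M\<^esub> y) = a \<odot>\<^bsub>M\<^esub> x \<ominus>\<^bsub>M\<^esub> a \<odot>\<^bsub>M\<^esub> y"
  by (rule additive_hom_minus[OF M.abelian_group_axioms M.abelian_group_axioms smult_hom])

lemma lmod_hom_finsum_pointwise:
  assumes "left_module A N" "\<And>i. i \<in> I \<Longrightarrow> h i \<in> lmod_hom A M N"
  shows "(\<lambda>x. finsum N (\<lambda>i. h i x) I) \<in> lmod_hom A M N"
proof -
  interpret N: left_module A N by fact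
  have c: "(\<lambda>i. h i x) \<in> I \<rightarrow> carrier N" if "x \<in> carrier M" for x
    using assms(2) that lmod_hom_closed by fastforce
  show ?thesis
  proof (rule lmod_homI)
    fix x assume x: "x \<in> carrier M"
    then show "finsum N (\<lambda>i. h i x) I \<in> carrier N" using c by simp
    show "finsum N (\<lambda>i. h i (a \<odot>\<^bsub>M\<^esub> x)) I = a \<odot>\<^bsub>N\<^esub> finsum N (\<lambda>i. h i x) I"
      if "a \<in> carrier A" for a
      unfolding N.finsum_smult[OF that c[OF x]]
      by (rule N.M.finsum_cong')
        (use x that c in \<open>auto simp: lmod_hom_smult[OF assms(2)] intro!: N.smult_closed\<close>)
    show "finsum N (\<lambda>i. h i (x \<oplus>\<^bsub>M\<^esub> y)) I = finsum N (\<lambda>i. h i x) I \<oplus>\<^bsub>N\<^esub> finsum N (\<lambda>i. h i y) I"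
      if y: "y \<in> carrier M" for y
      unfolding N.M.finsum_addf[OF c[OF x] c[OF y], symmetric]
      by (rule N.M.finsum_cong') (use x y c in \<open>auto simp: lmod_hom_add[OF assms(2)]\<close>)
  qed
qed

lemma lmod_hom_add_pointwise:
  assumes "left_module A N" "g \<in> lmod_hom A M N" "h \<in> lmod_hom A M N"
  shows "(\<lambda>x. g x \<oplus>\<^bsub>N\<^esub> h x) \<in> lmod_hom A M N"
proof -
  interpret N: left_module A N by fact
  show ?thesis
    using assms
    by (intro lmod_homI)
      (simp_all add: lmod_hom_closed lmod_hom_add lmod_hom_smult N.smult_r_distr N.M.a_ac)
qed

lemma lmod_hom_minus_pointwise:
  assumes "left_module A N" "g \<in> lmod_hom A M N" "h \<in> lmod_hom A M N"
  shows "(\<lambda>x. g x \<ominus>\<^bsub>N\<^esub> h x) \<in> lmod_hom A M N"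
proof -
  interpret N: left_module A N by fact
  show ?thesis
    using assms
    by (intro lmod_homI)
      (simp_all add: lmod_hom_closed lmod_hom_add lmod_hom_smult N.smult_minus a_minus_def
         N.smult_r_distr N.smult_uminus N.smult_closed N.M.minus_add N.M.a_ac)
qed

lemma zero_lmod_hom: "left_module A N \<Longrightarrow> (\<lambda>x. \<zero>\<^bsub>N\<^esub>) \<in> lmod_hom A M N"
proof -
  assume "left_module A N"
  then interpret left_module A N .
  show ?thesis by (rule lmod_homI) simp_all
qed

lemma left_moduleI:
  assumes "ring A" "abelian_group M"
    and "\<And>a x. a \<in> carrier A \<Longrightarrow> x \<in> carrier M \<Longrightarrow> a \<odot>\<^bsub>M\<^esub> x \<in> carrier M"
    and "\<And>a b x. a \<in> carrier A \<Longrightarrow> b \<in> carrier A \<Longrightarrow> x \<in> carrier M \<Longrightarrow>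
      (a \<oplus>\<^bsub>A\<^esub> b) \<odot>\<^bsub>M\<^esub> x = a \<odot>\<^bsub>M\<^esub> x \<oplus>\<^bsub>M\<^esub> b \<odot>\<^bsub>M\<^esub> x"
    and "\<And>a x y. a \<in> carrier A \<Longrightarrow> x \<in> carrier M \<Longrightarrow> y \<in> carrier M \<Longrightarrow>
      a \<odot>\<^bsub>M\<^esub> (x \<oplus>\<^bsub>M\<^esub> y) = a \<odot>\<^bsub>M\<^esub> x \<oplus>\<^bsub>M\<^esub> a \<odot>\<^bsub>M\<^esub> y"
    and "\<And>a b x. a \<in> carrier A \<Longrightarrow> b \<in> carrier A \<Longrightarrow> x \<in> carrier M \<Longrightarrow>
      (a \<otimes>\<^bsub>A\<^esub> b) \<odot>\<^bsub>M\<^esub> x = a \<odot>\<^bsub>M\<^esub> (b \<odot>\<^bsub>M\<^esub> x)"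
    and "\<And>x. x \<in> carrier M \<Longrightarrow> \<one>\<^bsub>A\<^esub> \<odot>\<^bsub>M\<^esub> x = x"
  shows "left_module A M"
  using assms by (simp add: left_module_def left_module_axioms_def)

text \<open>Negatives are the multiples by -1, so closure under addition and scalars already gives
  the subgroup that the library locale asks for.\<close>

lemma submoduleI:
  assumes "left_module A M" "N \<subseteq> carrier M" "\<zero>\<^bsub>M\<^esub> \<in> N"
    and add: "\<And>x y. x \<in> N \<Longrightarrow> y \<in> N \<Longrightarrow> x \<oplus>\<^bsub>M\<^esub> y \<in> N"
    and smult: "\<And>a x. a \<in> carrier A \<Longrightarrow> x \<in> N \<Longrightarrow> a \<odot>\<^bsub>M\<^esub> x \<in> N"
  shows "submodule N A M"
proof -
  interpret left_module A M by fact
  have "\<ominus>\<^bsub>M\<^esub> x \<in> N" if "x \<in> N" for x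
  proof -
    have x: "x \<in> carrier M" using that assms(2) by auto
    have "x \<oplus>\<^bsub>M\<^esub> (\<ominus>\<^bsub>A\<^esub> \<one>\<^bsub>A\<^esub>) \<odot>\<^bsub>M\<^esub> x = (\<one>\<^bsub>A\<^esub> \<oplus>\<^bsub>A\<^esub> (\<ominus>\<^bsub>A\<^esub> \<one>\<^bsub>A\<^esub>)) \<odot>\<^bsub>M\<^esub> x"
      using x by (subst smult_l_distr) (simp_all add: smult_one)
    also have "\<dots> = \<zero>\<^bsub>M\<^esub>" using x by (simp add: R.r_neg)
    finally have "\<ominus>\<^bsub>M\<^esub> x = (\<ominus>\<^bsub>A\<^esub> \<one>\<^bsub>A\<^esub>) \<odot>\<^bsub>M\<^esub> x"
      using x smult_closed by (metis M.minus_equality M.a_comm R.a_inv_closed R.one_closed)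
    then show ?thesis using smult[of "\<ominus>\<^bsub>A\<^esub> \<one>\<^bsub>A\<^esub>" x] that by simp
  qed
  then have "subgroup N (add_monoid M)"
    using assms by unfold_locales (auto simp: a_inv_def[symmetric])
  then show ?thesis
    using smult by (simp add: submodule_def submodule_axioms_def)
qed

lemma submodule_closed:
  assumes "submodule N A M"
  shows submodule_subset: "N \<subseteq> carrier M"
    and submodule_zero: "\<zero>\<^bsub>M\<^esub> \<in> N"
    and submodule_add: "x \<in> N \<Longrightarrow> y \<in> N \<Longrightarrow> x \<oplus>\<^bsub>M\<^esub> y \<in> N"
    and submodule_smult: "a \<in> carrier A \<Longrightarrow> x \<in> N \<Longrightarrow> a \<odot>\<^bsub>M\<^esub> x \<in> N"
    and submodule_uminus: "x \<in> N \<Longrightarrow> \<ominus>\<^bsub>M\<^esub> x \<in> N"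
proof -
  interpret submodule N A M by fact
  show "N \<subseteq> carrier M" "\<zero>\<^bsub>M\<^esub> \<in> N" "x \<in> N \<Longrightarrow> y \<in> N \<Longrightarrow> x \<oplus>\<^bsub>M\<^esub> y \<in> N"
    "a \<in> carrier A \<Longrightarrow> x \<in> N \<Longrightarrow> a \<odot>\<^bsub>M\<^esub> x \<in> N" "x \<in> N \<Longrightarrow> \<ominus>\<^bsub>M\<^esub> x \<in> N"
    using subset one_closed m_closed m_inv_closed by (auto simp: a_inv_def)
qed


lemma submodule_abelian_subgroup:
  "abelian_group M \<Longrightarrow> submodule N A M \<Longrightarrow> abelian_subgroup N M"
  by (simp add: abelian_subgroupI3 additive_subgroupI submodule_def)

lemma left_module_submodule:
  assumes "left_module A M" "submodule N A M"
  shows "left_module A (M\<lparr>carrier := N\<rparr>)"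
proof -
  interpret left_module A M by fact
  note N = submodule_closed[OF assms(2)]
  have c: "x \<in> N \<Longrightarrow> x \<in> carrier M" for x using N by auto
  have "abelian_group (M\<lparr>carrier := N\<rparr>)"
  proof (rule abelian_groupI)
    fix x assume "x \<in> carrier (M\<lparr>carrier := N\<rparr>)"
    then show "\<exists>y\<in>carrier (M\<lparr>carrier := N\<rparr>). y \<oplus>\<^bsub>M\<lparr>carrier := N\<rparr>\<^esub> x = \<zero>\<^bsub>M\<lparr>carrier := N\<rparr>\<^esub>"
      using N by (intro bexI[of _ "\<ominus>\<^bsub>M\<^esub> x"]) (auto simp: c M.l_neg)
  qed (use N in \<open>auto simp: c M.a_ac\<close>)
  then show ?thesis
    by (intro left_moduleI R.ring_axioms)
      (use N in \<open>auto simp: c smult_l_distr smult_r_distr smult_assoc smult_one\<close>)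
qed

lemma submodule_kernel:
  assumes "left_module A M" "left_module A N" "h \<in> lmod_hom A M N"
  shows "submodule (a_kernel M N h) A M"
proof -
  interpret M: left_module A M by fact
  interpret N: left_module A N by fact
  note lmod_hom_add[OF assms(3), simp] lmod_hom_smult[OF assms(3), simp]
  have "h \<zero>\<^bsub>M\<^esub> = \<zero>\<^bsub>N\<^esub>" using assms by (rule lmod_hom_zero)
  then show ?thesis
    by (intro submoduleI assms(1))
      (auto simp: a_kernel_def kernel_def M.smult_closed)
qed

lemma mem_a_kernel: "x \<in> a_kernel M N h \<longleftrightarrow> x \<in> carrier M \<and> h x = \<zero>\<^bsub>N\<^esub>"
  by (simp add: a_kernel_def kernel_def)

lemma submodule_image:
  assumes "left_module A M" "left_module A N" "h \<in> lmod_hom A M N"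
  shows "submodule (h ` carrier M) A N"
proof -
  interpret M: left_module A M by fact
  interpret N: left_module A N by fact
  note h = lmod_hom_closed[OF assms(3)] lmod_hom_add[OF assms(3), symmetric]
    lmod_hom_smult[OF assms(3), symmetric] lmod_hom_zero[OF assms, symmetric]
  show ?thesis
    by (intro submoduleI assms(2)) (auto simp: h M.smult_closed)
qed

lemma submodule_vimage:
  assumes "left_module A M" "left_module A N" "h \<in> lmod_hom A M N" "submodule L A N"
  shows "submodule {x \<in> carrier M. h x \<in> L} A M"
proof -
  interpret M: left_module A M by fact
  show ?thesis
    by (rule submoduleI[OF assms(1)])
      (simp_all add: lmod_hom_zero[OF assms(1-3)] lmod_hom_add[OF assms(3)] lmod_hom_smult[OF assms(3)]
        submodule_zero[OF assms(4)] submodule_add[OF assms(4)] submodule_smult[OF assms(4)]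
        M.smult_closed Collect_restrict)
qed

lemma submodule_generated_least:
  "submodule N A M \<Longrightarrow> S \<subseteq> N \<Longrightarrow> submodule_generated A M S \<subseteq> N"
  unfolding submodule_generated_def by (rule Inter_lower) simp

lemma submodule_generated_incl: "S \<subseteq> submodule_generated A M S"
  unfolding submodule_generated_def by (rule Inter_greatest) simp

lemma submodule_carrier: "left_module A M \<Longrightarrow> submodule (carrier M) A M"
proof -
  assume M: "left_module A M"
  interpret left_module A M by (rule M)
  show ?thesis by (rule submoduleI[OF M]) (simp_all add: smult_closed)
qed

text \<open>The inclusion of \<open>S\<close> in the carrier makes the family of submodules
  nonempty, with \<open>carrier M\<close> as a member; an empty intersection would be the whole
  type.\<close>

lemma submodule_submodule_generated:
  assumes "left_module A M" "S \<subseteq> carrier M"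
  shows "submodule (submodule_generated A M S) A M"
proof (rule submoduleI[OF assms(1)])
  show "submodule_generated A M S \<subseteq> carrier M"
    by (rule submodule_generated_least[OF submodule_carrier[OF assms(1)] assms(2)])
qed (simp_all add: submodule_generated_def, meson submodule_zero, meson submodule_add, meson submodule_smult)

subsection \<open>Quotients\<close>

lemma quot_module_simps [simp]:
  "carrier (quot_module M N) = a_rcosets\<^bsub>M\<^esub> N"
  "\<zero>\<^bsub>quot_module M N\<^esub> = N"
  "C \<oplus>\<^bsub>quot_module M N\<^esub> D = C <+>\<^bsub>M\<^esub> D"
  "a \<odot>\<^bsub>quot_module M N\<^esub> C = (\<Union>x\<in>C. N +>\<^bsub>M\<^esub> (a \<odot>\<^bsub>M\<^esub> x))"
  by (simp_all add: quot_module_def)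

lemma mem_a_rcosets: "C \<in> a_rcosets\<^bsub>M\<^esub> N \<longleftrightarrow> (\<exists>x\<in>carrier M. C = N +>\<^bsub>M\<^esub> x)"
  by (auto simp: A_RCOSETS_def')

lemma (in abelian_subgroup) coset_eq_iff:
  assumes "x \<in> carrier G" "y \<in> carrier G"
  shows "H +> x = H +> y \<longleftrightarrow> x \<ominus> y \<in> H"
proof -
  have "H +> x = H +> y \<longleftrightarrow> x \<in> H +> y"
    using assms a_repr_independence' a_rcos_self by metis
  also have "\<dots> \<longleftrightarrow> x \<ominus> y \<in> H"
    using assms a_rcos_module[of y x] by (simp add: a_minus_def)
  finally show ?thesis .
qed

lemma abelian_group_quot_module:
  fixes G :: "('a, 'm) module"
  assumes "abelian_subgroup H G"
  shows "abelian_group (quot_module G H)"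
proof -
  interpret abelian_subgroup H G by fact
  note add = a_rcos_sum
  have zero: "H = H +>\<^bsub>G\<^esub> \<zero>\<^bsub>G\<^esub>" using a_subset by simp
  show ?thesis
  proof (rule abelian_groupI)
    fix C assume "C \<in> carrier (quot_module G H)"
    then obtain x where x: "x \<in> carrier G" "C = H +>\<^bsub>G\<^esub> x" by (auto simp: mem_a_rcosets)
    show "\<zero>\<^bsub>quot_module G H\<^esub> \<oplus>\<^bsub>quot_module G H\<^esub> C = C"
      using x add[of "\<zero>\<^bsub>G\<^esub>" x] zero by simp
    show "\<exists>D\<in>carrier (quot_module G H). D \<oplus>\<^bsub>quot_module G H\<^esub> C = \<zero>\<^bsub>quot_module G H\<^esub>"
      using x add[of "\<ominus>\<^bsub>G\<^esub> x" x] zero a_rcosetsI[OF a_subset a_inv_closed[of x]]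
      by (intro bexI[of _ "H +>\<^bsub>G\<^esub> (\<ominus>\<^bsub>G\<^esub> x)"]) (auto simp: l_neg)
    fix D assume "D \<in> carrier (quot_module G H)"
    then obtain y where y: "y \<in> carrier G" "D = H +>\<^bsub>G\<^esub> y" by (auto simp: mem_a_rcosets)
    show "C \<oplus>\<^bsub>quot_module G H\<^esub> D \<in> carrier (quot_module G H)"
      using x y by (auto simp: add mem_a_rcosets)
    show "C \<oplus>\<^bsub>quot_module G H\<^esub> D = D \<oplus>\<^bsub>quot_module G H\<^esub> C"
      using x y by (simp add: add a_comm)
    fix E assume "E \<in> carrier (quot_module G H)"
    then obtain z where z: "z \<in> carrier G" "E = H +>\<^bsub>G\<^esub> z" by (auto simp: mem_a_rcosets)
    show "C \<oplus>\<^bsub>quot_module G H\<^esub> D \<oplus>\<^bsub>quot_module G H\<^esub> E =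
        C \<oplus>\<^bsub>quot_module G H\<^esub> (D \<oplus>\<^bsub>quot_module G H\<^esub> E)"
      using x y z by (simp add: add a_assoc)
  next
    show "\<zero>\<^bsub>quot_module G H\<^esub> \<in> carrier (quot_module G H)"
      using zero by (auto simp: mem_a_rcosets)
  qed
qed

text \<open>All cosets in the union that defines \<open>quot_map\<close> coincide: two elements of
  \<open>H +> x\<close> differ by an element of \<open>H\<close>, whose image lies in
  \<open>H'\<close>. A union of equal sets over a nonempty index set is that set.\<close>

lemma (in abelian_subgroup) quot_map_coset:
  assumes "abelian_subgroup H' G'" "h \<in> hom (add_monoid G) (add_monoid G')" "h ` H \<subseteq> H'"
    and x: "x \<in> carrier G"
  shows "quot_map G' H' h (H +> x) = H' +>\<^bsub>G'\<^esub> h x"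
proof -
  interpret Q: abelian_subgroup H' G' by fact
  note h = additive_hom_closed[OF abelian_group_axioms Q.abelian_group_axioms assms(2)]
    additive_hom_minus[OF abelian_group_axioms Q.abelian_group_axioms assms(2)]
  have "H' +>\<^bsub>G'\<^esub> h y = H' +>\<^bsub>G'\<^esub> h x" if "y \<in> H +> x" for y
  proof -
    have y: "y \<in> carrier G" using that x a_elemrcos_carrier by blast
    have "H +> y = H +> x" using that x a_repr_independence' by metis
    then have "y \<ominus> x \<in> H" using x y coset_eq_iff by blast
    then have "h y \<ominus>\<^bsub>G'\<^esub> h x \<in> H'" using assms(3) h(2)[OF y x] by force
    then show ?thesis using x y h(1) Q.coset_eq_iff by blast
  qed
  moreover have "x \<in> H +> x" using x by (rule a_rcos_self)
  ultimately show ?thesis unfolding quot_map_def by (intro UN_constant_eq) blast+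
qed

text \<open>The scalar action of \<open>quot_module\<close> has the same form as
  \<open>quot_map\<close> applied to multiplication by \<open>a\<close>, so this is an instance of
  the preceding lemma.\<close>

lemma quot_module_smult_coset:
  fixes G :: "('a, 'm) module"
  assumes "abelian_subgroup H G"
    "(\<lambda>x. a \<odot>\<^bsub>G\<^esub> x) \<in> hom (add_monoid G) (add_monoid G)"
    "(\<lambda>x. a \<odot>\<^bsub>G\<^esub> x) ` H \<subseteq> H" "x \<in> carrier G"
  shows "a \<odot>\<^bsub>quot_module G H\<^esub> (H +>\<^bsub>G\<^esub> x) = H +>\<^bsub>G\<^esub> (a \<odot>\<^bsub>G\<^esub> x)"
  using abelian_subgroup.quot_map_coset[OF assms(1) assms] by (simp add: quot_map_def)

lemma quot_module_add_coset:
  fixes G :: "('a, 'm) module"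
  shows "abelian_subgroup H G \<Longrightarrow> x \<in> carrier G \<Longrightarrow> y \<in> carrier G \<Longrightarrow>
    (H +>\<^bsub>G\<^esub> x) \<oplus>\<^bsub>quot_module G H\<^esub> (H +>\<^bsub>G\<^esub> y) = H +>\<^bsub>G\<^esub> (x \<oplus>\<^bsub>G\<^esub> y)"
  by (simp add: abelian_subgroup.a_rcos_sum)

text \<open>Meaningful only if \<open>h\<close> is constant on \<open>C\<close>, such as for a coset \<open>C\<close> of a subgroup on which the
  homomorphism \<open>h\<close> vanishes.\<close>

definition coset_ext :: "('m \<Rightarrow> 'n) \<Rightarrow> 'm set \<Rightarrow> 'n" where
  "coset_ext h C = the_elem (h ` C)"

lemma (in abelian_subgroup) coset_ext_coset:
  assumes "abelian_group P" "h \<in> hom (add_monoid G) (add_monoid P)"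
    and zero: "\<And>x. x \<in> H \<Longrightarrow> h x = \<zero>\<^bsub>P\<^esub>" and x: "x \<in> carrier G"
  shows "coset_ext h (H +> x) = h x"
proof -
  interpret P: abelian_group P by fact
  note h = additive_hom_closed[OF abelian_group_axioms P.abelian_group_axioms assms(2)]
    additive_hom_minus[OF abelian_group_axioms P.abelian_group_axioms assms(2)]
  have "h y = h x" if "y \<in> H +> x" for y
  proof -
    have y: "y \<in> carrier G" using that x a_elemrcos_carrier by blast
    have "H +> y = H +> x" using that x a_repr_independence' by metis
    then have "y \<ominus> x \<in> H" using x y coset_eq_iff by blast
    then have "h y \<ominus>\<^bsub>P\<^esub> h x = \<zero>\<^bsub>P\<^esub>" using zero h(2)[OF y x] by force
    then show ?thesis using x y h(1) P.minus_eq_zero_iff by blast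
  qed
  moreover have "x \<in> H +> x" using x by (rule a_rcos_self)
  ultimately have "h ` (H +> x) = {h x}" by (metis image_constant_conv image_cong empty_iff)
  then show ?thesis by (simp add: coset_ext_def)
qed

lemma coset_ext_additive:
  fixes G :: "('a, 'm) module"
  assumes "abelian_subgroup H G" "abelian_group P" "h \<in> hom (add_monoid G) (add_monoid P)"
    and zero: "\<And>x. x \<in> H \<Longrightarrow> h x = \<zero>\<^bsub>P\<^esub>"
  shows "coset_ext h \<in> hom (add_monoid (quot_module G H)) (add_monoid P)"
proof (rule homI)
  interpret abelian_subgroup H G by fact
  note e = coset_ext_coset[OF assms(2-)]
  note h = additive_hom_closed[OF abelian_group_axioms assms(2,3)]
    additive_hom_add[OF abelian_group_axioms assms(2,3)]
  fix C assume "C \<in> carrier (add_monoid (quot_module G H))"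
  then obtain x where x: "x \<in> carrier G" "C = H +>\<^bsub>G\<^esub> x" by (auto simp: mem_a_rcosets)
  then show "coset_ext h C \<in> carrier (add_monoid P)" using e h by simp
  fix D assume "D \<in> carrier (add_monoid (quot_module G H))"
  then obtain y where y: "y \<in> carrier G" "D = H +>\<^bsub>G\<^esub> y" by (auto simp: mem_a_rcosets)
  show "coset_ext h (C \<otimes>\<^bsub>add_monoid (quot_module G H)\<^esub> D) =
      coset_ext h C \<otimes>\<^bsub>add_monoid P\<^esub> coset_ext h D"
    using x y e h by (simp add: a_rcos_sum)
qed

lemma submodule_smult_image:
  "submodule N A M \<Longrightarrow> a \<in> carrier A \<Longrightarrow> (\<lambda>x. a \<odot>\<^bsub>M\<^esub> x) ` N \<subseteq> N"
  by (auto simp: submodule_smult)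

lemma quot_module_smult:
  assumes "left_module A M" "submodule N A M" "a \<in> carrier A" "x \<in> carrier M"
  shows "a \<odot>\<^bsub>quot_module M N\<^esub> (N +>\<^bsub>M\<^esub> x) = N +>\<^bsub>M\<^esub> (a \<odot>\<^bsub>M\<^esub> x)"
proof -
  interpret left_module A M by fact
  interpret abelian_subgroup N M
    using submodule_abelian_subgroup[OF M.abelian_group_axioms assms(2)] .
  show ?thesis
    using assms by (intro quot_module_smult_coset abelian_subgroup_axioms smult_hom submodule_smult_image)
qed

lemma quot_module_add:
  assumes "left_module A M" "submodule N A M" "x \<in> carrier M" "y \<in> carrier M"
  shows "(N +>\<^bsub>M\<^esub> x) \<oplus>\<^bsub>quot_module M N\<^esub> (N +>\<^bsub>M\<^esub> y) = N +>\<^bsub>M\<^esub> (x \<oplus>\<^bsub>M\<^esub> y)"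
  by (rule quot_module_add_coset[OF submodule_abelian_subgroup[OF left_module_abelian_group[OF assms(1)] assms(2)] assms(3,4)])

lemma quot_module_coset_eq_iff:
  assumes "left_module A M" "submodule N A M" "x \<in> carrier M" "y \<in> carrier M"
  shows "N +>\<^bsub>M\<^esub> x = N +>\<^bsub>M\<^esub> y \<longleftrightarrow> x \<ominus>\<^bsub>M\<^esub> y \<in> N"
  by (rule abelian_subgroup.coset_eq_iff[OF submodule_abelian_subgroup[OF left_module_abelian_group[OF assms(1)] assms(2)] assms(3,4)])

lemma quot_module_coset_eq_zero_iff:
  assumes "left_module A M" "submodule N A M" "x \<in> carrier M"
  shows "N +>\<^bsub>M\<^esub> x = N \<longleftrightarrow> x \<in> N"
proof -
  interpret left_module A M by fact
  interpret abelian_subgroup N M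
    using submodule_abelian_subgroup[OF M.abelian_group_axioms assms(2)] .
  have "N +>\<^bsub>M\<^esub> \<zero>\<^bsub>M\<^esub> = N" using a_subset by simp
  then show ?thesis using quot_module_coset_eq_iff[OF assms(1,2,3), of "\<zero>\<^bsub>M\<^esub>"] assms(3)
    by (simp add: a_minus_def M.uminus_zero)
qed

lemma left_module_quot_module:
  assumes "left_module A M" "submodule N A M"
  shows "left_module A (quot_module M N)"
proof -
  interpret left_module A M by fact
  interpret abelian_subgroup N M
    using submodule_abelian_subgroup[OF M.abelian_group_axioms assms(2)] .
  note s = quot_module_smult[OF assms] quot_module_add[OF assms]
  show ?thesis
    by (intro left_moduleI R.ring_axioms abelian_group_quot_module abelian_subgroup_axioms)
      (auto simp: mem_a_rcosets s smult_closed smult_l_distr smult_r_distr smult_assoc smult_one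
        simp del: quot_module_simps(3,4))
qed

lemma coset_mem_quot_module: "x \<in> carrier M \<Longrightarrow> N +>\<^bsub>M\<^esub> x \<in> carrier (quot_module M N)"
  by (auto simp: mem_a_rcosets)

lemma coset_lmod_hom:
  assumes "left_module A M" "submodule N A M"
  shows "(\<lambda>x. N +>\<^bsub>M\<^esub> x) \<in> lmod_hom A M (quot_module M N)"
  by (rule lmod_homI)
    (simp_all add: quot_module_smult[OF assms] quot_module_add[OF assms] coset_mem_quot_module
       del: quot_module_simps)

lemma quot_map_apply:
  assumes "left_module A M" "submodule N A M" "left_module A M'" "submodule N' A M'"
    "h \<in> lmod_hom A M M'" "h ` N \<subseteq> N'" "x \<in> carrier M"
  shows "quot_map M' N' h (N +>\<^bsub>M\<^esub> x) = N' +>\<^bsub>M'\<^esub> h x"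
  by (rule abelian_subgroup.quot_map_coset[OF
        submodule_abelian_subgroup[OF left_module_abelian_group[OF assms(1)] assms(2)]
        submodule_abelian_subgroup[OF left_module_abelian_group[OF assms(3)] assms(4)]
        lmod_hom_additive[OF assms(5)] assms(6,7)])

lemma quot_map_lmod_hom:
  assumes "left_module A M" "submodule N A M" "left_module A M'" "submodule N' A M'"
    "h \<in> lmod_hom A M M'" "h ` N \<subseteq> N'"
  shows "quot_map M' N' h \<in> lmod_hom A (quot_module M N) (quot_module M' N')"
proof -
  interpret M: left_module A M by fact
  interpret M': left_module A M' by fact
  note q = quot_map_apply[OF assms]
  note s = quot_module_smult[OF assms(1,2)] quot_module_add[OF assms(1,2)]
    quot_module_smult[OF assms(3,4)] quot_module_add[OF assms(3,4)]
  note h = lmod_hom_closed[OF assms(5)] lmod_hom_add[OF assms(5)] lmod_hom_smult[OF assms(5)]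
  show ?thesis
    by (rule lmod_homI)
      (auto simp: mem_a_rcosets s q h M.smult_closed simp del: quot_module_simps(3,4))
qed

lemma coset_ext_apply:
  assumes "left_module A M" "submodule N A M" "left_module A P" "h \<in> lmod_hom A M P"
    "\<And>x. x \<in> N \<Longrightarrow> h x = \<zero>\<^bsub>P\<^esub>" "x \<in> carrier M"
  shows "coset_ext h (N +>\<^bsub>M\<^esub> x) = h x"
  by (rule abelian_subgroup.coset_ext_coset[OF
        submodule_abelian_subgroup[OF left_module_abelian_group[OF assms(1)] assms(2)]
        left_module_abelian_group[OF assms(3)] lmod_hom_additive[OF assms(4)] assms(5,6)])

lemma coset_ext_lmod_hom:
  assumes "left_module A M" "submodule N A M" "left_module A P" "h \<in> lmod_hom A M P"
    "\<And>x. x \<in> N \<Longrightarrow> h x = \<zero>\<^bsub>P\<^esub>"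
  shows "coset_ext h \<in> lmod_hom A (quot_module M N) P"
proof -
  interpret M: left_module A M by fact
  note q = coset_ext_apply[OF assms]
  note s = quot_module_smult[OF assms(1,2)] quot_module_add[OF assms(1,2)]
  note h = lmod_hom_closed[OF assms(4)] lmod_hom_add[OF assms(4)] lmod_hom_smult[OF assms(4)]
  show ?thesis
    by (rule lmod_homI)
      (auto simp: mem_a_rcosets s q h M.smult_closed simp del: quot_module_simps(3,4))
qed

subsection \<open>Direct sums\<close>

lemma direct_sum_simps:
  "t \<in> carrier (direct_sum I M) \<longleftrightarrow>
    t \<in> (\<Pi>\<^sub>E i\<in>I. carrier (M i)) \<and> finite {i \<in> I. t i \<noteq> \<zero>\<^bsub>M i\<^esub>}"
  "\<zero>\<^bsub>direct_sum I M\<^esub> = (\<lambda>i\<in>I. \<zero>\<^bsub>M i\<^esub>)"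
  "s \<oplus>\<^bsub>direct_sum I M\<^esub> t = (\<lambda>i\<in>I. s i \<oplus>\<^bsub>M i\<^esub> t i)"
  "a \<odot>\<^bsub>direct_sum I M\<^esub> t = (\<lambda>i\<in>I. a \<odot>\<^bsub>M i\<^esub> t i)"
  by (simp_all add: direct_sum_def)

lemma direct_sum_memD: "t \<in> carrier (direct_sum I M) \<Longrightarrow> i \<in> I \<Longrightarrow> t i \<in> carrier (M i)"
  by (auto simp: direct_sum_simps)

lemma direct_sum_ext_eq:
  "s \<in> carrier (direct_sum I M) \<Longrightarrow> t \<in> carrier (direct_sum I N) \<Longrightarrow>
    (\<And>i. i \<in> I \<Longrightarrow> s i = t i) \<Longrightarrow> s = t"
  unfolding direct_sum_simps PiE_iff by (auto intro: extensionalityI)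

lemma finite_direct_sum_mem:
  "finite I \<Longrightarrow> t \<in> carrier (direct_sum I M) \<longleftrightarrow> t \<in> (\<Pi>\<^sub>E i\<in>I. carrier (M i))"
  by (simp add: direct_sum_simps)

lemma left_module_direct_sum:
  assumes "ring A" and M: "\<And>i. i \<in> I \<Longrightarrow> left_module A (M i)"
  shows "left_module A (direct_sum I M)"
proof -
  interpret A: ring A by fact
  have abM: "abelian_group (M i)" if "i \<in> I" for i
    using M[OF that] by (rule left_module_abelian_group)
  have fin: "finite {i \<in> I. f i \<noteq> \<zero>\<^bsub>M i\<^esub>}"
    if "finite {i \<in> I. s i \<noteq> \<zero>\<^bsub>M i\<^esub>}" "finite {i \<in> I. t i \<noteq> \<zero>\<^bsub>M i\<^esub>}"
      "\<And>i. i \<in> I \<Longrightarrow> s i = \<zero>\<^bsub>M i\<^esub> \<Longrightarrow> t i = \<zero>\<^bsub>M i\<^esub> \<Longrightarrow> f i = \<zero>\<^bsub>M i\<^esub>" for f s t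
    by (rule finite_subset[OF _ finite_UnI[OF that(1,2)]]) (use that(3) in auto)
  note z = abelian_group.axioms(1)[OF abM, THEN abelian_monoid.zero_closed]
    abelian_group.axioms(1)[OF abM, THEN abelian_monoid.l_zero]
    abelian_group.axioms(1)[OF abM, THEN abelian_monoid.a_closed]
  have add: "s \<oplus>\<^bsub>direct_sum I M\<^esub> t \<in> carrier (direct_sum I M)"
    if "s \<in> carrier (direct_sum I M)" "t \<in> carrier (direct_sum I M)" for s t
    using that unfolding direct_sum_simps
    by (auto simp: z PiE_iff intro!: fin[of s t] cong: conj_cong)
  have smult: "a \<odot>\<^bsub>direct_sum I M\<^esub> t \<in> carrier (direct_sum I M)"
    if "t \<in> carrier (direct_sum I M)" "a \<in> carrier A" for a t
    using that left_module.smult_closed[OF M] left_module.smult_r_null[OF M] unfolding direct_sum_simps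
    by (auto simp: PiE_iff intro!: fin[of t t] cong: conj_cong)
  have zero: "\<zero>\<^bsub>direct_sum I M\<^esub> \<in> carrier (direct_sum I M)"
    by (auto simp: direct_sum_simps z cong: conj_cong)
  have uminus: "(\<lambda>i\<in>I. \<ominus>\<^bsub>M i\<^esub> t i) \<in> carrier (direct_sum I M)"
    if "t \<in> carrier (direct_sum I M)" for t
    using that abelian_group.uminus_zero[OF abM] abelian_group.a_inv_closed[OF abM]
    unfolding direct_sum_simps
    by (auto simp: PiE_iff intro!: fin[of t t] cong: conj_cong)
  have comp: "(s \<oplus>\<^bsub>direct_sum I M\<^esub> t) i = s i \<oplus>\<^bsub>M i\<^esub> t i"
    "(a \<odot>\<^bsub>direct_sum I M\<^esub> t) i = a \<odot>\<^bsub>M i\<^esub> t i" "\<zero>\<^bsub>direct_sum I M\<^esub> i = \<zero>\<^bsub>M i\<^esub>"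
    if "i \<in> I" for i s t a
    using that by (simp_all add: direct_sum_simps)
  show ?thesis
  proof (rule left_moduleI)
    show "abelian_group (direct_sum I M)"
    proof (rule abelian_groupI)
      fix x y z
      assume x: "x \<in> carrier (direct_sum I M)" and y: "y \<in> carrier (direct_sum I M)"
        and z': "z \<in> carrier (direct_sum I M)"
      note m = direct_sum_memD[OF x] direct_sum_memD[OF y] direct_sum_memD[OF z']
      show "x \<oplus>\<^bsub>direct_sum I M\<^esub> y \<oplus>\<^bsub>direct_sum I M\<^esub> z = x \<oplus>\<^bsub>direct_sum I M\<^esub> (y \<oplus>\<^bsub>direct_sum I M\<^esub> z)"
        by (rule direct_sum_ext_eq[of _ I M _ M]; (intro add x y z')?)
          (simp add: comp m abelian_monoid.a_assoc[OF abelian_group.axioms(1), OF abM])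
      show "x \<oplus>\<^bsub>direct_sum I M\<^esub> y = y \<oplus>\<^bsub>direct_sum I M\<^esub> x"
        by (rule direct_sum_ext_eq[of _ I M _ M]; (intro add x y)?)
          (simp add: comp m abelian_monoid.a_comm[OF abelian_group.axioms(1), OF abM])
      show "\<zero>\<^bsub>direct_sum I M\<^esub> \<oplus>\<^bsub>direct_sum I M\<^esub> x = x"
        by (rule direct_sum_ext_eq[of _ I M _ M]; (intro add zero x)?) (simp add: comp z m)
      show "\<exists>y\<in>carrier (direct_sum I M). y \<oplus>\<^bsub>direct_sum I M\<^esub> x = \<zero>\<^bsub>direct_sum I M\<^esub>"
        by (rule bexI[OF _ uminus[OF x]], rule direct_sum_ext_eq[of _ I M _ M]; (intro add uminus zero x)?)
          (simp add: comp abelian_group.l_neg[OF abM] m)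
    qed (use add zero in auto)
  next
    fix x y assume x: "x \<in> carrier (direct_sum I M)" and y: "y \<in> carrier (direct_sum I M)"
    note m = direct_sum_memD[OF x] direct_sum_memD[OF y]
    show "\<one>\<^bsub>A\<^esub> \<odot>\<^bsub>direct_sum I M\<^esub> x = x"
      by (rule direct_sum_ext_eq[of _ I M _ M])
        (use x smult m assms in \<open>auto simp: comp left_module.smult_one[OF M] ring.ring_simprules(6)\<close>)
    fix a b assume a: "a \<in> carrier A" and b: "b \<in> carrier A"
    show "(a \<oplus>\<^bsub>A\<^esub> b) \<odot>\<^bsub>direct_sum I M\<^esub> x =
        a \<odot>\<^bsub>direct_sum I M\<^esub> x \<oplus>\<^bsub>direct_sum I M\<^esub> b \<odot>\<^bsub>direct_sum I M\<^esub> x"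
      by (rule direct_sum_ext_eq[of _ I M _ M])
        (use a b x add smult m in \<open>auto simp: comp left_module.smult_l_distr[OF M]\<close>)
    show "a \<odot>\<^bsub>direct_sum I M\<^esub> (x \<oplus>\<^bsub>direct_sum I M\<^esub> y) =
        a \<odot>\<^bsub>direct_sum I M\<^esub> x \<oplus>\<^bsub>direct_sum I M\<^esub> a \<odot>\<^bsub>direct_sum I M\<^esub> y"
      by (rule direct_sum_ext_eq[of _ I M _ M])
        (use a x y add smult m in \<open>auto simp: comp left_module.smult_r_distr[OF M]\<close>)
    show "(a \<otimes>\<^bsub>A\<^esub> b) \<odot>\<^bsub>direct_sum I M\<^esub> x = a \<odot>\<^bsub>direct_sum I M\<^esub> (b \<odot>\<^bsub>direct_sum I M\<^esub> x)"
      by (rule direct_sum_ext_eq[of _ I M _ M])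
        (use a b x smult m in \<open>auto simp: comp left_module.smult_assoc[OF M]\<close>)
  qed (use assms smult in auto)
qed

text \<open>The map out of the direct sum with components \<open>h i\<close>. The sum runs over the
  support because \<open>finsum\<close> over an infinite index set has the default value
  zero.\<close>

definition direct_sum_ext ::
    "('a, 'n) module \<Rightarrow> 'i set \<Rightarrow> ('i \<Rightarrow> ('a, 'm) module) \<Rightarrow> ('i \<Rightarrow> 'm \<Rightarrow> 'n) \<Rightarrow> ('i \<Rightarrow> 'm) \<Rightarrow> 'n" where
  "direct_sum_ext P I M h t = (\<Oplus>\<^bsub>P\<^esub>i\<in>{i \<in> I. t i \<noteq> \<zero>\<^bsub>M i\<^esub>}. h i (t i))"

text \<open>Components outside the support contribute \<open>h i\<close> of zero, hence nothing, so
  the support may be enlarged to any finite set. Additivity needs this: the supports of two elements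
  and of their sum have to be replaced by one common index set.\<close>

lemma direct_sum_ext_finsum:
  assumes "left_module A P" "\<And>i. i \<in> I \<Longrightarrow> left_module A (M i)"
    "\<And>i. i \<in> I \<Longrightarrow> h i \<in> lmod_hom A (M i) P"
    "t \<in> carrier (direct_sum I M)" "finite J" "J \<subseteq> I" "\<And>i. i \<in> I - J \<Longrightarrow> t i = \<zero>\<^bsub>M i\<^esub>"
  shows "direct_sum_ext P I M h t = (\<Oplus>\<^bsub>P\<^esub>i\<in>J. h i (t i))"
proof -
  interpret P: left_module A P by fact
  have "h i (t i) \<in> carrier P" if "i \<in> I" for i
    using lmod_hom_closed[OF assms(3)[OF that] direct_sum_memD[OF assms(4) that]] .
  moreover have "h i (t i) = \<zero>\<^bsub>P\<^esub>" if "i \<in> I" "t i = \<zero>\<^bsub>M i\<^esub>" for i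
    using lmod_hom_zero[OF assms(2)[OF that(1)] assms(1) assms(3)[OF that(1)]] that(2) by simp
  ultimately show ?thesis
    unfolding direct_sum_ext_def
    using assms(5-7) by (intro P.M.add.finprod_mono_neutral_cong_left) auto
qed

lemma direct_sum_ext_finite:
  assumes "left_module A P" "\<And>i. i \<in> I \<Longrightarrow> left_module A (M i)"
    "\<And>i. i \<in> I \<Longrightarrow> h i \<in> lmod_hom A (M i) P" "t \<in> carrier (direct_sum I M)" "finite I"
  shows "direct_sum_ext P I M h t = (\<Oplus>\<^bsub>P\<^esub>i\<in>I. h i (t i))"
  by (rule direct_sum_ext_finsum[OF assms(1-4)]) (use assms(5) in auto)

lemma direct_sum_ext_lmod_hom:
  assumes "left_module A P" and M: "\<And>i. i \<in> I \<Longrightarrow> left_module A (M i)"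
    and h: "\<And>i. i \<in> I \<Longrightarrow> h i \<in> lmod_hom A (M i) P"
  shows "direct_sum_ext P I M h \<in> lmod_hom A (direct_sum I M) P"
proof -
  interpret P: left_module A P by fact
  interpret D: left_module A "direct_sum I M"
    using P.R.ring_axioms M by (rule left_module_direct_sum)
  have e: "direct_sum_ext P I M h t = (\<Oplus>\<^bsub>P\<^esub>i\<in>J. h i (t i))"
    if "t \<in> carrier (direct_sum I M)" "finite J" "J \<subseteq> I" "\<And>i. i \<in> I - J \<Longrightarrow> t i = \<zero>\<^bsub>M i\<^esub>" for t J
    using assms that by (rule direct_sum_ext_finsum)
  have c: "h i (t i) \<in> carrier P" if "i \<in> I" "t \<in> carrier (direct_sum I M)" for i t
    using lmod_hom_closed[OF h[OF that(1)] direct_sum_memD[OF that(2,1)]] .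
  have z: "\<zero>\<^bsub>M i\<^esub> \<oplus>\<^bsub>M i\<^esub> \<zero>\<^bsub>M i\<^esub> = \<zero>\<^bsub>M i\<^esub>" "a \<in> carrier A \<Longrightarrow> a \<odot>\<^bsub>M i\<^esub> \<zero>\<^bsub>M i\<^esub> = \<zero>\<^bsub>M i\<^esub>"
    if "i \<in> I" for i a
  proof -
    interpret Mi: left_module A "M i" using M that .
    show "\<zero>\<^bsub>M i\<^esub> \<oplus>\<^bsub>M i\<^esub> \<zero>\<^bsub>M i\<^esub> = \<zero>\<^bsub>M i\<^esub>" "a \<in> carrier A \<Longrightarrow> a \<odot>\<^bsub>M i\<^esub> \<zero>\<^bsub>M i\<^esub> = \<zero>\<^bsub>M i\<^esub>"
      by simp_all
  qed
  let ?S = "\<lambda>t. {i \<in> I. t i \<noteq> \<zero>\<^bsub>M i\<^esub>}"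
  have fin: "finite (?S t)" if "t \<in> carrier (direct_sum I M)" for t
    using that by (simp add: direct_sum_simps)
  show ?thesis
  proof (rule lmod_homI)
    fix s assume s: "s \<in> carrier (direct_sum I M)"
    show "direct_sum_ext P I M h s \<in> carrier P"
      unfolding direct_sum_ext_def using c s by (intro P.M.finsum_closed) auto
    {
      fix t assume t: "t \<in> carrier (direct_sum I M)"
      let ?J = "?S s \<union> ?S t"
      have J: "finite ?J" "?J \<subseteq> I" using fin s t by auto
      have "direct_sum_ext P I M h (s \<oplus>\<^bsub>direct_sum I M\<^esub> t)
          = (\<Oplus>\<^bsub>P\<^esub>i\<in>?J. h i ((s \<oplus>\<^bsub>direct_sum I M\<^esub> t) i))"
        by (rule e[OF D.M.a_closed[OF s t] J]) (auto simp: direct_sum_simps(3) z)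
      also have "\<dots> = (\<Oplus>\<^bsub>P\<^esub>i\<in>?J. h i (s i) \<oplus>\<^bsub>P\<^esub> h i (t i))"
        using c[of _ s] c[of _ t] s t J(2) lmod_hom_add[OF h direct_sum_memD[OF s] direct_sum_memD[OF t]]
        by (intro P.M.finsum_cong') (auto simp: direct_sum_simps(3))
      also have "\<dots> = (\<Oplus>\<^bsub>P\<^esub>i\<in>?J. h i (s i)) \<oplus>\<^bsub>P\<^esub> (\<Oplus>\<^bsub>P\<^esub>i\<in>?J. h i (t i))"
        using c s t J by (intro P.M.finsum_addf) auto
      also have "(\<Oplus>\<^bsub>P\<^esub>i\<in>?J. h i (s i)) = direct_sum_ext P I M h s"
        by (rule e[symmetric]) (use s J in auto)
      also have "(\<Oplus>\<^bsub>P\<^esub>i\<in>?J. h i (t i)) = direct_sum_ext P I M h t"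
        by (rule e[symmetric]) (use t J in auto)
      finally show "direct_sum_ext P I M h (s \<oplus>\<^bsub>direct_sum I M\<^esub> t) =
        direct_sum_ext P I M h s \<oplus>\<^bsub>P\<^esub> direct_sum_ext P I M h t" .
    }
    fix a assume a: "a \<in> carrier A"
    have J: "finite (?S s)" "?S s \<subseteq> I" using fin s by auto
    have "direct_sum_ext P I M h (a \<odot>\<^bsub>direct_sum I M\<^esub> s)
        = (\<Oplus>\<^bsub>P\<^esub>i\<in>?S s. h i ((a \<odot>\<^bsub>direct_sum I M\<^esub> s) i))"
      by (rule e[OF D.smult_closed[OF a s] J]) (auto simp: direct_sum_simps(4) z a)
    also have "\<dots> = (\<Oplus>\<^bsub>P\<^esub>i\<in>?S s. a \<odot>\<^bsub>P\<^esub> h i (s i))"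
      using c s J(2) a lmod_hom_smult[OF h a direct_sum_memD[OF s]]
      by (intro P.M.finsum_cong') (auto simp: direct_sum_simps(4) P.smult_closed)
    also have "\<dots> = a \<odot>\<^bsub>P\<^esub> (\<Oplus>\<^bsub>P\<^esub>i\<in>?S s. h i (s i))"
      using c s J a by (intro P.finsum_smult[symmetric]) auto
    finally show "direct_sum_ext P I M h (a \<odot>\<^bsub>direct_sum I M\<^esub> s) = a \<odot>\<^bsub>P\<^esub> direct_sum_ext P I M h s"
      by (simp add: direct_sum_ext_def)
  qed
qed

lemma direct_sum_incl_apply:
  "i \<in> I \<Longrightarrow> direct_sum_incl I M j x i = (if i = j then x else \<zero>\<^bsub>M i\<^esub>)"
  by (simp add: direct_sum_incl_def)

lemma direct_sum_incl_lmod_hom: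
  assumes "ring A" and M: "\<And>i. i \<in> I \<Longrightarrow> left_module A (M i)" and j: "j \<in> I"
  shows "direct_sum_incl I M j \<in> lmod_hom A (M j) (direct_sum I M)"
proof -
  interpret D: left_module A "direct_sum I M"
    using assms(1) M by (rule left_module_direct_sum)
  interpret Mj: left_module A "M j" using M j .
  have z: "\<zero>\<^bsub>M i\<^esub> \<in> carrier (M i)" "\<zero>\<^bsub>M i\<^esub> \<oplus>\<^bsub>M i\<^esub> \<zero>\<^bsub>M i\<^esub> = \<zero>\<^bsub>M i\<^esub>"
    "a \<in> carrier A \<Longrightarrow> a \<odot>\<^bsub>M i\<^esub> \<zero>\<^bsub>M i\<^esub> = \<zero>\<^bsub>M i\<^esub>" if "i \<in> I" for i a
  proof -
    interpret Mi: left_module A "M i" using M that .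
    show "\<zero>\<^bsub>M i\<^esub> \<in> carrier (M i)" "\<zero>\<^bsub>M i\<^esub> \<oplus>\<^bsub>M i\<^esub> \<zero>\<^bsub>M i\<^esub> = \<zero>\<^bsub>M i\<^esub>"
      "a \<in> carrier A \<Longrightarrow> a \<odot>\<^bsub>M i\<^esub> \<zero>\<^bsub>M i\<^esub> = \<zero>\<^bsub>M i\<^esub>" by simp_all
  qed
  have c: "direct_sum_incl I M j x \<in> carrier (direct_sum I M)" if "x \<in> carrier (M j)" for x
  proof -
    have "{i \<in> I. direct_sum_incl I M j x i \<noteq> \<zero>\<^bsub>M i\<^esub>} \<subseteq> {j}"
      by (auto simp: direct_sum_incl_def split: if_splits)
    then show ?thesis
      using that by (auto simp: direct_sum_simps direct_sum_incl_def z intro: finite_subset)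
  qed
  show ?thesis
  proof (rule lmod_homI)
    fix x assume x: "x \<in> carrier (M j)"
    show "direct_sum_incl I M j x \<in> carrier (direct_sum I M)" by (rule c[OF x])
    show "direct_sum_incl I M j (x \<oplus>\<^bsub>M j\<^esub> y) =
        direct_sum_incl I M j x \<oplus>\<^bsub>direct_sum I M\<^esub> direct_sum_incl I M j y"
      if "y \<in> carrier (M j)" for y
      by (rule direct_sum_ext_eq[OF c D.M.a_closed[OF c c]])
        (use x that in \<open>auto simp: direct_sum_simps(3) direct_sum_incl_apply z\<close>)
    show "direct_sum_incl I M j (a \<odot>\<^bsub>M j\<^esub> x) = a \<odot>\<^bsub>direct_sum I M\<^esub> direct_sum_incl I M j x"
      if "a \<in> carrier A" for a
      by (rule direct_sum_ext_eq[OF c D.smult_closed[OF _ c]])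
        (use x that in \<open>auto simp: direct_sum_simps(4) direct_sum_incl_apply z Mj.smult_closed\<close>)
  qed
qed

lemma direct_sum_ext_incl:
  assumes "left_module A P" "\<And>i. i \<in> I \<Longrightarrow> left_module A (M i)"
    "\<And>i. i \<in> I \<Longrightarrow> h i \<in> lmod_hom A (M i) P" "j \<in> I" "x \<in> carrier (M j)"
  shows "direct_sum_ext P I M h (direct_sum_incl I M j x) = h j x"
proof -
  interpret P: left_module A P by fact
  have "direct_sum_incl I M j x \<in> carrier (direct_sum I M)"
    using direct_sum_incl_lmod_hom[OF P.R.ring_axioms assms(2,4)] assms(5) by (rule lmod_hom_closed)
  then have "direct_sum_ext P I M h (direct_sum_incl I M j x)
      = (\<Oplus>\<^bsub>P\<^esub>i\<in>{j}. h i (direct_sum_incl I M j x i))"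
    by (intro direct_sum_ext_finsum[OF assms(1-3)])
      (use assms(4) in \<open>auto simp: direct_sum_incl_apply\<close>)
  also have "\<dots> = h j x"
    using lmod_hom_closed[OF assms(3)[OF assms(4)] assms(5)] assms(4)
    by (simp add: direct_sum_incl_apply)
  finally show ?thesis .
qed

lemma direct_sum_proj_lmod_hom: "j \<in> I \<Longrightarrow> (\<lambda>t. t j) \<in> lmod_hom A (direct_sum I M) (M j)"
  by (rule lmod_homI) (auto simp: direct_sum_simps)

lemma direct_sum_tuple_hom:
  assumes "finite I" and h: "\<And>i. i \<in> I \<Longrightarrow> h i \<in> lmod_hom A L (M i)"
  shows "(\<lambda>z. \<lambda>i\<in>I. h i z) \<in> lmod_hom A L (direct_sum I M)"
proof (rule lmod_homI)
  fix z assume z: "z \<in> carrier L"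
  show "(\<lambda>i\<in>I. h i z) \<in> carrier (direct_sum I M)"
    unfolding finite_direct_sum_mem[OF assms(1)]
    by (intro restrict_PiE_iff[THEN iffD2] ballI) (rule lmod_hom_closed[OF h z])
  show "(\<lambda>i\<in>I. h i (z \<oplus>\<^bsub>L\<^esub> y)) = (\<lambda>i\<in>I. h i z) \<oplus>\<^bsub>direct_sum I M\<^esub> (\<lambda>i\<in>I. h i y)"
    if "y \<in> carrier L" for y
    using lmod_hom_add[OF h z that] by (simp add: direct_sum_simps(3) fun_eq_iff restrict_def)
  show "(\<lambda>i\<in>I. h i (a \<odot>\<^bsub>L\<^esub> z)) = a \<odot>\<^bsub>direct_sum I M\<^esub> (\<lambda>i\<in>I. h i z)" if "a \<in> carrier A" for a
    using lmod_hom_smult[OF h that z] by (simp add: direct_sum_simps(4) fun_eq_iff restrict_def)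
qed

lemma direct_sum_decomp:
  assumes "ring A" and M: "\<And>i. i \<in> I \<Longrightarrow> left_module A (M i)" and t: "t \<in> carrier (direct_sum I M)"
  shows "t = (\<Oplus>\<^bsub>direct_sum I M\<^esub>i\<in>{i \<in> I. t i \<noteq> \<zero>\<^bsub>M i\<^esub>}. direct_sum_incl I M i (t i))"
    (is "_ = finsum _ ?f ?J")
proof -
  interpret D: left_module A "direct_sum I M"
    using assms(1) M by (rule left_module_direct_sum)
  have J: "finite ?J" using t by (simp add: direct_sum_simps)
  have c: "?f \<in> ?J \<rightarrow> carrier (direct_sum I M)"
    using lmod_hom_closed[OF direct_sum_incl_lmod_hom[where M = M, OF assms(1) M]] direct_sum_memD[OF t] by auto
  show ?thesis
  proof (rule direct_sum_ext_eq[OF t D.M.finsum_closed[OF c]])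
    fix j assume j: "j \<in> I"
    interpret Mj: left_module A "M j" using M j .
    have "finsum (direct_sum I M) ?f ?J j = (\<Oplus>\<^bsub>M j\<^esub>i\<in>?J. ?f i j)"
      using lmod_hom_finsum[OF D.left_module_axioms Mj.left_module_axioms
          direct_sum_proj_lmod_hom[OF j] c] .
    also have "\<dots> = (\<Oplus>\<^bsub>M j\<^esub>i\<in>?J. if j = i then t i else \<zero>\<^bsub>M j\<^esub>)"
      using j t by (intro Mj.M.finsum_cong') (auto simp: direct_sum_incl_apply direct_sum_memD)
    also have "\<dots> = t j"
    proof (cases "j \<in> ?J")
      case True
      have "(\<Oplus>\<^bsub>M j\<^esub>i\<in>?J. if j = i then t i else \<zero>\<^bsub>M j\<^esub>) =
          (\<Oplus>\<^bsub>M j\<^esub>i\<in>?J. if j = i then t j else \<zero>\<^bsub>M j\<^esub>)"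
        using j t by (intro Mj.M.finsum_cong') (auto simp: direct_sum_memD)
      also have "\<dots> = t j"
        using True J t by (intro Mj.M.finsum_singleton) (auto simp: direct_sum_memD)
      finally show ?thesis .
    next
      case False
      then show ?thesis using j by (subst Mj.M.add.finprod_one_eqI) auto
    qed
    finally show "t j = finsum (direct_sum I M) ?f ?J j" by simp
  qed
qed

text \<open>Every element is a finite sum of elements of single summands. This is how identities
  between maps out of a direct sum are reduced to generators.\<close>

lemma direct_sum_hom_eq:
  assumes "ring A" "\<And>i. i \<in> I \<Longrightarrow> left_module A (M i)" "left_module A P"
    "g \<in> lmod_hom A (direct_sum I M) P" "h \<in> lmod_hom A (direct_sum I M) P"
    "\<And>i x. i \<in> I \<Longrightarrow> x \<in> carrier (M i) \<Longrightarrow>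
      g (direct_sum_incl I M i x) = h (direct_sum_incl I M i x)"
    "t \<in> carrier (direct_sum I M)"
  shows "g t = h t"
proof -
  interpret P: left_module A P by fact
  have D: "left_module A (direct_sum I M)"
    using assms(1,2) by (rule left_module_direct_sum)
  let ?J = "{i \<in> I. t i \<noteq> \<zero>\<^bsub>M i\<^esub>}"
  let ?f = "\<lambda>i. direct_sum_incl I M i (t i)"
  have c: "?f \<in> ?J \<rightarrow> carrier (direct_sum I M)"
    using lmod_hom_closed[OF direct_sum_incl_lmod_hom[where M = M, OF assms(1,2)]] direct_sum_memD[OF assms(7)]
    by auto
  have "g t = g (finsum (direct_sum I M) ?f ?J)"
    using direct_sum_decomp[OF assms(1,2,7)] by simp
  also have "\<dots> = (\<Oplus>\<^bsub>P\<^esub>i\<in>?J. g (?f i))" by (rule lmod_hom_finsum[OF D assms(3,4) c])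
  also have "\<dots> = (\<Oplus>\<^bsub>P\<^esub>i\<in>?J. h (?f i))"
    using c assms(6) direct_sum_memD[OF assms(7)]
    by (intro P.M.finsum_cong') (auto intro!: lmod_hom_closed[OF assms(5)])
  also have "\<dots> = h (finsum (direct_sum I M) ?f ?J)"
    by (rule lmod_hom_finsum[OF D assms(3,5) c, symmetric])
  also have "\<dots> = h t" using direct_sum_decomp[OF assms(1,2,7)] by simp
  finally show ?thesis .
qed

lemma direct_sum_map_lmod_hom:
  assumes M: "\<And>i. i \<in> I \<Longrightarrow> left_module A (M i)" and N: "\<And>i. i \<in> I \<Longrightarrow> left_module A (N i)"
    and h: "\<And>i. i \<in> I \<Longrightarrow> h i \<in> lmod_hom A (M i) (N i)"
  shows "(\<lambda>t. \<lambda>i\<in>I. h i (t i)) \<in> lmod_hom A (direct_sum I M) (direct_sum I N)"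
proof (rule lmod_homI)
  fix s assume s: "s \<in> carrier (direct_sum I M)"
  have "{i \<in> I. h i (s i) \<noteq> \<zero>\<^bsub>N i\<^esub>} \<subseteq> {i \<in> I. s i \<noteq> \<zero>\<^bsub>M i\<^esub>}"
    using lmod_hom_zero[OF M N h] by auto
  then show "(\<lambda>i\<in>I. h i (s i)) \<in> carrier (direct_sum I N)"
    using s lmod_hom_closed[OF h] by (auto simp: direct_sum_simps PiE_iff intro: finite_subset cong: conj_cong)
  show "(\<lambda>i\<in>I. h i ((s \<oplus>\<^bsub>direct_sum I M\<^esub> t) i)) =
      (\<lambda>i\<in>I. h i (s i)) \<oplus>\<^bsub>direct_sum I N\<^esub> (\<lambda>i\<in>I. h i (t i))"
    if "t \<in> carrier (direct_sum I M)" for t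
    using direct_sum_memD[OF s] direct_sum_memD[OF that] lmod_hom_add[OF h]
    by (auto simp: direct_sum_simps(3) fun_eq_iff)
  show "(\<lambda>i\<in>I. h i ((a \<odot>\<^bsub>direct_sum I M\<^esub> s) i)) = a \<odot>\<^bsub>direct_sum I N\<^esub> (\<lambda>i\<in>I. h i (s i))"
    if "a \<in> carrier A" for a
    using direct_sum_memD[OF s] lmod_hom_smult[OF h that]
    by (auto simp: direct_sum_simps(4) fun_eq_iff)
qed

lemma direct_sum_map_incl:
  assumes "\<And>i. i \<in> I \<Longrightarrow> left_module A (M i)" "\<And>i. i \<in> I \<Longrightarrow> left_module A (N i)"
    "\<And>i. i \<in> I \<Longrightarrow> h i \<in> lmod_hom A (M i) (N i)"
  shows "(\<lambda>i\<in>I. h i (direct_sum_incl I M j x i)) = direct_sum_incl I N j (h j x)"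
  using lmod_hom_zero[OF assms] by (auto simp: direct_sum_incl_def fun_eq_iff)

subsection \<open>Homology\<close>

lemma a_r_coset_carrier_update [simp]: "a_r_coset (M\<lparr>carrier := S\<rparr>) H x = a_r_coset M H x"
  by (simp add: a_r_coset_def r_coset_def)

lemma quot_map_carrier_update [simp]: "quot_map (M\<lparr>carrier := S\<rparr>) H h = quot_map M H h"
  by (simp add: quot_map_def fun_eq_iff)

text \<open>A common frame for the two modules to be compared: \<open>tor1\<close> and the mesh
  homology are both of the form \<open>homology_at\<close>.\<close>

locale three_term_complex =
  fixes A :: "('a, 's) ring_scheme" and L :: "('a, 'l) module" and f and M :: "('a, 'm) module"
    and g and N :: "('a, 'n) module"
  assumes mods: "left_module A L" "left_module A M" "left_module A N"
    and f: "f \<in> lmod_hom A L M" and g: "g \<in> lmod_hom A M N"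
    and gf: "x \<in> carrier L \<Longrightarrow> g (f x) = \<zero>\<^bsub>N\<^esub>"
begin

abbreviation "Z \<equiv> a_kernel M N g"
abbreviation "B \<equiv> f ` carrier L"

lemma submodule_Z: "submodule Z A M"
  by (rule submodule_kernel[OF mods(2,3) g])

lemma left_module_Z: "left_module A (M\<lparr>carrier := Z\<rparr>)"
  by (rule left_module_submodule[OF mods(2) submodule_Z])

lemma submodule_B: "submodule B A (M\<lparr>carrier := Z\<rparr>)"
  by (rule submodule_image[OF mods(1) left_module_Z])
    (use f g gf in \<open>auto simp: lmod_hom_def hom_def mem_a_kernel\<close>)

text \<open>The negative in a record is described as an inverse within its carrier, so shrinking the
  carrier could change it as a term; uniqueness of solutions in \<open>M\<close> shows that it does
  not.\<close>

lemma minus_Z: "x \<in> Z \<Longrightarrow> y \<in> Z \<Longrightarrow> x \<ominus>\<^bsub>M\<lparr>carrier := Z\<rparr>\<^esub> y = x \<ominus>\<^bsub>M\<^esub> y"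
proof -
  assume xy: "x \<in> Z" "y \<in> Z"
  interpret M: left_module A M by (rule mods)
  interpret Z: left_module A "M\<lparr>carrier := Z\<rparr>" by (rule left_module_Z)
  have "x \<ominus>\<^bsub>M\<lparr>carrier := Z\<rparr>\<^esub> y \<in> Z" "(x \<ominus>\<^bsub>M\<lparr>carrier := Z\<rparr>\<^esub> y) \<oplus>\<^bsub>M\<^esub> y = x"
    using Z.M.minus_closed[of x y] Z.M.minus_add_cancel[of x y] xy by auto
  then show ?thesis
    using xy M.M.add.inv_solve_right[of _ x y] by (auto simp: mem_a_kernel a_minus_def)
qed

lemma carrier_homology: "C \<in> carrier (homology_at L f M g N) \<longleftrightarrow> (\<exists>z\<in>Z. C = B +>\<^bsub>M\<^esub> z)"
  by (simp add: homology_at_def mem_a_rcosets)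

lemma homology_eq_iff: "x \<in> Z \<Longrightarrow> y \<in> Z \<Longrightarrow> B +>\<^bsub>M\<^esub> x = B +>\<^bsub>M\<^esub> y \<longleftrightarrow> x \<ominus>\<^bsub>M\<^esub> y \<in> B"
  using quot_module_coset_eq_iff[OF left_module_Z submodule_B] by (simp add: minus_Z)

lemma homology_zero: "\<zero>\<^bsub>homology_at L f M g N\<^esub> = B"
  by (simp add: homology_at_def)

text \<open>Turns vanishing of homology, the form in which normality is given, into exactness for
  elements.\<close>

lemma homology_trivialD:
  assumes "carrier (homology_at L f M g N) = {\<zero>\<^bsub>homology_at L f M g N\<^esub>}" "z \<in> Z"
  shows "z \<in> B"
proof -
  have "B +>\<^bsub>M\<^esub> z \<in> carrier (homology_at L f M g N)"
    unfolding carrier_homology by (rule bexI[OF refl assms(2)])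
  then have "B +>\<^bsub>M\<^esub> z = B" unfolding assms(1) homology_zero by simp
  then show ?thesis
    using quot_module_coset_eq_zero_iff[OF left_module_Z submodule_B] assms(2) by simp
qed

end

locale three_term_map =
  C: three_term_complex A L f M g N + D: three_term_complex A L' f' M' g' N'
  for A :: "('a, 's) ring_scheme" and L :: "('a, 'l) module" and f and M :: "('a, 'm) module"
    and g and N :: "('a, 'n) module" and L' :: "('a, 'l2) module" and f'
    and M' :: "('a, 'm2) module" and g' and N' :: "('a, 'n2) module" +
  fixes \<Phi>
  assumes map_hom: "\<Phi> \<in> lmod_hom A M M'"
    and map_Z: "z \<in> C.Z \<Longrightarrow> g' (\<Phi> z) = \<zero>\<^bsub>N'\<^esub>"
    and map_B: "x \<in> carrier L \<Longrightarrow> \<Phi> (f x) \<in> D.B"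
begin

lemma map_hom_Z: "\<Phi> \<in> lmod_hom A (M\<lparr>carrier := C.Z\<rparr>) (M'\<lparr>carrier := D.Z\<rparr>)"
  using map_hom map_Z by (auto simp: lmod_hom_def hom_def mem_a_kernel)

lemma homology_map_coset: "z \<in> C.Z \<Longrightarrow> quot_map M' D.B \<Phi> (C.B +>\<^bsub>M\<^esub> z) = D.B +>\<^bsub>M'\<^esub> \<Phi> z"
  using quot_map_apply[OF C.left_module_Z C.submodule_B D.left_module_Z D.submodule_B map_hom_Z]
    map_B by auto

lemma homology_map_hom:
  "quot_map M' D.B \<Phi> \<in> lmod_hom A (homology_at L f M g N) (homology_at L' f' M' g' N')"
  using quot_map_lmod_hom[OF C.left_module_Z C.submodule_B D.left_module_Z D.submodule_B map_hom_Z]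
    map_B by (auto simp: homology_at_def)

text \<open>The two maps need to be inverse to each other only on cycles and only up to boundaries.
  This is the shape of a homotopy identity after the term that factors through the outgoing
  differential has vanished.\<close>

lemma homology_iso:
  assumes \<Psi>: "three_term_map A L' f' M' g' N' L f M g N \<Psi>"
    and left: "\<And>z. z \<in> C.Z \<Longrightarrow> \<Psi> (\<Phi> z) \<ominus>\<^bsub>M\<^esub> z \<in> C.B"
    and right: "\<And>t. t \<in> D.Z \<Longrightarrow> \<Phi> (\<Psi> t) \<ominus>\<^bsub>M'\<^esub> t \<in> D.B"
  shows "quot_map M' D.B \<Phi> \<in> lmod_iso A (homology_at L f M g N) (homology_at L' f' M' g' N')"
proof -
  interpret R: three_term_map A L' f' M' g' N' L f M g N \<Psi> by fact
  have "bij_betw (quot_map M' D.B \<Phi>) (carrier (homology_at L f M g N))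
     (carrier (homology_at L' f' M' g' N'))"
  proof (rule bij_betw_byWitness[where f' = "quot_map M C.B \<Psi>"])
    have Z: "\<Phi> z \<in> D.Z" if "z \<in> C.Z" for z
      using lmod_hom_closed[OF map_hom_Z] that by simp
    have Z': "\<Psi> t \<in> C.Z" if "t \<in> D.Z" for t
      using lmod_hom_closed[OF R.map_hom_Z] that by simp
    show "\<forall>a\<in>carrier (homology_at L f M g N). quot_map M C.B \<Psi> (quot_map M' D.B \<Phi> a) = a"
    proof
      fix a assume "a \<in> carrier (homology_at L f M g N)"
      then obtain z where z: "z \<in> C.Z" "a = C.B +>\<^bsub>M\<^esub> z" unfolding C.carrier_homology by blast
      then show "quot_map M C.B \<Psi> (quot_map M' D.B \<Phi> a) = a"
        using C.homology_eq_iff[OF Z'[OF Z[OF z(1)]] z(1)] left[OF z(1)]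
        by (simp add: homology_map_coset R.homology_map_coset Z)
    qed
    show "\<forall>a\<in>carrier (homology_at L' f' M' g' N'). quot_map M' D.B \<Phi> (quot_map M C.B \<Psi> a) = a"
    proof
      fix a assume "a \<in> carrier (homology_at L' f' M' g' N')"
      then obtain z where z: "z \<in> D.Z" "a = D.B +>\<^bsub>M'\<^esub> z" unfolding D.carrier_homology by blast
      then show "quot_map M' D.B \<Phi> (quot_map M C.B \<Psi> a) = a"
        using D.homology_eq_iff[OF Z[OF Z'[OF z(1)]] z(1)] right[OF z(1)]
        by (simp add: homology_map_coset R.homology_map_coset Z')
    qed
    show "quot_map M' D.B \<Phi> ` carrier (homology_at L f M g N) \<subseteq> carrier (homology_at L' f' M' g' N')"
      by (intro image_subsetI) (rule lmod_hom_closed[OF homology_map_hom])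
    show "quot_map M C.B \<Psi> ` carrier (homology_at L' f' M' g' N') \<subseteq> carrier (homology_at L f M g N)"
      by (intro image_subsetI) (rule lmod_hom_closed[OF R.homology_map_hom])
  qed
  then show ?thesis using homology_map_hom by (simp add: lmod_iso_def)
qed

end

section \<open>Linear categories and functors\<close>

text \<open>The record \<open>lincat\<close> carries only data; these are the axioms. They are shown
  below for path categories, for quotients by ideals and for opposite categories.\<close>

locale linear_category = K?: cring K
  for K :: "('k, 'r) ring_scheme" and C :: "('o, 'k, 'h) lincat" +
  assumes hom_mod: "\<lbrakk>p \<in> obj C; q \<in> obj C\<rbrakk> \<Longrightarrow> left_module K (homs C p q)"
    and comp_left:
      "\<lbrakk>p \<in> obj C; q \<in> obj C; r \<in> obj C; f \<in> carrier (homs C p q)\<rbrakk> \<Longrightarrow>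
        (\<lambda>g. comp_mor C p q r g f) \<in> lmod_hom K (homs C q r) (homs C p r)"
    and comp_right:
      "\<lbrakk>p \<in> obj C; q \<in> obj C; r \<in> obj C; g \<in> carrier (homs C q r)\<rbrakk> \<Longrightarrow>
        (\<lambda>f. comp_mor C p q r g f) \<in> lmod_hom K (homs C p q) (homs C p r)"
    and comp_assoc:
      "\<lbrakk>p \<in> obj C; q \<in> obj C; r \<in> obj C; s \<in> obj C; f \<in> carrier (homs C p q);
        g \<in> carrier (homs C q r); h \<in> carrier (homs C r s)\<rbrakk> \<Longrightarrow>
        comp_mor C p q s (comp_mor C q r s h g) f = comp_mor C p r s h (comp_mor C p q r g f)"
    and ident_closed: "p \<in> obj C \<Longrightarrow> ident C p \<in> carrier (homs C p p)"
    and comp_ident_right: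
      "\<lbrakk>p \<in> obj C; q \<in> obj C; f \<in> carrier (homs C p q)\<rbrakk> \<Longrightarrow> comp_mor C p p q f (ident C p) = f"
    and comp_ident_left:
      "\<lbrakk>p \<in> obj C; q \<in> obj C; f \<in> carrier (homs C p q)\<rbrakk> \<Longrightarrow> comp_mor C p q q (ident C q) f = f"
begin

lemma comp_closed:
  "\<lbrakk>p \<in> obj C; q \<in> obj C; r \<in> obj C; f \<in> carrier (homs C p q); g \<in> carrier (homs C q r)\<rbrakk>
    \<Longrightarrow> comp_mor C p q r g f \<in> carrier (homs C p r)"
  by (rule lmod_hom_closed[OF comp_left])

end

lemma opcat_simps [simp]:
  "obj (opcat C) = obj C" "homs (opcat C) p q = homs C q p"
  "comp_mor (opcat C) p q r g f = comp_mor C r q p f g" "ident (opcat C) = ident C"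
  by (simp_all add: opcat_def)

lemma linear_category_opcat:
  assumes "linear_category K C"
  shows "linear_category K (opcat C)"
proof -
  interpret linear_category K C by fact
  show ?thesis
    by (intro linear_category.intro linear_category_axioms.intro K.cring_axioms; unfold opcat_simps)
      (rule hom_mod comp_left comp_right comp_assoc[symmetric] ident_closed comp_ident_left comp_ident_right;
        assumption)+
qed

lemma linear_functorD:
  assumes "linear_functor K C A \<iota> F"
  shows functor_mod: "p \<in> obj C \<Longrightarrow> left_module A (fob F p)"
    and functor_hom: "\<lbrakk>p \<in> obj C; q \<in> obj C; f \<in> carrier (homs C p q)\<rbrakk> \<Longrightarrow>
      fmor F p q f \<in> lmod_hom A (fob F p) (fob F q)"
    and functor_add: "\<lbrakk>p \<in> obj C; q \<in> obj C; f \<in> carrier (homs C p q); g \<in> carrier (homs C p q);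
      x \<in> carrier (fob F p)\<rbrakk> \<Longrightarrow>
      fmor F p q (f \<oplus>\<^bsub>homs C p q\<^esub> g) x = fmor F p q f x \<oplus>\<^bsub>fob F q\<^esub> fmor F p q g x"
    and functor_smult: "\<lbrakk>p \<in> obj C; q \<in> obj C; c \<in> carrier K; f \<in> carrier (homs C p q);
      x \<in> carrier (fob F p)\<rbrakk> \<Longrightarrow>
      fmor F p q (c \<odot>\<^bsub>homs C p q\<^esub> f) x = \<iota> c \<odot>\<^bsub>fob F q\<^esub> fmor F p q f x"
    and functor_ident: "\<lbrakk>p \<in> obj C; x \<in> carrier (fob F p)\<rbrakk> \<Longrightarrow> fmor F p p (ident C p) x = x"
    and functor_comp: "\<lbrakk>p \<in> obj C; q \<in> obj C; r \<in> obj C; f \<in> carrier (homs C p q);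
      g \<in> carrier (homs C q r); x \<in> carrier (fob F p)\<rbrakk> \<Longrightarrow>
      fmor F p r (comp_mor C p q r g f) x = fmor F q r g (fmor F p q f x)"
  using assms unfolding linear_functor_def by auto

lemma functor_closed:
  "\<lbrakk>linear_functor K C A \<iota> F; p \<in> obj C; q \<in> obj C; f \<in> carrier (homs C p q); x \<in> carrier (fob F p)\<rbrakk>
    \<Longrightarrow> fmor F p q f x \<in> carrier (fob F q)"
  by (rule lmod_hom_closed[OF functor_hom])

lemma functor_additive:
  assumes "linear_functor K C A \<iota> F" "p \<in> obj C" "q \<in> obj C" "x \<in> carrier (fob F p)"
  shows "(\<lambda>f. fmor F p q f x) \<in> hom (add_monoid (homs C p q)) (add_monoid (fob F q))"
  using functor_closed[OF assms(1-3) _ assms(4)] functor_add[OF assms(1-3) _ _ assms(4)]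
  by (auto simp: hom_def)

lemma nat_transD:
  assumes "nat_trans C A F G \<eta>"
  shows nat_trans_hom: "p \<in> obj C \<Longrightarrow> \<eta> p \<in> lmod_hom A (fob F p) (fob G p)"
    and nat_trans_naturality: "\<lbrakk>p \<in> obj C; q \<in> obj C; f \<in> carrier (homs C p q); x \<in> carrier (fob F p)\<rbrakk>
      \<Longrightarrow> \<eta> q (fmor F p q f x) = fmor G p q f (\<eta> p x)"
  using assms unfolding nat_trans_def by auto

lemma nat_trans_closed:
  "nat_trans C A F G \<eta> \<Longrightarrow> p \<in> obj C \<Longrightarrow> x \<in> carrier (fob F p) \<Longrightarrow> \<eta> p x \<in> carrier (fob G p)"
  by (rule lmod_hom_closed[OF nat_trans_hom])

lemma nat_trans_comp:
  assumes "nat_trans C A F G \<eta>" "nat_trans C A G H \<theta>"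
  shows "nat_trans C A F H (\<lambda>p x. \<theta> p (\<eta> p x))"
  unfolding nat_trans_def
  using lmod_hom_comp[OF nat_trans_hom[OF assms(2)] nat_trans_hom[OF assms(1)]]
    nat_trans_naturality[OF assms(1)] nat_trans_naturality[OF assms(2)] nat_trans_closed[OF assms(1)]
  by simp

lemma nat_trans_id: "nat_trans C A F F (\<lambda>p x. x)"
  by (simp add: nat_trans_def lmod_hom_def hom_def)

lemma nat_trans_minus:
  assumes "linear_functor K C A \<iota> G" "nat_trans C A F G \<eta>" "nat_trans C A F G \<theta>"
  shows "nat_trans C A F G (\<lambda>p x. \<eta> p x \<ominus>\<^bsub>fob G p\<^esub> \<theta> p x)"
  unfolding nat_trans_def
proof (intro conjI ballI)
  fix p assume p: "p \<in> obj C"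
  show "(\<lambda>x. \<eta> p x \<ominus>\<^bsub>fob G p\<^esub> \<theta> p x) \<in> lmod_hom A (fob F p) (fob G p)"
    by (rule lmod_hom_minus_pointwise[OF functor_mod[OF assms(1) p]
        nat_trans_hom[OF assms(2) p] nat_trans_hom[OF assms(3) p]])
  fix q f x assume q: "q \<in> obj C" and f: "f \<in> carrier (homs C p q)" and x: "x \<in> carrier (fob F p)"
  show "\<eta> q (fmor F p q f x) \<ominus>\<^bsub>fob G q\<^esub> \<theta> q (fmor F p q f x) =
      fmor G p q f (\<eta> p x \<ominus>\<^bsub>fob G p\<^esub> \<theta> p x)"
    using lmod_hom_minus[OF functor_mod[OF assms(1) p] functor_mod[OF assms(1) q]
        functor_hom[OF assms(1) p q f] nat_trans_closed[OF assms(2) p x]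
        nat_trans_closed[OF assms(3) p x]]
      nat_trans_naturality[OF assms(2) p q f x] nat_trans_naturality[OF assms(3) p q f x]
    by simp
qed

lemma hom_functor_simps [simp]:
  "fob (hom_functor C p) = homs C p" "fmor (hom_functor C p) q r = comp_mor C p q r"
  by (simp_all add: hom_functor_def)

lemma linear_functor_hom_functor:
  assumes "linear_category K C" "p \<in> obj C"
  shows "linear_functor_to_base K C (hom_functor C p)"
proof -
  interpret linear_category K C by fact
  show ?thesis
    unfolding linear_functor_def
    by (simp add: hom_mod comp_right comp_assoc comp_ident_left assms(2)
        lmod_hom_add[OF comp_left] lmod_hom_smult[OF comp_left])
qed

text \<open>The half of the Yoneda lemma that produces maps: linearity in the morphism comes from
  the linearity of \<open>F\<close>, naturality from its functoriality. All maps out of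
  representable functors are obtained from it.\<close>

lemma yoneda_nat_trans:
  assumes "linear_category K C" "linear_functor_to_base K C F" "p \<in> obj C" "x \<in> carrier (fob F p)"
  shows "nat_trans C K (hom_functor C p) F (\<lambda>r f. fmor F p r f x)"
  using assms(3,4) functor_closed[OF assms(2)] functor_add[OF assms(2)] functor_smult[OF assms(2)]
    functor_comp[OF assms(2)]
  by (simp add: nat_trans_def lmod_hom_def hom_def)

section \<open>Direct sums of functors and free functors\<close>

definition dsum_functor ::
    "'i set \<Rightarrow> ('i \<Rightarrow> ('o, 'h, 'a, 'm) modfun) \<Rightarrow> ('o, 'h, 'a, 'i \<Rightarrow> 'm) modfun" where
  "dsum_functor I F = \<lparr>fob = (\<lambda>p. direct_sum I (\<lambda>i. fob (F i) p)),
     fmor = (\<lambda>p q f t. \<lambda>i\<in>I. fmor (F i) p q f (t i))\<rparr>"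

lemma dsum_functor_simps [simp]:
  "fob (dsum_functor I F) p = direct_sum I (\<lambda>i. fob (F i) p)"
  "fmor (dsum_functor I F) p q f t = (\<lambda>i\<in>I. fmor (F i) p q f (t i))"
  by (simp_all add: dsum_functor_def)

lemma linear_functor_dsum_functor:
  assumes "ring A" and F: "\<And>i. i \<in> I \<Longrightarrow> linear_functor K C A \<iota> (F i)"
  shows "linear_functor K C A \<iota> (dsum_functor I F)"
  unfolding linear_functor_def
proof (intro conjI ballI)
  fix p assume p: "p \<in> obj C"
  show "left_module A (fob (dsum_functor I F) p)"
    unfolding dsum_functor_simps
    by (rule left_module_direct_sum[OF assms(1) functor_mod[OF F p]])
next
  fix p q f assume pq: "p \<in> obj C" "q \<in> obj C" and f: "f \<in> carrier (homs C p q)"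
  show "fmor (dsum_functor I F) p q f \<in> lmod_hom A (fob (dsum_functor I F) p) (fob (dsum_functor I F) q)"
    using direct_sum_map_lmod_hom[OF functor_mod[OF F pq(1)] functor_mod[OF F pq(2)] functor_hom[OF F pq f]]
    by (simp add: dsum_functor_def)
next
  fix p q f g x assume *: "p \<in> obj C" "q \<in> obj C" "f \<in> carrier (homs C p q)" "g \<in> carrier (homs C p q)"
    "x \<in> carrier (fob (dsum_functor I F) p)"
  show "fmor (dsum_functor I F) p q (f \<oplus>\<^bsub>homs C p q\<^esub> g) x = fmor (dsum_functor I F) p q f x
      \<oplus>\<^bsub>fob (dsum_functor I F) q\<^esub> fmor (dsum_functor I F) p q g x"
    using * functor_add[OF F] by (auto simp: direct_sum_simps fun_eq_iff PiE_iff)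
next
  fix p q c f x assume *: "p \<in> obj C" "q \<in> obj C" "c \<in> carrier K" "f \<in> carrier (homs C p q)"
    "x \<in> carrier (fob (dsum_functor I F) p)"
  show "fmor (dsum_functor I F) p q (c \<odot>\<^bsub>homs C p q\<^esub> f) x =
      \<iota> c \<odot>\<^bsub>fob (dsum_functor I F) q\<^esub> fmor (dsum_functor I F) p q f x"
    using * functor_smult[OF F] by (auto simp: direct_sum_simps fun_eq_iff PiE_iff)
next
  fix p x assume *: "p \<in> obj C" "x \<in> carrier (fob (dsum_functor I F) p)"
  then have "x \<in> extensional I" by (simp add: direct_sum_simps PiE_iff)
  then show "fmor (dsum_functor I F) p p (ident C p) x = x"
    using * functor_ident[OF F] by (auto simp: direct_sum_simps fun_eq_iff PiE_iff extensional_def)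
next
  fix p q r f g x assume *: "p \<in> obj C" "q \<in> obj C" "r \<in> obj C" "f \<in> carrier (homs C p q)"
    "g \<in> carrier (homs C q r)" "x \<in> carrier (fob (dsum_functor I F) p)"
  show "fmor (dsum_functor I F) p r (comp_mor C p q r g f) x =
      fmor (dsum_functor I F) q r g (fmor (dsum_functor I F) p q f x)"
    using * functor_comp[OF F] by (auto simp: direct_sum_simps fun_eq_iff PiE_iff)
qed

lemma dsum_functor_mor_incl:
  assumes "\<And>i. i \<in> I \<Longrightarrow> linear_functor K C A \<iota> (F i)" "p \<in> obj C" "q \<in> obj C"
    "f \<in> carrier (homs C p q)"
  shows "fmor (dsum_functor I F) p q f (direct_sum_incl I (\<lambda>i. fob (F i) p) j x) =
    direct_sum_incl I (\<lambda>i. fob (F i) q) j (fmor (F j) p q f x)"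
  using direct_sum_map_incl[OF functor_mod[OF assms(1,2)] functor_mod[OF assms(1,3)]
      functor_hom[OF assms(1-4)]]
  by simp

text \<open>Both ways around a naturality square are linear maps out of a direct sum, so they are
  compared on single summands, where naturality of \<open>\<eta> i\<close> applies.\<close>

lemma nat_trans_direct_sum_ext:
  assumes "ring A" and F: "\<And>i. i \<in> I \<Longrightarrow> linear_functor K C A \<iota> (F i)"
    and G: "linear_functor K C A \<iota> G" and \<eta>: "\<And>i. i \<in> I \<Longrightarrow> nat_trans C A (F i) G (\<eta> i)"
  shows "nat_trans C A (dsum_functor I F) G
    (\<lambda>p. direct_sum_ext (fob G p) I (\<lambda>i. fob (F i) p) (\<lambda>i. \<eta> i p))"
proof -
  let ?E = "\<lambda>p. direct_sum_ext (fob G p) I (\<lambda>i. fob (F i) p) (\<lambda>i. \<eta> i p)"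
  have E: "?E p \<in> lmod_hom A (direct_sum I (\<lambda>i. fob (F i) p)) (fob G p)" if p: "p \<in> obj C" for p
    by (rule direct_sum_ext_lmod_hom[OF functor_mod[OF G p] functor_mod[OF F p] nat_trans_hom[OF \<eta> p]])
  have D: "linear_functor K C A \<iota> (dsum_functor I F)"
    by (rule linear_functor_dsum_functor[OF assms(1) F])
  show ?thesis
    unfolding nat_trans_def
  proof (intro conjI ballI)
    fix p assume p: "p \<in> obj C"
    show "?E p \<in> lmod_hom A (fob (dsum_functor I F) p) (fob G p)" using E[OF p] by simp
    fix q f x assume q: "q \<in> obj C" and f: "f \<in> carrier (homs C p q)"
      and x: "x \<in> carrier (fob (dsum_functor I F) p)"
    have 1: "(\<lambda>t. ?E q (fmor (dsum_functor I F) p q f t)) \<in>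
        lmod_hom A (direct_sum I (\<lambda>i. fob (F i) p)) (fob G q)"
      using lmod_hom_comp[OF E[OF q] functor_hom[OF D p q f, unfolded dsum_functor_simps(1)]] .
    have 2: "(\<lambda>t. fmor G p q f (?E p t)) \<in> lmod_hom A (direct_sum I (\<lambda>i. fob (F i) p)) (fob G q)"
      by (rule lmod_hom_comp[OF functor_hom[OF G p q f] E[OF p]])
    show "?E q (fmor (dsum_functor I F) p q f x) = fmor G p q f (?E p x)"
    proof (rule direct_sum_hom_eq[OF assms(1) functor_mod[OF F p] functor_mod[OF G q] 1 2])
      fix i y assume i: "i \<in> I" and y: "y \<in> carrier (fob (F i) p)"
      note e = direct_sum_ext_incl[where M = "\<lambda>i. fob (F i) p" and h = "\<lambda>i. \<eta> i p",
          OF functor_mod[OF G p] functor_mod[OF F p] nat_trans_hom[OF \<eta> p] i y]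
      note e' = direct_sum_ext_incl[where M = "\<lambda>i. fob (F i) q" and h = "\<lambda>i. \<eta> i q",
          OF functor_mod[OF G q] functor_mod[OF F q] nat_trans_hom[OF \<eta> q] i
          functor_closed[OF F[OF i] p q f y]]
      have mi: "fmor (dsum_functor I F) p q f (direct_sum_incl I (\<lambda>i. fob (F i) p) i y) =
          direct_sum_incl I (\<lambda>i. fob (F i) q) i (fmor (F i) p q f y)"
        by (rule dsum_functor_mor_incl[OF F p q f])
      have "?E q (fmor (dsum_functor I F) p q f (direct_sum_incl I (\<lambda>i. fob (F i) p) i y)) =
          \<eta> i q (fmor (F i) p q f y)"
        using e' mi by (simp del: dsum_functor_simps(2))
      also have "\<dots> = fmor G p q f (\<eta> i p y)" by (rule nat_trans_naturality[OF \<eta>[OF i] p q f y])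
      finally show "?E q (fmor (dsum_functor I F) p q f (direct_sum_incl I (\<lambda>i. fob (F i) p) i y)) =
          fmor G p q f (?E p (direct_sum_incl I (\<lambda>i. fob (F i) p) i y))"
        using e by simp
    qed (use x in simp_all)
  qed
qed

text \<open>The sum of the functors \<open>C(fst i, -)\<close> is free with one basis element in
  degree \<open>fst i\<close> for each \<open>i\<close>; this is the map that sends it to
  \<open>y i\<close>. The index type is a product with the type of objects so that, for pairs of an
  object and an element of \<open>P\<close>, the free functor has the element type over which
  \<open>projective\<close> quantifies.\<close>

definition free_ext ::
    "('o, 'k, 'h) lincat \<Rightarrow> ('o \<times> 'i) set \<Rightarrow> ('o, 'h, 'k, 'm) modfun \<Rightarrow> ('o \<times> 'i \<Rightarrow> 'm) \<Rightarrow>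
      'o \<Rightarrow> ('o \<times> 'i \<Rightarrow> 'h) \<Rightarrow> 'm" where
  "free_ext C I G y p = direct_sum_ext (fob G p) I (\<lambda>i. fob (hom_functor C (fst i)) p)
     (\<lambda>i z. fmor G (fst i) p z (y i))"

lemma free_ext_props:
  assumes C: "linear_category K C" and G: "linear_functor_to_base K C G" and I: "fst ` I \<subseteq> obj C"
    and y: "\<And>i. i \<in> I \<Longrightarrow> y i \<in> carrier (fob G (fst i))"
  shows free_ext_nat_trans:
      "nat_trans C K (dsum_functor I (\<lambda>i. hom_functor C (fst i))) G (free_ext C I G y)"
    and free_ext_incl: "\<lbrakk>p \<in> obj C; i \<in> I; z \<in> carrier (homs C (fst i) p)\<rbrakk> \<Longrightarrow>
      free_ext C I G y p (direct_sum_incl I (\<lambda>i. homs C (fst i) p) i z) = fmor G (fst i) p z (y i)"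
proof -
  interpret linear_category K C by (rule C)
  have U: "linear_functor_to_base K C (hom_functor C (fst i))" if "i \<in> I" for i
    using that I by (intro linear_functor_hom_functor[OF C]) auto
  have nt: "nat_trans C K (hom_functor C (fst i)) G (\<lambda>p z. fmor G (fst i) p z (y i))"
    if "i \<in> I" for i
    using that I by (intro yoneda_nat_trans[OF C G] y) auto
  show "nat_trans C K (dsum_functor I (\<lambda>i. hom_functor C (fst i))) G (free_ext C I G y)"
    unfolding free_ext_def by (rule nat_trans_direct_sum_ext[OF K.ring_axioms U G nt])
  assume p: "p \<in> obj C" and i: "i \<in> I" and z: "z \<in> carrier (homs C (fst i) p)"
  show "free_ext C I G y p (direct_sum_incl I (\<lambda>i. homs C (fst i) p) i z) = fmor G (fst i) p z (y i)"
    using direct_sum_ext_incl[where M = "\<lambda>i. fob (hom_functor C (fst i)) p"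
        and h = "\<lambda>i z. fmor G (fst i) p z (y i)",
        OF functor_mod[OF G p] functor_mod[OF U p] nat_trans_hom[OF nt p] i, of z] z
    by (simp add: free_ext_def)
qed

text \<open>
  Lifting the identity of \<open>P\<close> along its free cover gives a section \<open>s\<close> of the cover; a lift along
  an arbitrary \<open>\<pi>\<close> is first chosen on the basis of the free cover and then composed with \<open>s\<close>.
\<close>

lemma projective_lift:
  fixes P :: "('o, 'h, 'k, 'm) modfun"
  assumes C: "linear_category K C" and P: "projective K C P" and M: "linear_functor_to_base K C M"
    and N: "\<And>p. p \<in> obj C \<Longrightarrow> left_module K (fob N p)"
    and \<pi>: "nat_trans C K M N \<pi>" and f: "nat_trans C K P N f"
    and im: "\<And>p x. p \<in> obj C \<Longrightarrow> x \<in> carrier (fob P p) \<Longrightarrow> f p x \<in> \<pi> p ` carrier (fob M p)"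
  obtains g where "nat_trans C K P M g"
    "\<And>p x. p \<in> obj C \<Longrightarrow> x \<in> carrier (fob P p) \<Longrightarrow> \<pi> p (g p x) = f p x"
proof -
  interpret linear_category K C by (rule C)
  have PF: "linear_functor_to_base K C P" using P by (simp add: projective_def)
  define I where "I = (SIGMA p : obj C. carrier (fob P p))"
  let ?F = "dsum_functor I (\<lambda>i. hom_functor C (fst i))"
  let ?incl = "\<lambda>p. direct_sum_incl I (\<lambda>i. homs C (fst i) p)"
  have I: "fst ` I \<subseteq> obj C" by (auto simp: I_def)
  have U: "linear_functor_to_base K C (hom_functor C (fst i))" if "i \<in> I" for i
    using that I by (intro linear_functor_hom_functor[OF C]) auto
  have snd_mem: "snd i \<in> carrier (fob P (fst i))" if "i \<in> I" for i
    using that by (auto simp: I_def)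
  let ?\<rho> = "free_ext C I P snd"
  have \<rho>: "nat_trans C K ?F P ?\<rho>" by (rule free_ext_nat_trans[OF C PF I snd_mem])
  have \<rho>_incl: "?\<rho> p (?incl p i z) = fmor P (fst i) p z (snd i)"
    if "p \<in> obj C" "i \<in> I" "z \<in> carrier (homs C (fst i) p)" for p i z
    by (rule free_ext_incl[OF C PF I snd_mem that])
  have D: "linear_functor_to_base K C ?F"
    by (rule linear_functor_dsum_functor[OF K.ring_axioms U])
  have incl_closed: "?incl p i z \<in> carrier (fob ?F p)"
    if "p \<in> obj C" "i \<in> I" "z \<in> carrier (homs C (fst i) p)" for p i z
    using lmod_hom_closed[OF direct_sum_incl_lmod_hom[where M = "\<lambda>i. homs C (fst i) p",
          OF K.ring_axioms functor_mod[OF U that(1), unfolded hom_functor_simps] that(2)] that(3)]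
    by simp
  have surj: "?\<rho> p ` carrier (fob ?F p) = carrier (fob P p)" if p: "p \<in> obj C" for p
  proof
    show "?\<rho> p ` carrier (fob ?F p) \<subseteq> carrier (fob P p)"
      by (intro image_subsetI) (rule nat_trans_closed[OF \<rho> p])
    show "carrier (fob P p) \<subseteq> ?\<rho> p ` carrier (fob ?F p)"
    proof
      fix x assume x: "x \<in> carrier (fob P p)"
      then have i: "(p, x) \<in> I" using p by (simp add: I_def)
      have id: "ident C p \<in> carrier (homs C (fst (p, x)) p)" using ident_closed[OF p] by simp
      have "?\<rho> p (?incl p (p, x) (ident C p)) = x"
        using \<rho>_incl[OF p i id] functor_ident[OF PF p x] by simp
      then show "x \<in> ?\<rho> p ` carrier (fob ?F p)"
        using imageI[OF incl_closed[OF p i id], of "?\<rho> p"] by (simp del: dsum_functor_simps)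
    qed
  qed
  \<comment> \<open>The definition of \<open>projective\<close> is used for the free cover of
    \<open>P\<close> and the identity of \<open>P\<close> only.\<close>
  have "\<exists>g. nat_trans C K P ?F g \<and> (\<forall>p\<in>obj C. \<forall>x\<in>carrier (fob P p). ?\<rho> p (g p x) = x)"
    by (rule P[unfolded projective_def, THEN conjunct2, THEN spec[where x = ?F], THEN spec[where x = P],
          THEN spec[where x = ?\<rho>], THEN spec[where x = "\<lambda>p x. x"], THEN mp, OF conjI[OF D conjI[OF PF
            conjI[OF \<rho> conjI[OF ballI[OF surj] nat_trans_id]]]]])
  then obtain s where s: "nat_trans C K P ?F s"
    and \<rho>s: "\<And>p x. p \<in> obj C \<Longrightarrow> x \<in> carrier (fob P p) \<Longrightarrow> ?\<rho> p (s p x) = x"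
    by auto
  \<comment> \<open>Basis elements are lifted one at a time. It suffices that \<open>f\<close> has
    values in the image of \<pi>, so exactness can be exploited without introducing kernel
    functors.\<close>
  have "\<forall>i\<in>I. \<exists>y\<in>carrier (fob M (fst i)). \<pi> (fst i) y = f (fst i) (snd i)"
    using im unfolding I_def by (metis imageE mem_Sigma_iff prod.collapse)
  then obtain y where y: "\<And>i. i \<in> I \<Longrightarrow> y i \<in> carrier (fob M (fst i))"
    and \<pi>y: "\<And>i. i \<in> I \<Longrightarrow> \<pi> (fst i) (y i) = f (fst i) (snd i)"
    by metis
  have G: "nat_trans C K ?F M (free_ext C I M y)" by (rule free_ext_nat_trans[OF C M I y])
  have \<pi>G: "\<pi> p (free_ext C I M y p t) = f p (?\<rho> p t)"
    if p: "p \<in> obj C" and t: "t \<in> carrier (fob ?F p)" for p t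
  proof (rule direct_sum_hom_eq[OF K.ring_axioms functor_mod[OF U p, unfolded hom_functor_simps] N[OF p], where I = I])
    show "(\<lambda>t. \<pi> p (free_ext C I M y p t)) \<in> lmod_hom K (direct_sum I (\<lambda>i. homs C (fst i) p)) (fob N p)"
      using nat_trans_hom[OF nat_trans_comp[OF G \<pi>] p] by simp
    show "(\<lambda>t. f p (?\<rho> p t)) \<in> lmod_hom K (direct_sum I (\<lambda>i. homs C (fst i) p)) (fob N p)"
      using nat_trans_hom[OF nat_trans_comp[OF \<rho> f] p] by simp
    show "t \<in> carrier (direct_sum I (\<lambda>i. homs C (fst i) p))" using t by simp
    fix i z assume i: "i \<in> I" and z': "z \<in> carrier (homs C (fst i) p)"
    have z: "z \<in> carrier (homs C (fst i) p)" and i1: "fst i \<in> obj C"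
      using z' i by (auto simp: I_def)
    show "\<pi> p (free_ext C I M y p (?incl p i z)) =
        f p (?\<rho> p (?incl p i z))"
      using free_ext_incl[where y = y, OF C M I y p i z] \<rho>_incl[OF p i z] nat_trans_naturality[OF \<pi> i1 p z y[OF i]]
        nat_trans_naturality[OF f i1 p z snd_mem[OF i]] \<pi>y[OF i] by simp
  qed
  show thesis
  proof (rule that)
    show "nat_trans C K P M (\<lambda>p x. free_ext C I M y p (s p x))" by (rule nat_trans_comp[OF s G])
    show "\<pi> p (free_ext C I M y p (s p x)) = f p x" if "p \<in> obj C" "x \<in> carrier (fob P p)" for p x
      using \<pi>G[OF that(1) nat_trans_closed[OF s that]] \<rho>s that by simp
  qed
qed

section \<open>Tensor products\<close>

lemma mem_free_tensor:
  "c \<in> carrier (free_tensor W X) \<longleftrightarrow> Poly_Mapping.keys c \<subseteq> carrier W \<times> carrier X"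
  by (simp add: free_tensor_def)

lemma free_tensor_simps [simp]:
  "\<zero>\<^bsub>free_tensor W X\<^esub> = 0" "c \<oplus>\<^bsub>free_tensor W X\<^esub> d = c + d"
  "a \<odot>\<^bsub>free_tensor W X\<^esub> c = frag_extend (\<lambda>(w, x). frag_of (w, a \<odot>\<^bsub>X\<^esub> x)) c"
  by (simp_all add: free_tensor_def)

lemma free_tensor_closed [simp]:
  "0 \<in> carrier (free_tensor W X)"
  "frag_of (w, x) \<in> carrier (free_tensor W X) \<longleftrightarrow> w \<in> carrier W \<and> x \<in> carrier X"
  "c \<in> carrier (free_tensor W X) \<Longrightarrow> - c \<in> carrier (free_tensor W X)"
  "c \<in> carrier (free_tensor W X) \<Longrightarrow> d \<in> carrier (free_tensor W X) \<Longrightarrow> c + d \<in> carrier (free_tensor W X)"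
  "c \<in> carrier (free_tensor W X) \<Longrightarrow> d \<in> carrier (free_tensor W X) \<Longrightarrow> c - d \<in> carrier (free_tensor W X)"
  using keys_add[of c d] keys_diff[of c d] by (simp_all add: mem_free_tensor, blast+)

lemma abelian_group_free_tensor: "abelian_group (free_tensor W X)"
proof (rule abelian_groupI)
  fix c assume "c \<in> carrier (free_tensor W X)"
  then show "\<exists>d\<in>carrier (free_tensor W X). d \<oplus>\<^bsub>free_tensor W X\<^esub> c = \<zero>\<^bsub>free_tensor W X\<^esub>"
    by (intro bexI[of _ "- c"]) simp_all
qed (simp_all add: add.assoc add.commute)

lemma free_tensor_a_inv:
  assumes "c \<in> carrier (free_tensor W X)"
  shows "\<ominus>\<^bsub>free_tensor W X\<^esub> c = - c"
proof -
  interpret abelian_group "free_tensor W X" by (rule abelian_group_free_tensor)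
  show ?thesis using assms by (intro minus_equality) auto
qed

lemma free_tensor_minus:
  assumes "c \<in> carrier (free_tensor W X)" "d \<in> carrier (free_tensor W X)"
  shows "c \<ominus>\<^bsub>free_tensor W X\<^esub> d = c - d"
  using free_tensor_a_inv[OF assms(2)] by (simp add: a_minus_def)

text \<open>Bridge to the universal property in the library: \<open>free_Abelian_group\<close> is a
  multiplicative record, \<open>free_tensor\<close> an additive one with the same elements and the
  same addition.\<close>

lemma hom_free_tensor_iff:
  "h \<in> hom (add_monoid (free_tensor W X)) G \<longleftrightarrow> h \<in> hom (free_Abelian_group (carrier W \<times> carrier X)) G"
  by (simp only: hom_def Pi_def mem_Collect_eq carrier_free_Abelian_group_iff mult_free_Abelian_group
      partial_object.simps monoid.simps mem_free_tensor free_tensor_simps Ball_def)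

lemma frag_extend_hom_free_tensor:
  assumes "\<And>w x. w \<in> carrier W \<Longrightarrow> x \<in> carrier X \<Longrightarrow> u w x \<in> carrier W' \<times> carrier X'"
  shows "frag_extend (\<lambda>(w, x). frag_of (u w x))
    \<in> hom (add_monoid (free_tensor W X)) (add_monoid (free_tensor W' X'))"
proof (rule homI)
  fix c assume "c \<in> carrier (add_monoid (free_tensor W X))"
  then have "Poly_Mapping.keys c \<subseteq> carrier W \<times> carrier X" by (simp add: mem_free_tensor)
  moreover have "Poly_Mapping.keys (frag_extend (\<lambda>(w, x). frag_of (u w x)) c) \<subseteq>
      (\<Union>z\<in>Poly_Mapping.keys c. Poly_Mapping.keys (case z of (w, x) \<Rightarrow> frag_of (u w x)))"
    by (rule keys_frag_extend)
  ultimately show "frag_extend (\<lambda>(w, x). frag_of (u w x)) c \<in> carrier (add_monoid (free_tensor W' X'))"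
    using assms by (simp add: mem_free_tensor) (fastforce split: prod.splits)
qed (simp add: frag_extend_add)

locale tensor_pair = ring_algebra K A \<iota> + W: left_module K W + X: left_module A X
  for K :: "('k, 'r) ring_scheme" and A :: "('a, 's) ring_scheme" and \<iota>
    and W :: "('k, 'w) module" and X :: "('a, 'x) module"
begin

abbreviation "F \<equiv> free_tensor W X"
abbreviation "R \<equiv> tensor_rels K \<iota> W X"
abbreviation "T \<equiv> tensor K \<iota> W X"
abbreviation "tens \<equiv> pure_tensor K \<iota> W X"

lemma \<iota>_closed: "c \<in> carrier K \<Longrightarrow> \<iota> c \<in> carrier A"
  using structure_hom by (rule ring_hom_closed)

text \<open>The relations are generated as a subgroup, without reference to the A-action. Membership
  in \<open>F\<close> is carried along because the cases for sums and negatives presuppose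
  it.\<close>

lemma tensor_rels_induct [consumes 1, case_names zero add uminus left right scalar]:
  assumes "c \<in> R" and zero: "Q 0"
    and add: "\<And>c d. c \<in> carrier F \<Longrightarrow> d \<in> carrier F \<Longrightarrow> Q c \<Longrightarrow> Q d \<Longrightarrow> Q (c + d)"
    and uminus: "\<And>c. c \<in> carrier F \<Longrightarrow> Q c \<Longrightarrow> Q (- c)"
    and left: "\<And>w w' x. w \<in> carrier W \<Longrightarrow> w' \<in> carrier W \<Longrightarrow> x \<in> carrier X \<Longrightarrow>
      Q (frag_of (w \<oplus>\<^bsub>W\<^esub> w', x) - frag_of (w, x) - frag_of (w', x))"
    and right: "\<And>w x x'. w \<in> carrier W \<Longrightarrow> x \<in> carrier X \<Longrightarrow> x' \<in> carrier X \<Longrightarrow>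
      Q (frag_of (w, x \<oplus>\<^bsub>X\<^esub> x') - frag_of (w, x) - frag_of (w, x'))"
    and scalar: "\<And>k w x. k \<in> carrier K \<Longrightarrow> w \<in> carrier W \<Longrightarrow> x \<in> carrier X \<Longrightarrow>
      Q (frag_of (k \<odot>\<^bsub>W\<^esub> w, x) - frag_of (w, \<iota> k \<odot>\<^bsub>X\<^esub> x))"
  shows "c \<in> carrier F \<and> Q c"
  using assms(1) unfolding tensor_rels_def
proof (induction c rule: generate.induct)
  case (incl h)
  then show ?case
    by (elim UnE) (auto simp del: carrier_free_Abelian_group_iff
      intro!: left right scalar free_tensor_closed(5) W.smult_closed X.smult_closed \<iota>_closed)
next
  case (inv h)
  have "h \<in> carrier F \<and> Q h"
    using inv by (elim UnE) (auto simp del: carrier_free_Abelian_group_iff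
      intro!: left right scalar free_tensor_closed(5) W.smult_closed X.smult_closed \<iota>_closed)
  then show ?case using uminus by (simp add: mem_free_tensor)
next
  case (eng h1 h2)
  then show ?case using add[of h1 h2] by simp
qed (simp add: zero)

lemma tensor_rels_carrier: "c \<in> R \<Longrightarrow> c \<in> carrier F"
  using tensor_rels_induct[of c "\<lambda>_. True"] by blast

lemma rels_gens_closed:
  "{frag_of (w \<oplus>\<^bsub>W\<^esub> w', x) - frag_of (w, x) - frag_of (w', x) | w w' x.
        w \<in> carrier W \<and> w' \<in> carrier W \<and> x \<in> carrier X} \<union>
     {frag_of (w, x \<oplus>\<^bsub>X\<^esub> x') - frag_of (w, x) - frag_of (w, x') | w x x'.
        w \<in> carrier W \<and> x \<in> carrier X \<and> x' \<in> carrier X} \<union>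
     {frag_of (c \<odot>\<^bsub>W\<^esub> w, x) - frag_of (w, \<iota> c \<odot>\<^bsub>X\<^esub> x) | c w x.
        c \<in> carrier K \<and> w \<in> carrier W \<and> x \<in> carrier X}
    \<subseteq> carrier (free_Abelian_group (carrier W \<times> carrier X))"
proof -
  have "carrier (free_Abelian_group (carrier W \<times> carrier X)) = carrier F"
    unfolding free_tensor_def by simp
  then show ?thesis
    by (intro Un_least subsetI; elim CollectE exE conjE;
        simp add: W.smult_closed X.smult_closed \<iota>_closed del: carrier_free_Abelian_group_iff)
qed

text \<open>The operation of A on \<open>free_tensor\<close> is not distributive in the scalar, so
  \<open>F\<close> is not an A-module and the results on quotient modules do not apply. The tensor
  product is treated first as a quotient of abelian groups.\<close>

lemma abelian_subgroup_rels: "abelian_subgroup R F"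
proof (rule abelian_subgroupI3)
  show "abelian_group F" by (rule abelian_group_free_tensor)
  show "additive_subgroup R F"
  proof (rule additive_subgroupI, rule group.subgroupI)
    show "group (add_monoid F)"
      by (rule abelian_group.a_group[OF abelian_group_free_tensor])
    show "R \<subseteq> carrier (add_monoid F)" using tensor_rels_carrier by auto
    show "R \<noteq> {}" unfolding tensor_rels_def using generate.one by fastforce
    fix c assume c: "c \<in> R"
    have "- c \<in> R"
      unfolding tensor_rels_def
      using group.generate_m_inv_closed[OF group_free_Abelian_group _ c[unfolded tensor_rels_def]]
        tensor_rels_carrier[OF c] rels_gens_closed
      by (simp add: mem_free_tensor)
    then show "inv\<^bsub>add_monoid F\<^esub> c \<in> R"
      using free_tensor_a_inv[OF tensor_rels_carrier[OF c]] by (simp add: a_inv_def)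
    fix d assume d: "d \<in> R"
    show "c \<otimes>\<^bsub>add_monoid F\<^esub> d \<in> R"
      using generate.eng[OF c[unfolded tensor_rels_def] d[unfolded tensor_rels_def]]
      by (simp add: tensor_rels_def)
  qed
qed

sublocale S: abelian_subgroup R F by (rule abelian_subgroup_rels)

lemma abelian_group_tensor: "abelian_group T"
  unfolding tensor_def by (rule abelian_group_quot_module[OF abelian_subgroup_rels])

lemma mem_tensor: "C \<in> carrier T \<longleftrightarrow> (\<exists>c\<in>carrier F. C = R +>\<^bsub>F\<^esub> c)"
  by (simp add: tensor_def mem_a_rcosets)

lemma tensor_add: "c \<in> carrier F \<Longrightarrow> d \<in> carrier F \<Longrightarrow>
    (R +>\<^bsub>F\<^esub> c) \<oplus>\<^bsub>T\<^esub> (R +>\<^bsub>F\<^esub> d) = R +>\<^bsub>F\<^esub> (c + d)"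
  unfolding tensor_def using quot_module_add_coset[OF abelian_subgroup_rels, of c d] by simp

lemma tens_closed: "w \<in> carrier W \<Longrightarrow> x \<in> carrier X \<Longrightarrow> tens w x \<in> carrier T"
  unfolding mem_tensor pure_tensor_def by (rule bexI[of _ "frag_of (w, x)"]) simp_all

lemma coset_additive: "(\<lambda>c. R +>\<^bsub>F\<^esub> c) \<in> hom (add_monoid F) (add_monoid T)"
proof (rule homI)
  show "R +>\<^bsub>F\<^esub> c \<in> carrier (add_monoid T)" if "c \<in> carrier (add_monoid F)" for c
    using that mem_tensor by force
qed (simp add: tensor_add)

text \<open>Pure tensors generate the tensor product as an abelian group. The lemma speaks of
  additive maps because the module axioms of the tensor product are themselves derived from
  it.\<close>

lemma tensor_additive_eq:
  assumes "abelian_group P" "g \<in> hom (add_monoid T) (add_monoid P)" "h \<in> hom (add_monoid T) (add_monoid P)"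
    and eq: "\<And>w x. w \<in> carrier W \<Longrightarrow> x \<in> carrier X \<Longrightarrow> g (tens w x) = h (tens w x)"
    and "C \<in> carrier T"
  shows "g C = h C"
proof -
  note g = additive_hom_simps[OF abelian_group_tensor assms(1,2)]
    and h = additive_hom_simps[OF abelian_group_tensor assms(1,3)]
    and r = additive_hom_simps[OF abelian_group_free_tensor abelian_group_tensor coset_additive]
  obtain c where "c \<in> carrier F" "C = R +>\<^bsub>F\<^esub> c"
    using assms(5) unfolding mem_tensor by (elim bexE)
  note c = this(1)[unfolded mem_free_tensor] this(2)
  from c(1) have "g (R +>\<^bsub>F\<^esub> c) = h (R +>\<^bsub>F\<^esub> c)"
  proof (induction c rule: free_Abelian_group_induct[consumes 1, case_names zero diff basis])
    case zero
    show ?case using r(3) g(3) h(3) by simp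
  next
    case (diff c d)
    note diff(1,2)[folded mem_free_tensor, simp]
    from diff show ?case
      using r(1)[of c] r(1)[of d] r(5)[of c d] free_tensor_minus[of c W X d]
        g(5)[of "R +>\<^bsub>F\<^esub> c" "R +>\<^bsub>F\<^esub> d"] h(5)[of "R +>\<^bsub>F\<^esub> c" "R +>\<^bsub>F\<^esub> d"] by simp
  next
    case (basis z)
    then show ?case using eq by (auto simp: pure_tensor_def)
  qed
  then show ?thesis using c by simp
qed

lemma tens_rel: "c \<in> carrier F \<Longrightarrow> d \<in> carrier F \<Longrightarrow> c - d \<in> R \<Longrightarrow> R +>\<^bsub>F\<^esub> c = R +>\<^bsub>F\<^esub> d"
  using S.coset_eq_iff[of c d] free_tensor_minus[of c W X d] by simp

lemma tens_add_left:
  assumes "w \<in> carrier W" "w' \<in> carrier W" "x \<in> carrier X"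
  shows "tens (w \<oplus>\<^bsub>W\<^esub> w') x = tens w x \<oplus>\<^bsub>T\<^esub> tens w' x"
proof -
  have "frag_of (w \<oplus>\<^bsub>W\<^esub> w', x) - (frag_of (w, x) + frag_of (w', x)) \<in> R"
    unfolding tensor_rels_def diff_diff_eq[symmetric] by (rule generate.incl) (use assms in auto)
  then show ?thesis
    using assms tensor_add[of "frag_of (w, x)" "frag_of (w', x)"]
    by (simp add: pure_tensor_def tens_rel)
qed

lemma tens_add_right:
  assumes "w \<in> carrier W" "x \<in> carrier X" "x' \<in> carrier X"
  shows "tens w (x \<oplus>\<^bsub>X\<^esub> x') = tens w x \<oplus>\<^bsub>T\<^esub> tens w x'"
proof -
  have "frag_of (w, x \<oplus>\<^bsub>X\<^esub> x') - (frag_of (w, x) + frag_of (w, x')) \<in> R"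
    unfolding tensor_rels_def diff_diff_eq[symmetric] by (rule generate.incl) (use assms in auto)
  then show ?thesis
    using assms tensor_add[of "frag_of (w, x)" "frag_of (w, x')"]
    by (simp add: pure_tensor_def tens_rel)
qed

lemma tens_scalar:
  assumes "k \<in> carrier K" "w \<in> carrier W" "x \<in> carrier X"
  shows "tens (k \<odot>\<^bsub>W\<^esub> w) x = tens w (\<iota> k \<odot>\<^bsub>X\<^esub> x)"
proof -
  have "frag_of (k \<odot>\<^bsub>W\<^esub> w, x) - frag_of (w, \<iota> k \<odot>\<^bsub>X\<^esub> x) \<in> R"
    unfolding tensor_rels_def by (rule generate.incl) (use assms in auto)
  then show ?thesis
    using assms by (simp add: pure_tensor_def tens_rel W.smult_closed X.smult_closed \<iota>_closed)
qed

text \<open>The kernel of \<open>h\<close> is a subgroup, so it is enough that \<open>h\<close>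
  respects the three families of generators. Both the maps \<open>h \<otimes> k\<close> and the
  universal property descend to the quotient by this.\<close>

lemma free_hom_vanishes_on_rels:
  assumes P: "abelian_group P" and h: "h \<in> hom (add_monoid F) (add_monoid P)"
    and "\<And>w w' x. w \<in> carrier W \<Longrightarrow> w' \<in> carrier W \<Longrightarrow> x \<in> carrier X \<Longrightarrow>
      h (frag_of (w \<oplus>\<^bsub>W\<^esub> w', x)) = h (frag_of (w, x)) \<oplus>\<^bsub>P\<^esub> h (frag_of (w', x))"
    and "\<And>w x x'. w \<in> carrier W \<Longrightarrow> x \<in> carrier X \<Longrightarrow> x' \<in> carrier X \<Longrightarrow>
      h (frag_of (w, x \<oplus>\<^bsub>X\<^esub> x')) = h (frag_of (w, x)) \<oplus>\<^bsub>P\<^esub> h (frag_of (w, x'))"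
    and "\<And>k w x. k \<in> carrier K \<Longrightarrow> w \<in> carrier W \<Longrightarrow> x \<in> carrier X \<Longrightarrow>
      h (frag_of (k \<odot>\<^bsub>W\<^esub> w, x)) = h (frag_of (w, \<iota> k \<odot>\<^bsub>X\<^esub> x))"
    and "c \<in> R"
  shows "h c = \<zero>\<^bsub>P\<^esub>"
proof -
  interpret P: abelian_group P by (rule P)
  note hs = additive_hom_simps[OF abelian_group_free_tensor P h]
  have minus: "h (c - d) = h c \<ominus>\<^bsub>P\<^esub> h d" if "c \<in> carrier F" "d \<in> carrier F" for c d
    using hs(5)[OF that] free_tensor_minus[OF that] by simp
  have cl: "frag_of (w, x) \<in> carrier F \<and> h (frag_of (w, x)) \<in> carrier P"
    if "w \<in> carrier W" "x \<in> carrier X" for w x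
    using hs(1)[of "frag_of (w, x)"] that by simp
  have diff: "c - d \<in> carrier F" if "c \<in> carrier F" "d \<in> carrier F" for c d
    using that by simp
  have "c \<in> carrier F \<and> h c = \<zero>\<^bsub>P\<^esub>"
    using assms(6)
  proof (induction c rule: tensor_rels_induct)
    case zero
    then show ?case using hs(3) by simp
  next
    case (add c d)
    then show ?case using hs(2)[of c d] by simp
  next
    case (uminus c)
    then show ?case using hs(4)[of c] free_tensor_a_inv[of c W X] by (simp add: P.uminus_zero)
  next
    case (left w w' x)
    then show ?case
      using cl[of w x] cl[of w' x] cl[of "w \<oplus>\<^bsub>W\<^esub> w'" x] assms(3)[of w w' x]
        minus[OF diff, of "frag_of (w \<oplus>\<^bsub>W\<^esub> w', x)" "frag_of (w, x)" "frag_of (w', x)"]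
        minus[of "frag_of (w \<oplus>\<^bsub>W\<^esub> w', x)" "frag_of (w, x)"]
      by (simp add: a_minus_def P.a_ac P.r_neg P.r_neg2 P.r_neg1 P.minus_add)
  next
    case (right w x x')
    then show ?case
      using cl[of w x] cl[of w x'] cl[of w "x \<oplus>\<^bsub>X\<^esub> x'"] assms(4)[of w x x']
        minus[OF diff, of "frag_of (w, x \<oplus>\<^bsub>X\<^esub> x')" "frag_of (w, x)" "frag_of (w, x')"]
        minus[of "frag_of (w, x \<oplus>\<^bsub>X\<^esub> x')" "frag_of (w, x)"]
      by (simp add: a_minus_def P.a_ac P.r_neg P.r_neg2 P.r_neg1 P.minus_add)
  next
    case (scalar k w x)
    then show ?case
      using cl[of "k \<odot>\<^bsub>W\<^esub> w" x] cl[of w "\<iota> k \<odot>\<^bsub>X\<^esub> x"] assms(5)[of k w x]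
        minus[of "frag_of (k \<odot>\<^bsub>W\<^esub> w, x)" "frag_of (w, \<iota> k \<odot>\<^bsub>X\<^esub> x)"]
      by (simp add: P.minus_eq_zero_iff W.smult_closed X.smult_closed \<iota>_closed)
  qed
  then show ?thesis by simp
qed

end

text \<open>The map \<open>k\<close> need not be \<open>A\<close>-linear, so that the lemma applies to the multiplication by an
  element of \<open>A\<close>, before the tensor product is known to be an \<open>A\<close>-module.\<close>

lemma tensor_map_props:
  assumes "tensor_pair K A \<iota> W X" "tensor_pair K A \<iota> W' X'"
    and h: "h \<in> lmod_hom K W W'" and k: "k \<in> hom (add_monoid X) (add_monoid X')"
    and k\<iota>: "\<And>c x. c \<in> carrier K \<Longrightarrow> x \<in> carrier X \<Longrightarrow> k (\<iota> c \<odot>\<^bsub>X\<^esub> x) = \<iota> c \<odot>\<^bsub>X'\<^esub> k x"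
  shows tensor_map_additive: "tensor_map K \<iota> W' X' h k
      \<in> hom (add_monoid (tensor K \<iota> W X)) (add_monoid (tensor K \<iota> W' X'))"
    and tensor_map_tens: "w \<in> carrier W \<Longrightarrow> x \<in> carrier X \<Longrightarrow>
      tensor_map K \<iota> W' X' h k (pure_tensor K \<iota> W X w x) = pure_tensor K \<iota> W' X' (h w) (k x)"
proof -
  interpret I: tensor_pair K A \<iota> W X by fact
  interpret J: tensor_pair K A \<iota> W' X' by fact
  let ?f = "frag_extend (\<lambda>(w, x). frag_of (h w, k x))"
  note ks = additive_hom_simps[OF I.X.M.abelian_group_axioms J.X.M.abelian_group_axioms k]
  have f: "?f \<in> hom (add_monoid I.F) (add_monoid J.F)"
    by (rule frag_extend_hom_free_tensor) (simp add: lmod_hom_closed[OF h] ks(1))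
  have f': "(\<lambda>c. J.R +>\<^bsub>J.F\<^esub> ?f c) \<in> hom (add_monoid I.F) (add_monoid J.T)"
    using hom_compose[OF f J.coset_additive] by (simp add: comp_def)
  \<comment> \<open>Instead of computing the image of a generator in the free group,
    \<open>?f\<close> is composed with the quotient map. There bilinearity of pure tensors makes the
    relations vanish, and an element whose coset is the zero coset is a relation.\<close>
  have "?f c \<in> J.R" if c: "c \<in> I.R" for c
  proof -
    have "J.R +>\<^bsub>J.F\<^esub> ?f c = \<zero>\<^bsub>J.T\<^esub>"
      by (rule I.free_hom_vanishes_on_rels[OF J.abelian_group_tensor f' _ _ _ c])
        (use J.tens_add_left J.tens_add_right J.tens_scalar in
          \<open>simp_all add: pure_tensor_def lmod_hom_closed[OF h] lmod_hom_add[OF h] lmod_hom_smult[OF h] ks(1,2) k\<iota>\<close>)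
    moreover have "?f c \<in> J.R +>\<^bsub>J.F\<^esub> ?f c"
      using additive_hom_closed[OF abelian_group_free_tensor abelian_group_free_tensor f
          I.tensor_rels_carrier[OF c]] by (rule J.S.a_rcos_self)
    ultimately show ?thesis by (simp add: tensor_def)
  qed
  then have "?f ` I.R \<subseteq> J.R" by blast
  note qm = I.S.quot_map_coset[OF J.abelian_subgroup_rels f this]
  have map: "tensor_map K \<iota> W' X' h k (I.R +>\<^bsub>I.F\<^esub> c) = J.R +>\<^bsub>J.F\<^esub> ?f c"
    if "c \<in> carrier I.F" for c
    unfolding tensor_map_def by (rule qm[OF that])
  show "tensor_map K \<iota> W' X' h k (pure_tensor K \<iota> W X w x) = pure_tensor K \<iota> W' X' (h w) (k x)"
    if "w \<in> carrier W" "x \<in> carrier X"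
    using map[of "frag_of (w, x)"] that by (simp add: pure_tensor_def)
  show "tensor_map K \<iota> W' X' h k \<in> hom (add_monoid I.T) (add_monoid J.T)"
  proof (rule homI)
    note f's = additive_hom_simps[OF abelian_group_free_tensor J.abelian_group_tensor f']
    fix C assume "C \<in> carrier (add_monoid I.T)"
    then obtain c where c: "c \<in> carrier I.F" "C = I.R +>\<^bsub>I.F\<^esub> c"
      unfolding partial_object.simps monoid.simps I.mem_tensor by (elim bexE)
    then show "tensor_map K \<iota> W' X' h k C \<in> carrier (add_monoid J.T)"
      using map[OF c(1)] f's(1)[OF c(1)] by simp
    fix D assume "D \<in> carrier (add_monoid I.T)"
    then obtain d where d: "d \<in> carrier I.F" "D = I.R +>\<^bsub>I.F\<^esub> d"
      unfolding partial_object.simps monoid.simps I.mem_tensor by (elim bexE)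
    have cd: "c + d \<in> carrier I.F" using c(1) d(1) by simp
    show "tensor_map K \<iota> W' X' h k (C \<otimes>\<^bsub>add_monoid I.T\<^esub> D) =
        tensor_map K \<iota> W' X' h k C \<otimes>\<^bsub>add_monoid J.T\<^esub> tensor_map K \<iota> W' X' h k D"
      using c d map[OF c(1)] map[OF d(1)] map[OF cd] I.tensor_add[OF c(1) d(1)]
        f's(2)[OF c(1) d(1)] by simp
  qed
qed

context tensor_pair
begin

text \<open>This is where the structure map has to be central: multiplication by \<open>a\<close>
  respects the relation that moves a scalar of K across the tensor sign.\<close>

lemma \<iota>_commute_smult:
  assumes "a \<in> carrier A" "c \<in> carrier K" "x \<in> carrier X"
  shows "a \<odot>\<^bsub>X\<^esub> (\<iota> c \<odot>\<^bsub>X\<^esub> x) = \<iota> c \<odot>\<^bsub>X\<^esub> (a \<odot>\<^bsub>X\<^esub> x)"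
  using assms structure_central[of c a] X.smult_assoc[of a "\<iota> c" x] X.smult_assoc[of "\<iota> c" a x] \<iota>_closed
  by simp

text \<open>The action of \<open>a\<close> is the tensor product of the identity with multiplication
  by \<open>a\<close>; its additivity and its values on pure tensors are therefore those of a
  \<open>tensor_map\<close>.\<close>

lemma tensor_smult_eq_map: "a \<odot>\<^bsub>T\<^esub> C = tensor_map K \<iota> W X (\<lambda>w. w) (\<lambda>x. a \<odot>\<^bsub>X\<^esub> x) C"
  by (simp add: tensor_def tensor_map_def quot_map_def)

lemma id_lmod_hom: "(\<lambda>w. w) \<in> lmod_hom K W W"
  by (rule lmod_homI) auto

lemma tensor_smult_props:
  assumes "a \<in> carrier A"
  shows tensor_smult_additive: "(\<lambda>C. a \<odot>\<^bsub>T\<^esub> C) \<in> hom (add_monoid T) (add_monoid T)"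
    and smult_tens: "w \<in> carrier W \<Longrightarrow> x \<in> carrier X \<Longrightarrow> a \<odot>\<^bsub>T\<^esub> tens w x = tens w (a \<odot>\<^bsub>X\<^esub> x)"
  using tensor_map_props[OF tensor_pair_axioms tensor_pair_axioms id_lmod_hom
      X.smult_hom[OF assms] \<iota>_commute_smult[OF assms]]
  unfolding tensor_smult_eq_map by auto

text \<open>Each module axiom, for fixed scalars, says that two additive maps agree, and on pure
  tensors it reduces to the same axiom in \<open>X\<close>.\<close>

lemma left_module_tensor: "left_module A T"
proof -
  interpret T: abelian_group T by (rule abelian_group_tensor)
  note ab = T.abelian_group_axioms
  have closed: "a \<odot>\<^bsub>T\<^esub> C \<in> carrier T" if "a \<in> carrier A" "C \<in> carrier T" for a C
    by (rule additive_hom_closed[OF ab ab tensor_smult_additive[OF that(1)] that(2)])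
  have comp: "(\<lambda>C. a \<odot>\<^bsub>T\<^esub> (b \<odot>\<^bsub>T\<^esub> C)) \<in> hom (add_monoid T) (add_monoid T)"
    if "a \<in> carrier A" "b \<in> carrier A" for a b
    using hom_compose[OF tensor_smult_additive[OF that(2)] tensor_smult_additive[OF that(1)]]
    by (simp add: comp_def)
  have sum: "(\<lambda>C. a \<odot>\<^bsub>T\<^esub> C \<oplus>\<^bsub>T\<^esub> b \<odot>\<^bsub>T\<^esub> C) \<in> hom (add_monoid T) (add_monoid T)"
    if "a \<in> carrier A" "b \<in> carrier A" for a b
    using closed[OF that(1)] closed[OF that(2)]
      additive_hom_add[OF ab ab tensor_smult_additive[OF that(1)]]
      additive_hom_add[OF ab ab tensor_smult_additive[OF that(2)]]
    by (intro homI) (auto simp: T.a_ac)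
  have id: "(\<lambda>C. C) \<in> hom (add_monoid T) (add_monoid T)" by (rule homI) auto
  show ?thesis
  proof (rule left_moduleI[OF A.ring_axioms ab])
    fix a b C assume a: "a \<in> carrier A" and b: "b \<in> carrier A" and C: "C \<in> carrier T"
    show "(a \<oplus>\<^bsub>A\<^esub> b) \<odot>\<^bsub>T\<^esub> C = a \<odot>\<^bsub>T\<^esub> C \<oplus>\<^bsub>T\<^esub> b \<odot>\<^bsub>T\<^esub> C"
      by (rule tensor_additive_eq[OF ab tensor_smult_additive[OF A.a_closed[OF a b]] sum[OF a b] _ C])
        (use a b in \<open>simp add: smult_tens X.smult_l_distr tens_add_right X.smult_closed\<close>)
    show "(a \<otimes>\<^bsub>A\<^esub> b) \<odot>\<^bsub>T\<^esub> C = a \<odot>\<^bsub>T\<^esub> (b \<odot>\<^bsub>T\<^esub> C)"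
      by (rule tensor_additive_eq[OF ab tensor_smult_additive[OF A.m_closed[OF a b]] comp[OF a b] _ C])
        (use a b in \<open>simp add: smult_tens X.smult_assoc X.smult_closed\<close>)
  next
    fix C assume C: "C \<in> carrier T"
    show "\<one>\<^bsub>A\<^esub> \<odot>\<^bsub>T\<^esub> C = C"
      by (rule tensor_additive_eq[OF ab tensor_smult_additive[OF A.one_closed] id _ C])
        (simp add: smult_tens X.smult_one)
  qed (rule closed additive_hom_add[OF ab ab tensor_smult_additive]; assumption)+
qed

lemma tensor_hom_eq:
  assumes "left_module A P" "g \<in> lmod_hom A T P" "h \<in> lmod_hom A T P"
    and "\<And>w x. w \<in> carrier W \<Longrightarrow> x \<in> carrier X \<Longrightarrow> g (tens w x) = h (tens w x)"
    and "C \<in> carrier T"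
  shows "g C = h C"
  by (rule tensor_additive_eq[OF left_module_abelian_group[OF assms(1)]
        lmod_hom_additive[OF assms(2)] lmod_hom_additive[OF assms(3)] assms(4,5)])

lemma lmod_hom_from_tensor:
  assumes P: "left_module A P" and h: "h \<in> hom (add_monoid T) (add_monoid P)"
    and "\<And>a w x. a \<in> carrier A \<Longrightarrow> w \<in> carrier W \<Longrightarrow> x \<in> carrier X \<Longrightarrow>
      h (tens w (a \<odot>\<^bsub>X\<^esub> x)) = a \<odot>\<^bsub>P\<^esub> h (tens w x)"
  shows "h \<in> lmod_hom A T P"
proof -
  interpret P: left_module A P by (rule P)
  note ab = left_module_abelian_group[OF P]
  have "h (a \<odot>\<^bsub>T\<^esub> C) = a \<odot>\<^bsub>P\<^esub> h C" if a: "a \<in> carrier A" and C: "C \<in> carrier T" for a C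
  proof (rule tensor_additive_eq[OF ab _ _ _ C])
    show "(\<lambda>C. h (a \<odot>\<^bsub>T\<^esub> C)) \<in> hom (add_monoid T) (add_monoid P)"
      using hom_compose[OF tensor_smult_additive[OF a] h] by (simp add: comp_def)
    show "(\<lambda>C. a \<odot>\<^bsub>P\<^esub> h C) \<in> hom (add_monoid T) (add_monoid P)"
      using hom_compose[OF h P.smult_hom[OF a]] by (simp add: comp_def)
  qed (simp add: smult_tens a assms(3))
  then show ?thesis using h by (simp add: lmod_hom_def)
qed

text \<open>With \<beta> linear in the second argument, the condition \<open>scalar\<close> is
  balancedness: both sides equal \<beta> at \<open>w\<close> and the multiple of \<open>x\<close> by
  the image of \<open>k\<close> in A.\<close>

lemma tensor_universal:
  assumes P: "left_module A P"
    and closed: "\<And>w x. w \<in> carrier W \<Longrightarrow> x \<in> carrier X \<Longrightarrow> \<beta> w x \<in> carrier P"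
    and left: "\<And>w w' x. w \<in> carrier W \<Longrightarrow> w' \<in> carrier W \<Longrightarrow> x \<in> carrier X \<Longrightarrow>
      \<beta> (w \<oplus>\<^bsub>W\<^esub> w') x = \<beta> w x \<oplus>\<^bsub>P\<^esub> \<beta> w' x"
    and right: "\<And>w. w \<in> carrier W \<Longrightarrow> \<beta> w \<in> lmod_hom A X P"
    and scalar: "\<And>k w x. k \<in> carrier K \<Longrightarrow> w \<in> carrier W \<Longrightarrow> x \<in> carrier X \<Longrightarrow>
      \<beta> (k \<odot>\<^bsub>W\<^esub> w) x = \<iota> k \<odot>\<^bsub>P\<^esub> \<beta> w x"
  obtains h where "h \<in> lmod_hom A T P"
    "\<And>w x. w \<in> carrier W \<Longrightarrow> x \<in> carrier X \<Longrightarrow> h (tens w x) = \<beta> w x"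
proof -
  interpret P: left_module A P by (rule P)
  note ab = left_module_abelian_group[OF P]
  obtain u where u: "u \<in> hom (add_monoid F) (add_monoid P)"
    and u_of: "\<And>w x. w \<in> carrier W \<Longrightarrow> x \<in> carrier X \<Longrightarrow> u (frag_of (w, x)) = \<beta> w x"
  proof -
    have "(\<lambda>(w, x). \<beta> w x) ` (carrier W \<times> carrier X) \<subseteq> carrier (add_monoid P)"
      using closed by auto
    then show thesis
    proof (rule comm_group.free_Abelian_group_universal[OF P.M.a_comm_group])
      fix u assume u: "u \<in> hom (free_Abelian_group (carrier W \<times> carrier X)) (add_monoid P)"
        "\<And>z. z \<in> carrier W \<times> carrier X \<Longrightarrow> u (frag_of z) = (\<lambda>(w, x). \<beta> w x) z"
      have "u \<in> hom (add_monoid F) (add_monoid P)" unfolding hom_free_tensor_iff by (rule u(1))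
      then show thesis by (rule that[of u]) (use u(2) in simp)
    qed
  qed
  have zero: "u c = \<zero>\<^bsub>P\<^esub>" if "c \<in> R" for c
    by (rule free_hom_vanishes_on_rels[OF ab u _ _ _ that])
      (simp_all add: u_of left scalar lmod_hom_add[OF right] lmod_hom_smult[OF right]
        \<iota>_closed W.smult_closed X.smult_closed)
  have ext: "coset_ext u \<in> hom (add_monoid T) (add_monoid P)"
    unfolding tensor_def by (rule coset_ext_additive[OF abelian_subgroup_rels ab u zero])
  have ext_tens: "coset_ext u (tens w x) = \<beta> w x" if "w \<in> carrier W" "x \<in> carrier X" for w x
    using S.coset_ext_coset[OF ab u zero, of "frag_of (w, x)"] that u_of by (simp add: pure_tensor_def)
  show thesis
  proof (rule that)
    show "coset_ext u \<in> lmod_hom A T P"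
      by (rule lmod_hom_from_tensor[OF P ext])
        (simp add: ext_tens X.smult_closed lmod_hom_smult[OF right])
  qed (rule ext_tens)
qed

end

lemma tensor_map_lmod_hom:
  assumes "tensor_pair K A \<iota> W X" "tensor_pair K A \<iota> W' X'"
    and h: "h \<in> lmod_hom K W W'" and k: "k \<in> lmod_hom A X X'"
  shows "tensor_map K \<iota> W' X' h k \<in> lmod_hom A (tensor K \<iota> W X) (tensor K \<iota> W' X')"
    and "w \<in> carrier W \<Longrightarrow> x \<in> carrier X \<Longrightarrow>
      tensor_map K \<iota> W' X' h k (pure_tensor K \<iota> W X w x) = pure_tensor K \<iota> W' X' (h w) (k x)"
proof -
  interpret I: tensor_pair K A \<iota> W X by fact
  interpret J: tensor_pair K A \<iota> W' X' by fact
  have k\<iota>: "k (\<iota> c \<odot>\<^bsub>X\<^esub> x) = \<iota> c \<odot>\<^bsub>X'\<^esub> k x" if "c \<in> carrier K" "x \<in> carrier X" for c x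
    using lmod_hom_smult[OF k I.\<iota>_closed[OF that(1)] that(2)] .
  note m = tensor_map_props[OF assms(1-3) lmod_hom_additive[OF k] k\<iota>]
  show t: "tensor_map K \<iota> W' X' h k (pure_tensor K \<iota> W X w x) = pure_tensor K \<iota> W' X' (h w) (k x)"
    if "w \<in> carrier W" "x \<in> carrier X" for w x
    using m(2) that by blast
  show "tensor_map K \<iota> W' X' h k \<in> lmod_hom A I.T J.T"
    by (rule I.lmod_hom_from_tensor[OF J.left_module_tensor])
      (use m(1) in \<open>simp_all add: t I.X.smult_closed J.smult_tens lmod_hom_closed[OF h] lmod_hom_closed[OF k]
        lmod_hom_smult[OF k]\<close>)
qed

section \<open>The tensor product over a linear category\<close>

definition tensor_over_elt ::
    "('k, 'r) ring_scheme \<Rightarrow> ('o, 'k, 'h) lincat \<Rightarrow> ('a, 's) ring_scheme \<Rightarrow> ('k \<Rightarrow> 'a) \<Rightarrow>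
      ('o, 'h, 'k, 'w) modfun \<Rightarrow> ('o, 'h, 'a, 'x) modfun \<Rightarrow>
      'o \<Rightarrow> 'w \<Rightarrow> 'x \<Rightarrow> ('o \<Rightarrow> (('w \<times> 'x) \<Rightarrow>\<^sub>0 int) set) set" where
  "tensor_over_elt K C A \<iota> W X p w x =
    coend_rels K C A \<iota> W X +>\<^bsub>coend_sum K C \<iota> W X\<^esub> coend_elt K C \<iota> W X p w x"

locale tensor_functors = ring_algebra K A \<iota> + C: linear_category K C
  for K :: "('k, 'r) ring_scheme" and A :: "('a, 's) ring_scheme" and \<iota>
    and C :: "('o, 'k, 'h) lincat" +
  fixes W :: "('o, 'h, 'k, 'w) modfun" and X :: "('o, 'h, 'a, 'x) modfun"
  assumes W: "linear_functor_to_base K (opcat C) W" and X: "linear_functor K C A \<iota> X"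
begin

abbreviation "M p \<equiv> tensor K \<iota> (fob W p) (fob X p)"
abbreviation "S \<equiv> coend_sum K C \<iota> W X"
abbreviation "R \<equiv> coend_rels K C A \<iota> W X"
abbreviation "T \<equiv> tensor_over K C A \<iota> W X"
abbreviation "tens \<equiv> tensor_over_elt K C A \<iota> W X"

lemma W_mod: "p \<in> obj C \<Longrightarrow> left_module K (fob W p)"
  using functor_mod[OF W] by simp

lemmas X_mod = functor_mod[OF X]

lemma tensor_pair: "p \<in> obj C \<Longrightarrow> tensor_pair K A \<iota> (fob W p) (fob X p)"
  by (intro tensor_pair.intro ring_algebra_axioms W_mod X_mod)

lemma mod_M: "p \<in> obj C \<Longrightarrow> left_module A (M p)"
  by (rule tensor_pair.left_module_tensor[OF tensor_pair])

lemma mod_S: "left_module A S"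
  unfolding coend_sum_def by (rule left_module_direct_sum[OF A.ring_axioms mod_M])

lemma incl_hom: "p \<in> obj C \<Longrightarrow> direct_sum_incl (obj C) M p \<in> lmod_hom A (M p) S"
  unfolding coend_sum_def by (rule direct_sum_incl_lmod_hom[OF A.ring_axioms mod_M])

lemma coend_elt_closed:
  "p \<in> obj C \<Longrightarrow> w \<in> carrier (fob W p) \<Longrightarrow> x \<in> carrier (fob X p) \<Longrightarrow> coend_elt K C \<iota> W X p w x \<in> carrier S"
  unfolding coend_elt_def
  by (rule lmod_hom_closed[OF incl_hom tensor_pair.tens_closed[OF tensor_pair]])

lemma W_mor: "p \<in> obj C \<Longrightarrow> r \<in> obj C \<Longrightarrow> f \<in> carrier (homs C p r) \<Longrightarrow> w \<in> carrier (fob W r) \<Longrightarrow>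
    fmor W r p f w \<in> carrier (fob W p)"
  using functor_closed[OF W, of r p f w] by simp

lemma coend_gens_closed:
  "{coend_elt K C \<iota> W X p (fmor W r p f w) x \<ominus>\<^bsub>S\<^esub> coend_elt K C \<iota> W X r w (fmor X p r f x) | p r f w x.
       p \<in> obj C \<and> r \<in> obj C \<and> f \<in> carrier (homs C p r) \<and>
       w \<in> carrier (fob W r) \<and> x \<in> carrier (fob X p)} \<subseteq> carrier S"
proof -
  interpret S: left_module A S by (rule mod_S)
  show ?thesis
    by (intro subsetI; elim CollectE exE conjE)
      (simp add: S.M.minus_closed coend_elt_closed W_mor functor_closed[OF X])
qed

lemma submodule_R: "submodule R A S"
  unfolding coend_rels_def by (rule submodule_submodule_generated[OF mod_S coend_gens_closed])

lemma mod_T: "left_module A T"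
  unfolding tensor_over_def by (rule left_module_quot_module[OF mod_S submodule_R])

lemma proj_hom: "(\<lambda>t. R +>\<^bsub>S\<^esub> t) \<in> lmod_hom A S T"
  unfolding tensor_over_def by (rule coset_lmod_hom[OF mod_S submodule_R])

lemma tens_eq: "tens p w x = R +>\<^bsub>S\<^esub> direct_sum_incl (obj C) M p (pure_tensor K \<iota> (fob W p) (fob X p) w x)"
  by (simp add: tensor_over_elt_def coend_elt_def)

lemma tens_hom: "p \<in> obj C \<Longrightarrow> (\<lambda>t. R +>\<^bsub>S\<^esub> direct_sum_incl (obj C) M p t) \<in> lmod_hom A (M p) T"
  by (rule lmod_hom_comp[OF proj_hom incl_hom])

lemma tens_closed:
  "p \<in> obj C \<Longrightarrow> w \<in> carrier (fob W p) \<Longrightarrow> x \<in> carrier (fob X p) \<Longrightarrow> tens p w x \<in> carrier T"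
  unfolding tens_eq by (rule lmod_hom_closed[OF tens_hom tensor_pair.tens_closed[OF tensor_pair]])

lemma tens_add_left:
  assumes "p \<in> obj C" "w \<in> carrier (fob W p)" "w' \<in> carrier (fob W p)" "x \<in> carrier (fob X p)"
  shows "tens p (w \<oplus>\<^bsub>fob W p\<^esub> w') x = tens p w x \<oplus>\<^bsub>T\<^esub> tens p w' x"
proof -
  interpret P: tensor_pair K A \<iota> "fob W p" "fob X p" by (rule tensor_pair[OF assms(1)])
  show ?thesis
    unfolding tens_eq P.tens_add_left[OF assms(2-4)]
    by (rule lmod_hom_add[OF tens_hom[OF assms(1)]]) (simp_all add: P.tens_closed assms)
qed

lemma tens_hom_right:
  assumes "p \<in> obj C" "w \<in> carrier (fob W p)"
  shows "tens p w \<in> lmod_hom A (fob X p) T"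
proof (rule lmod_homI)
  interpret P: tensor_pair K A \<iota> "fob W p" "fob X p" by (rule tensor_pair[OF assms(1)])
  fix x assume x: "x \<in> carrier (fob X p)"
  show "tens p w x \<in> carrier T" by (rule tens_closed[OF assms x])
  show "tens p w (x \<oplus>\<^bsub>fob X p\<^esub> y) = tens p w x \<oplus>\<^bsub>T\<^esub> tens p w y" if "y \<in> carrier (fob X p)" for y
    unfolding tens_eq P.tens_add_right[OF assms(2) x that]
    by (rule lmod_hom_add[OF tens_hom[OF assms(1)]]) (simp_all add: P.tens_closed assms x that)
  show "tens p w (a \<odot>\<^bsub>fob X p\<^esub> x) = a \<odot>\<^bsub>T\<^esub> tens p w x" if "a \<in> carrier A" for a
    unfolding tens_eq P.smult_tens[OF that assms(2) x, symmetric]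
    by (rule lmod_hom_smult[OF tens_hom[OF assms(1)] that P.tens_closed[OF assms(2) x]])
qed

lemma tens_additive_left:
  assumes "p \<in> obj C" "x \<in> carrier (fob X p)"
  shows "(\<lambda>w. tens p w x) \<in> hom (add_monoid (fob W p)) (add_monoid T)"
  by (rule homI) (simp_all add: assms tens_closed tens_add_left)

lemma tens_slide:
  assumes "p \<in> obj C" "r \<in> obj C" "f \<in> carrier (homs C p r)" "w \<in> carrier (fob W r)"
    "x \<in> carrier (fob X p)"
  shows "tens p (fmor W r p f w) x = tens r w (fmor X p r f x)"
  unfolding tensor_over_elt_def
proof (subst quot_module_coset_eq_iff[OF mod_S submodule_R])
  show "coend_elt K C \<iota> W X p (fmor W r p f w) x \<ominus>\<^bsub>S\<^esub> coend_elt K C \<iota> W X r w (fmor X p r f x) \<in> R"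
    unfolding coend_rels_def
    by (rule subsetD[OF submodule_generated_incl], intro CollectI exI conjI; (rule refl | rule assms))
qed (simp_all add: coend_elt_closed assms W_mor functor_closed[OF X])

text \<open>The coend is generated by the classes of \<open>w \<otimes> x\<close>: the direct sum is
  generated by its summands, and each summand by pure tensors. Identities between maps out of
  \<open>R n \<otimes> X\<close> are checked by this lemma.\<close>

lemma tensor_over_hom_eq:
  assumes P: "left_module A P" and g: "g \<in> lmod_hom A T P" and h: "h \<in> lmod_hom A T P"
    and eq: "\<And>p w x. p \<in> obj C \<Longrightarrow> w \<in> carrier (fob W p) \<Longrightarrow> x \<in> carrier (fob X p) \<Longrightarrow>
      g (tens p w x) = h (tens p w x)"
    and z: "z \<in> carrier T"
  shows "g z = h z"
proof -
  obtain t where t: "t \<in> carrier S" "z = R +>\<^bsub>S\<^esub> t"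
    using z unfolding tensor_over_def quot_module_simps mem_a_rcosets by (elim bexE)
  have "g (R +>\<^bsub>S\<^esub> t) = h (R +>\<^bsub>S\<^esub> t)"
  proof (rule direct_sum_hom_eq[where g = "\<lambda>t. g (R +>\<^bsub>S\<^esub> t)" and h = "\<lambda>t. h (R +>\<^bsub>S\<^esub> t)" and M = M
        and I = "obj C", OF A.ring_axioms mod_M P])
    show "(\<lambda>t. g (R +>\<^bsub>S\<^esub> t)) \<in> lmod_hom A (direct_sum (obj C) M) P"
      using lmod_hom_comp[OF g proj_hom] by (simp only: coend_sum_def)
    show "(\<lambda>t. h (R +>\<^bsub>S\<^esub> t)) \<in> lmod_hom A (direct_sum (obj C) M) P"
      using lmod_hom_comp[OF h proj_hom] by (simp only: coend_sum_def)
    show "t \<in> carrier (direct_sum (obj C) M)" using t(1) by (simp only: coend_sum_def)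
    fix p u assume p: "p \<in> obj C" and u: "u \<in> carrier (M p)"
    show "g (R +>\<^bsub>S\<^esub> direct_sum_incl (obj C) M p u) = h (R +>\<^bsub>S\<^esub> direct_sum_incl (obj C) M p u)"
      by (rule tensor_pair.tensor_hom_eq[OF tensor_pair[OF p] P lmod_hom_comp[OF g tens_hom[OF p]]
            lmod_hom_comp[OF h tens_hom[OF p]] _ u])
        (use eq[OF p] in \<open>simp add: tens_eq\<close>)
  qed
  then show ?thesis using t by simp
qed

text \<open>The map descends through two quotients: \<open>tensor_universal\<close> provides it at
  every object, and the sum of these maps kills the coend relations because of
  \<open>slide\<close>.\<close>

lemma tensor_over_universal:
  assumes P: "left_module A P"
    and left: "\<And>p x. p \<in> obj C \<Longrightarrow> x \<in> carrier (fob X p) \<Longrightarrow>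
      (\<lambda>w. \<beta> p w x) \<in> hom (add_monoid (fob W p)) (add_monoid P)"
    and right: "\<And>p w. p \<in> obj C \<Longrightarrow> w \<in> carrier (fob W p) \<Longrightarrow> \<beta> p w \<in> lmod_hom A (fob X p) P"
    and scalar: "\<And>p k w x. p \<in> obj C \<Longrightarrow> k \<in> carrier K \<Longrightarrow> w \<in> carrier (fob W p) \<Longrightarrow>
      x \<in> carrier (fob X p) \<Longrightarrow> \<beta> p (k \<odot>\<^bsub>fob W p\<^esub> w) x = \<iota> k \<odot>\<^bsub>P\<^esub> \<beta> p w x"
    and slide: "\<And>p r f w x. p \<in> obj C \<Longrightarrow> r \<in> obj C \<Longrightarrow> f \<in> carrier (homs C p r) \<Longrightarrow>
      w \<in> carrier (fob W r) \<Longrightarrow> x \<in> carrier (fob X p) \<Longrightarrow>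
      \<beta> p (fmor W r p f w) x = \<beta> r w (fmor X p r f x)"
  obtains h where "h \<in> lmod_hom A T P"
    "\<And>p w x. p \<in> obj C \<Longrightarrow> w \<in> carrier (fob W p) \<Longrightarrow> x \<in> carrier (fob X p) \<Longrightarrow>
      h (tens p w x) = \<beta> p w x"
proof -
  interpret P: left_module A P by (rule P)
  have "\<exists>h. h \<in> lmod_hom A (M p) P \<and> (\<forall>w\<in>carrier (fob W p). \<forall>x\<in>carrier (fob X p).
      h (pure_tensor K \<iota> (fob W p) (fob X p) w x) = \<beta> p w x)" if p: "p \<in> obj C" for p
  proof -
    obtain h where "h \<in> lmod_hom A (M p) P"
      "\<And>w x. w \<in> carrier (fob W p) \<Longrightarrow> x \<in> carrier (fob X p) \<Longrightarrow>
        h (pure_tensor K \<iota> (fob W p) (fob X p) w x) = \<beta> p w x"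
    proof (rule tensor_pair.tensor_universal[OF tensor_pair[OF p] P, of "\<beta> p"])
      note l = additive_hom_simps[OF left_module_abelian_group[OF W_mod[OF p]]
          left_module_abelian_group[OF P] left[OF p]]
      show "\<beta> p w x \<in> carrier P" if "w \<in> carrier (fob W p)" "x \<in> carrier (fob X p)" for w x
        by (rule l(1)[OF that(2,1)])
      show "\<beta> p (w \<oplus>\<^bsub>fob W p\<^esub> w') x = \<beta> p w x \<oplus>\<^bsub>P\<^esub> \<beta> p w' x"
        if "w \<in> carrier (fob W p)" "w' \<in> carrier (fob W p)" "x \<in> carrier (fob X p)" for w w' x
        by (rule l(2)[OF that(3,1,2)])
    qed (rule right[OF p] scalar[OF p] that; assumption)+
    then show ?thesis by (intro exI[of _ h] conjI ballI)
  qed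
  then obtain h where h: "\<And>p. p \<in> obj C \<Longrightarrow> h p \<in> lmod_hom A (M p) P"
    and h_tens: "\<And>p w x. p \<in> obj C \<Longrightarrow> w \<in> carrier (fob W p) \<Longrightarrow> x \<in> carrier (fob X p) \<Longrightarrow>
      h p (pure_tensor K \<iota> (fob W p) (fob X p) w x) = \<beta> p w x"
    by metis
  let ?h = "direct_sum_ext P (obj C) M h"
  have hom: "?h \<in> lmod_hom A S P"
    unfolding coend_sum_def by (rule direct_sum_ext_lmod_hom[OF P mod_M h])
  have h_elt: "?h (coend_elt K C \<iota> W X p w x) = \<beta> p w x"
    if "p \<in> obj C" "w \<in> carrier (fob W p)" "x \<in> carrier (fob X p)" for p w x
    unfolding coend_elt_def
    using direct_sum_ext_incl[where M = M and h = h, OF P mod_M h that(1)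
        tensor_pair.tens_closed[OF tensor_pair[OF that(1)] that(2,3)]] h_tens[OF that] by simp
  \<comment> \<open>The kernel is a submodule, and \<open>R\<close> is the smallest submodule that
    contains the relations; so only the generating relations have to be examined.\<close>
  have "R \<subseteq> a_kernel S P ?h"
    unfolding coend_rels_def
  proof (rule submodule_generated_least[OF submodule_kernel[OF mod_S P hom]],
      intro subsetI; elim CollectE exE conjE)
    fix z p r f w x
    assume *: "p \<in> obj C" "r \<in> obj C" "f \<in> carrier (homs C p r)" "w \<in> carrier (fob W r)"
      "x \<in> carrier (fob X p)"
      and z: "z = coend_elt K C \<iota> W X p (fmor W r p f w) x \<ominus>\<^bsub>S\<^esub> coend_elt K C \<iota> W X r w (fmor X p r f x)"
    note fw = W_mor[OF *(1-4)] and fx = functor_closed[OF X *(1-3,5)]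
    note c = coend_elt_closed[OF *(1) fw *(5)] coend_elt_closed[OF *(2,4) fx]
    interpret S: left_module A S by (rule mod_S)
    show "z \<in> a_kernel S P ?h"
      unfolding mem_a_kernel z lmod_hom_minus[OF mod_S P hom c] h_elt[OF *(1) fw *(5)] h_elt[OF *(2,4) fx]
        slide[OF *]
      using c lmod_hom_closed[OF right[OF *(2,4)] fx] by (simp add: S.M.minus_closed P.M.minus_eq_zero_iff)
  qed
  then have zero: "?h z = \<zero>\<^bsub>P\<^esub>" if "z \<in> R" for z
    using subsetD[OF _ that, of "a_kernel S P ?h"] by (simp add: mem_a_kernel)
  show thesis
  proof (rule that)
    show "coset_ext ?h \<in> lmod_hom A T P"
      unfolding tensor_over_def by (rule coset_ext_lmod_hom[OF mod_S submodule_R P hom zero])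
    show "coset_ext ?h (tens p w x) = \<beta> p w x"
      if "p \<in> obj C" "w \<in> carrier (fob W p)" "x \<in> carrier (fob X p)" for p w x
      unfolding tensor_over_elt_def
      using coset_ext_apply[OF mod_S submodule_R P hom zero coend_elt_closed[OF that]] h_elt[OF that]
      by simp
  qed
qed

end

text \<open>Naturality of \<theta> and \<eta> turns the coend relation for \<open>f\<close>,
  \<open>w\<close>, \<open>x\<close> into the one for \<open>f\<close>, \<open>\<theta> r w\<close>,
  \<open>\<eta> p x\<close>. The preimage of a submodule is a submodule, so the relations generated
  by these are respected as well.\<close>

lemma tensor_over_map_props:
  assumes "tensor_functors K A \<iota> C W X" "tensor_functors K A \<iota> C W' X'"
    and \<theta>: "nat_trans (opcat C) K W W' \<theta>" and \<eta>: "nat_trans C A X X' \<eta>"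
  shows tensor_over_map_lmod_hom: "tensor_over_map K C A \<iota> W' X' \<theta> \<eta>
      \<in> lmod_hom A (tensor_over K C A \<iota> W X) (tensor_over K C A \<iota> W' X')"
    and tensor_over_map_elt: "p \<in> obj C \<Longrightarrow> w \<in> carrier (fob W p) \<Longrightarrow> x \<in> carrier (fob X p) \<Longrightarrow>
      tensor_over_map K C A \<iota> W' X' \<theta> \<eta> (tensor_over_elt K C A \<iota> W X p w x) =
      tensor_over_elt K C A \<iota> W' X' p (\<theta> p w) (\<eta> p x)"
proof -
  interpret I: tensor_functors K A \<iota> C W X by fact
  interpret J: tensor_functors K A \<iota> C W' X' by fact
  let ?t = "\<lambda>p. tensor_map K \<iota> (fob W' p) (fob X' p) (\<theta> p) (\<eta> p)"
  let ?h = "\<lambda>t. \<lambda>p\<in>obj C. ?t p (t p)"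
  have \<theta>_hom: "\<theta> p \<in> lmod_hom K (fob W p) (fob W' p)" if "p \<in> obj C" for p
    using nat_trans_hom[OF \<theta>] that by simp
  have t: "?t p \<in> lmod_hom A (I.M p) (J.M p)" if "p \<in> obj C" for p
    by (rule tensor_map_lmod_hom(1)[OF I.tensor_pair[OF that] J.tensor_pair[OF that] \<theta>_hom[OF that]
          nat_trans_hom[OF \<eta> that]])
  have h: "?h \<in> lmod_hom A I.S J.S"
    unfolding coend_sum_def by (rule direct_sum_map_lmod_hom[OF I.mod_M J.mod_M t])
  have h_elt: "?h (coend_elt K C \<iota> W X p w x) = coend_elt K C \<iota> W' X' p (\<theta> p w) (\<eta> p x)"
    if "p \<in> obj C" "w \<in> carrier (fob W p)" "x \<in> carrier (fob X p)" for p w x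
  proof -
    have "?h (direct_sum_incl (obj C) I.M p u) = direct_sum_incl (obj C) J.M p (?t p u)" for u
      by (rule direct_sum_map_incl[OF I.mod_M J.mod_M t])
    then show ?thesis
      unfolding coend_elt_def
      using tensor_map_lmod_hom(2)[OF I.tensor_pair[OF that(1)] J.tensor_pair[OF that(1)]
          \<theta>_hom[OF that(1)] nat_trans_hom[OF \<eta> that(1)] that(2,3)] by (simp only:)
  qed
  have "I.R \<subseteq> {z \<in> carrier I.S. ?h z \<in> J.R}"
    unfolding coend_rels_def[of _ _ _ _ W X]
  proof (rule submodule_generated_least[OF submodule_vimage[OF I.mod_S J.mod_S h J.submodule_R]],
      intro subsetI; elim CollectE exE conjE)
    fix z p r f w x
    assume *: "p \<in> obj C" "r \<in> obj C" "f \<in> carrier (homs C p r)" "w \<in> carrier (fob W r)"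
      "x \<in> carrier (fob X p)"
      and z: "z = coend_elt K C \<iota> W X p (fmor W r p f w) x \<ominus>\<^bsub>I.S\<^esub> coend_elt K C \<iota> W X r w (fmor X p r f x)"
    note fw = I.W_mor[OF *(1-4)] and fx = functor_closed[OF I.X *(1-3,5)]
    note c = I.coend_elt_closed[OF *(1) fw *(5)] I.coend_elt_closed[OF *(2,4) fx]
    have \<theta>w: "\<theta> r w \<in> carrier (fob W' r)" by (rule lmod_hom_closed[OF \<theta>_hom[OF *(2)] *(4)])
    have \<eta>x: "\<eta> p x \<in> carrier (fob X' p)" by (rule nat_trans_closed[OF \<eta> *(1,5)])
    have n: "\<theta> p (fmor W r p f w) = fmor W' r p f (\<theta> r w)" "\<eta> r (fmor X p r f x) = fmor X' p r f (\<eta> p x)"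
      using nat_trans_naturality[OF \<theta>, of r p f w] nat_trans_naturality[OF \<eta> *(1-3,5)] * by simp_all
    interpret S: left_module A I.S by (rule I.mod_S)
    have "?h z = coend_elt K C \<iota> W' X' p (fmor W' r p f (\<theta> r w)) (\<eta> p x) \<ominus>\<^bsub>J.S\<^esub>
        coend_elt K C \<iota> W' X' r (\<theta> r w) (fmor X' p r f (\<eta> p x))"
      unfolding z lmod_hom_minus[OF I.mod_S J.mod_S h c] h_elt[OF *(1) fw *(5)] h_elt[OF *(2,4) fx] n ..
    also have "\<dots> \<in> J.R"
      unfolding coend_rels_def
      by (rule subsetD[OF submodule_generated_incl], intro CollectI exI conjI;
          (rule refl | rule *(1-3) \<theta>w \<eta>x))
    finally have "?h z \<in> J.R" .
    moreover have "z \<in> carrier I.S" unfolding z using c by (simp add: S.M.minus_closed)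
    ultimately show "z \<in> {z \<in> carrier I.S. ?h z \<in> J.R}" by simp
  qed
  then have sub: "?h ` I.R \<subseteq> J.R" by (intro image_subsetI) (drule subsetD, assumption, simp)
  show "tensor_over_map K C A \<iota> W' X' \<theta> \<eta> \<in> lmod_hom A I.T J.T"
    unfolding tensor_over_map_def tensor_over_def
    by (rule quot_map_lmod_hom[OF I.mod_S I.submodule_R J.mod_S J.submodule_R h sub])
  show "tensor_over_map K C A \<iota> W' X' \<theta> \<eta> (I.tens p w x) = J.tens p (\<theta> p w) (\<eta> p x)"
    if "p \<in> obj C" "w \<in> carrier (fob W p)" "x \<in> carrier (fob X p)"
    unfolding tensor_over_map_def tensor_over_elt_def
      quot_map_apply[OF I.mod_S I.submodule_R J.mod_S J.submodule_R h sub I.coend_elt_closed[OF that]]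
      h_elt[OF that] ..
qed

section \<open>Path categories, quotient categories and mesh categories\<close>

lemma path_module_simps:
  "f \<in> carrier (path_module K \<Gamma> p q) \<longleftrightarrow> (\<forall>w. f w \<in> carrier K) \<and> finite {w. f w \<noteq> \<zero>\<^bsub>K\<^esub>} \<and>
    (\<forall>w. f w \<noteq> \<zero>\<^bsub>K\<^esub> \<longrightarrow> pre_digraph.awalk \<Gamma> p w q)"
  "\<zero>\<^bsub>path_module K \<Gamma> p q\<^esub> = (\<lambda>w. \<zero>\<^bsub>K\<^esub>)"
  "f \<oplus>\<^bsub>path_module K \<Gamma> p q\<^esub> g = (\<lambda>w. f w \<oplus>\<^bsub>K\<^esub> g w)"
  "c \<odot>\<^bsub>path_module K \<Gamma> p q\<^esub> f = (\<lambda>w. c \<otimes>\<^bsub>K\<^esub> f w)"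
  by (simp_all add: path_module_def)

lemma path_moduleI:
  assumes "\<And>w. f w \<in> carrier K" "finite S" "\<And>w. w \<notin> S \<Longrightarrow> f w = \<zero>\<^bsub>K\<^esub>"
    "\<And>w. w \<in> S \<Longrightarrow> pre_digraph.awalk \<Gamma> p w q"
  shows "f \<in> carrier (path_module K \<Gamma> p q)"
proof -
  have "{w. f w \<noteq> \<zero>\<^bsub>K\<^esub>} \<subseteq> S" using assms(3) by auto
  then show ?thesis
    using assms finite_subset[OF _ assms(2)] unfolding path_module_simps by blast
qed

lemma path_moduleE:
  assumes "f \<in> carrier (path_module K \<Gamma> p q)"
  obtains S where "finite S" "\<And>w. w \<notin> S \<Longrightarrow> f w = \<zero>\<^bsub>K\<^esub>" "\<And>w. w \<in> S \<Longrightarrow> pre_digraph.awalk \<Gamma> p w q"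
  by (rule that[of "{w. f w \<noteq> \<zero>\<^bsub>K\<^esub>}"]) (use assms in \<open>simp_all add: path_module_simps\<close>)

lemma path_module_value: "f \<in> carrier (path_module K \<Gamma> p q) \<Longrightarrow> f w \<in> carrier K"
  by (simp add: path_module_simps)

lemma left_module_path_module:
  assumes "cring K"
  shows "left_module K (path_module K \<Gamma> p q)"
proof -
  interpret K: cring K by fact
  have add: "f \<oplus>\<^bsub>path_module K \<Gamma> p q\<^esub> g \<in> carrier (path_module K \<Gamma> p q)"
    if fg: "f \<in> carrier (path_module K \<Gamma> p q)" "g \<in> carrier (path_module K \<Gamma> p q)" for f g
  proof -
    obtain S where S: "finite S" "\<And>w. w \<notin> S \<Longrightarrow> f w = \<zero>\<^bsub>K\<^esub>" "\<And>w. w \<in> S \<Longrightarrow> pre_digraph.awalk \<Gamma> p w q"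
      by (rule path_moduleE[OF fg(1)]) (rule that)
    obtain S' where S': "finite S'" "\<And>w. w \<notin> S' \<Longrightarrow> g w = \<zero>\<^bsub>K\<^esub>" "\<And>w. w \<in> S' \<Longrightarrow> pre_digraph.awalk \<Gamma> p w q"
      by (rule path_moduleE[OF fg(2)]) (rule that)
    show ?thesis
      unfolding path_module_simps(3)
      by (rule path_moduleI[where S = "S \<union> S'"])
        (use S S' path_module_value[OF fg(1)] path_module_value[OF fg(2)] in auto)
  qed
  have smult: "c \<odot>\<^bsub>path_module K \<Gamma> p q\<^esub> f \<in> carrier (path_module K \<Gamma> p q)"
    if fg: "f \<in> carrier (path_module K \<Gamma> p q)" "c \<in> carrier K" for f c
  proof -
    obtain S where S: "finite S" "\<And>w. w \<notin> S \<Longrightarrow> f w = \<zero>\<^bsub>K\<^esub>" "\<And>w. w \<in> S \<Longrightarrow> pre_digraph.awalk \<Gamma> p w q"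
      by (rule path_moduleE[OF fg(1)]) (rule that)
    show ?thesis
      unfolding path_module_simps(4)
      by (rule path_moduleI[OF _ S(1)]) (use S fg path_module_value[OF fg(1)] in auto)
  qed
  have zero: "\<zero>\<^bsub>path_module K \<Gamma> p q\<^esub> \<in> carrier (path_module K \<Gamma> p q)"
    by (simp add: path_module_simps)
  note v = path_module_value[of _ K \<Gamma> p q]
  show ?thesis
  proof (rule left_moduleI[OF K.ring_axioms])
    show "abelian_group (path_module K \<Gamma> p q)"
    proof (rule abelian_groupI)
      fix f assume f: "f \<in> carrier (path_module K \<Gamma> p q)"
      show "\<exists>g\<in>carrier (path_module K \<Gamma> p q).
          g \<oplus>\<^bsub>path_module K \<Gamma> p q\<^esub> f = \<zero>\<^bsub>path_module K \<Gamma> p q\<^esub>"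
        by (rule bexI[OF _ smult[OF f, of "\<ominus>\<^bsub>K\<^esub> \<one>\<^bsub>K\<^esub>"]])
          (use v[OF f] in \<open>simp_all add: path_module_simps(2-) K.l_minus K.l_neg\<close>)
    qed (use add zero v in \<open>simp_all add: path_module_simps(2-) K.a_ac\<close>)
  qed (use add smult v in \<open>simp_all add: path_module_simps(2-) K.l_distr K.r_distr K.m_assoc\<close>)
qed

lemma path_elt_closed:
  assumes "cring K" "pre_digraph.awalk \<Gamma> p w q"
  shows "path_elt K w \<in> carrier (path_module K \<Gamma> p q)"
proof -
  interpret K: cring K by fact
  show ?thesis
    by (rule path_moduleI[where S = "{w}"]) (auto simp: path_elt_def assms(2))
qed

text \<open>Induction on a finite set of paths outside of which \<open>f\<close> vanishes: setting
  one coefficient to zero splits off a multiple of a path. The set may be larger than the support,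
  so coefficients that happen to be zero need no separate case.\<close>

lemma path_module_induct [consumes 2, case_names zero path add]:
  assumes K: "cring K" and f: "f \<in> carrier (path_module K \<Gamma> p q)"
    and zero: "Q \<zero>\<^bsub>path_module K \<Gamma> p q\<^esub>"
    and path: "\<And>c w. c \<in> carrier K \<Longrightarrow> pre_digraph.awalk \<Gamma> p w q \<Longrightarrow>
      Q (c \<odot>\<^bsub>path_module K \<Gamma> p q\<^esub> path_elt K w)"
    and add: "\<And>f g. f \<in> carrier (path_module K \<Gamma> p q) \<Longrightarrow> g \<in> carrier (path_module K \<Gamma> p q) \<Longrightarrow>
      Q f \<Longrightarrow> Q g \<Longrightarrow> Q (f \<oplus>\<^bsub>path_module K \<Gamma> p q\<^esub> g)"
  shows "Q f"
proof -
  interpret K: cring K by (rule K)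
  interpret M: left_module K "path_module K \<Gamma> p q" by (rule left_module_path_module[OF K])
  obtain S where "finite S" and out: "\<And>w. w \<notin> S \<Longrightarrow> f w = \<zero>\<^bsub>K\<^esub>"
    and S: "\<And>w. w \<in> S \<Longrightarrow> pre_digraph.awalk \<Gamma> p w q"
    by (rule path_moduleE[OF f]) (rule that)
  from \<open>finite S\<close> f out S show ?thesis
  proof (induction S arbitrary: f rule: finite_induct)
    case empty
    then have "f = \<zero>\<^bsub>path_module K \<Gamma> p q\<^esub>" by (auto simp: path_module_simps(2))
    then show ?case using zero by simp
  next
    case (insert w S)
    note v = path_module_value[OF insert.prems(1)]
    let ?g = "f(w := \<zero>\<^bsub>K\<^esub>)" and ?h = "f w \<odot>\<^bsub>path_module K \<Gamma> p q\<^esub> path_elt K w"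
    have w: "pre_digraph.awalk \<Gamma> p w q" using insert.prems(3) by simp
    have g: "?g \<in> carrier (path_module K \<Gamma> p q)"
      by (rule path_moduleI[OF _ insert.hyps(1)]) (use v insert.prems(2,3) in auto)
    have "Q ?g" by (rule insert.IH[OF g]) (use insert.prems(2,3) in auto)
    moreover have "?h \<in> carrier (path_module K \<Gamma> p q)"
      by (rule M.smult_closed[OF v path_elt_closed[OF K w]])
    ultimately have "Q (?g \<oplus>\<^bsub>path_module K \<Gamma> p q\<^esub> ?h)"
      using path[OF v w] g by (intro add)
    moreover have "?g \<oplus>\<^bsub>path_module K \<Gamma> p q\<^esub> ?h = f"
      using v by (auto simp: fun_eq_iff path_module_simps(3,4) path_elt_def)
    ultimately show ?case by simp
  qed
qed

lemma path_module_hom_eq: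
  assumes K: "cring K" and N: "left_module K N" and g: "g \<in> lmod_hom K (path_module K \<Gamma> p q) N"
    and h: "h \<in> lmod_hom K (path_module K \<Gamma> p q) N"
    and eq: "\<And>w. pre_digraph.awalk \<Gamma> p w q \<Longrightarrow> g (path_elt K w) = h (path_elt K w)"
    and f: "f \<in> carrier (path_module K \<Gamma> p q)"
  shows "g f = h f"
  using K f
proof (induction rule: path_module_induct)
  case zero
  show ?case
    using lmod_hom_zero[OF left_module_path_module[OF K] N g]
      lmod_hom_zero[OF left_module_path_module[OF K] N h] by simp
next
  case (path c w)
  note el = path_elt_closed[OF K path(2)]
  show ?case
    using lmod_hom_smult[OF g path(1) el] lmod_hom_smult[OF h path(1) el] eq[OF path(2)] by simp
next
  case (add f f')
  then show ?case using lmod_hom_add[OF g add(1,2)] lmod_hom_add[OF h add(1,2)] by simp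
qed

lemma path_cat_simps [simp]:
  "obj (path_cat K \<Gamma>) = verts \<Gamma>" "homs (path_cat K \<Gamma>) = path_module K \<Gamma>"
  "ident (path_cat K \<Gamma>) p = path_elt K []"
  by (simp_all add: path_cat_def)

lemma path_cat_comp:
  "comp_mor (path_cat K \<Gamma>) p q r g f w = (\<Oplus>\<^bsub>K\<^esub>i\<in>{..length w}. f (take i w) \<otimes>\<^bsub>K\<^esub> g (drop i w))"
  by (simp add: path_cat_def)

lemma path_comp_closed:
  assumes "cring K" "wf_digraph \<Gamma>" and f: "f \<in> carrier (path_module K \<Gamma> p q)"
    and g: "g \<in> carrier (path_module K \<Gamma> q r)"
  shows "comp_mor (path_cat K \<Gamma>) p q r g f \<in> carrier (path_module K \<Gamma> p r)"
proof -
  interpret K: cring K by fact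
  interpret wf_digraph \<Gamma> by fact
  note v = path_module_value[OF f] path_module_value[OF g]
  obtain S where S: "finite S" "\<And>w. w \<notin> S \<Longrightarrow> f w = \<zero>\<^bsub>K\<^esub>" "\<And>w. w \<in> S \<Longrightarrow> awalk p w q"
    by (rule path_moduleE[OF f]) (rule that)
  obtain S' where S': "finite S'" "\<And>w. w \<notin> S' \<Longrightarrow> g w = \<zero>\<^bsub>K\<^esub>" "\<And>w. w \<in> S' \<Longrightarrow> awalk q w r"
    by (rule path_moduleE[OF g]) (rule that)
  show ?thesis
  \<comment> \<open>A nonzero coefficient at \<open>w\<close> requires a cut of \<open>w\<close>
    into a path in the support bound of \<open>f\<close> and one in that of \<open>g\<close>; hence
    concatenations bound the support.\<close>
  proof (rule path_moduleI[where S = "(\<lambda>(u, v). u @ v) ` (S \<times> S')"])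
    show "comp_mor (path_cat K \<Gamma>) p q r g f w \<in> carrier K" for w
      unfolding path_cat_comp by (intro K.finsum_closed funcsetI K.m_closed v)
    show "finite ((\<lambda>(u, v). u @ v) ` (S \<times> S'))" using S(1) S'(1) by simp
    show "comp_mor (path_cat K \<Gamma>) p q r g f w = \<zero>\<^bsub>K\<^esub>" if "w \<notin> (\<lambda>(u, v). u @ v) ` (S \<times> S')" for w
      unfolding path_cat_comp
    proof (rule K.add.finprod_one_eqI)
      fix i
      have "take i w \<notin> S \<or> drop i w \<notin> S'"
      proof (rule ccontr)
        assume "\<not> (take i w \<notin> S \<or> drop i w \<notin> S')"
        then have "(take i w, drop i w) \<in> S \<times> S'" by simp
        from imageI[OF this, of "\<lambda>(u, v). u @ v"] show False using that by simp
      qed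
      then show "f (take i w) \<otimes>\<^bsub>K\<^esub> g (drop i w) = \<zero>\<^bsub>K\<^esub>"
        using S(2) S'(2) v by auto
    qed
    show "awalk p w r" if hw: "w \<in> (\<lambda>(u, v). u @ v) ` (S \<times> S')" for w
    proof -
      obtain z where z: "w = (\<lambda>(u, v). u @ v) z" "z \<in> S \<times> S'"
        using hw by (rule imageE)
      have "awalk p (fst z @ snd z) r"
        by (rule awalk_appendI[OF S(3) S'(3)]) (use z(2) in \<open>simp_all add: mem_Times_iff\<close>)
      then show ?thesis using z(1) by (simp add: case_prod_beta)
    qed
  qed
qed

lemma path_comp_hom:
  assumes "cring K" "wf_digraph \<Gamma>"
  shows path_comp_left: "f \<in> carrier (path_module K \<Gamma> p q) \<Longrightarrow>
      (\<lambda>g. comp_mor (path_cat K \<Gamma>) p q r g f) \<in> lmod_hom K (path_module K \<Gamma> q r) (path_module K \<Gamma> p r)"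
    and path_comp_right: "g \<in> carrier (path_module K \<Gamma> q r) \<Longrightarrow>
      (\<lambda>f. comp_mor (path_cat K \<Gamma>) p q r g f) \<in> lmod_hom K (path_module K \<Gamma> p q) (path_module K \<Gamma> p r)"
proof -
  interpret K: cring K by fact
  note c = path_comp_closed[OF assms]
  show "(\<lambda>g. comp_mor (path_cat K \<Gamma>) p q r g f) \<in> lmod_hom K (path_module K \<Gamma> q r) (path_module K \<Gamma> p r)"
    if f: "f \<in> carrier (path_module K \<Gamma> p q)"
  proof (rule lmod_homI)
    fix g assume g: "g \<in> carrier (path_module K \<Gamma> q r)"
    note v = path_module_value[OF f] path_module_value[OF g]
    show "comp_mor (path_cat K \<Gamma>) p q r g f \<in> carrier (path_module K \<Gamma> p r)" by (rule c[OF f g])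
    show "comp_mor (path_cat K \<Gamma>) p q r (g \<oplus>\<^bsub>path_module K \<Gamma> q r\<^esub> h) f =
        comp_mor (path_cat K \<Gamma>) p q r g f \<oplus>\<^bsub>path_module K \<Gamma> p r\<^esub> comp_mor (path_cat K \<Gamma>) p q r h f"
      if "h \<in> carrier (path_module K \<Gamma> q r)" for h
      using v path_module_value[OF that]
      by (simp add: fun_eq_iff path_cat_comp path_module_simps(3) K.r_distr Pi_def)
    show "comp_mor (path_cat K \<Gamma>) p q r (k \<odot>\<^bsub>path_module K \<Gamma> q r\<^esub> g) f =
        k \<odot>\<^bsub>path_module K \<Gamma> p r\<^esub> comp_mor (path_cat K \<Gamma>) p q r g f"
      if "k \<in> carrier K" for k
      using v that
      by (simp add: fun_eq_iff path_cat_comp path_module_simps(4) K.finsum_rdistr Pi_def K.m_lcomm)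
  qed
  show "(\<lambda>f. comp_mor (path_cat K \<Gamma>) p q r g f) \<in> lmod_hom K (path_module K \<Gamma> p q) (path_module K \<Gamma> p r)"
    if g: "g \<in> carrier (path_module K \<Gamma> q r)"
  proof (rule lmod_homI)
    fix f assume f: "f \<in> carrier (path_module K \<Gamma> p q)"
    note v = path_module_value[OF f] path_module_value[OF g]
    show "comp_mor (path_cat K \<Gamma>) p q r g f \<in> carrier (path_module K \<Gamma> p r)" by (rule c[OF f g])
    show "comp_mor (path_cat K \<Gamma>) p q r g (f \<oplus>\<^bsub>path_module K \<Gamma> p q\<^esub> h) =
        comp_mor (path_cat K \<Gamma>) p q r g f \<oplus>\<^bsub>path_module K \<Gamma> p r\<^esub> comp_mor (path_cat K \<Gamma>) p q r g h"
      if "h \<in> carrier (path_module K \<Gamma> p q)" for h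
      using v path_module_value[OF that]
      by (simp add: fun_eq_iff path_cat_comp path_module_simps(3) K.l_distr Pi_def)
    show "comp_mor (path_cat K \<Gamma>) p q r g (k \<odot>\<^bsub>path_module K \<Gamma> p q\<^esub> f) =
        k \<odot>\<^bsub>path_module K \<Gamma> p r\<^esub> comp_mor (path_cat K \<Gamma>) p q r g f"
      if "k \<in> carrier K" for k
      using v that
      by (simp add: fun_eq_iff path_cat_comp path_module_simps(4) K.finsum_rdistr Pi_def K.m_assoc)
  qed
qed

text \<open>Among all cuts of \<open>u @ v\<close> only the one at \<open>length u\<close> has
  \<open>u\<close> as its first piece, so exactly one term of the sum survives.\<close>

lemma path_comp_elt:
  assumes "cring K"
  shows "comp_mor (path_cat K \<Gamma>) p q r (path_elt K v) (path_elt K u) = path_elt K (u @ v)"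
proof
  interpret K: cring K by fact
  fix w
  show "comp_mor (path_cat K \<Gamma>) p q r (path_elt K v) (path_elt K u) w = path_elt K (u @ v) w"
  proof (cases "w = u @ v")
    case True
    have "comp_mor (path_cat K \<Gamma>) p q r (path_elt K v) (path_elt K u) w =
        (\<Oplus>\<^bsub>K\<^esub>i\<in>{..length w}. if length u = i then \<one>\<^bsub>K\<^esub> else \<zero>\<^bsub>K\<^esub>)"
      unfolding path_cat_comp
    proof (rule K.finsum_cong')
      fix i assume "i \<in> {..length w}"
      then have "length (take i w) = i" by simp
      then have "take i w \<noteq> u" if "length u \<noteq> i" using that by auto
      then show "path_elt K u (take i w) \<otimes>\<^bsub>K\<^esub> path_elt K v (drop i w) =
          (if length u = i then \<one>\<^bsub>K\<^esub> else \<zero>\<^bsub>K\<^esub>)"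
        by (auto simp: path_elt_def True)
    qed auto
    also have "\<dots> = \<one>\<^bsub>K\<^esub>" using True by (intro K.finsum_singleton) auto
    finally show ?thesis by (simp add: path_elt_def True)
  next
    case False
    have "path_elt K u (take i w) \<otimes>\<^bsub>K\<^esub> path_elt K v (drop i w) = \<zero>\<^bsub>K\<^esub>" for i
      using False append_take_drop_id[of i w] by (auto simp: path_elt_def)
    then show ?thesis using False by (simp add: path_cat_comp path_elt_def[of K "u @ v"])
  qed
qed

text \<open>Composition is bilinear, so associativity is reduced one argument at a time to paths,
  where it is associativity of concatenation. This avoids a manipulation of double sums over
  cuts.\<close>

lemma linear_category_path_cat:
  assumes K: "cring K" and \<Gamma>: "wf_digraph \<Gamma>"
  shows "linear_category K (path_cat K \<Gamma>)"
proof -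
  interpret K: cring K by (rule K)
  interpret wf_digraph \<Gamma> by (rule \<Gamma>)
  note lm = left_module_path_module[OF K] and el = path_elt_closed[OF K]
  note l = path_comp_left[OF K \<Gamma>] and r = path_comp_right[OF K \<Gamma>] and c = path_comp_closed[OF K \<Gamma>]
  have id_hom: "(\<lambda>f. f) \<in> lmod_hom K M M" for M :: "('a, 'z) module"
    by (rule lmod_homI) auto
  let ?c = "comp_mor (path_cat K \<Gamma>)"
  have assoc: "?c p q s (?c q r s h g) f = ?c p r s h (?c p q r g f)"
    if f: "f \<in> carrier (path_module K \<Gamma> p q)" and g: "g \<in> carrier (path_module K \<Gamma> q r)"
      and h: "h \<in> carrier (path_module K \<Gamma> r s)" for p q r s f g h
  proof (rule path_module_hom_eq[where g = "\<lambda>h. ?c p q s (?c q r s h g) f"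
        and h = "\<lambda>h. ?c p r s h (?c p q r g f)", OF K lm _ _ _ h])
    show "(\<lambda>h. ?c p r s h (?c p q r g f)) \<in> lmod_hom K (path_module K \<Gamma> r s) (path_module K \<Gamma> p s)"
      by (rule l[OF c[OF f g]])
    show "(\<lambda>h. ?c p q s (?c q r s h g) f) \<in> lmod_hom K (path_module K \<Gamma> r s) (path_module K \<Gamma> p s)"
      by (rule lmod_hom_comp[OF l[OF f] l[OF g]])
    fix u assume u: "awalk r u s"
    show "?c p q s (?c q r s (path_elt K u) g) f = ?c p r s (path_elt K u) (?c p q r g f)"
    proof (rule path_module_hom_eq[OF K lm _ _ _ g, where g = "\<lambda>g. ?c p q s (?c q r s (path_elt K u) g) f"
          and h = "\<lambda>g. ?c p r s (path_elt K u) (?c p q r g f)"])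
      show "(\<lambda>g. ?c p q s (?c q r s (path_elt K u) g) f) \<in> lmod_hom K (path_module K \<Gamma> q r) (path_module K \<Gamma> p s)"
        by (rule lmod_hom_comp[OF l[OF f] r[OF el[OF u]]])
      show "(\<lambda>g. ?c p r s (path_elt K u) (?c p q r g f)) \<in> lmod_hom K (path_module K \<Gamma> q r) (path_module K \<Gamma> p s)"
        by (rule lmod_hom_comp[OF r[OF el[OF u]] l[OF f]])
      fix v assume v: "awalk q v r"
      show "?c p q s (?c q r s (path_elt K u) (path_elt K v)) f =
          ?c p r s (path_elt K u) (?c p q r (path_elt K v) f)"
      proof (rule path_module_hom_eq[OF K lm _ _ _ f,
            where g = "\<lambda>f. ?c p q s (?c q r s (path_elt K u) (path_elt K v)) f"
            and h = "\<lambda>f. ?c p r s (path_elt K u) (?c p q r (path_elt K v) f)"])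
        show "(\<lambda>f. ?c p q s (?c q r s (path_elt K u) (path_elt K v)) f)
            \<in> lmod_hom K (path_module K \<Gamma> p q) (path_module K \<Gamma> p s)"
          by (rule r[OF c[OF el[OF v] el[OF u]]])
        show "(\<lambda>f. ?c p r s (path_elt K u) (?c p q r (path_elt K v) f))
            \<in> lmod_hom K (path_module K \<Gamma> p q) (path_module K \<Gamma> p s)"
          by (rule lmod_hom_comp[OF r[OF el[OF u]] r[OF el[OF v]]])
      qed (simp add: path_comp_elt[OF K])
    qed
  qed
  have id_right: "?c p p q f (path_elt K []) = f"
    if f: "f \<in> carrier (path_module K \<Gamma> p q)" and p: "p \<in> verts \<Gamma>" for p q f
    by (rule path_module_hom_eq[OF K lm l id_hom _ f]) (use p in \<open>simp_all add: path_comp_elt[OF K] el awalk_Nil_iff\<close>)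
  have id_left: "?c p q q (path_elt K []) f = f"
    if f: "f \<in> carrier (path_module K \<Gamma> p q)" and q: "q \<in> verts \<Gamma>" for p q f
    by (rule path_module_hom_eq[OF K lm r id_hom _ f]) (use q in \<open>simp_all add: path_comp_elt[OF K] el awalk_Nil_iff\<close>)
  show ?thesis
    by (intro linear_category.intro linear_category_axioms.intro K; unfold path_cat_simps)
      (rule lm l r assoc id_right id_left el awalk_Nil_iff[THEN iffD2] conjI refl; assumption?)+
qed

section \<open>Ideals of linear categories and quotient categories\<close>

lemma gen_cat_ideal_least:
  "cat_ideal K C J \<Longrightarrow> (\<And>u v. u \<in> obj C \<Longrightarrow> v \<in> obj C \<Longrightarrow> S u v \<subseteq> J u v) \<Longrightarrow>
    gen_cat_ideal K C S p q \<subseteq> J p q"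
  unfolding gen_cat_ideal_def by (rule Inter_lower) (use CollectI in blast)

lemma gen_cat_ideal_incl:
  "u \<in> obj C \<Longrightarrow> v \<in> obj C \<Longrightarrow> S u v \<subseteq> gen_cat_ideal K C S u v"
  unfolding gen_cat_ideal_def by (rule Inter_greatest) auto

lemma cat_idealD:
  assumes "cat_ideal K C I" "p \<in> obj C" "q \<in> obj C"
  shows cat_ideal_submodule: "submodule (I p q) K (homs C p q)"
    and cat_ideal_left: "r \<in> obj C \<Longrightarrow> f \<in> I p q \<Longrightarrow> g \<in> carrier (homs C q r) \<Longrightarrow>
      comp_mor C p q r g f \<in> I p r"
    and cat_ideal_right: "r \<in> obj C \<Longrightarrow> f \<in> carrier (homs C p q) \<Longrightarrow> g \<in> I q r \<Longrightarrow>
      comp_mor C p q r g f \<in> I p r"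
  using assms unfolding cat_ideal_def by auto

lemma cat_ideal_gen_cat_ideal:
  assumes C: "linear_category K C"
    and S: "\<And>u v. u \<in> obj C \<Longrightarrow> v \<in> obj C \<Longrightarrow> S u v \<subseteq> carrier (homs C u v)"
  shows "cat_ideal K C (gen_cat_ideal K C S)"
proof -
  interpret linear_category K C by (rule C)
  let ?G = "gen_cat_ideal K C S"
  \<comment> \<open>The ideal of all morphisms belongs to the family that is intersected, which
    keeps the generated ideal inside the hom modules.\<close>
  have all: "cat_ideal K C (\<lambda>p q. carrier (homs C p q))"
    unfolding cat_ideal_def using submodule_carrier[OF hom_mod] comp_closed by simp
  have sub: "?G p q \<subseteq> carrier (homs C p q)" for p q
    by (rule gen_cat_ideal_least[OF all S])
  \<comment> \<open>Every closure property of an intersection reduces to that of its members; each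
    ideal considered here contains \<open>?G\<close>.\<close>
  have mem: "x \<in> ?G p q"
    if H: "\<And>I. cat_ideal K C I \<Longrightarrow> (\<And>p q. ?G p q \<subseteq> I p q) \<Longrightarrow> x \<in> I p q" for x p q
  proof -
    have "x \<in> I p q" if I: "cat_ideal K C I" and SI: "\<forall>u\<in>obj C. \<forall>v\<in>obj C. S u v \<subseteq> I u v" for I
      by (rule H[OF I], rule gen_cat_ideal_least[OF I]) (use SI in simp)
    then show ?thesis unfolding gen_cat_ideal_def by auto
  qed
  show ?thesis
    unfolding cat_ideal_def
  proof (intro conjI ballI)
    fix p q assume pq: "p \<in> obj C" "q \<in> obj C"
    note sm = cat_ideal_submodule[OF _ pq]
    show "submodule (?G p q) K (homs C p q)"
    proof (rule submoduleI[OF hom_mod[OF pq] sub])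
      show "\<zero>\<^bsub>homs C p q\<^esub> \<in> ?G p q" by (rule mem) (rule submodule_zero[OF sm])
      show "f \<oplus>\<^bsub>homs C p q\<^esub> g \<in> ?G p q" if "f \<in> ?G p q" "g \<in> ?G p q" for f g
        by (rule mem, rule submodule_add[OF sm]) (use that in \<open>simp_all add: subset_iff\<close>)
      show "c \<odot>\<^bsub>homs C p q\<^esub> f \<in> ?G p q" if "c \<in> carrier K" "f \<in> ?G p q" for c f
        by (rule mem, rule submodule_smult[OF sm]) (use that in \<open>simp_all add: subset_iff\<close>)
    qed
    fix r f g assume r: "r \<in> obj C"
    show "comp_mor C p q r g f \<in> ?G p r" if "f \<in> ?G p q" "g \<in> carrier (homs C q r)"
      by (rule mem, rule cat_ideal_left[OF _ pq r]) (use that in \<open>simp_all add: subset_iff\<close>)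
    show "comp_mor C p q r g f \<in> ?G p r" if "f \<in> carrier (homs C p q)" "g \<in> ?G q r"
      by (rule mem, rule cat_ideal_right[OF _ pq r]) (use that in \<open>simp_all add: subset_iff\<close>)
  qed
qed

lemma quot_cat_simps [simp]:
  "obj (quot_cat C I) = obj C" "homs (quot_cat C I) p q = quot_module (homs C p q) (I p q)"
  "ident (quot_cat C I) p = I p p +>\<^bsub>homs C p p\<^esub> ident C p"
  by (simp_all add: quot_cat_def)

text \<open>The double union in \<open>quot_cat\<close> is one of equal cosets. The representative
  \<open>g'\<close> is replaced by \<open>g\<close> with \<open>f'\<close> fixed, then
  \<open>f'\<close> by \<open>f\<close>; the two changes use the two sides of the ideal
  property.\<close>

lemma quot_cat_comp:
  assumes C: "linear_category K C" and I: "cat_ideal K C I"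
    and obj: "p \<in> obj C" "q \<in> obj C" "r \<in> obj C"
    and f: "f \<in> carrier (homs C p q)" and g: "g \<in> carrier (homs C q r)"
  shows "comp_mor (quot_cat C I) p q r (I q r +>\<^bsub>homs C q r\<^esub> g) (I p q +>\<^bsub>homs C p q\<^esub> f) =
    I p r +>\<^bsub>homs C p r\<^esub> comp_mor C p q r g f"
proof -
  interpret linear_category K C by (rule C)
  note sm = cat_ideal_submodule[OF I]
  have ab: "abelian_subgroup (I u v) (homs C u v)" if "u \<in> obj C" "v \<in> obj C" for u v
    by (rule submodule_abelian_subgroup[OF left_module_abelian_group[OF hom_mod[OF that]] sm[OF that]])
  have coset: "x \<in> carrier (homs C u v)" "x \<ominus>\<^bsub>homs C u v\<^esub> y \<in> I u v"
    if uv: "u \<in> obj C" "v \<in> obj C" and y: "y \<in> carrier (homs C u v)" and x: "x \<in> I u v +>\<^bsub>homs C u v\<^esub> y"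
    for u v x y
  proof -
    show 1: "x \<in> carrier (homs C u v)"
      by (rule abelian_subgroup.a_elemrcos_carrier[OF ab[OF uv] y x])
    have "I u v +>\<^bsub>homs C u v\<^esub> x = I u v +>\<^bsub>homs C u v\<^esub> y"
      using abelian_subgroup.a_repr_independence'[OF ab[OF uv] x y] by simp
    then show "x \<ominus>\<^bsub>homs C u v\<^esub> y \<in> I u v"
      using quot_module_coset_eq_iff[OF hom_mod[OF uv] sm[OF uv] 1 y] by simp
  qed
  have const: "I p r +>\<^bsub>homs C p r\<^esub> comp_mor C p q r g' f' = I p r +>\<^bsub>homs C p r\<^esub> comp_mor C p q r g f"
    if g': "g' \<in> I q r +>\<^bsub>homs C q r\<^esub> g" and f': "f' \<in> I p q +>\<^bsub>homs C p q\<^esub> f" for g' f'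
  proof -
    note g'' = coset[OF obj(2,3) g g'] and f'' = coset[OF obj(1,2) f f']
    have "comp_mor C p q r g' f' \<ominus>\<^bsub>homs C p r\<^esub> comp_mor C p q r g f' \<in> I p r"
      using cat_ideal_right[OF I obj f''(1) g''(2)]
        lmod_hom_minus[OF hom_mod hom_mod comp_left[OF obj f''(1)] g''(1) g] obj by simp
    then have 1: "I p r +>\<^bsub>homs C p r\<^esub> comp_mor C p q r g' f' = I p r +>\<^bsub>homs C p r\<^esub> comp_mor C p q r g f'"
      using quot_module_coset_eq_iff[OF hom_mod sm comp_closed[OF obj f''(1) g''(1)] comp_closed[OF obj f''(1) g]] obj
      by simp
    have "comp_mor C p q r g f' \<ominus>\<^bsub>homs C p r\<^esub> comp_mor C p q r g f \<in> I p r"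
      using cat_ideal_left[OF I obj f''(2) g]
        lmod_hom_minus[OF hom_mod hom_mod comp_right[OF obj g] f''(1) f] obj by simp
    then show ?thesis
      using 1 quot_module_coset_eq_iff[OF hom_mod sm comp_closed[OF obj f''(1) g] comp_closed[OF obj f g]] obj
      by simp
  qed
  have self: "g \<in> I q r +>\<^bsub>homs C q r\<^esub> g" "f \<in> I p q +>\<^bsub>homs C p q\<^esub> f"
    by (rule abelian_subgroup.a_rcos_self[OF ab[OF obj(2,3)] g] abelian_subgroup.a_rcos_self[OF ab[OF obj(1,2)] f])+
  have "comp_mor (quot_cat C I) p q r (I q r +>\<^bsub>homs C q r\<^esub> g) (I p q +>\<^bsub>homs C p q\<^esub> f) =
      (\<Union>g'\<in>I q r +>\<^bsub>homs C q r\<^esub> g. \<Union>f'\<in>I p q +>\<^bsub>homs C p q\<^esub> f.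
        I p r +>\<^bsub>homs C p r\<^esub> comp_mor C p q r g' f')"
    by (simp add: quot_cat_def)
  also have "\<dots> = (\<Union>g'\<in>I q r +>\<^bsub>homs C q r\<^esub> g. I p r +>\<^bsub>homs C p r\<^esub> comp_mor C p q r g f)"
    by (intro SUP_cong refl UN_constant_eq[OF self(2)] ballI const)
  also have "\<dots> = I p r +>\<^bsub>homs C p r\<^esub> comp_mor C p q r g f"
    by (intro UN_constant_eq[OF self(1)] ballI refl)
  finally show ?thesis .
qed

lemma linear_category_quot_cat:
  assumes C: "linear_category K C" and I: "cat_ideal K C I"
  shows "linear_category K (quot_cat C I)"
proof -
  interpret linear_category K C by (rule C)
  note sm = cat_ideal_submodule[OF I] and qc = quot_cat_comp[OF C I]
  note s = quot_module_smult[OF hom_mod sm] quot_module_add[OF hom_mod sm]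
  have rep: "\<exists>x\<in>carrier (homs C p q). F = I p q +>\<^bsub>homs C p q\<^esub> x"
    if "F \<in> carrier (homs (quot_cat C I) p q)" for F p q
    using that by (simp add: mem_a_rcosets)
  have coset: "I p q +>\<^bsub>homs C p q\<^esub> x \<in> carrier (homs (quot_cat C I) p q)"
    if "x \<in> carrier (homs C p q)" for x p q
    using coset_mem_quot_module[OF that] by simp
  show ?thesis
  proof (intro linear_category.intro linear_category_axioms.intro K.cring_axioms)
    fix p q assume pq: "p \<in> obj (quot_cat C I)" "q \<in> obj (quot_cat C I)"
    show "left_module K (homs (quot_cat C I) p q)"
      using left_module_quot_module[OF hom_mod sm] pq by simp
    fix F assume F: "F \<in> carrier (homs (quot_cat C I) p q)"
    then obtain f where f: "f \<in> carrier (homs C p q)" "F = I p q +>\<^bsub>homs C p q\<^esub> f" using rep by blast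
    show "comp_mor (quot_cat C I) p p q F (ident (quot_cat C I) p) = F"
      using qc[of p p q "ident C p" f] pq f ident_closed comp_ident_right by simp
    show "comp_mor (quot_cat C I) p q q (ident (quot_cat C I) q) F = F"
      using qc[of p q q f "ident C q"] pq f ident_closed comp_ident_left by simp
    fix r assume r: "r \<in> obj (quot_cat C I)"
    show "(\<lambda>G. comp_mor (quot_cat C I) p q r G F) \<in>
        lmod_hom K (homs (quot_cat C I) q r) (homs (quot_cat C I) p r)"
    proof (rule lmod_homI)
      fix G assume "G \<in> carrier (homs (quot_cat C I) q r)"
      then obtain g where g: "g \<in> carrier (homs C q r)" "G = I q r +>\<^bsub>homs C q r\<^esub> g" using rep by blast
      interpret Hqr: left_module K "homs C q r" using hom_mod pq r by simp
      show "comp_mor (quot_cat C I) p q r G F \<in> carrier (homs (quot_cat C I) p r)"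
        using qc[of p q r f g] f g pq r coset[OF comp_closed[of p q r f g]] by simp
      show "comp_mor (quot_cat C I) p q r (k \<odot>\<^bsub>homs (quot_cat C I) q r\<^esub> G) F =
          k \<odot>\<^bsub>homs (quot_cat C I) p r\<^esub> comp_mor (quot_cat C I) p q r G F" if "k \<in> carrier K" for k
        using qc[of p q r f g] qc[of p q r f "k \<odot>\<^bsub>homs C q r\<^esub> g"] f g pq r that
          lmod_hom_smult[OF comp_left[of p q r f] that g(1)] Hqr.smult_closed
        by (simp add: s comp_closed del: quot_module_simps)
      fix G' assume "G' \<in> carrier (homs (quot_cat C I) q r)"
      then obtain g' where g': "g' \<in> carrier (homs C q r)" "G' = I q r +>\<^bsub>homs C q r\<^esub> g'" using rep by blast
      show "comp_mor (quot_cat C I) p q r (G \<oplus>\<^bsub>homs (quot_cat C I) q r\<^esub> G') F =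
          comp_mor (quot_cat C I) p q r G F \<oplus>\<^bsub>homs (quot_cat C I) p r\<^esub> comp_mor (quot_cat C I) p q r G' F"
        using qc[of p q r f g] qc[of p q r f g'] qc[of p q r f "g \<oplus>\<^bsub>homs C q r\<^esub> g'"] f g g' pq r
          lmod_hom_add[OF comp_left[of p q r f] g(1) g'(1)]
        by (simp add: s comp_closed del: quot_module_simps)
    qed
  next
    fix p q r G assume obj: "p \<in> obj (quot_cat C I)" "q \<in> obj (quot_cat C I)" "r \<in> obj (quot_cat C I)"
      and "G \<in> carrier (homs (quot_cat C I) q r)"
    then obtain g where g: "g \<in> carrier (homs C q r)" "G = I q r +>\<^bsub>homs C q r\<^esub> g" using rep by blast
    show "(\<lambda>F. comp_mor (quot_cat C I) p q r G F) \<in>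
        lmod_hom K (homs (quot_cat C I) p q) (homs (quot_cat C I) p r)"
    proof (rule lmod_homI)
      fix F assume "F \<in> carrier (homs (quot_cat C I) p q)"
      then obtain f where f: "f \<in> carrier (homs C p q)" "F = I p q +>\<^bsub>homs C p q\<^esub> f" using rep by blast
      interpret Hpq: left_module K "homs C p q" using hom_mod obj by simp
      show "comp_mor (quot_cat C I) p q r G F \<in> carrier (homs (quot_cat C I) p r)"
        using qc[of p q r f g] f g obj coset[OF comp_closed[of p q r f g]] by simp
      show "comp_mor (quot_cat C I) p q r G (k \<odot>\<^bsub>homs (quot_cat C I) p q\<^esub> F) =
          k \<odot>\<^bsub>homs (quot_cat C I) p r\<^esub> comp_mor (quot_cat C I) p q r G F" if "k \<in> carrier K" for k
        using qc[of p q r f g] qc[of p q r "k \<odot>\<^bsub>homs C p q\<^esub> f" g] f g obj that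
          lmod_hom_smult[OF comp_right[of p q r g] that f(1)] Hpq.smult_closed
        by (simp add: s comp_closed del: quot_module_simps)
      fix F' assume "F' \<in> carrier (homs (quot_cat C I) p q)"
      then obtain f' where f': "f' \<in> carrier (homs C p q)" "F' = I p q +>\<^bsub>homs C p q\<^esub> f'" using rep by blast
      show "comp_mor (quot_cat C I) p q r G (F \<oplus>\<^bsub>homs (quot_cat C I) p q\<^esub> F') =
          comp_mor (quot_cat C I) p q r G F \<oplus>\<^bsub>homs (quot_cat C I) p r\<^esub> comp_mor (quot_cat C I) p q r G F'"
        using qc[of p q r f g] qc[of p q r f' g] qc[of p q r "f \<oplus>\<^bsub>homs C p q\<^esub> f'" g] f g f' obj
          lmod_hom_add[OF comp_right[of p q r g] f(1) f'(1)]
        by (simp add: s comp_closed del: quot_module_simps)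
    qed
  next
    fix p q r t F G H
    assume obj: "p \<in> obj (quot_cat C I)" "q \<in> obj (quot_cat C I)" "r \<in> obj (quot_cat C I)" "t \<in> obj (quot_cat C I)"
      and FGH: "F \<in> carrier (homs (quot_cat C I) p q)" "G \<in> carrier (homs (quot_cat C I) q r)"
        "H \<in> carrier (homs (quot_cat C I) r t)"
    obtain f where f: "f \<in> carrier (homs C p q)" "F = I p q +>\<^bsub>homs C p q\<^esub> f" using rep[OF FGH(1)] by blast
    obtain g where g: "g \<in> carrier (homs C q r)" "G = I q r +>\<^bsub>homs C q r\<^esub> g" using rep[OF FGH(2)] by blast
    obtain h where h: "h \<in> carrier (homs C r t)" "H = I r t +>\<^bsub>homs C r t\<^esub> h" using rep[OF FGH(3)] by blast
    show "comp_mor (quot_cat C I) p q t (comp_mor (quot_cat C I) q r t H G) F =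
        comp_mor (quot_cat C I) p r t H (comp_mor (quot_cat C I) p q r G F)"
      using obj f g h by (simp add: qc comp_closed comp_assoc)
  next
    fix p assume "p \<in> obj (quot_cat C I)"
    then show "ident (quot_cat C I) p \<in> carrier (homs (quot_cat C I) p p)"
      using coset[OF ident_closed] by simp
  qed
qed

section \<open>Mesh categories\<close>

locale mesh_category = K?: cring K + stable_translation_quiver \<Gamma> \<tau> \<sigma>
  for K :: "('k, 'r) ring_scheme" and \<Gamma> :: "('v, 'e) pre_digraph" and \<tau> and \<sigma>
begin

abbreviation "P \<equiv> path_cat K \<Gamma>"
abbreviation "I \<equiv> mesh_ideal K \<Gamma> \<tau> \<sigma>"
abbreviation "Q \<equiv> mesh_cat K \<Gamma> \<tau> \<sigma>"
abbreviation "\<alpha> \<equiv> arrow K \<Gamma> \<tau> \<sigma>"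
abbreviation "V \<equiv> verts \<Gamma>"
abbreviation "t \<equiv> tail \<Gamma>"
abbreviation "In \<equiv> in_arcs \<Gamma>"

lemma path_linear: "linear_category K P"
  by (rule linear_category_path_cat[OF K.cring_axioms wf_digraph_axioms])

lemma tau_closed: "q \<in> V \<Longrightarrow> \<tau> q \<in> V"
  using bij_tau by (rule bij_betwE[THEN bspec])

lemma sigma_closed: "a \<in> arcs \<Gamma> \<Longrightarrow> \<sigma> a \<in> arcs \<Gamma>"
  using bij_sigma by (rule bij_betwE[THEN bspec])

lemma in_arcD: "a \<in> In q \<Longrightarrow> a \<in> arcs \<Gamma> \<and> head \<Gamma> a = q \<and> t a \<in> V \<and> q \<in> V"
  using tail_in_verts head_in_verts by (auto simp: in_arcs_def)

lemma awalk_arc: "a \<in> arcs \<Gamma> \<Longrightarrow> awalk (t a) [a] (head \<Gamma> a)"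
  by (rule arc_implies_awalk)

lemma sigma_arc:
  assumes "a \<in> In q"
  shows "\<sigma> a \<in> arcs \<Gamma>" "t (\<sigma> a) = \<tau> q" "head \<Gamma> (\<sigma> a) = t a"
  using in_arcD[OF assms] sigma_closed[of a] tail_sigma[of a] head_sigma[of a] by simp_all

lemma awalk_mesh:
  assumes "a \<in> In q"
  shows "awalk (\<tau> q) [\<sigma> a, a] q"
  using in_arcD[OF assms] sigma_arc[OF assms] by (simp add: awalk_Cons_iff awalk_Nil_iff)

lemma left_module_path: "left_module K (path_module K \<Gamma> p q)"
  by (rule left_module_path_module[OF K.cring_axioms])

lemma mesh_elt_closed: "mesh_elt K \<Gamma> \<tau> \<sigma> q \<in> carrier (path_module K \<Gamma> (\<tau> q) q)"
proof -
  interpret M: left_module K "path_module K \<Gamma> (\<tau> q) q" by (rule left_module_path)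
  show ?thesis
    unfolding mesh_elt_def
    by (intro M.M.finsum_closed funcsetI) (rule path_elt_closed[OF K.cring_axioms awalk_mesh])
qed

lemma mesh_ideal: "cat_ideal K P I"
  unfolding mesh_ideal_def
  by (rule cat_ideal_gen_cat_ideal[OF path_linear]) (use mesh_elt_closed in auto)

lemma mesh_elt_mem: "q \<in> V \<Longrightarrow> mesh_elt K \<Gamma> \<tau> \<sigma> q \<in> I (\<tau> q) q"
  unfolding mesh_ideal_def by (rule subsetD[OF gen_cat_ideal_incl]) (simp_all add: tau_closed)

sublocale Q: linear_category K Q
  unfolding mesh_cat_def by (rule linear_category_quot_cat[OF path_linear mesh_ideal])

lemma Q_simps [simp]:
  "obj Q = V" "homs Q p q = quot_module (path_module K \<Gamma> p q) (I p q)"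
  "ident Q p = I p p +>\<^bsub>path_module K \<Gamma> p p\<^esub> path_elt K []"
  by (simp_all add: mesh_cat_def)

lemma Q_mod: "p \<in> V \<Longrightarrow> q \<in> V \<Longrightarrow> left_module K (homs Q p q)"
  by (rule Q.hom_mod) (simp_all del: Q_simps(2,3))

text \<open>From here on the hom modules and identities of Q stay opaque to the simplifier, so that
  calculations use the axioms of a linear category and not cosets of combinations of paths.\<close>

lemmas Q_simps(2,3) [simp del]

lemmas I_submodule = cat_ideal_submodule[OF mesh_ideal, unfolded path_cat_simps]

lemma coset_hom:
  "p \<in> V \<Longrightarrow> q \<in> V \<Longrightarrow> (\<lambda>f. I p q +>\<^bsub>path_module K \<Gamma> p q\<^esub> f) \<in> lmod_hom K (path_module K \<Gamma> p q) (homs Q p q)"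
  unfolding Q_simps(2) by (rule coset_lmod_hom[OF left_module_path I_submodule])

lemma coset_comp:
  "\<lbrakk>p \<in> V; q \<in> V; r \<in> V; f \<in> carrier (path_module K \<Gamma> p q); g \<in> carrier (path_module K \<Gamma> q r)\<rbrakk> \<Longrightarrow>
    comp_mor Q p q r (I q r +>\<^bsub>path_module K \<Gamma> q r\<^esub> g) (I p q +>\<^bsub>path_module K \<Gamma> p q\<^esub> f) =
    I p r +>\<^bsub>path_module K \<Gamma> p r\<^esub> comp_mor P p q r g f"
  using quot_cat_comp[OF path_linear mesh_ideal, of p q r f g] by (simp add: mesh_cat_def)

lemma arrow_closed: "a \<in> arcs \<Gamma> \<Longrightarrow> \<alpha> a \<in> carrier (homs Q (t a) (head \<Gamma> a))"
  unfolding arrow_def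
  by (rule lmod_hom_closed[OF coset_hom path_elt_closed[OF K.cring_axioms awalk_arc]]) simp_all

lemma arrow_in:
  assumes "a \<in> In q"
  shows "\<alpha> a \<in> carrier (homs Q (t a) q)"
  using arrow_closed[of a] in_arcD[OF assms] by simp

lemma arrow_sigma:
  assumes "a \<in> In q"
  shows "\<alpha> (\<sigma> a) \<in> carrier (homs Q (\<tau> q) (t a))"
  using arrow_closed[of "\<sigma> a"] sigma_arc[OF assms] by simp

lemma comp_arrow_closed:
  assumes "a \<in> In q" "p \<in> V" "u \<in> carrier (homs Q p (t a))"
  shows "comp_mor Q p (t a) q (\<alpha> a) u \<in> carrier (homs Q p q)"
  by (rule Q.comp_closed) (use in_arcD[OF assms(1)] arrow_in[OF assms(1)] assms(2,3) in simp_all)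

text \<open>The coset map is additive, so the sum is the class of \<open>mesh_elt\<close>, a
  generator of the mesh ideal. This is what makes the mesh sequence of every functor a
  complex.\<close>

lemma mesh_relation:
  assumes q: "q \<in> V"
  shows "(\<Oplus>\<^bsub>homs Q (\<tau> q) q\<^esub>a\<in>In q. comp_mor Q (\<tau> q) (t a) q (\<alpha> a) (\<alpha> (\<sigma> a))) = \<zero>\<^bsub>homs Q (\<tau> q) q\<^esub>"
proof -
  let ?M = "path_module K \<Gamma> (\<tau> q) q"
  note tq = tau_closed[OF q]
  interpret H: left_module K "homs Q (\<tau> q) q" by (rule Q_mod[OF tq q])
  have e: "path_elt K [\<sigma> a, a] \<in> carrier ?M" if "a \<in> In q" for a
    by (rule path_elt_closed[OF K.cring_axioms awalk_mesh[OF that]])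
  have c: "comp_mor Q (\<tau> q) (t a) q (\<alpha> a) (\<alpha> (\<sigma> a)) = I (\<tau> q) q +>\<^bsub>?M\<^esub> path_elt K [\<sigma> a, a]"
    if a: "a \<in> In q" for a
  proof -
    have *: "a \<in> arcs \<Gamma>" "head \<Gamma> a = q" "t a \<in> V" "\<sigma> a \<in> arcs \<Gamma>" "t (\<sigma> a) = \<tau> q" "head \<Gamma> (\<sigma> a) = t a"
      using in_arcD[OF a] sigma_arc[OF a] by simp_all
    show ?thesis
      using coset_comp[OF tq *(3) q, of "path_elt K [\<sigma> a]" "path_elt K [a]"]
        path_elt_closed[OF K.cring_axioms awalk_arc[OF *(1)]]
        path_elt_closed[OF K.cring_axioms awalk_arc[OF *(4)]]
        path_comp_elt[OF K.cring_axioms, of \<Gamma> "\<tau> q" "t a" q "[a]" "[\<sigma> a]"]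
      by (simp add: arrow_def *)
  qed
  have "(\<Oplus>\<^bsub>homs Q (\<tau> q) q\<^esub>a\<in>In q. comp_mor Q (\<tau> q) (t a) q (\<alpha> a) (\<alpha> (\<sigma> a))) =
      (\<Oplus>\<^bsub>homs Q (\<tau> q) q\<^esub>a\<in>In q. I (\<tau> q) q +>\<^bsub>?M\<^esub> path_elt K [\<sigma> a, a])"
    by (rule H.M.finsum_cong') (use c lmod_hom_closed[OF coset_hom[OF tq q] e] in auto)
  also have "\<dots> = I (\<tau> q) q +>\<^bsub>?M\<^esub> mesh_elt K \<Gamma> \<tau> \<sigma> q"
    unfolding mesh_elt_def
    by (rule lmod_hom_finsum[OF left_module_path H.left_module_axioms coset_hom[OF tq q], symmetric])
      (use e in auto)
  also have "\<dots> = I (\<tau> q) q"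
    using quot_module_coset_eq_zero_iff[OF left_module_path I_submodule[OF tq q] mesh_elt_closed]
      mesh_elt_mem[OF q] by simp
  finally show ?thesis by (simp add: Q_simps(2))
qed

section \<open>The mesh complex of a functor\<close>

lemma X_mod:
  fixes A :: "('a, 's) ring_scheme"
  shows "linear_functor K Q A \<iota> X \<Longrightarrow> p \<in> V \<Longrightarrow> left_module A (fob X p)"
  by (rule functor_mod[where C = Q]) (unfold Q_simps(1))

lemma X_mod_tail:
  fixes A :: "('a, 's) ring_scheme"
  shows "linear_functor K Q A \<iota> X \<Longrightarrow> a \<in> In q \<Longrightarrow> left_module A (fob X (t a))"
  by (rule X_mod) (use in_arcD in blast)+

lemma at_arrow_hom:
  fixes A :: "('a, 's) ring_scheme"
  assumes X: "linear_functor K Q A \<iota> X" and a: "a \<in> In q"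
  shows "at_arrow K \<Gamma> \<tau> \<sigma> X a \<in> lmod_hom A (fob X (t a)) (fob X q)"
  using functor_hom[OF X, of "t a" q "\<alpha> a"] arrow_in[OF a] in_arcD[OF a] by (simp add: at_arrow_def)

lemma at_sigma_hom:
  fixes A :: "('a, 's) ring_scheme"
  assumes X: "linear_functor K Q A \<iota> X" and a: "a \<in> In q"
  shows "at_arrow K \<Gamma> \<tau> \<sigma> X (\<sigma> a) \<in> lmod_hom A (fob X (\<tau> q)) (fob X (t a))"
  using functor_hom[OF X, of "\<tau> q" "t a" "\<alpha> (\<sigma> a)"] arrow_sigma[OF a] in_arcD[OF a]
    tau_closed[of q] sigma_arc[OF a] by (simp add: at_arrow_def)

lemma mesh_complex:
  fixes A :: "('a, 's) ring_scheme"
  assumes X: "linear_functor K Q A \<iota> X" and A: "ring A" and q: "q \<in> V"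
  shows "three_term_complex A (fob X (\<tau> q)) (mesh_in K \<Gamma> \<tau> \<sigma> q X) (mesh_middle \<Gamma> q X)
    (mesh_out K \<Gamma> \<tau> \<sigma> q X) (fob X q)"
proof -
  interpret A: ring A by (rule A)
  note X_mod = X_mod[OF X] and M = X_mod_tail[OF X]
  interpret Xq: left_module A "fob X q" by (rule X_mod[OF q])
  note tq = tau_closed[OF q]
  note Xa = at_arrow_hom[OF X] and X\<sigma> = at_sigma_hom[OF X]
  have in_hom: "mesh_in K \<Gamma> \<tau> \<sigma> q X \<in> lmod_hom A (fob X (\<tau> q)) (mesh_middle \<Gamma> q X)"
    unfolding mesh_middle_def mesh_in_def[abs_def]
    by (rule direct_sum_tuple_hom[OF finite_in_arcs[OF q] X\<sigma>])
  have out_hom: "mesh_out K \<Gamma> \<tau> \<sigma> q X \<in> lmod_hom A (mesh_middle \<Gamma> q X) (fob X q)"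
    unfolding mesh_out_def mesh_middle_def
    by (rule lmod_hom_finsum_pointwise[OF Xq.left_module_axioms])
      (rule lmod_hom_comp[OF Xa direct_sum_proj_lmod_hom[where M = "\<lambda>a. fob X (t a)"]])
  have zero: "mesh_out K \<Gamma> \<tau> \<sigma> q X (mesh_in K \<Gamma> \<tau> \<sigma> q X x) = \<zero>\<^bsub>fob X q\<^esub>" if x: "x \<in> carrier (fob X (\<tau> q))" for x
  proof -
    let ?c = "\<lambda>a. comp_mor Q (\<tau> q) (t a) q (\<alpha> a) (\<alpha> (\<sigma> a))"
    have c: "?c a \<in> carrier (homs Q (\<tau> q) q)" if a: "a \<in> In q" for a
      by (rule comp_arrow_closed[OF a tq arrow_sigma[OF a]])
    have obj: "\<tau> q \<in> obj Q" "q \<in> obj Q" using tq q by simp_all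
    note ad = functor_additive[OF X obj x]
    note ads = additive_hom_simps[OF left_module_abelian_group[OF Q_mod[OF tq q]]
        left_module_abelian_group[OF X_mod[OF q]] ad]
    \<comment> \<open>By functoriality and additivity in the morphism, the composite of the two maps
      is the value of X at the mesh relation.\<close>
    have "mesh_out K \<Gamma> \<tau> \<sigma> q X (mesh_in K \<Gamma> \<tau> \<sigma> q X x) = (\<Oplus>\<^bsub>fob X q\<^esub>a\<in>In q. fmor X (\<tau> q) q (?c a) x)"
      unfolding mesh_out_def
    proof (rule Xq.M.finsum_cong')
      show "(\<lambda>a. fmor X (\<tau> q) q (?c a) x) \<in> In q \<rightarrow> carrier (fob X q)"
        by (rule funcsetI) (rule ads(1)[OF c])
      fix a assume a: "a \<in> In q"
      show "at_arrow K \<Gamma> \<tau> \<sigma> X a (mesh_in K \<Gamma> \<tau> \<sigma> q X x a) = fmor X (\<tau> q) q (?c a) x"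
        using functor_comp[OF X, of "\<tau> q" "t a" q "\<alpha> (\<sigma> a)" "\<alpha> a" x] arrow_in[OF a] arrow_sigma[OF a]
          in_arcD[OF a] tq x sigma_arc[OF a] a
        by (simp add: at_arrow_def mesh_in_def)
    qed (rule refl)
    also have "\<dots> = fmor X (\<tau> q) q (\<Oplus>\<^bsub>homs Q (\<tau> q) q\<^esub>a\<in>In q. ?c a) x"
      by (rule ads(6)[symmetric]) (rule funcsetI, rule c)
    also have "\<dots> = \<zero>\<^bsub>fob X q\<^esub>" unfolding mesh_relation[OF q] by (rule ads(3))
    finally show ?thesis .
  qed
  show ?thesis
    by (intro three_term_complex.intro X_mod tq q in_hom out_hom zero)
      (unfold mesh_middle_def, rule left_module_direct_sum[OF A M])
qed

lemma mesh_middle_mod: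
  fixes A :: "('a, 's) ring_scheme"
  assumes "linear_functor K Q A \<iota> X" "ring A"
  shows "left_module A (mesh_middle \<Gamma> q X)"
  unfolding mesh_middle_def by (rule left_module_direct_sum[OF assms(2) X_mod_tail[OF assms(1)]])

lemma incl_hom:
  fixes A :: "('a, 's) ring_scheme"
  assumes "linear_functor K Q A \<iota> X" "ring A" "a \<in> In q"
  shows "direct_sum_incl (In q) (\<lambda>b. fob X (t b)) a \<in> lmod_hom A (fob X (t a)) (mesh_middle \<Gamma> q X)"
  unfolding mesh_middle_def
  by (rule direct_sum_incl_lmod_hom[where M = "\<lambda>b. fob X (t b)", OF assms(2) X_mod_tail[OF assms(1)] assms(3)])

lemma mesh_out_incl:
  fixes A :: "('a, 's) ring_scheme"
  assumes X: "linear_functor K Q A \<iota> X" and A: "ring A" and a: "a \<in> In q" and x: "x \<in> carrier (fob X (t a))"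
  shows "mesh_out K \<Gamma> \<tau> \<sigma> q X (direct_sum_incl (In q) (\<lambda>b. fob X (t b)) a x) = at_arrow K \<Gamma> \<tau> \<sigma> X a x"
proof -
  have q: "q \<in> V" using in_arcD[OF a] by simp
  let ?s = "direct_sum_incl (In q) (\<lambda>b. fob X (t b)) a x"
  note mods = X_mod[OF X q] X_mod_tail[OF X] at_arrow_hom[OF X]
  have s: "?s \<in> carrier (direct_sum (In q) (\<lambda>b. fob X (t b)))"
    using lmod_hom_closed[OF incl_hom[OF X A a] x] by (simp only: mesh_middle_def)
  have "mesh_out K \<Gamma> \<tau> \<sigma> q X ?s =
      direct_sum_ext (fob X q) (In q) (\<lambda>b. fob X (t b)) (at_arrow K \<Gamma> \<tau> \<sigma> X) ?s"
    unfolding mesh_out_def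
    by (rule direct_sum_ext_finite[OF mods s finite_in_arcs[OF q], symmetric])
  also have "\<dots> = at_arrow K \<Gamma> \<tau> \<sigma> X a x"
    by (rule direct_sum_ext_incl[where M = "\<lambda>b. fob X (t b)", OF mods a x])
  finally show ?thesis .
qed

section \<open>Mesh complexes of representable functors and evaluation at an element\<close>

abbreviation "U \<equiv> hom_functor Q"

lemma U_functor: "p \<in> V \<Longrightarrow> linear_functor_to_base K Q (U p)"
  by (rule linear_functor_hom_functor[OF Q.linear_category_axioms]) simp

lemma U_complex: "p \<in> V \<Longrightarrow> q \<in> V \<Longrightarrow> three_term_complex K (homs Q p (\<tau> q)) (mesh_in K \<Gamma> \<tau> \<sigma> q (U p))
    (mesh_middle \<Gamma> q (U p)) (mesh_out K \<Gamma> \<tau> \<sigma> q (U p)) (homs Q p q)"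
  using mesh_complex[OF U_functor K.ring_axioms] by simp

lemma mesh_out_U:
  assumes "q \<in> V" "p \<in> V" and s: "s \<in> carrier (mesh_middle \<Gamma> q (U p))"
  shows "mesh_out K \<Gamma> \<tau> \<sigma> q (U p) s = (\<Oplus>\<^bsub>homs Q p q\<^esub>a\<in>In q. comp_mor Q p (t a) q (\<alpha> a) (s a))"
proof -
  interpret H: left_module K "homs Q p q" by (rule Q_mod[OF assms(2,1)])
  show ?thesis
    unfolding mesh_out_def hom_functor_simps
  proof (rule H.M.finsum_cong')
    show "(\<lambda>a. comp_mor Q p (t a) q (\<alpha> a) (s a)) \<in> In q \<rightarrow> carrier (homs Q p q)"
    proof (rule funcsetI)
      fix a assume a: "a \<in> In q"
      show "comp_mor Q p (t a) q (\<alpha> a) (s a) \<in> carrier (homs Q p q)"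
        using comp_arrow_closed[OF a assms(2)] direct_sum_memD[OF s[unfolded mesh_middle_def] a] by simp
    qed
    fix a assume "a \<in> In q"
    from in_arcD[OF this] show "at_arrow K \<Gamma> \<tau> \<sigma> (U p) a (s a) = comp_mor Q p (t a) q (\<alpha> a) (s a)"
      by (simp add: at_arrow_def)
  qed (rule refl)
qed

lemma U_middle_memD: "s \<in> carrier (mesh_middle \<Gamma> q (U p)) \<Longrightarrow> a \<in> In q \<Longrightarrow> s a \<in> carrier (homs Q p (t a))"
  unfolding mesh_middle_def by (drule direct_sum_memD) simp_all

text \<open>By the Yoneda lemma an element \<open>x\<close> of \<open>X(p)\<close> induces a map from the mesh complex of
  \<open>Q(p,-)\<close> to that of \<open>X\<close>; this is its middle component.\<close>

definition mesh_eval :: "'v \<Rightarrow> ('v, ('e list \<Rightarrow> 'k) set, 'a, 'x) modfun \<Rightarrow> 'v \<Rightarrow>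
    ('e \<Rightarrow> ('e list \<Rightarrow> 'k) set) \<Rightarrow> 'x \<Rightarrow> 'e \<Rightarrow> 'x" where
  "mesh_eval q X p s x = (\<lambda>a\<in>In q. fmor X p (t a) (s a) x)"

lemma mesh_eval_closed:
  fixes A :: "('a, 's) ring_scheme"
  assumes X: "linear_functor K Q A \<iota> X" and "p \<in> V" "q \<in> V" "s \<in> carrier (mesh_middle \<Gamma> q (U p))"
    "x \<in> carrier (fob X p)"
  shows "mesh_eval q X p s x \<in> carrier (mesh_middle \<Gamma> q X)"
  unfolding mesh_middle_def mesh_eval_def finite_direct_sum_mem[OF finite_in_arcs[OF assms(3)]]
proof (intro restrict_PiE_iff[THEN iffD2] ballI)
  fix a assume a: "a \<in> In q"
  show "fmor X p (t a) (s a) x \<in> carrier (fob X (t a))"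
    by (rule functor_closed[OF X]) (use assms(2,5) in_arcD[OF a] U_middle_memD[OF assms(4) a] in simp_all)
qed

text \<open>Functoriality moves the arrows inside \<open>fmor X\<close>, and additivity in the
  morphism moves the sum inside. For \<open>X\<close> representable this says that the last map of
  the mesh complex of Q(p,-) is natural in p, the variable along which the resolution lives.\<close>

lemma mesh_out_eval:
  fixes A :: "('a, 's) ring_scheme"
  assumes X: "linear_functor K Q A \<iota> X" and p: "p \<in> V" and q: "q \<in> V"
    and s: "s \<in> carrier (mesh_middle \<Gamma> q (U p))" and x: "x \<in> carrier (fob X p)"
  shows "mesh_out K \<Gamma> \<tau> \<sigma> q X (mesh_eval q X p s x) = fmor X p q (mesh_out K \<Gamma> \<tau> \<sigma> q (U p) s) x"
proof -
  have obj: "p \<in> obj Q" "q \<in> obj Q" using p q by simp_all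
  interpret Xq: left_module A "fob X q" by (rule X_mod[OF X q])
  note ads = additive_hom_simps[OF left_module_abelian_group[OF Q_mod[OF p q]]
      left_module_abelian_group[OF X_mod[OF X q]] functor_additive[OF X obj x]]
  note c = comp_arrow_closed[OF _ p U_middle_memD[OF s]]
  have "mesh_out K \<Gamma> \<tau> \<sigma> q X (mesh_eval q X p s x) =
      (\<Oplus>\<^bsub>fob X q\<^esub>a\<in>In q. fmor X p q (comp_mor Q p (t a) q (\<alpha> a) (s a)) x)"
    unfolding mesh_out_def
  proof (rule Xq.M.finsum_cong')
    show "(\<lambda>a. fmor X p q (comp_mor Q p (t a) q (\<alpha> a) (s a)) x) \<in> In q \<rightarrow> carrier (fob X q)"
      by (rule funcsetI) (rule ads(1)[OF c])
    fix a assume a: "a \<in> In q"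
    show "at_arrow K \<Gamma> \<tau> \<sigma> X a (mesh_eval q X p s x a) = fmor X p q (comp_mor Q p (t a) q (\<alpha> a) (s a)) x"
      using functor_comp[OF X, of p "t a" q "s a" "\<alpha> a" x] p x in_arcD[OF a] arrow_in[OF a]
        U_middle_memD[OF s a] a by (simp add: at_arrow_def mesh_eval_def)
  qed (rule refl)
  also have "\<dots> = fmor X p q (\<Oplus>\<^bsub>homs Q p q\<^esub>a\<in>In q. comp_mor Q p (t a) q (\<alpha> a) (s a)) x"
    by (rule ads(6)[symmetric]) (rule funcsetI, rule c)
  finally show ?thesis unfolding mesh_out_U[OF q p s] .
qed

text \<open>The analogue for the first map: evaluation is a map of complexes, and for
  \<open>X\<close> representable the first map is natural in the representing vertex. At an identity
  \<open>z\<close> it expresses \<open>mesh_in\<close> of any \<open>x\<close> through one universal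
  element, which serves below.\<close>

lemma mesh_in_eval:
  fixes A :: "('a, 's) ring_scheme"
  assumes X: "linear_functor K Q A \<iota> X" and p: "p \<in> V" and q: "q \<in> V"
    and z: "z \<in> carrier (homs Q p (\<tau> q))" and x: "x \<in> carrier (fob X p)"
  shows "mesh_in K \<Gamma> \<tau> \<sigma> q X (fmor X p (\<tau> q) z x) = mesh_eval q X p (mesh_in K \<Gamma> \<tau> \<sigma> q (U p) z) x"
  unfolding mesh_in_def mesh_eval_def
proof (rule restrict_ext)
  fix a assume a: "a \<in> In q"
  show "at_arrow K \<Gamma> \<tau> \<sigma> X (\<sigma> a) (fmor X p (\<tau> q) z x) =
      fmor X p (t a) ((\<lambda>a\<in>In q. at_arrow K \<Gamma> \<tau> \<sigma> (U p) (\<sigma> a) z) a) x"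
    using functor_comp[OF X, of p "\<tau> q" "t a" z "\<alpha> (\<sigma> a)" x] p x z in_arcD[OF a] sigma_arc[OF a]
      arrow_sigma[OF a] tau_closed[OF q] a by (simp add: at_arrow_def)
qed

lemma mesh_in_natural:
  fixes A :: "('a, 's) ring_scheme"
  assumes X: "linear_functor K Q A \<iota> X" and \<eta>: "nat_trans Q A X Y \<eta>" and q: "q \<in> V"
    and x: "x \<in> carrier (fob X (\<tau> q))"
  shows "(\<lambda>a\<in>In q. \<eta> (t a) (mesh_in K \<Gamma> \<tau> \<sigma> q X x a)) = mesh_in K \<Gamma> \<tau> \<sigma> q Y (\<eta> (\<tau> q) x)"
  unfolding mesh_in_def
proof (rule restrict_ext)
  fix a assume a: "a \<in> In q"
  show "\<eta> (t a) ((\<lambda>a\<in>In q. at_arrow K \<Gamma> \<tau> \<sigma> X (\<sigma> a) x) a) = at_arrow K \<Gamma> \<tau> \<sigma> Y (\<sigma> a) (\<eta> (\<tau> q) x)"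
    using nat_trans_naturality[OF \<eta>, of "\<tau> q" "t a" "\<alpha> (\<sigma> a)" x] x in_arcD[OF a] sigma_arc[OF a]
      arrow_sigma[OF a] tau_closed[OF q] a by (simp add: at_arrow_def)
qed

lemma mesh_out_natural:
  fixes A :: "('a, 's) ring_scheme"
  assumes X: "linear_functor K Q A \<iota> X" and Y: "linear_functor K Q A \<iota> Y"
    and \<eta>: "nat_trans Q A X Y \<eta>" and q: "q \<in> V" and s: "s \<in> carrier (mesh_middle \<Gamma> q X)"
  shows "mesh_out K \<Gamma> \<tau> \<sigma> q Y (\<lambda>a\<in>In q. \<eta> (t a) (s a)) = \<eta> q (mesh_out K \<Gamma> \<tau> \<sigma> q X s)"
proof -
  interpret Yq: left_module A "fob Y q" by (rule X_mod[OF Y q])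
  have \<eta>q: "\<eta> q \<in> lmod_hom A (fob X q) (fob Y q)" using nat_trans_hom[OF \<eta>] q by simp
  have c: "at_arrow K \<Gamma> \<tau> \<sigma> X a (s a) \<in> carrier (fob X q)" if a: "a \<in> In q" for a
    by (rule lmod_hom_closed[OF at_arrow_hom[OF X a] direct_sum_memD[OF s[unfolded mesh_middle_def] a]])
  have "mesh_out K \<Gamma> \<tau> \<sigma> q Y (\<lambda>a\<in>In q. \<eta> (t a) (s a)) = (\<Oplus>\<^bsub>fob Y q\<^esub>a\<in>In q. \<eta> q (at_arrow K \<Gamma> \<tau> \<sigma> X a (s a)))"
    unfolding mesh_out_def
  proof (rule Yq.M.finsum_cong')
    show "(\<lambda>a. \<eta> q (at_arrow K \<Gamma> \<tau> \<sigma> X a (s a))) \<in> In q \<rightarrow> carrier (fob Y q)"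
      by (rule funcsetI) (rule lmod_hom_closed[OF \<eta>q c])
    fix a assume a: "a \<in> In q"
    show "at_arrow K \<Gamma> \<tau> \<sigma> Y a ((\<lambda>a\<in>In q. \<eta> (t a) (s a)) a) = \<eta> q (at_arrow K \<Gamma> \<tau> \<sigma> X a (s a))"
      using nat_trans_naturality[OF \<eta>, of "t a" q "\<alpha> a" "s a"] in_arcD[OF a] arrow_in[OF a] a
        direct_sum_memD[OF s[unfolded mesh_middle_def] a] by (simp add: at_arrow_def)
  qed (rule refl)
  also have "\<dots> = \<eta> q (mesh_out K \<Gamma> \<tau> \<sigma> q X s)"
    unfolding mesh_out_def
    by (rule lmod_hom_finsum[OF X_mod[OF X q] X_mod[OF Y q] \<eta>q, symmetric]) (rule funcsetI, rule c)
  finally show ?thesis .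
qed

section \<open>The arrow ideal as the image of the last map of the mesh complex\<close>

definition arrow_span :: "'v \<Rightarrow> 'v \<Rightarrow> ('e list \<Rightarrow> 'k) set set" where
  "arrow_span p q = mesh_out K \<Gamma> \<tau> \<sigma> q (U p) ` carrier (mesh_middle \<Gamma> q (U p))"

lemma arrow_span_submodule: "p \<in> V \<Longrightarrow> q \<in> V \<Longrightarrow> submodule (arrow_span p q) K (homs Q p q)"
  unfolding arrow_span_def
  using three_term_complex.mods[OF U_complex] three_term_complex.g[OF U_complex]
  by (intro submodule_image)

lemma arrow_span_comp:
  assumes a: "a \<in> In q" and p: "p \<in> V" and u: "u \<in> carrier (homs Q p (t a))"
  shows "comp_mor Q p (t a) q (\<alpha> a) u \<in> arrow_span p q"
proof -
  let ?s = "direct_sum_incl (In q) (\<lambda>b. fob (U p) (t b)) a u"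
  have u': "u \<in> carrier (fob (U p) (t a))" using u by simp
  have "mesh_out K \<Gamma> \<tau> \<sigma> q (U p) ?s = comp_mor Q p (t a) q (\<alpha> a) u"
    unfolding mesh_out_incl[OF U_functor[OF p] K.ring_axioms a u'] using in_arcD[OF a]
    by (simp add: at_arrow_def)
  moreover have "?s \<in> carrier (mesh_middle \<Gamma> q (U p))"
    by (rule lmod_hom_closed[OF incl_hom[OF U_functor[OF p] K.ring_axioms a] u'])
  ultimately show ?thesis unfolding arrow_span_def using imageI by metis
qed

text \<open>The elements of the span are sums of morphisms whose last factor is an arrow. If
  \<open>w\<close> is nontrivial, its last arrow is the last factor of the composite; if
  \<open>w\<close> is trivial, the composite is \<open>f\<close> itself.\<close>

lemma comp_path_arrow_span:
  assumes "p \<in> V" "q \<in> V" "r \<in> V" and f: "f \<in> arrow_span p q" and w: "awalk q w r"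
  shows "comp_mor Q p q r (I q r +>\<^bsub>path_module K \<Gamma> q r\<^esub> path_elt K w) f \<in> arrow_span p r"
proof (cases w rule: rev_cases)
  case Nil
  then have qr: "q = r" using w by (simp add: awalk_Nil_iff)
  have f': "f \<in> carrier (homs Q p q)" using submodule_subset[OF arrow_span_submodule[OF assms(1,2)]] f by (rule subsetD)
  show ?thesis
    using Q.comp_ident_left[of p q f] f f' assms(1,2) qr Nil by (simp add: Q_simps(3))
next
  case (snoc v a)
  have f': "f \<in> carrier (homs Q p q)" using submodule_subset[OF arrow_span_submodule[OF assms(1,2)]] f by (rule subsetD)
  have wa: "awalk q v (t a)" "a \<in> arcs \<Gamma>" "head \<Gamma> a = r" "t a \<in> V"
    using w snoc by (auto simp: awalk_Cons_iff awalk_Nil_iff)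
  then have a: "a \<in> In r" by (simp add: in_arcs_def)
  let ?v = "I q (t a) +>\<^bsub>path_module K \<Gamma> q (t a)\<^esub> path_elt K v"
  note ve = path_elt_closed[OF K.cring_axioms wa(1)]
  note ae = path_elt_closed[OF K.cring_axioms awalk_arc[OF wa(2)], unfolded wa(3)]
  have v: "?v \<in> carrier (homs Q q (t a))" by (rule lmod_hom_closed[OF coset_hom[OF assms(2) wa(4)] ve])
  have "I q r +>\<^bsub>path_module K \<Gamma> q r\<^esub> path_elt K w = comp_mor Q q (t a) r (\<alpha> a) ?v"
    using coset_comp[OF assms(2) wa(4) assms(3) ve ae] wa(3) snoc
    by (simp add: arrow_def path_comp_elt[OF K.cring_axioms])
  then have "comp_mor Q p q r (I q r +>\<^bsub>path_module K \<Gamma> q r\<^esub> path_elt K w) f =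
      comp_mor Q p (t a) r (\<alpha> a) (comp_mor Q p q (t a) ?v f)"
    using Q.comp_assoc[of p q "t a" r f ?v "\<alpha> a"] assms(1-3) wa(4) f' v arrow_in[OF a] by simp
  also have "\<dots> \<in> arrow_span p r"
    by (rule arrow_span_comp[OF a assms(1)]) (use Q.comp_closed[of p q "t a" f ?v] assms wa(4) f' v in simp)
  finally show ?thesis .
qed

text \<open>Precomposition acts on the factors before the last arrow and so stays in the span.
  Postcomposition puts something after the last arrow; it is reduced to paths by linearity, and a
  path either is trivial or provides a new last arrow.\<close>

lemma arrow_span_ideal: "cat_ideal K Q arrow_span"
  unfolding cat_ideal_def Q_simps(1)
proof (intro conjI ballI)
  fix p q assume pq: "p \<in> V" "q \<in> V"
  note sm = arrow_span_submodule
  show "submodule (arrow_span p q) K (homs Q p q)" by (rule sm[OF pq])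
  fix r f g assume r: "r \<in> V"
  show "comp_mor Q p q r g f \<in> arrow_span p r"
    if f: "f \<in> arrow_span p q" and g: "g \<in> carrier (homs Q q r)"
  proof -
    have f': "f \<in> carrier (homs Q p q)" using submodule_subset[OF sm[OF pq]] f by (rule subsetD)
    obtain h where h: "h \<in> carrier (path_module K \<Gamma> q r)" and gh: "g = I q r +>\<^bsub>path_module K \<Gamma> q r\<^esub> h"
      using g unfolding Q_simps(2) quot_module_simps mem_a_rcosets by (elim bexE)
    let ?L = "\<lambda>h. comp_mor Q p q r (I q r +>\<^bsub>path_module K \<Gamma> q r\<^esub> h) f"
    have L: "?L \<in> lmod_hom K (path_module K \<Gamma> q r) (homs Q p r)"
      by (rule lmod_hom_comp[OF Q.comp_left coset_hom]) (use pq r f' in simp_all)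
    from K.cring_axioms h have "?L h \<in> arrow_span p r"
    proof (induction rule: path_module_induct)
      case zero
      show ?case
        using lmod_hom_zero[OF left_module_path Q_mod[OF pq(1) r] L] submodule_zero[OF sm[OF pq(1) r]] by simp
    next
      case (path c w)
      show ?case
        using lmod_hom_smult[OF L path(1) path_elt_closed[OF K.cring_axioms path(2)]]
          submodule_smult[OF sm[OF pq(1) r] path(1) comp_path_arrow_span[OF pq r f path(2)]] by simp
    next
      case (add u v)
      show ?case
        using lmod_hom_add[OF L add(1,2)] submodule_add[OF sm[OF pq(1) r] add(3,4)] by simp
    qed
    then show ?thesis using gh by simp
  qed
  show "comp_mor Q p q r g f \<in> arrow_span p r"
    if f: "f \<in> carrier (homs Q p q)" and g: "g \<in> arrow_span q r"
  proof -
    obtain s where s: "s \<in> carrier (mesh_middle \<Gamma> r (U q))" and gs: "g = mesh_out K \<Gamma> \<tau> \<sigma> r (U q) s"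
      using g unfolding arrow_span_def by (elim imageE)
    have f': "f \<in> carrier (fob (U p) q)" using f by simp
    \<comment> \<open>Precomposing with \<open>f\<close> is evaluation of the tuple \<open>s\<close>
      at \<open>f\<close>, viewed as an element of Q(p,-) at q.\<close>
    show ?thesis
      using mesh_out_eval[OF U_functor[OF pq(1)] pq(2) r s f']
        imageI[OF mesh_eval_closed[OF U_functor[OF pq(1)] pq(2) r s f'], of "mesh_out K \<Gamma> \<tau> \<sigma> r (U p)"]
      by (simp add: gs arrow_span_def)
  qed
qed

text \<open>An arrow is its own composite with an identity, so the span is an ideal that contains
  the generators of the arrow ideal.\<close>

lemma arrow_ideal_subset: "arrow_ideal K \<Gamma> \<tau> \<sigma> p q \<subseteq> arrow_span p q"
  unfolding arrow_ideal_def
proof (rule gen_cat_ideal_least[OF arrow_span_ideal], intro image_subsetI, elim CollectE conjE)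
  fix u v a assume a: "a \<in> arcs \<Gamma>" "t a = u" "head \<Gamma> a = v"
  then have u: "u \<in> V" and a': "a \<in> In v" using tail_in_verts by (auto simp: in_arcs_def)
  have "comp_mor Q u u v (\<alpha> a) (ident Q u) \<in> arrow_span u v"
    using arrow_span_comp[OF a' u, of "ident Q u"] Q.ident_closed[of u] u a(2) by simp
  then show "\<alpha> a \<in> arrow_span u v"
    using Q.comp_ident_right[of u v "\<alpha> a"] arrow_in[OF a'] a u in_arcD[OF a'] by simp
qed

lemma arrow_ideal_ideal: "cat_ideal K Q (arrow_ideal K \<Gamma> \<tau> \<sigma>)"
  unfolding arrow_ideal_def
  by (rule cat_ideal_gen_cat_ideal[OF Q.linear_category_axioms])
    (use arrow_closed in \<open>auto simp del: Q_simps(2)\<close>)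

end

section \<open>Comparison of a projective resolution with the mesh complex\<close>

locale mesh_resolution = mesh_category K \<Gamma> \<tau> \<sigma>
  for K :: "('k, 'r) ring_scheme" and \<Gamma> :: "('v, 'e) pre_digraph" and \<tau> and \<sigma> +
  fixes q :: 'v and R :: "nat \<Rightarrow> ('v, ('e list \<Rightarrow> 'k) set, 'k, 'm) modfun"
    and d :: "nat \<Rightarrow> 'v \<Rightarrow> 'm \<Rightarrow> 'm" and \<epsilon> :: "'v \<Rightarrow> 'm \<Rightarrow> ('e list \<Rightarrow> 'k) set set"
  assumes normal: "normal_quiver K \<Gamma> \<tau> \<sigma>" and q: "q \<in> V"
    and resolution: "projective_resolution K (opcat Q) (stalk K \<Gamma> \<tau> \<sigma> q) R d \<epsilon>"
begin

abbreviation "D \<equiv> opcat Q"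
abbreviation "J \<equiv> arrow_ideal K \<Gamma> \<tau> \<sigma>"
abbreviation "S \<equiv> stalk K \<Gamma> \<tau> \<sigma> q"
abbreviation "N p \<equiv> hom_functor D p"
abbreviation "F \<equiv> dsum_functor (In q) (\<lambda>a. N (t a))"
abbreviation "out p \<equiv> mesh_out K \<Gamma> \<tau> \<sigma> q (U p)"
abbreviation "inn p \<equiv> mesh_in K \<Gamma> \<tau> \<sigma> q (U p)"
abbreviation "incl p \<equiv> direct_sum_incl (In q) (\<lambda>a. homs Q p (t a))"

section \<open>The resolution, the stalk functor and the mesh complex as contravariant
  functors\<close>

lemma D_linear: "linear_category K D"
  by (rule linear_category_opcat[OF Q.linear_category_axioms])

lemma D_simps: "obj D = V" "homs D r s = homs Q s r" "comp_mor D p r s f g = comp_mor Q s r p g f"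
  by simp_all

lemma fob_N: "fob (N p) r = homs Q r p" "fmor (N p) r s f g = comp_mor Q s r p g f"
  by simp_all

lemma N_functor: "p \<in> V \<Longrightarrow> linear_functor_to_base K D (N p)"
  by (rule linear_functor_hom_functor[OF D_linear]) simp

lemma tail_V: "a \<in> In p \<Longrightarrow> t a \<in> V"
  using in_arcD by blast

lemma F_functor: "linear_functor_to_base K D F"
  by (rule linear_functor_dsum_functor[OF K.ring_axioms N_functor[OF tail_V]])

text \<open>The same module is read in two ways: as the value at p of a sum of contravariant
  representables, and as the middle term of the mesh complex of the covariant functor Q(p,-). The
  second reading is the one in which normality is stated.\<close>

lemma fob_F: "fob F p = mesh_middle \<Gamma> q (U p)"
  by (simp add: mesh_middle_def)

lemma fmor_F: "fmor F r p f s = mesh_eval q (U p) r s f"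
  by (simp add: mesh_eval_def)

lemma resD:
  shows res_proj: "projective K D (R n)"
    and res_nat: "nat_trans D K (R (Suc n)) (R n) (d n)"
    and aug_nat: "nat_trans D K (R 0) S \<epsilon>"
    and aug_surj: "p \<in> V \<Longrightarrow> \<epsilon> p ` carrier (fob (R 0) p) = carrier (fob S p)"
    and aug_exact: "p \<in> V \<Longrightarrow> d 0 p ` carrier (fob (R (Suc 0)) p) = a_kernel (fob (R 0) p) (fob S p) (\<epsilon> p)"
    and res_exact: "p \<in> V \<Longrightarrow> d (Suc n) p ` carrier (fob (R (Suc (Suc n))) p) =
      a_kernel (fob (R (Suc n)) p) (fob (R n) p) (d n p)"
  using resolution unfolding projective_resolution_def by (simp_all only: D_simps(1) One_nat_def)

lemma res_functor: "linear_functor_to_base K D (R n)"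
  using res_proj[of n] by (simp only: projective_def)

lemma R_mod: "p \<in> V \<Longrightarrow> left_module K (fob (R n) p)"
  by (rule functor_mod[OF res_functor]) (unfold D_simps)

lemma R_closed:
  "\<lbrakk>r \<in> V; p \<in> V; f \<in> carrier (homs Q p r); x \<in> carrier (fob (R n) r)\<rbrakk> \<Longrightarrow> fmor (R n) r p f x \<in> carrier (fob (R n) p)"
  by (rule functor_closed[OF res_functor]) (unfold D_simps)

lemma R_comp:
  "\<lbrakk>p \<in> V; r \<in> V; s \<in> V; f \<in> carrier (homs Q r p); g \<in> carrier (homs Q s r); x \<in> carrier (fob (R n) p)\<rbrakk>
    \<Longrightarrow> fmor (R n) p s (comp_mor Q s r p f g) x = fmor (R n) r s g (fmor (R n) p r f x)"
  using functor_comp[OF res_functor, of p r s f g x n] by (simp only: D_simps)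

lemma R_nat:
  "\<lbrakk>p \<in> V; r \<in> V; f \<in> carrier (homs Q r p); x \<in> carrier (fob (R (Suc n)) p)\<rbrakk>
    \<Longrightarrow> d n r (fmor (R (Suc n)) p r f x) = fmor (R n) p r f (d n p x)"
  using nat_trans_naturality[OF res_nat, of p r f x n] by (simp only: D_simps)

lemma d_hom: "p \<in> V \<Longrightarrow> d n p \<in> lmod_hom K (fob (R (Suc n)) p) (fob (R n) p)"
  by (rule nat_trans_hom[OF res_nat]) (unfold D_simps)

lemma d_closed: "p \<in> V \<Longrightarrow> x \<in> carrier (fob (R (Suc n)) p) \<Longrightarrow> d n p x \<in> carrier (fob (R n) p)"
  by (rule lmod_hom_closed[OF d_hom])

lemma d_d:
  assumes "p \<in> V" and x: "x \<in> carrier (fob (R (Suc (Suc n))) p)"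
  shows "d n p (d (Suc n) p x) = \<zero>\<^bsub>fob (R n) p\<^esub>"
  using imageI[OF x, of "d (Suc n) p"] unfolding res_exact[OF assms(1)] by (simp only: mem_a_kernel)

lemma aug_d:
  assumes "p \<in> V" and x: "x \<in> carrier (fob (R (Suc 0)) p)"
  shows "\<epsilon> p (d 0 p x) = \<zero>\<^bsub>fob S p\<^esub>"
  using imageI[OF x, of "d 0 p"] unfolding aug_exact[OF assms(1)] by (simp only: mem_a_kernel)

lemma J_submodule: "p \<in> V \<Longrightarrow> r \<in> V \<Longrightarrow> submodule (J p r) K (homs Q p r)"
  by (rule cat_ideal_submodule[OF arrow_ideal_ideal]) (unfold Q_simps(1))

lemma fob_S: "fob S p = quot_module (homs Q p q) (J p q)"
  by (simp add: stalk_def quot_functor_def)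

lemma S_mod: "p \<in> V \<Longrightarrow> left_module K (fob S p)"
  unfolding fob_S by (rule left_module_quot_module[OF Q_mod[OF _ q] J_submodule[OF _ q]])

abbreviation "cl p z \<equiv> J p q +>\<^bsub>homs Q p q\<^esub> z"

lemma cl_nat: "nat_trans D K (N q) S cl"
  unfolding nat_trans_def D_simps
proof (intro conjI ballI)
  fix p assume p: "p \<in> V"
  show "cl p \<in> lmod_hom K (fob (N q) p) (fob S p)"
    unfolding fob_S fob_N by (rule coset_lmod_hom[OF Q_mod[OF p q] J_submodule[OF p q]])
  fix r f z assume r: "r \<in> V" and f: "f \<in> carrier (homs Q r p)" and z: "z \<in> carrier (fob (N q) p)"
  have z': "z \<in> carrier (homs Q p q)" using z by simp
  have h: "(\<lambda>z. comp_mor Q r p q z f) \<in> lmod_hom K (homs Q p q) (homs Q r q)"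
    by (rule Q.comp_left) (use p q r f in simp_all)
  have "(\<lambda>z. comp_mor Q r p q z f) ` J p q \<subseteq> J r q"
    by (intro image_subsetI, rule cat_ideal_right[OF arrow_ideal_ideal]) (use p q r f in simp_all)
  then have "quot_map (homs Q r q) (J r q) (\<lambda>z. comp_mor Q r p q z f) (cl p z) = cl r (comp_mor Q r p q z f)"
    by (rule quot_map_apply[OF Q_mod[OF p q] J_submodule[OF p q] Q_mod[OF r q] J_submodule[OF r q] h _ z'])
  then show "cl r (fmor (N q) p r f z) = fmor S p r f (cl p z)"
    by (simp add: stalk_def quot_functor_def hom_functor_def opcat_def)
qed

text \<open>Exactness at Q(-,q): a morphism with zero class lies in the arrow ideal, hence is a sum
  of morphisms that end with an arrow into q.\<close>

lemma cl_eq_zero: "p \<in> V \<Longrightarrow> z \<in> carrier (homs Q p q) \<Longrightarrow> cl p z = \<zero>\<^bsub>fob S p\<^esub> \<Longrightarrow> z \<in> out p ` carrier (mesh_middle \<Gamma> q (U p))"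
  using quot_module_coset_eq_zero_iff[OF Q_mod[OF _ q] J_submodule[OF _ q]] subsetD[OF arrow_ideal_subset, of z p q]
  unfolding arrow_span_def by (simp add: fob_S)

lemma out_hom: "p \<in> V \<Longrightarrow> out p \<in> lmod_hom K (mesh_middle \<Gamma> q (U p)) (homs Q p q)"
  using three_term_complex.g[OF U_complex[OF _ q]] .

lemma inn_hom: "p \<in> V \<Longrightarrow> inn p \<in> lmod_hom K (homs Q p (\<tau> q)) (mesh_middle \<Gamma> q (U p))"
  using three_term_complex.f[OF U_complex[OF _ q]] .

lemma out_inn: "p \<in> V \<Longrightarrow> z \<in> carrier (homs Q p (\<tau> q)) \<Longrightarrow> out p (inn p z) = \<zero>\<^bsub>homs Q p q\<^esub>"
  using three_term_complex.gf[OF U_complex[OF _ q]] .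

lemma middle_mod: "p \<in> V \<Longrightarrow> left_module K (mesh_middle \<Gamma> q (U p))"
  by (rule mesh_middle_mod[OF U_functor K.ring_axioms])

text \<open>Normality at q for the functor Q(p,-). Since p is arbitrary, this is exactness of
  contravariant functors in the middle term \<open>F\<close>.\<close>

lemma inn_exact:
  assumes p: "p \<in> V" and s: "s \<in> carrier (mesh_middle \<Gamma> q (U p))" "out p s = \<zero>\<^bsub>homs Q p q\<^esub>"
  shows "s \<in> inn p ` carrier (homs Q p (\<tau> q))"
proof -
  interpret three_term_complex K "homs Q p (\<tau> q)" "inn p" "mesh_middle \<Gamma> q (U p)" "out p" "homs Q p q"
    by (rule U_complex[OF p q])
  show ?thesis
    by (rule homology_trivialD)
      (use normal p q s in \<open>simp_all add: normal_quiver_def mesh_homology_def Let_def mem_a_kernel\<close>)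
qed

lemma out_nat: "nat_trans D K F (N q) out"
  unfolding nat_trans_def D_simps fob_F fmor_F fob_N
  by (intro conjI ballI out_hom) (simp_all add: mesh_out_eval[OF U_functor _ q])

lemma inn_nat: "nat_trans D K (N (\<tau> q)) F inn"
  unfolding nat_trans_def D_simps fob_F fmor_F fob_N
  by (intro conjI ballI inn_hom) (simp_all add: mesh_in_eval[OF U_functor _ q, symmetric])

subsection \<open>The comparison maps\<close>

text \<open>An element of the stalk functor is by construction the class of a morphism, so the
  augmentation takes values in the image of \<open>cl\<close> and lifts.\<close>

lemma comparison_0:
  obtains f0 where "nat_trans D K (R 0) (N q) f0"
    "\<And>p x. p \<in> V \<Longrightarrow> x \<in> carrier (fob (R 0) p) \<Longrightarrow> cl p (f0 p x) = \<epsilon> p x"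
proof (rule projective_lift[OF D_linear res_proj N_functor[OF q] _ cl_nat aug_nat], unfold D_simps)
  show "left_module K (fob S p)" if "p \<in> V" for p by (rule S_mod[OF that])
  show "\<epsilon> p x \<in> cl p ` carrier (fob (N q) p)" if "p \<in> V" "x \<in> carrier (fob (R 0) p)" for p x
  proof -
    have "\<epsilon> p x \<in> carrier (fob S p)" using imageI[OF that(2), of "\<epsilon> p"] unfolding aug_surj[OF that(1)] .
    then show ?thesis unfolding fob_S fob_N quot_module_simps mem_a_rcosets by (elim bexE) (rule image_eqI)
  qed
qed (rule that)

text \<open>The class of \<open>f0 p (d 0 p x)\<close> is \<epsilon> of a boundary, hence zero; so
  this morphism is in the image of \<open>out\<close> and projectivity of \<open>R (Suc 0)\<close>
  gives the lift.\<close>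

lemma comparison_1:
  assumes f0: "nat_trans D K (R 0) (N q) f0"
    "\<And>p x. p \<in> V \<Longrightarrow> x \<in> carrier (fob (R 0) p) \<Longrightarrow> cl p (f0 p x) = \<epsilon> p x"
  obtains f1 where "nat_trans D K (R (Suc 0)) F f1"
    "\<And>p x. p \<in> V \<Longrightarrow> x \<in> carrier (fob (R (Suc 0)) p) \<Longrightarrow> out p (f1 p x) = f0 p (d 0 p x)"
proof (rule projective_lift[OF D_linear res_proj F_functor _ out_nat nat_trans_comp[OF res_nat[of 0] f0(1)]],
      unfold D_simps)
  show "left_module K (fob (N q) p)" if "p \<in> V" for p
    unfolding fob_N by (rule Q_mod[OF that q])
  show "f0 p (d 0 p x) \<in> out p ` carrier (fob F p)" if p: "p \<in> V" and x: "x \<in> carrier (fob (R (Suc 0)) p)" for p x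
  proof -
    note dx = d_closed[OF p x]
    have "f0 p (d 0 p x) \<in> carrier (homs Q p q)"
      using nat_trans_closed[OF f0(1) _ dx] p by (simp only: D_simps fob_N)
    then show ?thesis
      unfolding fob_F by (rule cl_eq_zero[OF p]) (simp only: f0(2)[OF p dx] aug_d[OF p x])
  qed
qed (rule that)

text \<open>Applying \<open>out\<close> to \<open>f1\<close> of a boundary gives \<open>f0\<close>
  of a twofold differential, which is zero; normality puts \<open>f1\<close> of the boundary into
  the image of \<open>inn\<close>.\<close>

lemma comparison_2:
  assumes f0: "nat_trans D K (R 0) (N q) f0" and f1: "nat_trans D K (R (Suc 0)) F f1"
    and f1_out: "\<And>p x. p \<in> V \<Longrightarrow> x \<in> carrier (fob (R (Suc 0)) p) \<Longrightarrow> out p (f1 p x) = f0 p (d 0 p x)"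
  obtains f2 where "nat_trans D K (R (Suc (Suc 0))) (N (\<tau> q)) f2"
    "\<And>p x. p \<in> V \<Longrightarrow> x \<in> carrier (fob (R (Suc (Suc 0))) p) \<Longrightarrow> inn p (f2 p x) = f1 p (d (Suc 0) p x)"
proof (rule projective_lift[OF D_linear res_proj N_functor[OF tau_closed[OF q]] _ inn_nat
      nat_trans_comp[OF res_nat[of "Suc 0"] f1]], unfold D_simps)
  show "left_module K (fob F p)" if "p \<in> V" for p
    unfolding fob_F by (rule middle_mod[OF that])
  show "f1 p (d (Suc 0) p x) \<in> inn p ` carrier (fob (N (\<tau> q)) p)"
    if p: "p \<in> V" and x: "x \<in> carrier (fob (R (Suc (Suc 0))) p)" for p x
  proof -
    note dx = d_closed[OF p x]
    have c: "f1 p (d (Suc 0) p x) \<in> carrier (mesh_middle \<Gamma> q (U p))"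
      using nat_trans_closed[OF f1 _ dx] p by (simp only: D_simps fob_F)
    have "f0 p \<in> lmod_hom K (fob (R 0) p) (homs Q p q)"
      using nat_trans_hom[OF f0, of p] p by (simp only: D_simps fob_N)
    then have "out p (f1 p (d (Suc 0) p x)) = \<zero>\<^bsub>homs Q p q\<^esub>"
      unfolding f1_out[OF p dx] d_d[OF p x] by (rule lmod_hom_zero[OF R_mod[OF p] Q_mod[OF p q]])
    then show ?thesis unfolding fob_N by (rule inn_exact[OF p c])
  qed
qed (rule that)

section \<open>Elements of the resolution that lift the identity of q and the arrows into q\<close>

lemma ident_closed: "p \<in> V \<Longrightarrow> ident Q p \<in> carrier (homs Q p p)"
  by (rule Q.ident_closed) (unfold Q_simps(1))

lemma ident_left: "p \<in> V \<Longrightarrow> r \<in> V \<Longrightarrow> z \<in> carrier (homs Q p r) \<Longrightarrow> comp_mor Q p r r (ident Q r) z = z"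
  by (rule Q.comp_ident_left) (unfold Q_simps(1))

lemma ident_right: "p \<in> V \<Longrightarrow> r \<in> V \<Longrightarrow> z \<in> carrier (homs Q p r) \<Longrightarrow> comp_mor Q p p r z (ident Q p) = z"
  by (rule Q.comp_ident_right) (unfold Q_simps(1))

lemma basis_0:
  obtains u0 where "u0 \<in> carrier (fob (R 0) q)" "\<epsilon> q u0 = cl q (ident Q q)"
proof -
  have "cl q (ident Q q) \<in> \<epsilon> q ` carrier (fob (R 0) q)"
    unfolding aug_surj[OF q] fob_S by (rule coset_mem_quot_module[OF ident_closed[OF q]])
  then show thesis using that by (elim imageE) simp
qed

text \<open>Two natural transformations out of Q(-,q) agree as soon as they agree at the identity.
  The left side is \<epsilon> after the map represented by \<open>u0\<close>, the right side is the
  class map.\<close>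

lemma aug_mor:
  assumes u0: "u0 \<in> carrier (fob (R 0) q)" "\<epsilon> q u0 = cl q (ident Q q)"
    and p: "p \<in> V" and z: "z \<in> carrier (homs Q p q)"
  shows "\<epsilon> p (fmor (R 0) q p z u0) = cl p z"
proof -
  have "\<epsilon> p (fmor (R 0) q p z u0) = fmor S q p z (cl q (ident Q q))"
    using nat_trans_naturality[OF aug_nat, of q p z u0] q p z u0 by (simp only: D_simps)
  also have "\<dots> = cl p (fmor (N q) q p z (ident Q q))"
    by (rule nat_trans_naturality[OF cl_nat, symmetric]; unfold D_simps fob_N) (rule q p z ident_closed)+
  also have "\<dots> = cl p z" unfolding fob_N ident_left[OF p q z] ..
  finally show ?thesis .
qed

text \<open>An arrow lies in the arrow ideal, so its class is zero. Hence the translate of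
  \<open>u0\<close> along it is killed by \<epsilon>, and exactness of the resolution makes it a
  boundary.\<close>

lemma basis_1:
  assumes u0: "u0 \<in> carrier (fob (R 0) q)" "\<epsilon> q u0 = cl q (ident Q q)" and a: "a \<in> In q"
  shows "\<exists>u\<in>carrier (fob (R (Suc 0)) (t a)). d 0 (t a) u = fmor (R 0) q (t a) (\<alpha> a) u0"
proof -
  note ta = tail_V[OF a]
  have "\<alpha> a \<in> J (t a) q"
  proof -
    have "\<alpha> a \<in> (\<lambda>p q. \<alpha> ` {a \<in> arcs \<Gamma>. t a = p \<and> head \<Gamma> a = q}) (t a) q"
      using in_arcD[OF a] by simp
    also have "\<dots> \<subseteq> J (t a) q"
      unfolding arrow_ideal_def by (rule gen_cat_ideal_incl) (use ta q in simp_all)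
    finally show ?thesis .
  qed
  then have "cl (t a) (\<alpha> a) = \<zero>\<^bsub>fob S (t a)\<^esub>"
    using quot_module_coset_eq_zero_iff[OF Q_mod[OF ta q] J_submodule[OF ta q] arrow_in[OF a]]
    by (simp add: fob_S)
  then have "fmor (R 0) q (t a) (\<alpha> a) u0 \<in> a_kernel (fob (R 0) (t a)) (fob S (t a)) (\<epsilon> (t a))"
    using aug_mor[OF u0 ta arrow_in[OF a]] R_closed[OF q ta arrow_in[OF a] u0(1)]
    by (simp only: mem_a_kernel)
  then show ?thesis unfolding aug_exact[OF ta, symmetric] by (elim imageE) (rule bexI, rule sym)
qed

end

text \<open>The maps \<open>f0, f1, f2\<close> form a chain map from the resolution to
  \<open>Q(-,\<tau>q) \<rightarrow> \<Oplus>\<^sub>a Q(-,t a) \<rightarrow> Q(-,q)\<close>; by the Yoneda lemma the elements \<open>u0\<close> and \<open>u a\<close> represent a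
  chain map in the other direction, called \<open>g0, g1\<close> below.\<close>

locale mesh_comparison = mesh_resolution K \<Gamma> \<tau> \<sigma> q R d \<epsilon>
  for K :: "('k, 'r) ring_scheme" and \<Gamma> :: "('v, 'e) pre_digraph" and \<tau> and \<sigma> and q :: 'v
    and R :: "nat \<Rightarrow> ('v, ('e list \<Rightarrow> 'k) set, 'k, 'm) modfun" and d and \<epsilon> +
  fixes f0 f1 f2 u0 u
  assumes f0_nat: "nat_trans D K (R 0) (N q) f0"
    and f0: "\<And>p x. p \<in> V \<Longrightarrow> x \<in> carrier (fob (R 0) p) \<Longrightarrow> cl p (f0 p x) = \<epsilon> p x"
    and f1_nat: "nat_trans D K (R (Suc 0)) F f1"
    and f1: "\<And>p x. p \<in> V \<Longrightarrow> x \<in> carrier (fob (R (Suc 0)) p) \<Longrightarrow> out p (f1 p x) = f0 p (d 0 p x)"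
    and f2_nat: "nat_trans D K (R (Suc (Suc 0))) (N (\<tau> q)) f2"
    and f2: "\<And>p x. p \<in> V \<Longrightarrow> x \<in> carrier (fob (R (Suc (Suc 0))) p) \<Longrightarrow>
      inn p (f2 p x) = f1 p (d (Suc 0) p x)"
    and u0: "u0 \<in> carrier (fob (R 0) q)" "\<epsilon> q u0 = cl q (ident Q q)"
    and u: "\<And>a. a \<in> In q \<Longrightarrow> u a \<in> carrier (fob (R (Suc 0)) (t a))"
    and du: "\<And>a. a \<in> In q \<Longrightarrow> d 0 (t a) (u a) = fmor (R 0) q (t a) (\<alpha> a) u0"
begin

section \<open>The chain map from the mesh complex to the resolution\<close>

lemma f_closed:
  assumes "p \<in> V"
  shows f0_closed: "x \<in> carrier (fob (R 0) p) \<Longrightarrow> f0 p x \<in> carrier (homs Q p q)"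
    and f1_closed: "x \<in> carrier (fob (R (Suc 0)) p) \<Longrightarrow> f1 p x \<in> carrier (mesh_middle \<Gamma> q (U p))"
    and f2_closed: "x \<in> carrier (fob (R (Suc (Suc 0))) p) \<Longrightarrow> f2 p x \<in> carrier (homs Q p (\<tau> q))"
  using assms nat_trans_closed[OF f0_nat, of p x] nat_trans_closed[OF f1_nat, of p x]
    nat_trans_closed[OF f2_nat, of p x]
  by (simp_all only: D_simps fob_N fob_F)

definition g0 where "g0 p z = fmor (R 0) q p z u0"

definition g1 where
  "g1 p s = direct_sum_ext (fob (R (Suc 0)) p) (In q) (\<lambda>a. fob (N (t a)) p)
     (\<lambda>a z. fmor (R (Suc 0)) (t a) p z (u a)) s"

lemma g0_nat: "nat_trans D K (N q) (R 0) g0"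
  unfolding g0_def[abs_def] by (rule yoneda_nat_trans[OF D_linear res_functor _ u0(1)]) (simp add: q)

lemma g0_hom: "p \<in> V \<Longrightarrow> g0 p \<in> lmod_hom K (homs Q p q) (fob (R 0) p)"
  using nat_trans_hom[OF g0_nat, of p] by (simp only: D_simps fob_N)

lemma u_nat: "a \<in> In q \<Longrightarrow> nat_trans D K (N (t a)) (R (Suc 0)) (\<lambda>p z. fmor (R (Suc 0)) (t a) p z (u a))"
  by (rule yoneda_nat_trans[OF D_linear res_functor _ u]) (simp_all only: D_simps tail_V)

lemma g1_nat: "nat_trans D K F (R (Suc 0)) g1"
  unfolding g1_def[abs_def]
  by (rule nat_trans_direct_sum_ext[OF K.ring_axioms N_functor[OF tail_V] res_functor u_nat])

lemma g1_hom: "p \<in> V \<Longrightarrow> g1 p \<in> lmod_hom K (mesh_middle \<Gamma> q (U p)) (fob (R (Suc 0)) p)"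
  using nat_trans_hom[OF g1_nat, of p] by (simp only: D_simps fob_F)

lemma N_mod: "p \<in> V \<Longrightarrow> a \<in> In q \<Longrightarrow> left_module K (fob (N (t a)) p)"
  unfolding fob_N by (rule Q_mod[OF _ tail_V])

lemma u_hom: "p \<in> V \<Longrightarrow> a \<in> In q \<Longrightarrow>
    (\<lambda>z. fmor (R (Suc 0)) (t a) p z (u a)) \<in> lmod_hom K (fob (N (t a)) p) (fob (R (Suc 0)) p)"
  using nat_trans_hom[OF u_nat, of a p] by (simp only: D_simps)

lemma middle_eq: "mesh_middle \<Gamma> q (U p) = direct_sum (In q) (\<lambda>a. fob (N (t a)) p)"
  by (simp add: mesh_middle_def)

lemma g1_sum:
  assumes "p \<in> V" "s \<in> carrier (mesh_middle \<Gamma> q (U p))"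
  shows "g1 p s = (\<Oplus>\<^bsub>fob (R (Suc 0)) p\<^esub>a\<in>In q. fmor (R (Suc 0)) (t a) p (s a) (u a))"
  unfolding g1_def
  by (rule direct_sum_ext_finite[OF R_mod[OF assms(1)] N_mod[OF assms(1)] u_hom[OF assms(1)]
        assms(2)[unfolded middle_eq] finite_in_arcs[OF q]])

lemma g1_incl:
  assumes "p \<in> V" "a \<in> In q" "z \<in> carrier (homs Q p (t a))"
  shows "g1 p (incl p a z) = fmor (R (Suc 0)) (t a) p z (u a)"
  using direct_sum_ext_incl[where M = "\<lambda>a. fob (N (t a)) p" and h = "\<lambda>a z. fmor (R (Suc 0)) (t a) p z (u a)",
      OF R_mod[OF assms(1)] N_mod[OF assms(1)] u_hom[OF assms(1)] assms(2), of z] assms(3)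
  by (simp add: g1_def)

lemma incl_closed:
  assumes "p \<in> V" "a \<in> In q" "z \<in> carrier (homs Q p (t a))"
  shows "incl p a z \<in> carrier (mesh_middle \<Gamma> q (U p))"
  using lmod_hom_closed[OF incl_hom[OF U_functor[OF assms(1)] K.ring_axioms assms(2)], of z] assms(3)
  by simp

lemma out_incl:
  assumes "p \<in> V" "a \<in> In q" "z \<in> carrier (homs Q p (t a))"
  shows "out p (incl p a z) = comp_mor Q p (t a) q (\<alpha> a) z"
  using mesh_out_incl[OF U_functor[OF assms(1)] K.ring_axioms assms(2), of z] assms(3) in_arcD[OF assms(2)]
  by (simp add: at_arrow_def)

text \<open>The maps \<open>g0\<close>, \<open>g1\<close> commute with the differentials. On the
  summand of an arrow this is the choice of \<open>u a\<close>: the differential of its translate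
  along z is the translate of \<open>u0\<close> along the arrow composed with z.\<close>

lemma d_g1:
  assumes p: "p \<in> V" and s: "s \<in> carrier (mesh_middle \<Gamma> q (U p))"
  shows "d 0 p (g1 p s) = g0 p (out p s)"
proof (rule direct_sum_hom_eq[where g = "\<lambda>s. d 0 p (g1 p s)" and h = "\<lambda>s. g0 p (out p s)"
      and M = "\<lambda>a. fob (N (t a)) p" and I = "In q", OF K.ring_axioms N_mod[OF p] R_mod[OF p]])
  show "(\<lambda>s. d 0 p (g1 p s)) \<in> lmod_hom K (direct_sum (In q) (\<lambda>a. fob (N (t a)) p)) (fob (R 0) p)"
    unfolding middle_eq[symmetric] by (rule lmod_hom_comp[OF d_hom[OF p] g1_hom[OF p]])
  show "(\<lambda>s. g0 p (out p s)) \<in> lmod_hom K (direct_sum (In q) (\<lambda>a. fob (N (t a)) p)) (fob (R 0) p)"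
    unfolding middle_eq[symmetric] by (rule lmod_hom_comp[OF g0_hom[OF p] out_hom[OF p]])
  show "s \<in> carrier (direct_sum (In q) (\<lambda>a. fob (N (t a)) p))" using s unfolding middle_eq .
  fix a z assume a: "a \<in> In q" and "z \<in> carrier (fob (N (t a)) p)"
  then have z: "z \<in> carrier (homs Q p (t a))" by simp
  show "d 0 p (g1 p (direct_sum_incl (In q) (\<lambda>a. fob (N (t a)) p) a z)) =
      g0 p (out p (direct_sum_incl (In q) (\<lambda>a. fob (N (t a)) p) a z))"
    unfolding fob_N g1_incl[OF p a z] out_incl[OF p a z] R_nat[OF tail_V[OF a] p z u[OF a]] du[OF a]
      R_comp[OF q tail_V[OF a] p arrow_in[OF a] z u0(1), symmetric] g0_def ..
qed

section \<open>The two homotopies\<close>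

lemma homotopy_0:
  obtains h0 where "nat_trans D K (R 0) (R (Suc 0)) h0"
    "\<And>p x. p \<in> V \<Longrightarrow> x \<in> carrier (fob (R 0) p) \<Longrightarrow> d 0 p (h0 p x) = g0 p (f0 p x) \<ominus>\<^bsub>fob (R 0) p\<^esub> x"
proof (rule projective_lift[OF D_linear res_proj res_functor _ res_nat[of 0]
      nat_trans_minus[OF res_functor nat_trans_comp[OF f0_nat g0_nat] nat_trans_id]], unfold D_simps)
  show "left_module K (fob (R 0) p)" if "p \<in> V" for p by (rule R_mod[OF that])
  show "g0 p (f0 p x) \<ominus>\<^bsub>fob (R 0) p\<^esub> x \<in> d 0 p ` carrier (fob (R (Suc 0)) p)"
    if p: "p \<in> V" and x: "x \<in> carrier (fob (R 0) p)" for p x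
  proof -
    interpret Rp: left_module K "fob (R 0) p" by (rule R_mod[OF p])
    interpret Sp: left_module K "fob S p" by (rule S_mod[OF p])
    have \<epsilon>: "\<epsilon> p \<in> lmod_hom K (fob (R 0) p) (fob S p)"
      using nat_trans_hom[OF aug_nat, of p] p by (simp only: D_simps)
    note gf = lmod_hom_closed[OF g0_hom[OF p] f0_closed[OF p x]]
    \<comment> \<open>Augmenting after \<open>g0\<close> gives the class in the stalk functor, and
      the class of \<open>f0 p x\<close> is \<open>\<epsilon> p x\<close>. The difference is
      therefore in the kernel of \<epsilon>, which is the image of the first differential.\<close>
    have "\<epsilon> p (g0 p (f0 p x) \<ominus>\<^bsub>fob (R 0) p\<^esub> x) = \<epsilon> p (g0 p (f0 p x)) \<ominus>\<^bsub>fob S p\<^esub> \<epsilon> p x"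
      by (rule lmod_hom_minus[OF Rp.left_module_axioms Sp.left_module_axioms \<epsilon> gf x])
    also have "\<epsilon> p (g0 p (f0 p x)) = \<epsilon> p x"
      unfolding g0_def aug_mor[OF u0 p f0_closed[OF p x]] by (rule f0[OF p x])
    also have "\<epsilon> p x \<ominus>\<^bsub>fob S p\<^esub> \<epsilon> p x = \<zero>\<^bsub>fob S p\<^esub>"
      using lmod_hom_closed[OF \<epsilon> x] by (simp only: Sp.M.minus_eq_zero_iff)
    finally show ?thesis
      unfolding aug_exact[OF p] mem_a_kernel using gf x by (intro conjI Rp.M.minus_closed)
  qed
qed (rule that)

text \<open>The differential of \<open>g1 p (f1 p x)\<close> minus \<open>x\<close> is
  \<open>g0 f0 - 1\<close> applied to \<open>d 0 p x\<close>. By the choice of \<open>h0\<close>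
  this is also the differential of \<open>h0 p (d 0 p x)\<close>, so the corrected difference is a
  cycle and can be lifted.\<close>

lemma homotopy_1:
  assumes h0_nat: "nat_trans D K (R 0) (R (Suc 0)) h0"
    and h0: "\<And>p x. p \<in> V \<Longrightarrow> x \<in> carrier (fob (R 0) p) \<Longrightarrow> d 0 p (h0 p x) = g0 p (f0 p x) \<ominus>\<^bsub>fob (R 0) p\<^esub> x"
  obtains h1 where "nat_trans D K (R (Suc 0)) (R (Suc (Suc 0))) h1"
    "\<And>p x. p \<in> V \<Longrightarrow> x \<in> carrier (fob (R (Suc 0)) p) \<Longrightarrow> d (Suc 0) p (h1 p x) =
      (g1 p (f1 p x) \<ominus>\<^bsub>fob (R (Suc 0)) p\<^esub> x) \<ominus>\<^bsub>fob (R (Suc 0)) p\<^esub> h0 p (d 0 p x)"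
proof (rule projective_lift[OF D_linear res_proj res_functor _ res_nat[of "Suc 0"]
      nat_trans_minus[OF res_functor nat_trans_minus[OF res_functor nat_trans_comp[OF f1_nat g1_nat] nat_trans_id]
        nat_trans_comp[OF res_nat[of 0] h0_nat]]], unfold D_simps)
  show "left_module K (fob (R (Suc 0)) p)" if "p \<in> V" for p by (rule R_mod[OF that])
  show "(g1 p (f1 p x) \<ominus>\<^bsub>fob (R (Suc 0)) p\<^esub> x) \<ominus>\<^bsub>fob (R (Suc 0)) p\<^esub> h0 p (d 0 p x)
      \<in> d (Suc 0) p ` carrier (fob (R (Suc (Suc 0))) p)"
    if p: "p \<in> V" and x: "x \<in> carrier (fob (R (Suc 0)) p)" for p x
  proof -
    interpret R0: left_module K "fob (R 0) p" by (rule R_mod[OF p])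
    interpret R1: left_module K "fob (R (Suc 0)) p" by (rule R_mod[OF p])
    note dm = lmod_hom_minus[OF R1.left_module_axioms R0.left_module_axioms d_hom[OF p]]
    note dx = d_closed[OF p x]
    have hdx: "h0 p (d 0 p x) \<in> carrier (fob (R (Suc 0)) p)"
      using nat_trans_closed[OF h0_nat, of p] p dx by (simp only: D_simps)
    note gf = lmod_hom_closed[OF g1_hom[OF p] f1_closed[OF p x]]
    note gfx = R1.M.minus_closed[OF gf x]
    have c: "d 0 p (g1 p (f1 p x)) \<ominus>\<^bsub>fob (R 0) p\<^esub> d 0 p x \<in> carrier (fob (R 0) p)"
      by (rule R0.M.minus_closed[OF d_closed[OF p gf] dx])
    have "d 0 p ((g1 p (f1 p x) \<ominus>\<^bsub>fob (R (Suc 0)) p\<^esub> x) \<ominus>\<^bsub>fob (R (Suc 0)) p\<^esub> h0 p (d 0 p x)) = \<zero>\<^bsub>fob (R 0) p\<^esub>"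
      unfolding dm[OF gfx hdx] dm[OF gf x] h0[OF p dx] d_g1[OF p f1_closed[OF p x]] f1[OF p x]
      using c[unfolded d_g1[OF p f1_closed[OF p x]] f1[OF p x]] by (simp only: R0.M.minus_eq_zero_iff)
    then show ?thesis
      unfolding res_exact[OF p] mem_a_kernel by (rule conjI[OF R1.M.minus_closed[OF gfx hdx]])
  qed
qed (rule that)

text \<open>The element \<open>v\<close> represents the next component of g, from Q(-,\<tau>q) to
  \<open>R 2\<close>; its differential is prescribed at the identity of \<tau>q. It exists because
  \<open>d 0\<close> after \<open>g1\<close> is \<open>g0\<close> after \<open>out\<close>, which
  kills the image of \<open>inn\<close>.\<close>

lemma basis_2:
  obtains v where "v \<in> carrier (fob (R (Suc (Suc 0))) (\<tau> q))"
    "d (Suc 0) (\<tau> q) v = g1 (\<tau> q) (inn (\<tau> q) (ident Q (\<tau> q)))"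
proof -
  note tq = tau_closed[OF q]
  note e = lmod_hom_closed[OF inn_hom[OF tq] ident_closed[OF tq]]
  have "d 0 (\<tau> q) (g1 (\<tau> q) (inn (\<tau> q) (ident Q (\<tau> q)))) = \<zero>\<^bsub>fob (R 0) (\<tau> q)\<^esub>"
    unfolding d_g1[OF tq e] out_inn[OF tq ident_closed[OF tq]]
    by (rule lmod_hom_zero[OF Q_mod[OF tq q] R_mod[OF tq] g0_hom[OF tq]])
  then have "g1 (\<tau> q) (inn (\<tau> q) (ident Q (\<tau> q))) \<in> d (Suc 0) (\<tau> q) ` carrier (fob (R (Suc (Suc 0))) (\<tau> q))"
    unfolding res_exact[OF tq] mem_a_kernel using lmod_hom_closed[OF g1_hom[OF tq] e] by (intro conjI)
  then show thesis using that by (elim imageE) simp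
qed

text \<open>The composite \<open>f0 g0\<close> is an endomorphism of Q(-,q), represented by
  \<open>f0 q u0\<close>. This has the class of the identity, so the difference lies in the image of
  \<open>out\<close>; \<open>s0\<close> represents the first component of the homotopy, from Q(-,q)
  to \<open>F\<close>.\<close>

lemma cohomotopy_0:
  obtains s0 where "s0 \<in> carrier (mesh_middle \<Gamma> q (U q))"
    "out q s0 = f0 q u0 \<ominus>\<^bsub>homs Q q q\<^esub> ident Q q"
proof -
  interpret H: left_module K "homs Q q q" by (rule Q_mod[OF q q])
  interpret Sq: left_module K "fob S q" by (rule S_mod[OF q])
  note c = f0_closed[OF q u0(1)] ident_closed[OF q]
  have cl: "cl q \<in> lmod_hom K (homs Q q q) (fob S q)"
    unfolding fob_S by (rule coset_lmod_hom[OF Q_mod[OF q q] J_submodule[OF q q]])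
  have "cl q (f0 q u0 \<ominus>\<^bsub>homs Q q q\<^esub> ident Q q) = \<zero>\<^bsub>fob S q\<^esub>"
    unfolding lmod_hom_minus[OF H.left_module_axioms Sq.left_module_axioms cl c] f0[OF q u0(1)] u0(2)
    using lmod_hom_closed[OF cl c(2)] by (simp only: Sq.M.minus_eq_zero_iff)
  then have "f0 q u0 \<ominus>\<^bsub>homs Q q q\<^esub> ident Q q \<in> out q ` carrier (mesh_middle \<Gamma> q (U q))"
    by (rule cl_eq_zero[OF q H.M.minus_closed[OF c]])
  then show thesis using that by (elim imageE) simp
qed

text \<open>The formula \<open>f1 g1 = 1 + s0 out + inn s1\<close> at the basis element of
  \<open>F\<close> given by \<open>a\<close> and the identity of its tail: \<open>out\<close> sends
  it to the arrow, at which \<open>s0\<close> is evaluated. Applying \<open>out\<close> to the first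
  map minus the first two terms gives zero, and normality provides \<open>z\<close>, the component
  of \<open>s1\<close> at \<open>a\<close>.\<close>

lemma cohomotopy_1:
  assumes s0: "s0 \<in> carrier (mesh_middle \<Gamma> q (U q))" "out q s0 = f0 q u0 \<ominus>\<^bsub>homs Q q q\<^esub> ident Q q"
    and a: "a \<in> In q"
  shows "\<exists>z\<in>carrier (homs Q (t a) (\<tau> q)). f1 (t a) (u a) = incl (t a) a (ident Q (t a))
    \<oplus>\<^bsub>mesh_middle \<Gamma> q (U (t a))\<^esub> mesh_eval q (U (t a)) q s0 (\<alpha> a) \<oplus>\<^bsub>mesh_middle \<Gamma> q (U (t a))\<^esub> inn (t a) z"
proof -
  note ta = tail_V[OF a] and \<alpha> = arrow_in[OF a]
  let ?M = "mesh_middle \<Gamma> q (U (t a))"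
  interpret M: left_module K ?M by (rule middle_mod[OF ta])
  interpret H: left_module K "homs Q (t a) q" by (rule Q_mod[OF ta q])
  have \<alpha>': "\<alpha> a \<in> carrier (fob (U (t a)) q)" using \<alpha> by simp
  let ?y = "f1 (t a) (u a)" and ?i = "incl (t a) a (ident Q (t a))"
    and ?s = "mesh_eval q (U (t a)) q s0 (\<alpha> a)"
  note y = f1_closed[OF ta u[OF a]] and i = incl_closed[OF ta a ident_closed[OF ta]]
    and s = mesh_eval_closed[OF U_functor[OF ta] q q s0(1) \<alpha>']
  note om = lmod_hom_minus[OF M.left_module_axioms H.left_module_axioms out_hom[OF ta]]
  have fu: "f0 q u0 \<in> carrier (homs Q q q)" by (rule f0_closed[OF q u0(1)])
  have "out (t a) ?y = comp_mor Q (t a) q q (f0 q u0) (\<alpha> a)"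
    unfolding f1[OF ta u[OF a]] du[OF a]
    using nat_trans_naturality[OF f0_nat, of q "t a" "\<alpha> a" u0] q ta \<alpha> u0(1) by (simp only: D_simps fob_N)
  moreover have "out (t a) ?i = \<alpha> a"
    unfolding out_incl[OF ta a ident_closed[OF ta]] by (rule ident_right[OF ta q \<alpha>])
  moreover have "out (t a) ?s = comp_mor Q (t a) q q (f0 q u0) (\<alpha> a) \<ominus>\<^bsub>homs Q (t a) q\<^esub> \<alpha> a"
  proof -
    have "(\<lambda>z. comp_mor Q (t a) q q z (\<alpha> a)) \<in> lmod_hom K (homs Q q q) (homs Q (t a) q)"
      by (rule Q.comp_left) (use ta q \<alpha> in simp_all)
    note cm = lmod_hom_minus[OF Q_mod[OF q q] H.left_module_axioms this fu ident_closed[OF q]]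
    show ?thesis
      using mesh_out_eval[OF U_functor[OF ta] q q s0(1) \<alpha>'] cm ident_left[OF ta q \<alpha>] s0(2) by simp
  qed
  ultimately have "out (t a) ((?y \<ominus>\<^bsub>?M\<^esub> ?i) \<ominus>\<^bsub>?M\<^esub> ?s) = \<zero>\<^bsub>homs Q (t a) q\<^esub>"
    using om[OF M.M.minus_closed[OF y i] s] om[OF y i] lmod_hom_closed[OF out_hom[OF ta] s]
    by (simp add: H.M.minus_eq_zero_iff)
  then have "(?y \<ominus>\<^bsub>?M\<^esub> ?i) \<ominus>\<^bsub>?M\<^esub> ?s \<in> inn (t a) ` carrier (homs Q (t a) (\<tau> q))"
    by (rule inn_exact[OF ta M.M.minus_closed[OF M.M.minus_closed[OF y i] s]])
  then obtain z where z: "z \<in> carrier (homs Q (t a) (\<tau> q))" "(?y \<ominus>\<^bsub>?M\<^esub> ?i) \<ominus>\<^bsub>?M\<^esub> ?s = inn (t a) z"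
    by (elim imageE) (rule that)
  have "?i \<oplus>\<^bsub>?M\<^esub> ?s \<oplus>\<^bsub>?M\<^esub> ((?y \<ominus>\<^bsub>?M\<^esub> ?i) \<ominus>\<^bsub>?M\<^esub> ?s) = ((?y \<ominus>\<^bsub>?M\<^esub> ?i) \<ominus>\<^bsub>?M\<^esub> ?s \<oplus>\<^bsub>?M\<^esub> ?s) \<oplus>\<^bsub>?M\<^esub> ?i"
    using y i s M.M.minus_closed[OF y i] M.M.minus_closed[OF M.M.minus_closed[OF y i] s]
    by (simp add: M.M.a_ac)
  also have "\<dots> = ?y"
    unfolding M.M.minus_add_cancel[OF M.M.minus_closed[OF y i] s] by (rule M.M.minus_add_cancel[OF y i])
  finally show ?thesis using z by (intro bexI[OF _ z(1)]) simp
qed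

end

section \<open>The isomorphism\<close>

locale mesh_tor = mesh_comparison K \<Gamma> \<tau> \<sigma> q R d \<epsilon> f0 f1 f2 u0 u + ring_algebra K A \<iota>
  for K :: "('k, 'r) ring_scheme" and A :: "('a, 's) ring_scheme" and \<iota>
    and \<Gamma> :: "('v, 'e) pre_digraph" and \<tau> and \<sigma> and q :: 'v
    and R :: "nat \<Rightarrow> ('v, ('e list \<Rightarrow> 'k) set, 'k, 'm) modfun" and d and \<epsilon> and f0 f1 f2 u0 u
begin

abbreviation "X_functor X \<equiv> linear_functor K Q A \<iota> X"
abbreviation "T n X \<equiv> tensor_over K Q A \<iota> (R n) X"
abbreviation "te n X \<equiv> tensor_over_elt K Q A \<iota> (R n) X"
abbreviation "Dm n X \<equiv> tensor_over_map K Q A \<iota> (R n) X (d n) (\<lambda>p x. x)"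
abbreviation "MX X \<equiv> mesh_middle \<Gamma> q X"
abbreviation "minn X \<equiv> mesh_in K \<Gamma> \<tau> \<sigma> q X"
abbreviation "mout X \<equiv> mesh_out K \<Gamma> \<tau> \<sigma> q X"
abbreviation "inclX X \<equiv> direct_sum_incl (In q) (\<lambda>a. fob X (t a))"

section \<open>The complex that computes Tor\<close>

lemma tensor_functors: "X_functor X \<Longrightarrow> tensor_functors K A \<iota> Q (R n) X"
  by (intro tensor_functors.intro tensor_functors_axioms.intro ring_algebra_axioms
      Q.linear_category_axioms res_functor)

lemmas te_closed = tensor_functors.tens_closed[OF tensor_functors, unfolded Q_simps(1)]
  and te_add_left = tensor_functors.tens_add_left[OF tensor_functors, unfolded Q_simps(1)]
  and te_hom_right = tensor_functors.tens_hom_right[OF tensor_functors, unfolded Q_simps(1)]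
  and te_additive = tensor_functors.tens_additive_left[OF tensor_functors, unfolded Q_simps(1)]
  and te_slide = tensor_functors.tens_slide[OF tensor_functors, unfolded Q_simps(1)]
  and T_mod = tensor_functors.mod_T[OF tensor_functors]
  and T_hom_eq = tensor_functors.tensor_over_hom_eq[OF tensor_functors, unfolded Q_simps(1)]
  and T_universal = tensor_functors.tensor_over_universal[OF tensor_functors, unfolded Q_simps(1)]

lemma T_map:
  assumes "X_functor X" "nat_trans D K (R n) (R m) \<theta>"
  shows T_map_hom: "tensor_over_map K Q A \<iota> (R m) X \<theta> (\<lambda>p x. x) \<in> lmod_hom A (T n X) (T m X)"
    and T_map_elt: "p \<in> V \<Longrightarrow> w \<in> carrier (fob (R n) p) \<Longrightarrow> x \<in> carrier (fob X p) \<Longrightarrow>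
      tensor_over_map K Q A \<iota> (R m) X \<theta> (\<lambda>p x. x) (te n X p w x) = te m X p (\<theta> p w) x"
  using tensor_over_map_props[OF tensor_functors[OF assms(1)] tensor_functors[OF assms(1)] assms(2) nat_trans_id]
  by (simp_all only: Q_simps(1))

lemmas Dm_hom = T_map_hom[OF _ res_nat] and Dm_elt = T_map_elt[OF _ res_nat]

lemma te_zero:
  assumes "X_functor X" "p \<in> V" "x \<in> carrier (fob X p)"
  shows "te n X p \<zero>\<^bsub>fob (R n) p\<^esub> x = \<zero>\<^bsub>T n X\<^esub>"
  by (rule additive_hom_zero[OF left_module_abelian_group[OF R_mod[OF assms(2)]]
        left_module_abelian_group[OF T_mod[OF assms(1)]] te_additive[OF assms]])

lemma tor_complex:
  assumes X: "X_functor X"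
  shows "three_term_complex A (T (Suc (Suc 0)) X) (Dm (Suc 0) X) (T (Suc 0) X) (Dm 0 X) (T 0 X)"
proof (intro three_term_complex.intro T_mod[OF X] Dm_hom[OF X])
  fix y assume y: "y \<in> carrier (T (Suc (Suc 0)) X)"
  show "Dm 0 X (Dm (Suc 0) X y) = \<zero>\<^bsub>T 0 X\<^esub>"
    by (rule T_hom_eq[OF X T_mod[OF X] lmod_hom_comp[OF Dm_hom[OF X] Dm_hom[OF X]]
          zero_lmod_hom[OF T_mod[OF X]] _ y])
      (simp only: Dm_elt[OF X] d_closed d_d te_zero[OF X])
qed

text \<open>The composite of \<open>f \<otimes> X\<close> with the Yoneda isomorphism from
  \<open>Q(-,c) \<otimes> X\<close> to \<open>X(c)\<close>, built at once so that the tensor product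
  with a representable functor never has to be formed. Naturality of \<open>f\<close> gives the
  coend relation.\<close>

lemma eval_hom:
  assumes X: "X_functor X" and f: "nat_trans D K (R n) (N c) f" and c: "c \<in> V"
  obtains h where "h \<in> lmod_hom A (T n X) (fob X c)"
    "\<And>p w x. p \<in> V \<Longrightarrow> w \<in> carrier (fob (R n) p) \<Longrightarrow> x \<in> carrier (fob X p) \<Longrightarrow>
      h (te n X p w x) = fmor X p c (f p w) x"
proof (rule T_universal[where n = n and \<beta> = "\<lambda>p w x. fmor X p c (f p w) x", OF X X_mod[OF X c]])
  have f_hom: "f p \<in> lmod_hom K (fob (R n) p) (homs Q p c)" if "p \<in> V" for p
    using nat_trans_hom[OF f, of p] that by (simp only: D_simps fob_N)
  note f_closed = lmod_hom_closed[OF f_hom]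
  show "(\<lambda>w. fmor X p c (f p w) x) \<in> hom (add_monoid (fob (R n) p)) (add_monoid (fob X c))"
    if p: "p \<in> V" and x: "x \<in> carrier (fob X p)" for p x
    using hom_compose[OF lmod_hom_additive[OF f_hom[OF p]] functor_additive[OF X _ _ x, of c]] p c
    by (simp add: comp_def)
  show "(\<lambda>x. fmor X p c (f p w) x) \<in> lmod_hom A (fob X p) (fob X c)"
    if p: "p \<in> V" and w: "w \<in> carrier (fob (R n) p)" for p w
    using functor_hom[OF X, of p c "f p w"] p c f_closed[OF p w] by simp
  show "fmor X p c (f p (k \<odot>\<^bsub>fob (R n) p\<^esub> w)) x = \<iota> k \<odot>\<^bsub>fob X c\<^esub> fmor X p c (f p w) x"
    if "p \<in> V" "k \<in> carrier K" "w \<in> carrier (fob (R n) p)" "x \<in> carrier (fob X p)" for p k w x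
    unfolding lmod_hom_smult[OF f_hom[OF that(1)] that(2,3)]
    using functor_smult[OF X, of p c k "f p w" x] that c f_closed[OF that(1,3)] by simp
  show "fmor X p c (f p (fmor (R n) r p g w)) x = fmor X r c (f r w) (fmor X p r g x)"
    if "p \<in> V" "r \<in> V" "g \<in> carrier (homs Q p r)" "w \<in> carrier (fob (R n) r)" "x \<in> carrier (fob X p)"
    for p r g w x
  proof -
    have "f p (fmor (R n) r p g w) = comp_mor Q p r c (f r w) g"
      using nat_trans_naturality[OF f, of r p g w] that by (simp only: D_simps fob_N)
    then show ?thesis
      using functor_comp[OF X, of p r c g "f r w" x] that c f_closed[OF that(2,4)] by simp
  qed
qed (rule that)

section \<open>The map to the mesh complex and its inverse up to boundaries\<close>

lemma f1_component_nat:
  assumes "a \<in> In q"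
  shows "nat_trans D K (R (Suc 0)) (N (t a)) (\<lambda>p w. f1 p w a)"
proof (rule nat_trans_comp[OF f1_nat, where \<theta> = "\<lambda>p s. s a"])
  show "nat_trans D K F (N (t a)) (\<lambda>p s. s a)"
    unfolding nat_trans_def dsum_functor_simps
    using direct_sum_proj_lmod_hom[OF assms, of K "\<lambda>a. fob (N (t a)) _"] assms by simp
qed

text \<open>Each component of \<open>f1\<close> is a map into one representable functor and induces
  a map into \<open>X(tail a)\<close>. The components form a map into the direct sum because q is
  the target of finitely many arrows.\<close>

lemma Phi_exists:
  assumes X: "X_functor X"
  shows "\<exists>h. h \<in> lmod_hom A (T (Suc 0) X) (MX X) \<and>
    (\<forall>p w x. p \<in> V \<longrightarrow> w \<in> carrier (fob (R (Suc 0)) p) \<longrightarrow> x \<in> carrier (fob X p) \<longrightarrow>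
      h (te (Suc 0) X p w x) = mesh_eval q X p (f1 p w) x)"
proof -
  have "\<exists>h. h \<in> lmod_hom A (T (Suc 0) X) (fob X (t a)) \<and>
    (\<forall>p w x. p \<in> V \<longrightarrow> w \<in> carrier (fob (R (Suc 0)) p) \<longrightarrow> x \<in> carrier (fob X p) \<longrightarrow>
      h (te (Suc 0) X p w x) = fmor X p (t a) (f1 p w a) x)" if a: "a \<in> In q" for a
    by (rule eval_hom[OF X f1_component_nat[OF a] tail_V[OF a]]) (intro exI conjI allI impI)
  then obtain h where h: "\<And>a. a \<in> In q \<Longrightarrow> h a \<in> lmod_hom A (T (Suc 0) X) (fob X (t a))"
    and h_te: "\<And>a p w x. a \<in> In q \<Longrightarrow> p \<in> V \<Longrightarrow> w \<in> carrier (fob (R (Suc 0)) p) \<Longrightarrow> x \<in> carrier (fob X p) \<Longrightarrow>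
      h a (te (Suc 0) X p w x) = fmor X p (t a) (f1 p w a) x"
    by metis
  have "(\<lambda>z. \<lambda>a\<in>In q. h a z) \<in> lmod_hom A (T (Suc 0) X) (MX X)"
    unfolding mesh_middle_def by (rule direct_sum_tuple_hom[OF finite_in_arcs[OF q] h])
  moreover have "(\<lambda>a\<in>In q. h a (te (Suc 0) X p w x)) = mesh_eval q X p (f1 p w) x"
    if "p \<in> V" "w \<in> carrier (fob (R (Suc 0)) p)" "x \<in> carrier (fob X p)" for p w x
    unfolding mesh_eval_def by (rule restrict_ext) (rule h_te[OF _ that])
  ultimately show ?thesis by (intro exI[of _ "\<lambda>z. \<lambda>a\<in>In q. h a z"] conjI allI impI)
qed

text \<open>The choice is made separately for each \<open>X\<close>, but the values on the
  generating elements are prescribed by \<open>f1\<close>, which does not depend on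
  \<open>X\<close>. So \<open>Phi X\<close> is determined on its carrier, and naturality is not
  affected by the choice.\<close>

definition Phi :: "('v, ('e list \<Rightarrow> 'k) set, 'a, 'x) modfun \<Rightarrow>
    ('v \<Rightarrow> (('m \<times> 'x) \<Rightarrow>\<^sub>0 int) set) set \<Rightarrow> 'e \<Rightarrow> 'x" where
  "Phi X = (SOME h. h \<in> lmod_hom A (T (Suc 0) X) (MX X) \<and>
    (\<forall>p w x. p \<in> V \<longrightarrow> w \<in> carrier (fob (R (Suc 0)) p) \<longrightarrow> x \<in> carrier (fob X p) \<longrightarrow>
      h (te (Suc 0) X p w x) = mesh_eval q X p (f1 p w) x))"

lemma Phi_props:
  assumes "X_functor X"
  shows Phi_hom: "Phi X \<in> lmod_hom A (T (Suc 0) X) (MX X)"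
    and Phi_te: "p \<in> V \<Longrightarrow> w \<in> carrier (fob (R (Suc 0)) p) \<Longrightarrow> x \<in> carrier (fob X p) \<Longrightarrow>
      Phi X (te (Suc 0) X p w x) = mesh_eval q X p (f1 p w) x"
  using someI_ex[OF Phi_exists[OF assms]] unfolding Phi_def[symmetric] by simp_all

text \<open>This is \<open>g1 \<otimes> X\<close>, with \<open>F \<otimes> X\<close> replaced by the
  middle term of the mesh complex of \<open>X\<close>: an element of the summand of \<open>a\<close>
  is tensored with \<open>u a\<close>.\<close>

definition Psi :: "('v, ('e list \<Rightarrow> 'k) set, 'a, 'x) modfun \<Rightarrow>
    ('e \<Rightarrow> 'x) \<Rightarrow> ('v \<Rightarrow> (('m \<times> 'x) \<Rightarrow>\<^sub>0 int) set) set" where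
  "Psi X = direct_sum_ext (T (Suc 0) X) (In q) (\<lambda>a. fob X (t a)) (\<lambda>a. te (Suc 0) X (t a) (u a))"

lemma te_u_hom: "X_functor X \<Longrightarrow> a \<in> In q \<Longrightarrow> te (Suc 0) X (t a) (u a) \<in> lmod_hom A (fob X (t a)) (T (Suc 0) X)"
  by (rule te_hom_right[OF _ tail_V u])

lemma Psi_hom: "X_functor X \<Longrightarrow> Psi X \<in> lmod_hom A (MX X) (T (Suc 0) X)"
  unfolding Psi_def mesh_middle_def
  by (rule direct_sum_ext_lmod_hom[OF T_mod X_mod_tail te_u_hom])

lemma Psi_incl:
  assumes X: "X_functor X" and "a \<in> In q" "x \<in> carrier (fob X (t a))"
  shows "Psi X (inclX X a x) = te (Suc 0) X (t a) (u a) x"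
  unfolding Psi_def
  by (rule direct_sum_ext_incl[where M = "\<lambda>a. fob X (t a)" and h = "\<lambda>a. te (Suc 0) X (t a) (u a)",
        OF T_mod[OF X] X_mod_tail[OF X] te_u_hom[OF X] assms(2,3)])

lemma middle_hom_eq:
  assumes X: "X_functor X" and L: "left_module A L" and g: "g \<in> lmod_hom A (MX X) L" and h: "h \<in> lmod_hom A (MX X) L"
    and eq: "\<And>a x. a \<in> In q \<Longrightarrow> x \<in> carrier (fob X (t a)) \<Longrightarrow> g (inclX X a x) = h (inclX X a x)"
    and s: "s \<in> carrier (MX X)"
  shows "g s = h s"
  by (rule direct_sum_hom_eq[where M = "\<lambda>a. fob X (t a)" and I = "In q", OF A.ring_axioms X_mod_tail[OF X] L
        g[unfolded mesh_middle_def] h[unfolded mesh_middle_def] eq s[unfolded mesh_middle_def]])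

text \<open>The coend relation moves the components of \<open>s\<close> from \<open>x\<close> to the
  elements \<open>u a\<close>, and the resulting sum in \<open>R (Suc 0)\<close> is
  \<open>g1 p s\<close>.\<close>

lemma Psi_eval:
  assumes X: "X_functor X" and p: "p \<in> V" and s: "s \<in> carrier (mesh_middle \<Gamma> q (U p))" and x: "x \<in> carrier (fob X p)"
  shows "Psi X (mesh_eval q X p s x) = te (Suc 0) X p (g1 p s) x"
proof -
  interpret T1: left_module A "T (Suc 0) X" by (rule T_mod[OF X])
  note e = mesh_eval_closed[OF X p q s x]
  have r: "fmor (R (Suc 0)) (t a) p (s a) (u a) \<in> carrier (fob (R (Suc 0)) p)" if a: "a \<in> In q" for a
    by (rule R_closed[OF tail_V[OF a] p U_middle_memD[OF s a] u[OF a]])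
  have "Psi X (mesh_eval q X p s x) =
      (\<Oplus>\<^bsub>T (Suc 0) X\<^esub>a\<in>In q. te (Suc 0) X (t a) (u a) (mesh_eval q X p s x a))"
    unfolding Psi_def
    by (rule direct_sum_ext_finite[OF T_mod[OF X] X_mod_tail[OF X] te_u_hom[OF X] e[unfolded mesh_middle_def]
          finite_in_arcs[OF q]])
  also have "\<dots> = (\<Oplus>\<^bsub>T (Suc 0) X\<^esub>a\<in>In q. te (Suc 0) X p (fmor (R (Suc 0)) (t a) p (s a) (u a)) x)"
  proof (rule T1.M.finsum_cong'[OF refl])
    show "(\<lambda>a. te (Suc 0) X p (fmor (R (Suc 0)) (t a) p (s a) (u a)) x) \<in> In q \<rightarrow> carrier (T (Suc 0) X)"
      by (rule funcsetI) (rule te_closed[OF X p r x])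
    fix a assume a: "a \<in> In q"
    show "te (Suc 0) X (t a) (u a) (mesh_eval q X p s x a) =
        te (Suc 0) X p (fmor (R (Suc 0)) (t a) p (s a) (u a)) x"
      using te_slide[OF X p tail_V[OF a] U_middle_memD[OF s a] u[OF a] x] a by (simp add: mesh_eval_def)
  qed
  also have "\<dots> = te (Suc 0) X p (g1 p s) x"
    unfolding g1_sum[OF p s]
    by (rule additive_hom_finsum[OF left_module_abelian_group[OF R_mod[OF p]]
          left_module_abelian_group[OF T_mod[OF X]] te_additive[OF X p x], symmetric])
      (rule funcsetI, rule r)
  finally show ?thesis .
qed

text \<open>On the summand of \<open>a\<close> the left side is the translate of \<open>u0\<close>
  along the arrow, tensored with \<open>x\<close>; the coend relation moves the arrow over to
  \<open>x\<close>. So cycles of the mesh complex go to cycles.\<close>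

lemma D_Psi:
  assumes X: "X_functor X" and s: "s \<in> carrier (MX X)"
  shows "Dm 0 X (Psi X s) = te 0 X q u0 (mout X s)"
proof (rule middle_hom_eq[OF X T_mod[OF X] lmod_hom_comp[OF Dm_hom[OF X] Psi_hom[OF X]]
      lmod_hom_comp[OF te_hom_right[OF X q u0(1)] three_term_complex.g[OF mesh_complex[OF X A.ring_axioms q]]] _ s])
  fix a x assume a: "a \<in> In q" and x: "x \<in> carrier (fob X (t a))"
  show "Dm 0 X (Psi X (inclX X a x)) = te 0 X q u0 (mout X (inclX X a x))"
    unfolding Psi_incl[OF X a x] Dm_elt[OF X tail_V[OF a] u[OF a] x] du[OF a]
      te_slide[OF X tail_V[OF a] q arrow_in[OF a] u0(1) x] mesh_out_incl[OF X A.ring_axioms a x] at_arrow_def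
    using in_arcD[OF a] by simp
qed

text \<open>By evaluation at \<open>x\<close>, the claim for all functors follows from the universal
  case, the identity of \<tau>q: there the image of \<open>inn\<close> under \<open>g1\<close> is
  the boundary of \<open>v\<close>.\<close>

lemma Psi_in:
  assumes X: "X_functor X" and x: "x \<in> carrier (fob X (\<tau> q))"
  shows "Psi X (minn X x) \<in> Dm (Suc 0) X ` carrier (T (Suc (Suc 0)) X)"
proof -
  note tq = tau_closed[OF q]
  obtain v where v: "v \<in> carrier (fob (R (Suc (Suc 0))) (\<tau> q))"
    "d (Suc 0) (\<tau> q) v = g1 (\<tau> q) (inn (\<tau> q) (ident Q (\<tau> q)))"
    by (rule basis_2)
  have "minn X x = mesh_eval q X (\<tau> q) (inn (\<tau> q) (ident Q (\<tau> q))) x"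
    using mesh_in_eval[OF X tq q ident_closed[OF tq] x] functor_ident[OF X _ x] tq by simp
  then have "Psi X (minn X x) = te (Suc 0) X (\<tau> q) (g1 (\<tau> q) (inn (\<tau> q) (ident Q (\<tau> q)))) x"
    using Psi_eval[OF X tq lmod_hom_closed[OF inn_hom[OF tq] ident_closed[OF tq]] x] by simp
  also have "\<dots> = Dm (Suc 0) X (te (Suc (Suc 0)) X (\<tau> q) v x)"
    unfolding Dm_elt[OF X tq v(1) x] v(2) ..
  finally show ?thesis using imageI[OF te_closed[OF X tq v(1) x]] by simp
qed

text \<open>The differential of \<open>Phi\<close> factors through the differential of the
  resolution: \<open>mout X\<close> after \<open>Phi X\<close> is the map induced by
  \<open>f0\<close> after \<open>Dm 0 X\<close>, because \<open>f1\<close> lies over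
  \<open>f0\<close>.\<close>

lemma out_Phi:
  assumes X: "X_functor X" and z: "z \<in> carrier (T (Suc 0) X)" and Dz: "Dm 0 X z = \<zero>\<^bsub>T 0 X\<^esub>"
  shows "mout X (Phi X z) = \<zero>\<^bsub>fob X q\<^esub>"
proof -
  obtain h where h: "h \<in> lmod_hom A (T 0 X) (fob X q)"
    and h_te: "\<And>p w x. p \<in> V \<Longrightarrow> w \<in> carrier (fob (R 0) p) \<Longrightarrow> x \<in> carrier (fob X p) \<Longrightarrow>
      h (te 0 X p w x) = fmor X p q (f0 p w) x"
    by (rule eval_hom[OF X f0_nat q]) (rule that)
  have "mout X (Phi X z) = h (Dm 0 X z)"
    by (rule T_hom_eq[OF X X_mod[OF X q]
          lmod_hom_comp[OF three_term_complex.g[OF mesh_complex[OF X A.ring_axioms q]] Phi_hom[OF X]]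
          lmod_hom_comp[OF h Dm_hom[OF X]] _ z])
      (simp only: Phi_te[OF X] Dm_elt[OF X] h_te d_closed mesh_out_eval[OF X _ q f1_closed] f1)
  then show ?thesis unfolding Dz using lmod_hom_zero[OF T_mod[OF X] X_mod[OF X q] h] by simp
qed

text \<open>As before, one degree higher: \<open>Phi X\<close> of a boundary is
  \<open>minn X\<close> applied to the map induced by \<open>f2\<close>.\<close>

lemma Phi_D:
  assumes X: "X_functor X" and y: "y \<in> carrier (T (Suc (Suc 0)) X)"
  shows "Phi X (Dm (Suc 0) X y) \<in> minn X ` carrier (fob X (\<tau> q))"
proof -
  obtain h where h: "h \<in> lmod_hom A (T (Suc (Suc 0)) X) (fob X (\<tau> q))"
    and h_te: "\<And>p w x. p \<in> V \<Longrightarrow> w \<in> carrier (fob (R (Suc (Suc 0))) p) \<Longrightarrow> x \<in> carrier (fob X p) \<Longrightarrow>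
      h (te (Suc (Suc 0)) X p w x) = fmor X p (\<tau> q) (f2 p w) x"
    by (rule eval_hom[OF X f2_nat tau_closed[OF q]]) (rule that)
  have "Phi X (Dm (Suc 0) X y) = minn X (h y)"
    by (rule T_hom_eq[OF X mesh_middle_mod[OF X A.ring_axioms] lmod_hom_comp[OF Phi_hom[OF X] Dm_hom[OF X]]
          lmod_hom_comp[OF three_term_complex.f[OF mesh_complex[OF X A.ring_axioms q]] h] _ y])
      (simp only: Phi_te[OF X] Dm_elt[OF X] h_te d_closed mesh_in_eval[OF X _ q f2_closed] f2)
  then show ?thesis using imageI[OF lmod_hom_closed[OF h y], of "minn X"] by simp
qed

section \<open>Both composites are the identity up to boundaries\<close>

lemma Psi_Phi:
  assumes X: "X_functor X" and z: "z \<in> carrier (T (Suc 0) X)" and Dz: "Dm 0 X z = \<zero>\<^bsub>T 0 X\<^esub>"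
  shows "Psi X (Phi X z) \<ominus>\<^bsub>T (Suc 0) X\<^esub> z \<in> Dm (Suc 0) X ` carrier (T (Suc (Suc 0)) X)"
proof -
  obtain h0 where h0: "nat_trans D K (R 0) (R (Suc 0)) h0"
    "\<And>p x. p \<in> V \<Longrightarrow> x \<in> carrier (fob (R 0) p) \<Longrightarrow> d 0 p (h0 p x) = g0 p (f0 p x) \<ominus>\<^bsub>fob (R 0) p\<^esub> x"
    by (rule homotopy_0) (rule that)
  obtain h1 where h1: "nat_trans D K (R (Suc 0)) (R (Suc (Suc 0))) h1"
    "\<And>p x. p \<in> V \<Longrightarrow> x \<in> carrier (fob (R (Suc 0)) p) \<Longrightarrow> d (Suc 0) p (h1 p x) =
      (g1 p (f1 p x) \<ominus>\<^bsub>fob (R (Suc 0)) p\<^esub> x) \<ominus>\<^bsub>fob (R (Suc 0)) p\<^esub> h0 p (d 0 p x)"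
    by (rule homotopy_1[OF h0], assumption, assumption, rule that)
  let ?H0 = "tensor_over_map K Q A \<iota> (R (Suc 0)) X h0 (\<lambda>p x. x)"
  let ?H1 = "tensor_over_map K Q A \<iota> (R (Suc (Suc 0))) X h1 (\<lambda>p x. x)"
  note H0 = T_map_hom[OF X h0(1)] and H1 = T_map_hom[OF X h1(1)]
  interpret T1: left_module A "T (Suc 0) X" by (rule T_mod[OF X])
  have id: "(\<lambda>z. z) \<in> lmod_hom A (T (Suc 0) X) (T (Suc 0) X)" by (rule lmod_homI) simp_all
  \<comment> \<open>The homotopy formula in degree 1 tensored with \<open>X\<close>, checked on
    generating elements. For a cycle \<open>z\<close> the last summand vanishes and a boundary is
    left.\<close>
  have "Psi X (Phi X z) \<ominus>\<^bsub>T (Suc 0) X\<^esub> z = Dm (Suc 0) X (?H1 z) \<oplus>\<^bsub>T (Suc 0) X\<^esub> ?H0 (Dm 0 X z)"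
  proof (rule T_hom_eq[OF X T_mod[OF X]
        lmod_hom_minus_pointwise[OF T_mod[OF X] lmod_hom_comp[OF Psi_hom[OF X] Phi_hom[OF X]] id]
        lmod_hom_add_pointwise[OF T_mod[OF X] lmod_hom_comp[OF Dm_hom[OF X] H1] lmod_hom_comp[OF H0 Dm_hom[OF X]]] _ z])
    fix p w x assume p: "p \<in> V" and w: "w \<in> carrier (fob (R (Suc 0)) p)" and x: "x \<in> carrier (fob X p)"
    interpret R1: left_module K "fob (R (Suc 0)) p" by (rule R_mod[OF p])
    note tm = additive_hom_minus[OF R1.M.abelian_group_axioms T1.M.abelian_group_axioms te_additive[OF X p x]]
    note dw = d_closed[OF p w]
    have hdw: "h0 p (d 0 p w) \<in> carrier (fob (R (Suc 0)) p)"
      using nat_trans_closed[OF h0(1), of p] p dw by (simp only: D_simps)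
    have hw: "h1 p w \<in> carrier (fob (R (Suc (Suc 0))) p)"
      using nat_trans_closed[OF h1(1), of p] p w by (simp only: D_simps)
    note gf = lmod_hom_closed[OF g1_hom[OF p] f1_closed[OF p w]]
    note gfw = R1.M.minus_closed[OF gf w]
    show "Psi X (Phi X (te (Suc 0) X p w x)) \<ominus>\<^bsub>T (Suc 0) X\<^esub> te (Suc 0) X p w x =
        Dm (Suc 0) X (?H1 (te (Suc 0) X p w x)) \<oplus>\<^bsub>T (Suc 0) X\<^esub> ?H0 (Dm 0 X (te (Suc 0) X p w x))"
      unfolding Phi_te[OF X p w x] Psi_eval[OF X p f1_closed[OF p w] x] T_map_elt[OF X h1(1) p w x]
        Dm_elt[OF X p hw x] Dm_elt[OF X p w x] T_map_elt[OF X h0(1) p dw x] h1(2)[OF p w] tm[OF gfw hdw]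
        tm[OF gf w, symmetric]
      by (rule T1.M.minus_add_cancel[symmetric]; rule te_closed[OF X p _ x]; rule gfw hdw)
  qed
  also have "\<dots> = Dm (Suc 0) X (?H1 z)"
    unfolding Dz lmod_hom_zero[OF T_mod[OF X] T_mod[OF X] H0]
    by (rule T1.M.r_zero[OF lmod_hom_closed[OF Dm_hom[OF X] lmod_hom_closed[OF H1 z]]])
  finally show ?thesis using imageI[OF lmod_hom_closed[OF H1 z]] by simp
qed

lemma mesh_eval_add:
  assumes X: "X_functor X" and p: "p \<in> V" and s: "s \<in> carrier (mesh_middle \<Gamma> q (U p))"
    and s': "s' \<in> carrier (mesh_middle \<Gamma> q (U p))" and x: "x \<in> carrier (fob X p)"
  shows "mesh_eval q X p (s \<oplus>\<^bsub>mesh_middle \<Gamma> q (U p)\<^esub> s') x = mesh_eval q X p s x \<oplus>\<^bsub>MX X\<^esub> mesh_eval q X p s' x"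
  unfolding mesh_middle_def direct_sum_simps(3) mesh_eval_def
proof (rule restrict_ext)
  fix a assume a: "a \<in> In q"
  show "fmor X p (t a) ((\<lambda>a\<in>In q. s a \<oplus>\<^bsub>fob (U p) (t a)\<^esub> s' a) a) x =
      (\<lambda>a\<in>In q. fmor X p (t a) (s a) x) a \<oplus>\<^bsub>fob X (t a)\<^esub> (\<lambda>a\<in>In q. fmor X p (t a) (s' a) x) a"
    using functor_add[OF X, of p "t a" "s a" "s' a" x] p tail_V[OF a] x a
      U_middle_memD[OF s a] U_middle_memD[OF s' a] by simp
qed

text \<open>Evaluation is additive in the morphism, so the zero components remain zero.\<close>

lemma mesh_eval_incl:
  assumes X: "X_functor X" and p: "p \<in> V" and a: "a \<in> In q" and z: "z \<in> carrier (homs Q p (t a))" and x: "x \<in> carrier (fob X p)"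
  shows "mesh_eval q X p (incl p a z) x = inclX X a (fmor X p (t a) z x)"
  unfolding mesh_eval_def direct_sum_incl_def
proof (rule restrict_ext)
  fix b assume b: "b \<in> In q"
  have obj: "p \<in> obj Q" "t b \<in> obj Q" using p tail_V[OF b] by simp_all
  have "fmor X p (t b) \<zero>\<^bsub>homs Q p (t b)\<^esub> x = \<zero>\<^bsub>fob X (t b)\<^esub>"
    by (rule additive_hom_zero[OF left_module_abelian_group[OF Q_mod[OF p tail_V[OF b]]]
          left_module_abelian_group[OF X_mod_tail[OF X b]] functor_additive[OF X obj x]])
  then show "fmor X p (t b) ((\<lambda>i\<in>In q. if i = a then z else \<zero>\<^bsub>homs Q p (t i)\<^esub>) b) x =
      (if b = a then fmor X p (t a) z x else \<zero>\<^bsub>fob X (t b)\<^esub>)"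
    using b by simp
qed

lemma mesh_eval_eval:
  assumes X: "X_functor X" and p: "p \<in> V" and r: "r \<in> V" and s: "s \<in> carrier (mesh_middle \<Gamma> q (U r))"
    and f: "f \<in> carrier (homs Q p r)" and x: "x \<in> carrier (fob X p)"
  shows "mesh_eval q X p (mesh_eval q (U p) r s f) x = mesh_eval q X r s (fmor X p r f x)"
  unfolding mesh_eval_def
proof (rule restrict_ext)
  fix a assume a: "a \<in> In q"
  show "fmor X p (t a) ((\<lambda>a\<in>In q. fmor (U p) r (t a) (s a) f) a) x = fmor X r (t a) (s a) (fmor X p r f x)"
    using functor_comp[OF X, of p r "t a" f "s a" x] p r tail_V[OF a] f x a U_middle_memD[OF s a] by simp
qed

text \<open>The second homotopy has to be carried over to \<open>X\<close> by hand, as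
  \<open>F \<otimes> X\<close> is not formed: \<open>s0\<close> becomes evaluation at
  \<open>s0\<close>, and the elements \<open>s1 a\<close> become the map \<open>E\<close> from the
  middle term to \<open>X(\<tau>q)\<close>.\<close>

lemma Phi_Psi:
  assumes X: "X_functor X" and s: "s \<in> carrier (MX X)" and out: "mout X s = \<zero>\<^bsub>fob X q\<^esub>"
  shows "Phi X (Psi X s) \<ominus>\<^bsub>MX X\<^esub> s \<in> minn X ` carrier (fob X (\<tau> q))"
proof -
  note tq = tau_closed[OF q] and MX_mod = mesh_middle_mod[OF X A.ring_axioms]
  obtain s0 where s0: "s0 \<in> carrier (mesh_middle \<Gamma> q (U q))" "out q s0 = f0 q u0 \<ominus>\<^bsub>homs Q q q\<^esub> ident Q q"
    by (rule cohomotopy_0)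
  obtain s1 where s1: "\<And>a. a \<in> In q \<Longrightarrow> s1 a \<in> carrier (homs Q (t a) (\<tau> q))"
    and f1u: "\<And>a. a \<in> In q \<Longrightarrow> f1 (t a) (u a) = incl (t a) a (ident Q (t a))
      \<oplus>\<^bsub>mesh_middle \<Gamma> q (U (t a))\<^esub> mesh_eval q (U (t a)) q s0 (\<alpha> a) \<oplus>\<^bsub>mesh_middle \<Gamma> q (U (t a))\<^esub> inn (t a) (s1 a)"
    using cohomotopy_1[OF s0] by metis
  define E where "E = direct_sum_ext (fob X (\<tau> q)) (In q) (\<lambda>a. fob X (t a)) (\<lambda>a. fmor X (t a) (\<tau> q) (s1 a))"
  have s1_hom: "fmor X (t a) (\<tau> q) (s1 a) \<in> lmod_hom A (fob X (t a)) (fob X (\<tau> q))" if a: "a \<in> In q" for a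
    by (rule functor_hom[OF X]) (use tail_V[OF a] tq s1[OF a] in simp_all)
  have E: "E \<in> lmod_hom A (MX X) (fob X (\<tau> q))"
    unfolding E_def mesh_middle_def by (rule direct_sum_ext_lmod_hom[OF X_mod[OF X tq] X_mod_tail[OF X] s1_hom])
  have E_incl: "E (inclX X a x) = fmor X (t a) (\<tau> q) (s1 a) x" if "a \<in> In q" "x \<in> carrier (fob X (t a))" for a x
    unfolding E_def
    by (rule direct_sum_ext_incl[where M = "\<lambda>a. fob X (t a)" and h = "\<lambda>a. fmor X (t a) (\<tau> q) (s1 a)",
          OF X_mod[OF X tq] X_mod_tail[OF X] s1_hom that])
  have ev: "mesh_eval q X q s0 \<in> lmod_hom A (fob X q) (MX X)"
    unfolding mesh_middle_def mesh_eval_def[abs_def]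
  proof (rule direct_sum_tuple_hom[OF finite_in_arcs[OF q]])
    fix a assume a: "a \<in> In q"
    show "fmor X q (t a) (s0 a) \<in> lmod_hom A (fob X q) (fob X (t a))"
      by (rule functor_hom[OF X]) (use tail_V[OF a] q U_middle_memD[OF s0(1) a] in simp_all)
  qed
  interpret M: left_module A "MX X" by (rule MX_mod)
  have id: "(\<lambda>s. s) \<in> lmod_hom A (MX X) (MX X)" by (rule lmod_homI) simp_all
  note out_hom = three_term_complex.g[OF mesh_complex[OF X A.ring_axioms q]]
    and in_hom = three_term_complex.f[OF mesh_complex[OF X A.ring_axioms q]]
  \<comment> \<open>Valid for every \<open>s\<close> of the middle term; on the summand of an arrow
    it is \<open>cohomotopy_1\<close> evaluated at \<open>x\<close>. The cycle condition is used
    only afterwards, to remove the term with \<open>s0\<close>.\<close>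
  have "Phi X (Psi X s) = s \<oplus>\<^bsub>MX X\<^esub> mesh_eval q X q s0 (mout X s) \<oplus>\<^bsub>MX X\<^esub> minn X (E s)"
  proof (rule middle_hom_eq[OF X MX_mod lmod_hom_comp[OF Phi_hom[OF X] Psi_hom[OF X]]
        lmod_hom_add_pointwise[OF MX_mod lmod_hom_add_pointwise[OF MX_mod id lmod_hom_comp[OF ev out_hom]]
          lmod_hom_comp[OF in_hom E]] _ s])
    fix a x assume a: "a \<in> In q" and x: "x \<in> carrier (fob X (t a))"
    note ta = tail_V[OF a] and \<alpha> = arrow_in[OF a]
    have \<alpha>': "\<alpha> a \<in> carrier (fob (U (t a)) q)" using \<alpha> by simp
    note i = incl_closed[OF ta a ident_closed[OF ta]]
      and e = mesh_eval_closed[OF U_functor[OF ta] q q s0(1) \<alpha>']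
      and n = lmod_hom_closed[OF inn_hom[OF ta] s1[OF a]]
    interpret L: left_module K "mesh_middle \<Gamma> q (U (t a))" by (rule middle_mod[OF ta])
    have id_x: "fmor X (t a) (t a) (ident Q (t a)) x = x" using functor_ident[OF X _ x] ta by simp
    have at: "fmor X (t a) q (\<alpha> a) x = mout X (inclX X a x)"
      unfolding mesh_out_incl[OF X A.ring_axioms a x] at_arrow_def using in_arcD[OF a] by simp
    show "Phi X (Psi X (inclX X a x)) = inclX X a x \<oplus>\<^bsub>MX X\<^esub> mesh_eval q X q s0 (mout X (inclX X a x))
        \<oplus>\<^bsub>MX X\<^esub> minn X (E (inclX X a x))"
      unfolding Psi_incl[OF X a x] Phi_te[OF X ta u[OF a] x] f1u[OF a]
        mesh_eval_add[OF X ta L.M.a_closed[OF i e] n x] mesh_eval_add[OF X ta i e x]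
        mesh_eval_incl[OF X ta a ident_closed[OF ta] x] id_x mesh_eval_eval[OF X ta q s0(1) \<alpha> x] at
        mesh_in_eval[OF X ta q s1[OF a] x, symmetric] E_incl[OF a x] ..
  qed
  also have "\<dots> = s \<oplus>\<^bsub>MX X\<^esub> minn X (E s)"
    unfolding out lmod_hom_zero[OF X_mod[OF X q] MX_mod ev] using s by simp
  finally have "Phi X (Psi X s) \<ominus>\<^bsub>MX X\<^esub> s = minn X (E s)"
    using s lmod_hom_closed[OF in_hom lmod_hom_closed[OF E s]]
    by (simp add: a_minus_def M.M.a_ac M.M.r_neg1 M.M.r_neg2)
  then show ?thesis using imageI[OF lmod_hom_closed[OF E s], of "minn X"] by simp
qed

section \<open>Passage to homology and naturality\<close>

lemma Phi_map:
  assumes X: "X_functor X"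
  shows "three_term_map A (T (Suc (Suc 0)) X) (Dm (Suc 0) X) (T (Suc 0) X) (Dm 0 X) (T 0 X)
    (fob X (\<tau> q)) (minn X) (MX X) (mout X) (fob X q) (Phi X)"
  by (intro three_term_map.intro three_term_map_axioms.intro tor_complex[OF X] mesh_complex[OF X A.ring_axioms q]
      Phi_hom[OF X] Phi_D[OF X] out_Phi[OF X]) (simp_all only: mem_a_kernel)

lemma Psi_map:
  assumes X: "X_functor X"
  shows "three_term_map A (fob X (\<tau> q)) (minn X) (MX X) (mout X) (fob X q)
    (T (Suc (Suc 0)) X) (Dm (Suc 0) X) (T (Suc 0) X) (Dm 0 X) (T 0 X) (Psi X)"
proof (intro three_term_map.intro three_term_map_axioms.intro tor_complex[OF X] mesh_complex[OF X A.ring_axioms q]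
      Psi_hom[OF X] Psi_in[OF X])
  fix s assume "s \<in> a_kernel (MX X) (fob X q) (mout X)"
  then have s: "s \<in> carrier (MX X)" "mout X s = \<zero>\<^bsub>fob X q\<^esub>" by (simp_all only: mem_a_kernel)
  show "Dm 0 X (Psi X s) = \<zero>\<^bsub>T 0 X\<^esub>"
    unfolding D_Psi[OF X s(1)] s(2)
    by (rule lmod_hom_zero[OF X_mod[OF X q] T_mod[OF X] te_hom_right[OF X q u0(1)]])
qed

definition phi where
  "phi X = quot_map (MX X) (minn X ` carrier (fob X (\<tau> q))) (Phi X)"

lemma tor1_eq: "tor1 K Q A \<iota> R d X = homology_at (T (Suc (Suc 0)) X) (Dm (Suc 0) X) (T (Suc 0) X) (Dm 0 X) (T 0 X)"
  unfolding tor1_def numeral_2_eq_2 One_nat_def ..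

lemma phi_iso:
  assumes X: "X_functor X"
  shows "phi X \<in> lmod_iso A (tor1 K Q A \<iota> R d X) (mesh_homology K \<Gamma> \<tau> \<sigma> q X)"
  unfolding phi_def tor1_eq mesh_homology_def
  by (rule three_term_map.homology_iso[OF Phi_map[OF X] Psi_map[OF X]])
    (simp_all only: mem_a_kernel Psi_Phi[OF X] Phi_Psi[OF X])

text \<open>On generating elements the square for \<open>Phi\<close> is the naturality of \<eta> at
  the components of \<open>f1 p w\<close>, the same morphisms for both functors. To pass to cosets,
  the maps induced by \<eta> must also be shown to respect cycles and boundaries of both
  complexes.\<close>

lemma phi_natural:
  assumes X: "X_functor X" and Y: "X_functor Y" and \<eta>: "nat_trans Q A X Y \<eta>"
    and C: "C \<in> carrier (tor1 K Q A \<iota> R d X)"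
  shows "phi Y (tor1_map K Q A \<iota> R d Y \<eta> C) = mesh_homology_map K \<Gamma> \<tau> \<sigma> q Y \<eta> (phi X C)"
proof -
  let ?\<eta> = "\<lambda>n. tensor_over_map K Q A \<iota> (R n) Y (\<lambda>p x. x) \<eta>"
  let ?\<mu> = "\<lambda>s. \<lambda>a\<in>In q. \<eta> (t a) (s a)"
  note \<eta>_props = tensor_over_map_props[OF tensor_functors[OF X] tensor_functors[OF Y] nat_trans_id \<eta>, unfolded Q_simps(1)]
  note \<eta>_hom = \<eta>_props(1) and \<eta>_te = \<eta>_props(2)
  have \<eta>V: "\<eta> p \<in> lmod_hom A (fob X p) (fob Y p)" if "p \<in> V" for p
    using nat_trans_hom[OF \<eta>] that by simp
  note \<eta>_closed = lmod_hom_closed[OF \<eta>V]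
  have \<mu>_hom: "?\<mu> \<in> lmod_hom A (MX X) (MX Y)"
    unfolding mesh_middle_def
    by (rule direct_sum_map_lmod_hom[OF X_mod_tail[OF X] X_mod_tail[OF Y] \<eta>V[OF tail_V]])
  have \<eta>D: "Dm n Y (?\<eta> (Suc n) z) = ?\<eta> n (Dm n X z)" if z: "z \<in> carrier (T (Suc n) X)" for n z
    by (rule T_hom_eq[OF X T_mod[OF Y] lmod_hom_comp[OF Dm_hom[OF Y] \<eta>_hom]
          lmod_hom_comp[OF \<eta>_hom Dm_hom[OF X]] _ z])
      (simp only: \<eta>_te Dm_elt[OF X] Dm_elt[OF Y] d_closed \<eta>_closed)
  have \<eta>Phi: "Phi Y (?\<eta> (Suc 0) z) = ?\<mu> (Phi X z)" if z: "z \<in> carrier (T (Suc 0) X)" for z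
  proof (rule T_hom_eq[OF X mesh_middle_mod[OF Y A.ring_axioms] lmod_hom_comp[OF Phi_hom[OF Y] \<eta>_hom]
        lmod_hom_comp[OF \<mu>_hom Phi_hom[OF X]] _ z])
    fix p w x assume p: "p \<in> V" and w: "w \<in> carrier (fob (R (Suc 0)) p)" and x: "x \<in> carrier (fob X p)"
    show "Phi Y (?\<eta> (Suc 0) (te (Suc 0) X p w x)) = ?\<mu> (Phi X (te (Suc 0) X p w x))"
      unfolding \<eta>_te[OF p w x] Phi_te[OF X p w x] Phi_te[OF Y p w \<eta>_closed[OF p x]] mesh_eval_def
    proof (rule restrict_ext)
      fix a assume a: "a \<in> In q"
      show "fmor Y p (t a) (f1 p w a) (\<eta> p x) = \<eta> (t a) ((\<lambda>a\<in>In q. fmor X p (t a) (f1 p w a) x) a)"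
        using nat_trans_naturality[OF \<eta>, of p "t a" "f1 p w a" x] p tail_V[OF a] x a
          U_middle_memD[OF f1_closed[OF p w] a] by simp
    qed
  qed
  interpret PX: three_term_map A "T (Suc (Suc 0)) X" "Dm (Suc 0) X" "T (Suc 0) X" "Dm 0 X" "T 0 X"
    "fob X (\<tau> q)" "minn X" "MX X" "mout X" "fob X q" "Phi X" by (rule Phi_map[OF X])
  interpret PY: three_term_map A "T (Suc (Suc 0)) Y" "Dm (Suc 0) Y" "T (Suc 0) Y" "Dm 0 Y" "T 0 Y"
    "fob Y (\<tau> q)" "minn Y" "MX Y" "mout Y" "fob Y q" "Phi Y" by (rule Phi_map[OF Y])
  have \<eta>map: "three_term_map A (T (Suc (Suc 0)) X) (Dm (Suc 0) X) (T (Suc 0) X) (Dm 0 X) (T 0 X)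
      (T (Suc (Suc 0)) Y) (Dm (Suc 0) Y) (T (Suc 0) Y) (Dm 0 Y) (T 0 Y) (?\<eta> (Suc 0))"
  proof (intro three_term_map.intro three_term_map_axioms.intro tor_complex[OF X] tor_complex[OF Y] \<eta>_hom)
    show "Dm 0 Y (?\<eta> (Suc 0) z) = \<zero>\<^bsub>T 0 Y\<^esub>" if "z \<in> PX.C.Z" for z
    proof -
      from that have z: "z \<in> carrier (T (Suc 0) X)" "Dm 0 X z = \<zero>\<^bsub>T 0 X\<^esub>" by (simp_all only: mem_a_kernel)
      show ?thesis unfolding \<eta>D[OF z(1)] z(2) by (rule lmod_hom_zero[OF T_mod[OF X] T_mod[OF Y] \<eta>_hom])
    qed
    show "?\<eta> (Suc 0) (Dm (Suc 0) X y) \<in> PY.C.B" if y: "y \<in> carrier (T (Suc (Suc 0)) X)" for y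
      unfolding \<eta>D[OF y, symmetric] by (rule imageI[OF lmod_hom_closed[OF \<eta>_hom y]])
  qed
  have \<mu>map: "three_term_map A (fob X (\<tau> q)) (minn X) (MX X) (mout X) (fob X q)
      (fob Y (\<tau> q)) (minn Y) (MX Y) (mout Y) (fob Y q) ?\<mu>"
  proof (intro three_term_map.intro three_term_map_axioms.intro mesh_complex[OF X A.ring_axioms q]
        mesh_complex[OF Y A.ring_axioms q] \<mu>_hom)
    show "mout Y (?\<mu> s) = \<zero>\<^bsub>fob Y q\<^esub>" if "s \<in> PX.D.Z" for s
    proof -
      from that have s: "s \<in> carrier (MX X)" "mout X s = \<zero>\<^bsub>fob X q\<^esub>" by (simp_all only: mem_a_kernel)
      show ?thesis unfolding mesh_out_natural[OF X Y \<eta> q s(1)] s(2)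
        by (rule lmod_hom_zero[OF X_mod[OF X q] X_mod[OF Y q] \<eta>V[OF q]])
    qed
    show "?\<mu> (minn X x) \<in> PY.D.B" if x: "x \<in> carrier (fob X (\<tau> q))" for x
      unfolding mesh_in_natural[OF X \<eta> q x] by (rule imageI[OF \<eta>_closed[OF tau_closed[OF q] x]])
  qed
  obtain z where z: "z \<in> PX.C.Z" and Cz: "C = PX.C.B +>\<^bsub>T (Suc 0) X\<^esub> z"
    using C unfolding tor1_eq PX.C.carrier_homology by (elim bexE)
  have z1: "z \<in> carrier (T (Suc 0) X)" using z by (simp only: mem_a_kernel)
  have \<eta>z: "?\<eta> (Suc 0) z \<in> PY.C.Z"
    using lmod_hom_closed[OF three_term_map.map_hom_Z[OF \<eta>map], of z] z by simp
  have Pz: "Phi X z \<in> PX.D.Z"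
    using lmod_hom_closed[OF PX.map_hom_Z, of z] z by simp
  have "phi Y (tor1_map K Q A \<iota> R d Y \<eta> C) = phi Y (PY.C.B +>\<^bsub>T (Suc 0) Y\<^esub> ?\<eta> (Suc 0) z)"
    unfolding tor1_map_def Cz numeral_2_eq_2 One_nat_def three_term_map.homology_map_coset[OF \<eta>map z] ..
  also have "\<dots> = PY.D.B +>\<^bsub>MX Y\<^esub> ?\<mu> (Phi X z)"
    unfolding phi_def PY.homology_map_coset[OF \<eta>z] \<eta>Phi[OF z1] ..
  also have "\<dots> = mesh_homology_map K \<Gamma> \<tau> \<sigma> q Y \<eta> (phi X C)"
    unfolding mesh_homology_map_def phi_def Cz PX.homology_map_coset[OF z]
      three_term_map.homology_map_coset[OF \<mu>map Pz] ..
  finally show ?thesis .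
qed

end

theorem proposition8p18:
  fixes K :: "('k, 'r) ring_scheme"
    and A :: "('a, 's) ring_scheme"
    and \<iota> :: "'k \<Rightarrow> 'a"
    and \<Gamma> :: "('v, 'e) pre_digraph"
    and \<tau> :: "'v \<Rightarrow> 'v"
    and \<sigma> :: "'e \<Rightarrow> 'e"
    and q :: 'v
    and P :: "nat \<Rightarrow> ('v, ('e list \<Rightarrow> 'k) set, 'k, 'm) modfun"
    and d :: "nat \<Rightarrow> 'v \<Rightarrow> 'm \<Rightarrow> 'm"
    and \<epsilon> :: "'v \<Rightarrow> 'm \<Rightarrow> ('e list \<Rightarrow> 'k) set set"
  assumes "cring K" and "\<one>\<^bsub>K\<^esub> \<noteq> \<zero>\<^bsub>K\<^esub>"
    and "ring_algebra K A \<iota>"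
    and "stable_translation_quiver \<Gamma> \<tau> \<sigma>"
    and "normal_quiver K \<Gamma> \<tau> \<sigma>"
    and "q \<in> verts \<Gamma>"
    and "projective_resolution K (opcat (mesh_cat K \<Gamma> \<tau> \<sigma>)) (stalk K \<Gamma> \<tau> \<sigma> q) P d \<epsilon>"
  shows "\<exists>\<phi>.
    (\<forall>X :: ('v, ('e list \<Rightarrow> 'k) set, 'a, 'x) modfun. linear_functor K (mesh_cat K \<Gamma> \<tau> \<sigma>) A \<iota> X \<longrightarrow>
       \<phi> X \<in> lmod_iso A (tor1 K (mesh_cat K \<Gamma> \<tau> \<sigma>) A \<iota> P d X) (mesh_homology K \<Gamma> \<tau> \<sigma> q X)) \<and>
    (\<forall>(X :: ('v, ('e list \<Rightarrow> 'k) set, 'a, 'x) modfun) Y \<eta>.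
       linear_functor K (mesh_cat K \<Gamma> \<tau> \<sigma>) A \<iota> X \<and> linear_functor K (mesh_cat K \<Gamma> \<tau> \<sigma>) A \<iota> Y \<and> nat_trans (mesh_cat K \<Gamma> \<tau> \<sigma>) A X Y \<eta> \<longrightarrow>
       (\<forall>t\<in>carrier (tor1 K (mesh_cat K \<Gamma> \<tau> \<sigma>) A \<iota> P d X).
          \<phi> Y (tor1_map K (mesh_cat K \<Gamma> \<tau> \<sigma>) A \<iota> P d Y \<eta> t) = mesh_homology_map K \<Gamma> \<tau> \<sigma> q Y \<eta> (\<phi> X t)))"
proof -
  interpret M: mesh_resolution K \<Gamma> \<tau> \<sigma> q P d \<epsilon>
    by (intro mesh_resolution.intro mesh_category.intro mesh_resolution_axioms.intro assms)
  obtain f0 where f0: "nat_trans M.D K (P 0) (M.N q) f0"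
    "\<And>p x. p \<in> verts \<Gamma> \<Longrightarrow> x \<in> carrier (fob (P 0) p) \<Longrightarrow> M.cl p (f0 p x) = \<epsilon> p x"
    by (rule M.comparison_0) (rule that)
  obtain f1 where f1: "nat_trans M.D K (P (Suc 0)) M.F f1"
    "\<And>p x. p \<in> verts \<Gamma> \<Longrightarrow> x \<in> carrier (fob (P (Suc 0)) p) \<Longrightarrow> M.out p (f1 p x) = f0 p (d 0 p x)"
    by (rule M.comparison_1[OF f0], assumption, assumption, rule that)
  obtain f2 where f2: "nat_trans M.D K (P (Suc (Suc 0))) (M.N (\<tau> q)) f2"
    "\<And>p x. p \<in> verts \<Gamma> \<Longrightarrow> x \<in> carrier (fob (P (Suc (Suc 0))) p) \<Longrightarrow> M.inn p (f2 p x) = f1 p (d (Suc 0) p x)"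
    by (rule M.comparison_2[OF f0(1) f1], assumption, assumption, rule that)
  obtain u0 where u0: "u0 \<in> carrier (fob (P 0) q)" "\<epsilon> q u0 = M.cl q (ident M.Q q)"
    by (rule M.basis_0)
  obtain u where u: "\<And>a. a \<in> in_arcs \<Gamma> q \<Longrightarrow> u a \<in> carrier (fob (P (Suc 0)) (tail \<Gamma> a))"
    "\<And>a. a \<in> in_arcs \<Gamma> q \<Longrightarrow> d 0 (tail \<Gamma> a) (u a) = fmor (P 0) q (tail \<Gamma> a) (M.\<alpha> a) u0"
    using M.basis_1[OF u0] by metis
  \<comment> \<open>The data obtained so far involve only the quiver and the resolution;
    \<open>X\<close> has not been introduced. So one family \<open>C.phi\<close> serves all functors
    at once.\<close>
  interpret C: mesh_tor K A \<iota> \<Gamma> \<tau> \<sigma> q P d \<epsilon> f0 f1 f2 u0 u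
    by (intro mesh_tor.intro mesh_comparison.intro mesh_comparison_axioms.intro M.mesh_resolution_axioms
        f0 f1 f2 u0 u assms(3))
  show ?thesis
    by (intro exI[of _ C.phi] conjI allI impI ballI; (elim conjE)?)
      (rule C.phi_iso C.phi_natural; assumption)+
qed

end
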